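(* For each $d\ge 2$ let $Z^d=(X^d_t,V^d_t)_{t\ge0}$ be the Forward Event-Chain Monte Carlo (FECMC) process in dimension $d$ with standard Gaussian target $\pi^d=N_d(0,I_d)$, velocity distribution $\mu^d=\mathrm{Unif}(S^{d-1})$, and global refreshment rate $\rho=0$, assumed to have invariant distribution $\pi^d\otimes\mu^d$ and to be started from $Z^d_0\sim\pi^d\otimes\mu^d$. Let $$h(x):=\frac{1}{\sqrt2}\,\frac{|x|^2-d}{\sqrt d},\qquad g(x,v):=(x|v),$$ and for $T>0$ $$\widehat h^d_T:=\frac1T\int_0^T h(X^d_s)\,ds,\qquad \widehat g^d_T:=\frac1T\int_0^T g(X^d_s,V^d_s)\,ds .$$ Then $$\lim_{T\to\infty}\lim_{d\to\infty}T\,\mathrm{Var}\bigl[\widehat h^d_{dT}\bigr]=\frac{8}{\sigma_F^2},\qquad \lim_{T\to\infty}\lim_{d\to\infty}T\,\mathrm{Var}\bigl[\widehat g^d_{T}\bigr]=\frac{\sigma_F^2}{4},$$ where $\sigma_F^2=\sqrt{32/\pi}$.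
   Context: Notation: $(\cdot|\cdot)$ is the Euclidean inner product and $|\cdot|$ the Euclidean norm on $\mathbb{R}^d$; $x_+=\max(x,0)$; $S^{d-1}$ is the unit sphere in $\mathbb{R}^d$. The functions $h$ and $g$ are the potential $U^d(x)=|x|^2/2$ and its time derivative $(v|\nabla U^d(x))$, each standardized to mean $0$ and variance $1$ under $\pi^d\otimes\mu^d$. FECMC process (standard Gaussian target, $\rho=0$). $\nabla U^d(x)=x$, and $n(x):=x/|x|$ for $x\neq0$. $Z^d=(X^d,V^d)$ is the piecewise deterministic Markov process on $\mathbb{R}^d\times S^{d-1}$ such that between jumps $\frac{d}{dt}X^d_t=V^d_t$ and $V^d$ is constant; velocity jumps occur with rate $\lambda(x,v)=(v|\nabla U^d(x))_+=(v|x)_+$; at a jump occurring at $(x,v)$ the position is unchanged and $v$ is replaced by $$v_{\mathrm{new}}=-w\,n(x)+\sqrt{1-w^2}\,\frac{Av^\perp}{|v^\perp|},\qquad v^\perp:=v-(v|n(x))n(x),$$ where $w$ is drawn, independently of everything else, from the density $$q^{\parallel,d}(w)=(d-1)\,w\,(1-w^2)^{\frac{d-3}{2}}1_{(0,1)}(w),$$ and $A$ is drawn from a probability distribution $\nu^x$ on orthogonal matrices acting on the hyperplane $n(x)^\perp=\{u:(u|n(x))=0\}$. The choice of $\nu^x$ is left unspecified, subject only to $\pi^d\otimes\mu^d$ being invariant. *)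

theory Defs
  imports "HOL-Probability.Probability"
begin

text \<open>Since the dimension \<open>d\<close> tends to infinity inside the statement, vectors of \<open>\<real>\<^sup>d\<close> are
  extensional functions on \<open>{..<d}\<close>, i.e. elements of the space of \<open>Rd d\<close>, and \<open>d \<times> d\<close> matrices are
  extensional functions on \<open>{..<d} \<times> {..<d}\<close>. The Euclidean norm is \<open>L2_set x {..<d}\<close>.\<close>

type_synonym rvec = "nat \<Rightarrow> real"
type_synonym rmat = "nat \<times> nat \<Rightarrow> real"

definition Rd :: "nat \<Rightarrow> rvec measure" where
  "Rd d = (\<Pi>\<^sub>M i\<in>{..<d}. borel)"

definition Rdd :: "nat \<Rightarrow> rmat measure" where
  "Rdd d = (\<Pi>\<^sub>M ij\<in>{..<d} \<times> {..<d}. borel)"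

definition ip :: "nat \<Rightarrow> rvec \<Rightarrow> rvec \<Rightarrow> real" where
  "ip d x y = (\<Sum>i<d. x i * y i)"

abbreviation vnorm :: "nat \<Rightarrow> rvec \<Rightarrow> real" where
  "vnorm d x \<equiv> L2_set x {..<d}"

definition unit_sphere :: "nat \<Rightarrow> rvec set" where
  "unit_sphere d = {v \<in> space (Rd d). vnorm d v = 1}"

definition normalize_vec :: "nat \<Rightarrow> rvec \<Rightarrow> rvec" where
  "normalize_vec d x = (\<lambda>i\<in>{..<d}. x i / vnorm d x)"

definition mat_vec :: "nat \<Rightarrow> rmat \<Rightarrow> rvec \<Rightarrow> rvec" where
  "mat_vec d A x = (\<lambda>i\<in>{..<d}. \<Sum>j<d. A (i, j) * x j)"

definition gauss_law :: "nat \<Rightarrow> rvec measure" where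
  "gauss_law d = (\<Pi>\<^sub>M i\<in>{..<d}. std_normal_distribution)"

text \<open>The uniform distribution on the sphere is the normalized cone measure: a set of directions has
  as its mass the proportion of the volume of the unit ball lying over it.\<close>

definition sphere_unif :: "nat \<Rightarrow> rvec measure" where
  "sphere_unif d =
     distr (uniform_measure (\<Pi>\<^sub>M i\<in>{..<d}. lborel) {x \<in> space (Rd d). vnorm d x \<le> 1})
       (Rd d) (normalize_vec d)"

text \<open>For the standard Gaussian target the gradient of the potential at \<open>x\<close> is \<open>x\<close>.\<close>

definition jump_rate :: "nat \<Rightarrow> rvec \<Rightarrow> rvec \<Rightarrow> real" where
  "jump_rate d x v = max (ip d v x) 0"

definition drift :: "nat \<Rightarrow> real \<Rightarrow> rvec \<Rightarrow> rvec \<Rightarrow> rvec" where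
  "drift d s x v = (\<lambda>i\<in>{..<d}. x i + s * v i)"

definition perp_part :: "nat \<Rightarrow> rvec \<Rightarrow> rvec \<Rightarrow> rvec" where
  "perp_part d x v =
     (\<lambda>i\<in>{..<d}. v i - ip d v (normalize_vec d x) * normalize_vec d x i)"

definition new_velocity :: "nat \<Rightarrow> rvec \<Rightarrow> rvec \<Rightarrow> real \<Rightarrow> rmat \<Rightarrow> rvec" where
  "new_velocity d x v w A =
     (\<lambda>i\<in>{..<d}. - w * normalize_vec d x i
        + sqrt (1 - w\<^sup>2) * (mat_vec d A (perp_part d x v) i / vnorm d (perp_part d x v)))"

definition parallel_density :: "nat \<Rightarrow> real \<Rightarrow> real" where
  "parallel_density d w =
     (real d - 1) * w * (1 - w\<^sup>2) powr ((real d - 3) / 2) * indicator {0<..<1} w"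

text \<open>An orthogonal map of the hyperplane orthogonal to \<open>x\<close> is encoded by its unique extension to
  an orthogonal \<open>d \<times> d\<close> matrix that fixes \<open>x / |x|\<close>.\<close>

definition hyperplane_orthogonal :: "nat \<Rightarrow> rvec \<Rightarrow> rmat set" where
  "hyperplane_orthogonal d x =
     {A \<in> space (Rdd d).
        (\<forall>i<d. \<forall>j<d. (\<Sum>k<d. A (k, i) * A (k, j)) = (if i = j then 1 else 0)) \<and>
        mat_vec d A (normalize_vec d x) = normalize_vec d x}"

definition orthogonal_kernel :: "nat \<Rightarrow> (rvec \<Rightarrow> rmat measure) \<Rightarrow> bool" where
  "orthogonal_kernel d \<nu> \<longleftrightarrow>
     \<nu> \<in> restrict_space (Rd d) {x. vnorm d x \<noteq> 0} \<rightarrow>\<^sub>M prob_algebra (Rdd d) \<and>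
     (\<forall>x\<in>space (Rd d). vnorm d x \<noteq> 0 \<longrightarrow> (AE A in \<nu> x. A \<in> hyperplane_orthogonal d x))"

definition jump_kernel :: "nat \<Rightarrow> (rvec \<Rightarrow> rmat measure) \<Rightarrow> rvec \<Rightarrow> rvec \<Rightarrow> rvec measure" where
  "jump_kernel d \<nu> x v =
     distr (density lborel (parallel_density d) \<Otimes>\<^sub>M \<nu> x) (Rd d)
       (\<lambda>(w, A). new_velocity d x v w A)"

text \<open>Jump times and post-jump states up to the \<open>n\<close>-th jump; the zeroth jump time is 0.\<close>

definition history ::
  "(real \<Rightarrow> 'a \<Rightarrow> rvec) \<Rightarrow> (real \<Rightarrow> 'a \<Rightarrow> rvec) \<Rightarrow> (nat \<Rightarrow> 'a \<Rightarrow> real) \<Rightarrow> nat \<Rightarrow> 'a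
     \<Rightarrow> nat \<Rightarrow> real \<times> rvec \<times> rvec" where
  "history X V \<tau> n \<omega> = (\<lambda>k\<in>{..n}. (\<tau> k \<omega>, X (\<tau> k \<omega>) \<omega>, V (\<tau> k \<omega>) \<omega>))"

definition history_space :: "nat \<Rightarrow> nat \<Rightarrow> (nat \<Rightarrow> real \<times> rvec \<times> rvec) measure" where
  "history_space d n = (\<Pi>\<^sub>M k\<in>{..n}. borel \<Otimes>\<^sub>M Rd d \<Otimes>\<^sub>M Rd d)"

text \<open>The piecewise deterministic Markov process with jump times \<open>\<tau> 1 < \<tau> 2 < \<dots>\<close>. The last two
  conditions prescribe regular conditional distributions: that of the next waiting time given the
  history (hazard rate \<open>jump_rate\<close> along the flow), and that of the velocity after a jump given the
  history and the time of this jump. Both are written in integrated form over all events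
  determined by the conditioning variables.
  The jump times are constrained surely rather than almost surely; as they are existentially
  quantified, they can always be redefined on a null set.\<close>

definition fecmc_process ::
  "nat \<Rightarrow> (rvec \<Rightarrow> rmat measure) \<Rightarrow> 'a measure
     \<Rightarrow> (real \<Rightarrow> 'a \<Rightarrow> rvec) \<Rightarrow> (real \<Rightarrow> 'a \<Rightarrow> rvec) \<Rightarrow> bool" where
  "fecmc_process d \<nu> M X V \<longleftrightarrow>
     prob_space M \<and>
     (\<lambda>(t, \<omega>). X t \<omega>) \<in> restrict_space borel {0..} \<Otimes>\<^sub>M M \<rightarrow>\<^sub>M Rd d \<and>
     (\<lambda>(t, \<omega>). V t \<omega>) \<in> restrict_space borel {0..} \<Otimes>\<^sub>M M \<rightarrow>\<^sub>M Rd d \<and>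
     (\<forall>t\<ge>0. \<forall>\<omega>\<in>space M. V t \<omega> \<in> unit_sphere d) \<and>
     (\<exists>\<tau> :: nat \<Rightarrow> 'a \<Rightarrow> real.
        (\<forall>n. \<tau> n \<in> borel_measurable M) \<and>
        (\<forall>\<omega>\<in>space M. \<tau> 0 \<omega> = 0 \<and> strict_mono (\<lambda>n. \<tau> n \<omega>) \<and>
           filterlim (\<lambda>n. \<tau> n \<omega>) at_top sequentially) \<and>
        (AE \<omega> in M. \<forall>n. \<forall>t. \<tau> n \<omega> \<le> t \<and> t \<le> \<tau> (Suc n) \<omega> \<longrightarrow>
           X t \<omega> = drift d (t - \<tau> n \<omega>) (X (\<tau> n \<omega>) \<omega>) (V (\<tau> n \<omega>) \<omega>) \<and>
           (t < \<tau> (Suc n) \<omega> \<longrightarrow> V t \<omega> = V (\<tau> n \<omega>) \<omega>)) \<and>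
        (\<forall>n. \<forall>t\<ge>0. \<forall>E\<in>sets (history_space d n).
           emeasure M {\<omega> \<in> space M. history X V \<tau> n \<omega> \<in> E \<and> \<tau> (Suc n) \<omega> - \<tau> n \<omega> > t} =
           (\<integral>\<^sup>+\<omega>. indicator E (history X V \<tau> n \<omega>) *
              ennreal (exp (- (LBINT s:{0..t}.
                jump_rate d (drift d s (X (\<tau> n \<omega>) \<omega>) (V (\<tau> n \<omega>) \<omega>)) (V (\<tau> n \<omega>) \<omega>)))) \<partial>M)) \<and>
        (\<forall>n. \<forall>E\<in>sets (history_space d n \<Otimes>\<^sub>M borel). \<forall>B\<in>sets (Rd d).
           emeasure M {\<omega> \<in> space M. (history X V \<tau> n \<omega>, \<tau> (Suc n) \<omega>) \<in> E \<and>
                                     V (\<tau> (Suc n) \<omega>) \<omega> \<in> B} =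
           (\<integral>\<^sup>+\<omega>. indicator E (history X V \<tau> n \<omega>, \<tau> (Suc n) \<omega>) *
              emeasure (jump_kernel d \<nu> (X (\<tau> (Suc n) \<omega>) \<omega>) (V (\<tau> n \<omega>) \<omega>)) B \<partial>M)))"

definition state_law ::
  "nat \<Rightarrow> 'a measure \<Rightarrow> (real \<Rightarrow> 'a \<Rightarrow> rvec) \<Rightarrow> (real \<Rightarrow> 'a \<Rightarrow> rvec) \<Rightarrow> real
     \<Rightarrow> (rvec \<times> rvec) measure" where
  "state_law d M X V t = distr M (Rd d \<Otimes>\<^sub>M Rd d) (\<lambda>\<omega>. (X t \<omega>, V t \<omega>))"

definition h_fun :: "nat \<Rightarrow> rvec \<Rightarrow> real" where
  "h_fun d x = 1 / sqrt 2 * (((vnorm d x)\<^sup>2 - real d) / sqrt (real d))"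

definition g_fun :: "nat \<Rightarrow> rvec \<Rightarrow> rvec \<Rightarrow> real" where
  "g_fun d x v = ip d x v"

definition h_hat :: "nat \<Rightarrow> (real \<Rightarrow> 'a \<Rightarrow> rvec) \<Rightarrow> real \<Rightarrow> 'a \<Rightarrow> real" where
  "h_hat d X T \<omega> = 1 / T * (LBINT s:{0..T}. h_fun d (X s \<omega>))"

definition g_hat ::
  "nat \<Rightarrow> (real \<Rightarrow> 'a \<Rightarrow> rvec) \<Rightarrow> (real \<Rightarrow> 'a \<Rightarrow> rvec) \<Rightarrow> real \<Rightarrow> 'a \<Rightarrow> real" where
  "g_hat d X V T \<omega> = 1 / T * (LBINT s:{0..T}. g_fun d (X s \<omega>) (V s \<omega>))"

definition sigma_F_sq :: real where
  "sigma_F_sq = sqrt (32 / pi)"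

text \<open>The iterated limit of \<open>a d T\<close>, first \<open>d \<rightarrow> \<infinity>\<close> and then \<open>T \<rightarrow> \<infinity>\<close>, exists and is \<open>L\<close>.\<close>

definition iterated_limit :: "(nat \<Rightarrow> real \<Rightarrow> real) \<Rightarrow> real \<Rightarrow> bool" where
  "iterated_limit a L \<longleftrightarrow>
     (\<exists>l. (\<forall>T>0. (\<lambda>d. a d T) \<longlonglongrightarrow> l T) \<and> (l \<longlongrightarrow> L) at_top)"

end

theory Submission
  imports Defs "HOL-Real_Asymp.Real_Asymp"
begin

text \<open>The squared radius \<open>Y = |X|\<^sup>2\<close> and the radial velocity \<open>G = (X|V)\<close> form a Markov process of
  their own: between jumps \<open>Y' = 2 G\<close> and \<open>G' = 1\<close>, and at rate \<open>max G 0\<close> the value of \<open>G\<close> is replaced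
  by \<open>- w sqrt Y\<close>. The rotation therefore plays no role. In equilibrium \<open>G\<close> is standard normal, and \<open>w sqrt Y\<close>
  is close to a Rayleigh variable. The variance of an additive functional \<open>A\<close> of this process is governed by
  the correlations of \<open>A\<close> with functions of \<open>(Y, G)\<close>, to which Dynkin's formula applies.

  For the functional of \<open>G\<close>, the correlation with \<open>max G 0\<close> solves, up to an error vanishing as \<open>d\<close> grows,
  a Volterra equation whose kernel does not depend on \<open>d\<close>. By Gronwall's inequality the variances form a
  Cauchy sequence in \<open>d\<close>. The function \<open>phi\<close>, which the generator almost maps to \<open>- g\<close>, shows that
  the limiting second moment \<open>e\<close> satisfies \<open>|e - sqrt (2 / pi) T| \<le> 2 sqrt e\<close>.

  For the potential on the time scale \<open>d\<close>, a small correction of \<open>h\<close> is an approximate eigenfunction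
  of the generator with eigenvalue \<open>- sqrt (2 / pi) / (d + 1)\<close>. Hence the correlation of \<open>h\<close> with its time
  integral follows an exponential relaxation, whose rate gives the first limit.\<close>

section \<open>The radial law and Rayleigh variables\<close>

text \<open>Stationarity fixes one-time laws, but a variance involves two times. So the functional A
  is carried as a third coordinate: the second moment of A is a time integral of one-time
  expectations of A times a function, and Dynkin's formula for \<open>x * f s y g\<close> gives an
  integral equation for these. By Cauchy-Schwarz an error of L2 size q in the generator costs at
  most q times the elapsed time, integrated. Different dimensions live on unrelated probability
  spaces; only such expectations are compared. The function \<open>max g 0\<close> enters because
  free flight up to the final time leaves in the generator only the restart after a jump, which
  carries this weight. For the potential, the drift of h is \<open>sqrt (2 / d) * g\<close>. Adding
  \<open>sqrt (2 / d) * phi\<close> turns it into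
  \<open>sqrt (2 / d) * max g 0 * (1 - y / (d + 1))\<close>; as
  \<open>y - d = sqrt (2 * d) * h\<close>, this is about \<open>- 2 / (d + 1) * max g 0 * h\<close>.
  Replacing \<open>max g 0\<close> by its mean \<open>gauss_const\<close> gives the rate. In
  rescaled time h thus behaves like an Ornstein-Uhlenbeck process of rate
  \<open>sigma_F_sq / 4\<close>, with asymptotic variance 2 over this rate.\<close>

definition rayleigh_density :: "real \<Rightarrow> real" where
  "rayleigh_density b = indicator {0..} b * (b * exp (- b\<^sup>2 / 2))"

definition rayleigh :: "real measure" where
  "rayleigh = density lborel rayleigh_density"

text \<open>Quantile coupling: a Rayleigh variable pushed through this map has the density
  \<open>parallel_density d\<close>, and \<open>sqrt d * rayleigh_quantile d b\<close> tends to \<open>b\<close>. Thus the radial draws of all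
  dimensions live on one probability space.\<close>

definition rayleigh_quantile :: "nat \<Rightarrow> real \<Rightarrow> real" where
  "rayleigh_quantile d b = sqrt (1 - exp (- b\<^sup>2 / (real d - 1)))"

lemma rayleigh_density_nonneg [simp]: "0 \<le> rayleigh_density b"
  by (auto simp: rayleigh_density_def indicator_def)

lemma rayleigh_density_measurable [measurable]: "rayleigh_density \<in> borel_measurable borel"
  unfolding rayleigh_density_def by measurable

lemma sets_rayleigh [measurable_cong, simp]: "sets rayleigh = sets borel"
  and space_rayleigh [simp]: "space rayleigh = UNIV"
  by (auto simp: rayleigh_def)

lemma tendsto_exp_neg_square:
  assumes "c > 0" shows "((\<lambda>x::real. exp (- x\<^sup>2 * c)) \<longlongrightarrow> 0) at_top"
proof -
  have "filterlim (\<lambda>x::real. x\<^sup>2 * c) at_top at_top"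
    using assms by (intro filterlim_at_top_mult_tendsto_pos[OF tendsto_const] filterlim_pow_at_top filterlim_ident) auto
  then have "filterlim (\<lambda>x::real. - (x\<^sup>2 * c)) at_bot at_top"
    by (simp add: filterlim_uminus_at_top)
  from filterlim_compose[OF exp_at_bot this] show ?thesis by simp
qed

text \<open>A general \<open>c\<close> is kept because two values occur: \<open>c = 1 / 2\<close>
  for the Rayleigh tail, and \<open>c = 1 / 2 + 1 / (d - 1)\<close> for the second moment of the
  quantile map.\<close>

lemma nn_integral_weighted_rayleigh:
  assumes "c > 0" "0 \<le> a"
  shows "(\<integral>\<^sup>+b. ennreal (b * exp (- b\<^sup>2 * c)) * indicator {a..} b \<partial>lborel) = ennreal (exp (- a\<^sup>2 * c) / (2 * c))"
proof -
  have "(\<integral>\<^sup>+b. ennreal (b * exp (- b\<^sup>2 * c)) * indicator {a..} b \<partial>lborel)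
      = ennreal (0 - (- exp (- a\<^sup>2 * c) / (2 * c)))"
  proof (rule nn_integral_FTC_atLeast)
    show "((\<lambda>x. - exp (- x\<^sup>2 * c) / (2 * c)) \<longlongrightarrow> 0) at_top"
      using tendsto_divide[OF tendsto_minus[OF tendsto_exp_neg_square[OF assms(1)]] tendsto_const[of "2 * c"]] assms
      by simp
    show "DERIV (\<lambda>x. - exp (- x\<^sup>2 * c) / (2 * c)) x :> x * exp (- x\<^sup>2 * c)" for x
      using assms by (auto intro!: derivative_eq_intros simp: field_simps)
  qed (use assms in auto)
  then show ?thesis by simp
qed

lemma emeasure_rayleigh_Ioi: "emeasure rayleigh {x<..} = ennreal (exp (- (max x 0)\<^sup>2 / 2))"
proof -
  have "emeasure rayleigh {x<..} = (\<integral>\<^sup>+b. ennreal (rayleigh_density b) * indicator {x<..} b \<partial>lborel)"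
    unfolding rayleigh_def by (intro emeasure_density) auto
  also have "\<dots> = (\<integral>\<^sup>+b. ennreal (b * exp (- b\<^sup>2 * (1/2))) * indicator {max x 0..} b \<partial>lborel)"
    by (rule nn_integral_cong_AE, rule AE_mp[OF AE_lborel_singleton[of x]])
      (auto simp: rayleigh_density_def indicator_def max_def)
  also have "\<dots> = ennreal (exp (- (max x 0)\<^sup>2 / 2))"
    by (subst nn_integral_weighted_rayleigh) auto
  finally show ?thesis .
qed

interpretation rayleigh: prob_space rayleigh
proof
  have "emeasure rayleigh (space rayleigh) = (\<integral>\<^sup>+b. ennreal (rayleigh_density b) \<partial>lborel)"
    unfolding rayleigh_def by (subst emeasure_density) auto
  also have "\<dots> = (\<integral>\<^sup>+b. ennreal (b * exp (- b\<^sup>2 * (1/2))) * indicator {0..} b \<partial>lborel)"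
    by (rule nn_integral_cong) (auto simp: rayleigh_density_def indicator_def)
  also have "\<dots> = 1"
    by (subst nn_integral_weighted_rayleigh) auto
  finally show "emeasure rayleigh (space rayleigh) = 1" .
qed

lemma AE_rayleigh_nonneg: "AE b in rayleigh. 0 \<le> b"
  unfolding rayleigh_def by (subst AE_density) (auto simp: rayleigh_density_def indicator_def)

lemma rayleigh_quantile_measurable [measurable]: "rayleigh_quantile d \<in> borel_measurable borel"
  unfolding rayleigh_quantile_def by measurable

lemma rayleigh_quantile_bounds:
  assumes "2 \<le> d"
  shows "0 \<le> rayleigh_quantile d b" "rayleigh_quantile d b < 1"
    and "rayleigh_quantile d b \<le> \<bar>b\<bar> / sqrt (real d - 1)"
proof -
  have e: "exp (- b\<^sup>2 / (real d - 1)) \<le> 1" using assms by auto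
  show "0 \<le> rayleigh_quantile d b" using e unfolding rayleigh_quantile_def by simp
  show "rayleigh_quantile d b < 1" unfolding rayleigh_quantile_def by simp
  have "1 - exp (- b\<^sup>2 / (real d - 1)) \<le> b\<^sup>2 / (real d - 1)"
    using exp_ge_add_one_self[of "- b\<^sup>2 / (real d - 1)"] by (simp add: algebra_simps)
  then have "rayleigh_quantile d b \<le> sqrt (b\<^sup>2 / (real d - 1))"
    unfolding rayleigh_quantile_def by (rule real_sqrt_le_mono)
  then show "rayleigh_quantile d b \<le> \<bar>b\<bar> / sqrt (real d - 1)" by (simp add: real_sqrt_divide)
qed

text \<open>The density is the derivative of \<open>- (1 - w^2) powr ((d - 1) / 2)\<close>. The tail
  is therefore a pure power, which can be matched explicitly with the tail
  \<open>exp (- b^2 / 2)\<close>.\<close>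

lemma nn_integral_parallel_density_Ici:
  assumes "4 \<le> d" "0 \<le> x" "x \<le> 1"
  shows "(\<integral>\<^sup>+w. ennreal (parallel_density d w) * indicator {x..} w \<partial>lborel) = ennreal ((1 - x\<^sup>2) powr ((real d - 1) / 2))"
proof -
  let ?f = "\<lambda>w. (real d - 1) * w * (1 - w\<^sup>2) powr ((real d - 3) / 2)"
  let ?F = "\<lambda>w. - ((1 - w\<^sup>2) powr ((real d - 1) / 2))"
  have "(\<integral>\<^sup>+w. ennreal (parallel_density d w) * indicator {x..} w \<partial>lborel)
      = (\<integral>\<^sup>+w. ennreal (?f w) * indicator {x .. 1} w \<partial>lborel)"
    by (rule nn_integral_cong_AE, rule AE_mp[OF AE_lborel_singleton[of 1]], rule AE_mp[OF AE_lborel_singleton[of 0]])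
      (use assms in \<open>auto simp: parallel_density_def indicator_def\<close>)
  also have "\<dots> = ennreal (?F 1 - ?F x)"
  proof -
    have d: "(?F has_vector_derivative ?f w) (at w)" if "w \<in> {x<..<1}" for w
    proof -
      have w: "w\<^sup>2 < 1" using that assms by (simp add: abs_square_less_1)
      have "(real d - 1) / 2 = (real d - 3) / 2 + 1" by (simp add: field_simps)
      then have pw: "(1 - w\<^sup>2) powr ((real d - 1) / 2) = (1 - w\<^sup>2) powr ((real d - 3) / 2) * (1 - w\<^sup>2)"
        using w by (simp only: powr_add) simp
      have "((\<lambda>w. (1 - w\<^sup>2) powr ((real d - 1) / 2)) has_real_derivative
          (1 - w\<^sup>2) powr ((real d - 1) / 2) * (0 * ln (1 - w\<^sup>2) + (- 2 * w) * ((real d - 1) / 2) / (1 - w\<^sup>2))) (at w)"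
        using w by (intro DERIV_powr) (auto intro!: derivative_eq_intros)
      moreover have "- ((1 - w\<^sup>2) powr ((real d - 1) / 2) * (0 * ln (1 - w\<^sup>2) + (- 2 * w) * ((real d - 1) / 2) / (1 - w\<^sup>2))) = ?f w"
      proof -
        have "- (P * u * (0 * l + (- 2 * w) * ((real d - 1) / 2) / u)) = (real d - 1) * w * P" if "u \<noteq> 0" for P u l :: real
          using that by (simp add: field_simps)
        from this[of "1 - w\<^sup>2"] show ?thesis unfolding pw using w by simp
      qed
      ultimately have "DERIV ?F w :> ?f w"
        using DERIV_minus by metis
      then show ?thesis
        by (simp add: has_real_derivative_iff_has_vector_derivative)
    qed
    have c: "continuous_on {x..1} ?F"
      using assms by (intro continuous_on_minus continuous_on_powr' continuous_intros) (auto simp: abs_square_le_1)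
    have "(?f has_integral (?F 1 - ?F x)) {x..1}"
      using assms by (intro fundamental_theorem_of_calculus_interior c d) auto
    then have i: "((\<lambda>w. ?f w * indicator {x..1} w) has_integral (?F 1 - ?F x)) UNIV"
      unfolding indicator_def of_bool_def if_distrib[where f="\<lambda>x. a * x" for a]
      by (simp cong del: if_weak_cong del: atLeastAtMost_iff)
    have "(\<integral>\<^sup>+w. ennreal (?f w * indicator {x..1} w) \<partial>lborel) = ennreal (?F 1 - ?F x)"
      using assms by (intro nn_integral_has_integral_lborel[OF _ _ i]) (auto simp: indicator_def)
    then show ?thesis using assms
      by (subst (asm) nn_integral_cong[where v="\<lambda>w. ennreal (?f w) * indicator {x .. 1} w"]) (auto simp: indicator_def)
  qed
  also have "\<dots> = ennreal ((1 - x\<^sup>2) powr ((real d - 1) / 2))"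
    using assms by simp
  finally show ?thesis .
qed

text \<open>Finite measures on the line are determined by their values on open upper half lines. The
  three ranges of the threshold correspond to the support of the density in the unit
  interval.\<close>

lemma parallel_density_eq_distr_rayleigh:
  assumes "4 \<le> d"
  shows "density lborel (parallel_density d) = distr rayleigh borel (rayleigh_quantile d)"
proof -
  have [measurable]: "parallel_density d \<in> borel_measurable borel"
    unfolding parallel_density_def by measurable
  have pd: "emeasure (density lborel (parallel_density d)) {x<..} =
     (if x < 0 then 1 else if x < 1 then ennreal ((1 - x\<^sup>2) powr ((real d - 1) / 2)) else 0)" for x
  proof -
    let ?y = "max 0 (min x 1)"
    have "emeasure (density lborel (parallel_density d)) {x<..} =
       (\<integral>\<^sup>+w. ennreal (parallel_density d w) * indicator {x<..} w \<partial>lborel)"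
      by (intro emeasure_density) auto
    also have "\<dots> = (\<integral>\<^sup>+w. ennreal (parallel_density d w) * indicator {?y..} w \<partial>lborel)"
      by (rule nn_integral_cong_AE, rule AE_mp[OF AE_lborel_singleton[of x]])
        (auto simp: parallel_density_def indicator_def)
    also have "\<dots> = ennreal ((1 - ?y\<^sup>2) powr ((real d - 1) / 2))"
      using assms by (intro nn_integral_parallel_density_Ici) auto
    finally show ?thesis by auto
  qed
  show ?thesis
  proof (rule measure_eqI_lessThan)
    fix x
    show "emeasure (density lborel (\<lambda>w. ennreal (parallel_density d w))) {x<..} < \<infinity>"
      unfolding pd by (simp add: less_top)
    have "emeasure (distr rayleigh borel (rayleigh_quantile d)) {x<..}
        = emeasure rayleigh (rayleigh_quantile d -` {x<..})"
      by (subst emeasure_distr) auto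
    also have "\<dots> = (if x < 0 then 1 else if x < 1 then ennreal ((1 - x\<^sup>2) powr ((real d - 1) / 2)) else 0)"
    proof -
      consider "x < 0" | "0 \<le> x" "x < 1" | "1 \<le> x" by linarith
      then show ?thesis
      proof cases
        case 1
        then have "rayleigh_quantile d -` {x<..} = space rayleigh"
          using rayleigh_quantile_bounds(1)[of d] assms by (auto intro: less_le_trans)
        then show ?thesis using 1 rayleigh.emeasure_space_1 by simp
      next
        case 3
        then have "rayleigh_quantile d -` {x<..} = {}"
          using rayleigh_quantile_bounds(2)[of d] assms by (auto dest: less_trans) (meson less_le_trans not_less_iff_gr_or_eq)
        then show ?thesis using 3 by simp
      next
        case 2
        \<comment> \<open>The preimage of the threshold:
          \<open>rayleigh_quantile d r = x\<close>.\<close>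
        define r where "r = sqrt (- (real d - 1) * ln (1 - x\<^sup>2))"
        have x2: "x\<^sup>2 < 1" using 2 by (simp add: abs_square_less_1)
        have l: "ln (1 - x\<^sup>2) \<le> 0" using x2 by simp
        have r: "r\<^sup>2 = - (real d - 1) * ln (1 - x\<^sup>2)" "0 \<le> r"
          unfolding r_def using l assms mult_nonpos_nonpos[of "1 - real d" "ln (1 - x\<^sup>2)"] by auto
        have *: "(x < rayleigh_quantile d b) = (r < b)" if "0 \<le> b" for b
        proof -
          have "(x < rayleigh_quantile d b) = (x\<^sup>2 < 1 - exp (- b\<^sup>2 / (real d - 1)))"
            unfolding rayleigh_quantile_def using 2 real_less_rsqrt real_sqrt_less_iff
            by (metis abs_of_nonneg real_sqrt_abs)
          also have "\<dots> = (exp (- b\<^sup>2 / (real d - 1)) < exp (ln (1 - x\<^sup>2)))"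
            using x2 by auto
          also have "\<dots> = (- b\<^sup>2 / (real d - 1) < ln (1 - x\<^sup>2))" by (subst exp_less_cancel_iff) simp
          also have "\<dots> = (r\<^sup>2 < b\<^sup>2)" using assms unfolding r by (simp add: field_simps)
          also have "\<dots> = (r < b)" using that r(2) by (meson power_less_imp_less_base power_strict_mono zero_less_numeral)
          finally show ?thesis .
        qed
        have "emeasure rayleigh (rayleigh_quantile d -` {x<..}) = emeasure rayleigh {r<..}"
          by (rule emeasure_eq_AE) (use AE_rayleigh_nonneg * measurable_sets_borel[OF rayleigh_quantile_measurable] in auto)
        also have "\<dots> = ennreal (exp (- r\<^sup>2 / 2))" using r(2) by (simp add: emeasure_rayleigh_Ioi)
        also have "exp (- r\<^sup>2 / 2) = (1 - x\<^sup>2) powr ((real d - 1) / 2)"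
          using x2 unfolding r powr_def by (simp add: field_simps)
        finally show ?thesis using 2 by simp
      qed
    qed
    finally show "emeasure (density lborel (\<lambda>w. ennreal (parallel_density d w))) {x<..} =
        emeasure (distr rayleigh borel (rayleigh_quantile d)) {x<..}" unfolding pd by simp
  qed auto
qed

text \<open>The square is \<open>1 - exp (- b^2 / (d - 1))\<close>, and the exponential has Rayleigh
  mean \<open>(d - 1) / (d + 1)\<close>. This is where the denominator \<open>d + 1\<close> of all
  later error terms and rates originates.\<close>

lemma integral_rayleigh_quantile_sq:
  assumes "4 \<le> d"
  shows "(\<integral>b. (rayleigh_quantile d b)\<^sup>2 \<partial>rayleigh) = 2 / (real d + 1)"
proof -
  let ?c = "1 / 2 + 1 / (real d - 1)"
  have c: "0 < ?c" using assms by (auto intro: add_pos_pos)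
  have "(\<integral>\<^sup>+b. ennreal (exp (- b\<^sup>2 / (real d - 1))) \<partial>rayleigh)
     = (\<integral>\<^sup>+b. ennreal (rayleigh_density b) * ennreal (exp (- b\<^sup>2 / (real d - 1))) \<partial>lborel)"
    unfolding rayleigh_def by (subst nn_integral_density) auto
  also have "\<dots> = (\<integral>\<^sup>+b. ennreal (b * exp (- b\<^sup>2 * ?c)) * indicator {0..} b \<partial>lborel)"
  proof (rule nn_integral_cong)
    fix b :: real
    show "ennreal (rayleigh_density b) * ennreal (exp (- b\<^sup>2 / (real d - 1))) = ennreal (b * exp (- b\<^sup>2 * ?c)) * indicator {0..} b"
      by (auto simp: rayleigh_density_def indicator_def ennreal_mult[symmetric] algebra_simps exp_add[symmetric])
  qed
  also have "\<dots> = ennreal (1 / (2 * ?c))"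
    by (subst nn_integral_weighted_rayleigh[OF c]) auto
  also have "1 / (2 * ?c) = (real d - 1) / (real d + 1)" using assms by (simp add: field_simps)
  finally have "(\<integral>b. exp (- b\<^sup>2 / (real d - 1)) \<partial>rayleigh) = (real d - 1) / (real d + 1)"
    using assms by (subst integral_eq_nn_integral) auto
  moreover have "integrable rayleigh (\<lambda>b. exp (- b\<^sup>2 / (real d - 1)))"
    using assms by (intro rayleigh.integrable_const_bound[where B=1]) auto
  moreover have "(rayleigh_quantile d b)\<^sup>2 = 1 - exp (- b\<^sup>2 / (real d - 1))" for b
    using assms unfolding rayleigh_quantile_def by (subst real_sqrt_pow2) auto
  ultimately have "(\<integral>b. (rayleigh_quantile d b)\<^sup>2 \<partial>rayleigh) = 1 - (real d - 1) / (real d + 1)"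
    using rayleigh.prob_space by simp
  then show ?thesis by (simp add: field_simps)
qed

lemma half_line_integral_even:
  fixes f :: "real \<Rightarrow> real"
  assumes "has_bochner_integral lborel f v" "\<And>x. f (- x) = f x"
  shows "has_bochner_integral lborel (\<lambda>x. indicator {0..} x *\<^sub>R f x) (v / 2)"
proof -
  have int: "integrable lborel f" "integral\<^sup>L lborel f = v"
    using assms(1) by (auto simp: has_bochner_integral_iff)
  have [measurable]: "f \<in> borel_measurable lborel" using int by auto
  have "integrable lborel (\<lambda>x. indicator {0..} x *\<^sub>R f x)"
    by (rule Bochner_Integration.integrable_bound[OF int(1)]) (auto simp: indicator_def)
  then have h: "has_bochner_integral lborel (\<lambda>x. indicator {0..} x *\<^sub>R f x) (integral\<^sup>L lborel (\<lambda>x. indicator {0..} x *\<^sub>R f x))"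
    by (rule has_bochner_integral_integrable)
  from has_bochner_integral_even_function[OF this assms(2)]
  have "v = 2 * integral\<^sup>L lborel (\<lambda>x. indicator {0..} x *\<^sub>R f x)"
    using assms(1) has_bochner_integral_eq by fastforce
  with h show ?thesis by simp
qed

text \<open>Up to the factor \<open>sqrt (2 * pi)\<close> the mean is the second moment of the
  standard normal law over the positive half line.\<close>

lemma rayleigh_mean: "integrable rayleigh (\<lambda>b. b)" "(\<integral>b. b \<partial>rayleigh) = sqrt (pi / 2)"
proof -
  have "has_bochner_integral lborel (\<lambda>x. indicator {0..} x *\<^sub>R (std_normal_density x * x\<^sup>2)) (1 / 2)"
    using half_line_integral_even[OF std_normal_moment_even[of 1]] by (simp add: std_normal_density_def)
  then have "has_bochner_integral lborel (\<lambda>x. (indicator {0..} x *\<^sub>R (std_normal_density x * x\<^sup>2)) * sqrt (2 * pi)) (1 / 2 * sqrt (2 * pi))"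
    by (rule has_bochner_integral_mult_left)
  moreover have "(indicator {0..} x *\<^sub>R (std_normal_density x * x\<^sup>2)) * sqrt (2 * pi) = rayleigh_density x *\<^sub>R x" for x :: real
    by (simp add: std_normal_density_def rayleigh_density_def power2_eq_square)
  moreover have "1 / 2 * sqrt (2 * pi) = sqrt (pi / 2)"
    by (simp add: real_sqrt_divide real_sqrt_mult field_simps)
  ultimately have "has_bochner_integral lborel (\<lambda>x. rayleigh_density x *\<^sub>R x) (sqrt (pi / 2))"
    by simp
  then show "integrable rayleigh (\<lambda>b. b)" "(\<integral>b. b \<partial>rayleigh) = sqrt (pi / 2)"
    unfolding rayleigh_def by (auto simp: integrable_density integral_density has_bochner_integral_iff)
qed

text \<open>The L1 distance of the coupled radial draw from its limit. It bounds the error of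
  replacing one by the other inside any function with Lipschitz constant 1.\<close>

definition rayleigh_gap :: "nat \<Rightarrow> real" where
  "rayleigh_gap d = (\<integral>b. \<bar>sqrt (real d) * rayleigh_quantile d b - b\<bar> \<partial>rayleigh)"

text \<open>A bound uniform in \<open>d\<close>, needed as a dominating function. The crude estimate
  \<open>d / (d - 1) \<le> 4\<close> is chosen to have a rational square root.\<close>

lemma sqrt_rayleigh_quantile_bound:
  assumes "2 \<le> d"
  shows "sqrt (real d) * rayleigh_quantile d b \<le> 2 * \<bar>b\<bar>"
proof -
  have "sqrt (real d) * rayleigh_quantile d b \<le> sqrt (real d) * (\<bar>b\<bar> / sqrt (real d - 1))"
    using rayleigh_quantile_bounds[OF assms] by (intro mult_left_mono) auto
  also have "\<dots> = sqrt (real d / (real d - 1)) * \<bar>b\<bar>" by (simp add: real_sqrt_divide)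
  also have "\<dots> \<le> sqrt 4 * \<bar>b\<bar>"
    using assms by (intro mult_right_mono real_sqrt_le_mono) (auto simp: field_simps)
  finally show ?thesis by simp
qed

lemma integrable_rayleigh_quantile:
  assumes "2 \<le> d" shows "integrable rayleigh (rayleigh_quantile d)"
  using rayleigh_quantile_bounds(1,2)[OF assms]
  by (intro rayleigh.integrable_const_bound[where B=1]) (auto intro: less_imp_le)

lemma rayleigh_gap_integrable:
  assumes "2 \<le> d" shows "integrable rayleigh (\<lambda>b. \<bar>sqrt (real d) * rayleigh_quantile d b - b\<bar>)"
  using integrable_rayleigh_quantile[OF assms] rayleigh_mean(1) by auto

lemma tendsto_sqrt_rayleigh_quantile:
  assumes "0 \<le> b"
  shows "(\<lambda>d. sqrt (real d) * rayleigh_quantile d b) \<longlonglongrightarrow> b"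
proof -
  have "((\<lambda>d. sqrt (real d * (1 - exp (- b\<^sup>2 / (real d - 1))))) \<longlongrightarrow> sqrt (b\<^sup>2)) sequentially"
    by (intro tendsto_real_sqrt) real_asymp
  then show ?thesis using assms unfolding rayleigh_quantile_def by (simp add: real_sqrt_mult)
qed

lemma rayleigh_gap_tendsto: "rayleigh_gap \<longlonglongrightarrow> 0"
proof -
  \<comment> \<open>The index is shifted by 2 because the dominating bound only holds from dimension
    2 on.\<close>
  have "(\<lambda>d. \<integral>b. \<bar>sqrt (real (d + 2)) * rayleigh_quantile (d + 2) b - b\<bar> \<partial>rayleigh) \<longlonglongrightarrow> (\<integral>b. 0 \<partial>rayleigh)"
  proof (rule integral_dominated_convergence[where w="\<lambda>b. 3 * \<bar>b\<bar>"])
    show "integrable rayleigh (\<lambda>b. 3 * \<bar>b\<bar>)" using rayleigh_mean(1) by auto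
    show "AE b in rayleigh. (\<lambda>d. \<bar>sqrt (real (d + 2)) * rayleigh_quantile (d + 2) b - b\<bar>) \<longlonglongrightarrow> 0"
      using AE_rayleigh_nonneg
    proof eventually_elim
      case (elim b)
      from tendsto_sqrt_rayleigh_quantile[OF this]
      have "(\<lambda>d. \<bar>sqrt (real d) * rayleigh_quantile d b - b\<bar>) \<longlonglongrightarrow> 0"
        by (simp add: LIM_zero_iff tendsto_rabs_zero)
      then show ?case by (rule LIMSEQ_ignore_initial_segment)
    qed
    show "AE b in rayleigh. norm \<bar>sqrt (real (d + 2)) * rayleigh_quantile (d + 2) b - b\<bar> \<le> 3 * \<bar>b\<bar>" for d
    proof (rule AE_I2)
      fix b
      have "0 \<le> sqrt (real (d + 2)) * rayleigh_quantile (d + 2) b"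
        using rayleigh_quantile_bounds(1)[of "d + 2"] by (intro mult_nonneg_nonneg) auto
      then show "norm \<bar>sqrt (real (d + 2)) * rayleigh_quantile (d + 2) b - b\<bar> \<le> 3 * \<bar>b\<bar>"
        using sqrt_rayleigh_quantile_bound[of "d + 2" b] by auto
    qed
  qed measurable
  then have "(\<lambda>d. rayleigh_gap (d + 2)) \<longlonglongrightarrow> 0" unfolding rayleigh_gap_def by simp
  then show ?thesis by (rule LIMSEQ_offset)
qed

lemma rayleigh_gap_mean:
  assumes "2 \<le> d"
  shows "\<bar>sqrt (real d) * (\<integral>b. rayleigh_quantile d b \<partial>rayleigh) - sqrt (pi / 2)\<bar> \<le> rayleigh_gap d"
proof -
  have "sqrt (real d) * (\<integral>b. rayleigh_quantile d b \<partial>rayleigh) - sqrt (pi / 2) =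
      (\<integral>b. sqrt (real d) * rayleigh_quantile d b - b \<partial>rayleigh)"
    using integrable_rayleigh_quantile[OF assms] rayleigh_mean by simp
  then show ?thesis unfolding rayleigh_gap_def
    using integral_abs_bound[of rayleigh "\<lambda>b. sqrt (real d) * rayleigh_quantile d b - b"] by simp
qed

text \<open>The variance is nonnegative, so the squared mean is at most the second moment
  \<open>2 / (d + 1)\<close>.\<close>

lemma rayleigh_quantile_mean_le:
  assumes "4 \<le> d"
  shows "0 \<le> (\<integral>b. rayleigh_quantile d b \<partial>rayleigh)" "(\<integral>b. rayleigh_quantile d b \<partial>rayleigh) \<le> sqrt (2 / (real d + 1))"
proof -
  have d: "2 \<le> d" using assms by simp
  show "0 \<le> (\<integral>b. rayleigh_quantile d b \<partial>rayleigh)"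
    using rayleigh_quantile_bounds(1)[OF d] by (simp add: integral_nonneg_AE)
  have "integrable rayleigh (\<lambda>b. (rayleigh_quantile d b)\<^sup>2)"
    using rayleigh_quantile_bounds(1,2)[OF d]
    by (intro rayleigh.integrable_const_bound[where B=1] AE_I2) (auto simp: abs_square_le_1 intro: less_imp_le)
  with rayleigh.variance_positive[of "rayleigh_quantile d"] rayleigh.variance_eq[of "rayleigh_quantile d"] integrable_rayleigh_quantile[OF d]
  have "(\<integral>b. rayleigh_quantile d b \<partial>rayleigh)\<^sup>2 \<le> 2 / (real d + 1)"
    unfolding integral_rayleigh_quantile_sq[OF assms, symmetric] by simp
  then show "(\<integral>b. rayleigh_quantile d b \<partial>rayleigh) \<le> sqrt (2 / (real d + 1))"
    by (rule real_le_rsqrt)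
qed

text \<open>In the supremum norm with weight \<open>exp (- 2 * K * t)\<close> the integral operator
  has norm at most one half, so the integral term can be absorbed. The function is only bounded and
  measurable, as are the correlations to which this is applied.\<close>

lemma weighted_gronwall:
  fixes x :: "real \<Rightarrow> real"
  assumes [measurable]: "x \<in> borel_measurable borel"
    and B: "\<And>t. t \<in> {0..T} \<Longrightarrow> \<bar>x t\<bar> \<le> B" and K: "0 < K"
    and x: "\<And>t. t \<in> {0..T} \<Longrightarrow> \<bar>x t\<bar> \<le> \<epsilon> + K * (LBINT s:{0..t}. \<bar>x s\<bar>)"
    and t: "t \<in> {0..T}"
  shows "\<bar>x t\<bar> \<le> 2 * \<epsilon> * exp (2 * K * T)"
proof -
  define N where "N = (SUP t\<in>{0..T}. exp (- (2 * K * t)) * \<bar>x t\<bar>)"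
  have T: "0 \<le> T" using t by simp
  have B0: "0 \<le> B" using B[of t] t by linarith
  have bdd: "bdd_above ((\<lambda>t. exp (- (2 * K * t)) * \<bar>x t\<bar>) ` {0..T})"
  proof (rule bdd_aboveI2[where M=B])
    fix t assume t: "t \<in> {0..T}"
    have "exp (- (2 * K * t)) * \<bar>x t\<bar> \<le> 1 * B"
      using K t B by (intro mult_mono) auto
    then show "exp (- (2 * K * t)) * \<bar>x t\<bar> \<le> B" by simp
  qed
  have up: "exp (- (2 * K * s)) * \<bar>x s\<bar> \<le> N" if "s \<in> {0..T}" for s
    unfolding N_def using that bdd by (intro cSUP_upper) auto
  have N0: "0 \<le> N" using up[of 0] T by (auto intro: order_trans[rotated])
  have "(LBINT s:{0..0::real}. \<bar>x s\<bar>) = 0"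
    unfolding set_lebesgue_integral_def
    by (rule integral_eq_zero_AE, rule AE_mp[OF AE_lborel_singleton[of 0]]) (auto simp: indicator_def)
  then have e0: "0 \<le> \<epsilon>" using x[of 0] T by simp
  have ex: "has_bochner_integral lborel (\<lambda>s. (N * exp (2 * K * s)) * indicator {0..t} s)
         (N * exp (2 * K * t) / (2 * K) - N * exp (2 * K * 0) / (2 * K))" if "0 \<le> t" for t
    using K that by (intro has_bochner_integral_FTC_Icc_real) (auto intro!: derivative_eq_intros simp: field_simps)
  have "exp (- (2 * K * t)) * \<bar>x t\<bar> \<le> \<epsilon> + N / 2" if t: "t \<in> {0..T}" for t
  proof -
    have "(LBINT s:{0..t}. \<bar>x s\<bar>) \<le> (\<integral>s. (N * exp (2 * K * s)) * indicator {0..t} s \<partial>lborel)"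
      unfolding set_lebesgue_integral_def
    proof (rule integral_mono)
      show "integrable lborel (\<lambda>s. (N * exp (2 * K * s)) * indicator {0..t} s)"
        using ex[of t] t by (auto simp: has_bochner_integral_iff)
      show le: "indicator {0..t} s *\<^sub>R \<bar>x s\<bar> \<le> (N * exp (2 * K * s)) * indicator {0..t} s" for s
      proof (cases "s \<in> {0..t}")
        case True
        then have "exp (- (2 * K * s)) * \<bar>x s\<bar> \<le> N" using up[of s] t by simp
        then have "exp (2 * K * s) * (exp (- (2 * K * s)) * \<bar>x s\<bar>) \<le> exp (2 * K * s) * N"
          by (intro mult_left_mono) auto
        moreover have "exp (2 * K * s) * (exp (- (2 * K * s)) * \<bar>x s\<bar>) = \<bar>x s\<bar>"
          by (simp add: mult.assoc[symmetric] exp_add[symmetric])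
        ultimately have "\<bar>x s\<bar> \<le> N * exp (2 * K * s)" by (simp only: mult.commute)
        then show ?thesis using True by simp
      qed simp
      have nn: "0 \<le> indicator {0..t} s *\<^sub>R \<bar>x s\<bar>" for s by (auto simp: indicator_def)
      show "integrable lborel (\<lambda>s. indicator {0..t} s *\<^sub>R \<bar>x s\<bar>)"
      proof (rule Bochner_Integration.integrable_bound[where f="\<lambda>s. (N * exp (2 * K * s)) * indicator {0..t} s"])
        show "integrable lborel (\<lambda>s. (N * exp (2 * K * s)) * indicator {0..t} s)"
          using ex[of t] t by (auto simp: has_bochner_integral_iff)
        show "AE s in lborel. norm (indicator {0..t} s *\<^sub>R \<bar>x s\<bar>) \<le> norm ((N * exp (2 * K * s)) * indicator {0..t} s)"
          using le nn by (intro AE_I2) (metis abs_of_nonneg order_trans real_norm_def)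
      qed measurable
    qed
    also have "\<dots> = N * exp (2 * K * t) / (2 * K) - N / (2 * K)"
      using ex[of t] t by (auto simp: has_bochner_integral_iff)
    also have "\<dots> \<le> N * exp (2 * K * t) / (2 * K)" using N0 K by simp
    finally have "\<bar>x t\<bar> \<le> \<epsilon> + K * (N * exp (2 * K * t) / (2 * K))"
      using x[OF t] K mult_left_mono[of "LBINT s:{0..t}. \<bar>x s\<bar>" "N * exp (2 * K * t) / (2 * K)" K] by linarith
    also have "\<dots> = \<epsilon> + N * exp (2 * K * t) / 2" using K by simp
    finally have "exp (- (2 * K * t)) * \<bar>x t\<bar> \<le> exp (- (2 * K * t)) * (\<epsilon> + N * exp (2 * K * t) / 2)"
      by (intro mult_left_mono) auto
    also have "\<dots> = exp (- (2 * K * t)) * \<epsilon> + N / 2" by (simp add: field_simps exp_minus)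
    also have "\<dots> \<le> 1 * \<epsilon> + N / 2" using e0 K t by (intro add_right_mono mult_right_mono) auto
    finally show ?thesis by simp
  qed
  \<comment> \<open>\<open>N\<close> is a supremum of a bounded set, hence a genuine number, and
    half of it can be moved to the left.\<close>
  then have "N \<le> \<epsilon> + N / 2" unfolding N_def using T by (intro cSUP_least) auto
  then have "exp (- (2 * K * t)) * \<bar>x t\<bar> \<le> 2 * \<epsilon>" using up[OF t] by linarith
  then have "\<bar>x t\<bar> \<le> 2 * \<epsilon> * exp (2 * K * t)" by (simp add: exp_minus field_simps)
  also have "\<dots> \<le> 2 * \<epsilon> * exp (2 * K * T)" using e0 K t by (intro mult_left_mono) auto
  finally show ?thesis .
qed

section \<open>Test functions on the line\<close>

text \<open>Dynkin's formula below asks for a classical derivative along the flow. The test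
  functions have different formulas on the two half lines, and matching values and slopes at the
  junction makes them differentiable there too.\<close>

lemma DERIV_glue:
  fixes f g :: "real \<Rightarrow> real"
  assumes f: "x \<le> a \<Longrightarrow> (f has_real_derivative f' x) (at x)"
    and g: "a \<le> x \<Longrightarrow> (g has_real_derivative g' x) (at x)"
    and eq: "f a = g a" "f' a = g' a"
  shows "((\<lambda>x. if x \<le> a then f x else g x) has_real_derivative (if x \<le> a then f' x else g' x)) (at x)"
proof -
  have "((\<lambda>x. if x \<in> {..a} then f x else g x) has_vector_derivative
      (if x \<in> {..a} then f' x else g' x)) (at x within ({..a} \<union> {a<..}))"
    using assms
    by (intro has_vector_derivative_If_within_closures[where S="{..a}" and T="{a<..}" and u = "{..a} \<union> {a<..}"])
      (auto simp: has_real_derivative_iff_has_vector_derivative[symmetric] intro: has_field_derivative_at_within)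
  moreover have "{..a} \<union> {a<..} = UNIV" by auto
  ultimately show ?thesis by (simp add: has_real_derivative_iff_has_vector_derivative)
qed

lemma DERIV_pos_part_sq: "((\<lambda>x::real. (max x 0)\<^sup>2 / 2) has_real_derivative max x 0) (at x)"
proof -
  have "((\<lambda>x::real. if x \<le> 0 then 0 else x\<^sup>2 / 2) has_real_derivative (if x \<le> 0 then 0 else x)) (at x)"
    by (rule DERIV_glue) (auto intro!: derivative_eq_intros)
  moreover have "(\<lambda>x::real. if x \<le> 0 then 0 else x\<^sup>2 / 2) = (\<lambda>x. (max x 0)\<^sup>2 / 2)"
    by (auto simp: max_def)
  moreover have "(if x \<le> 0 then 0 else x) = max x 0" by auto
  ultimately show ?thesis by simp
qed

text \<open>The generator sends \<open>phi\<close> to the function \<open>g\<close> with the opposite sign, up to an error that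
  vanishes as \<open>d\<close> grows, because resampling replaces it by \<open>- y / (d + 1)\<close>, which is close to \<open>- 1\<close>.\<close>

definition phi :: "real \<Rightarrow> real" where "phi g = - (max (- g) 0)\<^sup>2 / 2"

lemma DERIV_phi: "(phi has_real_derivative max (- g) 0) (at g)"
proof -
  have "((\<lambda>x. (max (- x) 0)\<^sup>2 / 2) has_real_derivative (max (- g) 0) * (- 1)) (at g)"
    by (rule DERIV_chain2[OF DERIV_pos_part_sq]) (auto intro!: derivative_eq_intros)
  from DERIV_minus[OF this] show ?thesis by (simp add: phi_def[abs_def])
qed

text \<open>The standard normal density at 0, and at the same time the mean of
  \<open>max g 0\<close> under the standard normal law, that is, the mean jump rate in
  equilibrium.\<close>

definition gauss_const :: real where "gauss_const = 1 / sqrt (2 * pi)"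

definition normal_tail :: "real \<Rightarrow> real" where
  "normal_tail x = (LBINT s:{x<..}. std_normal_density s)"

lemma integrable_std_normal_density [simp]: "integrable lborel std_normal_density"
  using integrable_std_normal_moment[of 0] by simp

lemma std_normal_set_integrable: "A \<in> sets borel \<Longrightarrow> set_integrable lborel A std_normal_density"
  unfolding set_integrable_def by (intro integrable_mult_indicator) auto

text \<open>Near \<open>x\<close> the tail is a constant minus an integral with fixed base point
  \<open>x - 1\<close>, so the fundamental theorem on a compact interval applies.\<close>

lemma DERIV_normal_tail: "(normal_tail has_real_derivative - std_normal_density x) (at x)"
proof -
  let ?f = std_normal_density
  have cont: "continuous_on A ?f" for A :: "real set" unfolding std_normal_density_def by (intro continuous_intros) auto
  have "((\<lambda>u. integral {x - 1..u} ?f) has_real_derivative ?f x) (at x within {x - 1..x + 1})"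
    by (rule integral_has_real_derivative[OF cont]) simp
  moreover have "at x within {x - 1..x + 1} = at x" by (rule at_within_Icc_at) simp_all
  ultimately have d: "((\<lambda>u. integral {x - 1..u} ?f) has_real_derivative ?f x) (at x)"
    by simp
  have eq: "normal_tail u = normal_tail (x - 1) - integral {x - 1..u} ?f" if "x - 1 < u" for u
  proof -
    have "{x - 1<..} = {x - 1<..u} \<union> {u<..}" using that by auto
    then have "normal_tail (x - 1) = (LBINT s:{x - 1<..u}. ?f s) + normal_tail u"
      unfolding normal_tail_def
      by (metis (no_types, lifting) set_integral_Un std_normal_set_integrable disjoint_iff greaterThanAtMost_borel greaterThanAtMost_iff greaterThan_borel greaterThan_iff not_less)
    also have "(LBINT s:{x - 1<..u}. ?f s) = (LBINT s:{x - 1..u}. ?f s)"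
      unfolding set_lebesgue_integral_def
      by (intro integral_cong_AE, measurable, rule AE_mp[OF AE_lborel_singleton[of "x - 1"]]) (auto simp: indicator_def)
    also have "\<dots> = integral {x - 1..u} ?f"
      by (rule set_borel_integral_eq_integral) (auto intro: std_normal_set_integrable)
    finally show ?thesis by simp
  qed
  have "((\<lambda>u. normal_tail (x - 1) - integral {x - 1..u} ?f) has_real_derivative - ?f x) (at x)"
    using DERIV_diff[OF DERIV_const[of "normal_tail (x - 1)"] d] by simp
  moreover have "\<forall>\<^sub>F u in nhds x. normal_tail u = normal_tail (x - 1) - integral {x - 1..u} ?f"
    using eventually_nhds_in_open[of "{x - 1<..}" x] by (auto elim!: eventually_mono intro: eq)
  ultimately show ?thesis by (subst DERIV_cong_ev[OF refl _ refl]) auto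
qed

lemma half_line_std_normal: "(LBINT s:{0<..}. std_normal_density s) = 1 / 2"
proof -
  have "has_bochner_integral lborel std_normal_density 1"
    using std_normal_moment_even[of 0] by simp
  from half_line_integral_even[OF this] std_normal_density_def
  have "(\<integral>x. indicator {0..} x *\<^sub>R std_normal_density x \<partial>lborel) = 1 / 2"
    by (metis (no_types, lifting) has_bochner_integral_integral_eq power2_minus)
  moreover have "(\<integral>x. indicator {0..} x *\<^sub>R std_normal_density x \<partial>lborel) = (\<integral>x. indicator {0<..} x *\<^sub>R std_normal_density x \<partial>lborel)"
    by (intro integral_cong_AE, measurable, rule AE_mp[OF AE_lborel_singleton[of 0]]) (auto simp: indicator_def)
  ultimately show ?thesis unfolding set_lebesgue_integral_def by simp
qed

lemma normal_tail_0: "normal_tail 0 = 1 / 2"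
  unfolding normal_tail_def by (rule half_line_std_normal)

lemma normal_tail_nonneg: "0 \<le> normal_tail x"
  unfolding normal_tail_def set_lebesgue_integral_def by (intro integral_nonneg_AE) auto

lemma normal_tail_le:
  assumes "0 \<le> g" shows "normal_tail g \<le> exp (- g\<^sup>2 / 2) / 2"
proof -
  have "normal_tail g = (\<integral>s. indicator {g<..} s *\<^sub>R std_normal_density s \<partial>lborel)"
    by (simp add: normal_tail_def set_lebesgue_integral_def)
  also have "\<dots> = \<bar>1\<bar> *\<^sub>R (\<integral>s. indicator {g<..} (g + 1 * s) *\<^sub>R std_normal_density (g + 1 * s) \<partial>lborel)"
    by (rule lborel_integral_real_affine) simp
  also have "\<dots> = (\<integral>s. indicator {0<..} s *\<^sub>R std_normal_density (g + s) \<partial>lborel)"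
    by (simp add: indicator_def)
  also have "\<dots> \<le> (\<integral>s. exp (- g\<^sup>2 / 2) * (indicator {0<..} s *\<^sub>R std_normal_density s) \<partial>lborel)"
  proof (rule integral_mono')
    show "integrable lborel (\<lambda>s. exp (- g\<^sup>2 / 2) * (indicator {0<..} s *\<^sub>R std_normal_density s))"
      using std_normal_set_integrable[of "{0<..}"] unfolding set_integrable_def by simp
    show "indicator {0<..} s *\<^sub>R std_normal_density (g + s) \<le> exp (- g\<^sup>2 / 2) * (indicator {0<..} s *\<^sub>R std_normal_density s)" for s
    proof (cases "0 < s")
      case True
      have "- (g + s)\<^sup>2 / 2 \<le> - g\<^sup>2 / 2 + - s\<^sup>2 / 2" using True assms by (simp add: power2_sum)
      then have "exp (- (g + s)\<^sup>2 / 2) \<le> exp (- g\<^sup>2 / 2) * exp (- s\<^sup>2 / 2)"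
        by (simp only: exp_add[symmetric] exp_le_cancel_iff)
      then show ?thesis using True by (simp add: std_normal_density_def divide_right_mono)
    qed simp
  qed auto
  also have "\<dots> = exp (- g\<^sup>2 / 2) / 2"
    using half_line_std_normal unfolding set_lebesgue_integral_def by simp
  finally show ?thesis .
qed

text \<open>\<open>gauss_const\<close> times the Mills ratio (Gaussian tail over Gaussian density).
  It is the bounded solution on the positive half line of
  \<open>f' = g * f - gauss_const\<close>.\<close>

definition mills :: "real \<Rightarrow> real" where "mills g = exp (g\<^sup>2 / 2) * normal_tail g"

lemma DERIV_mills: "(mills has_real_derivative g * mills g - gauss_const) (at g)"
proof -
  have "((\<lambda>g. exp (g\<^sup>2 / 2) * normal_tail g) has_real_derivative
     (exp (g\<^sup>2 / 2) * (2 * g / 2)) * normal_tail g + (- std_normal_density g) * exp (g\<^sup>2 / 2)) (at g)"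
    by (intro DERIV_mult DERIV_normal_tail) (auto intro!: derivative_eq_intros)
  moreover have "std_normal_density g * exp (g\<^sup>2 / 2) = gauss_const"
    unfolding std_normal_density_def gauss_const_def by (simp add: exp_minus field_simps)
  ultimately show ?thesis unfolding mills_def[abs_def] by (simp add: mult_ac)
qed

lemma mills_0: "mills 0 = 1 / 2" by (simp add: mills_def normal_tail_0)

lemma mills_bounds: assumes "0 \<le> g" shows "0 \<le> mills g" "mills g \<le> 1 / 2"
proof -
  show "0 \<le> mills g" using normal_tail_nonneg by (simp add: mills_def)
  have "mills g \<le> exp (g\<^sup>2 / 2) * (exp (- g\<^sup>2 / 2) / 2)"
    unfolding mills_def by (intro mult_left_mono normal_tail_le assms) auto
  then show "mills g \<le> 1 / 2" by (simp add: exp_minus field_simps)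
qed

text \<open>The solution of the Poisson equation of the limiting jump process with source
  \<open>max g 0 - gauss_const\<close>; after a jump \<open>chi\<close> has mean \<open>1 / 2\<close>.\<close>

definition chi :: "real \<Rightarrow> real" where
  "chi g = (if g \<le> 0 then - gauss_const * g else mills g - 1 / 2)"

definition chi' :: "real \<Rightarrow> real" where
  "chi' g = max g 0 * mills (max g 0) - gauss_const"

lemma DERIV_chi: "(chi has_real_derivative chi' g) (at g)"
proof -
  have "(chi has_real_derivative (if g \<le> 0 then - gauss_const else g * mills g - gauss_const)) (at g)"
    unfolding chi_def[abs_def]
    by (rule DERIV_glue) (use DERIV_mills mills_0 in \<open>auto intro!: derivative_eq_intros\<close>)
  moreover have "(if g \<le> 0 then - gauss_const else g * mills g - gauss_const) = chi' g"
    by (auto simp: chi'_def max_def)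
  ultimately show ?thesis by simp
qed

lemma continuous_mills: "continuous_on A mills"
  by (meson DERIV_mills DERIV_isCont continuous_at_imp_continuous_on)

lemma continuous_chi: "continuous_on A chi"
  by (meson DERIV_chi DERIV_isCont continuous_at_imp_continuous_on)

lemma continuous_phi: "continuous_on A phi"
  by (meson DERIV_phi DERIV_isCont continuous_at_imp_continuous_on)

lemma continuous_chi': "continuous_on A chi'"
  unfolding chi'_def[abs_def]
  by (intro continuous_intros continuous_on_compose2[OF continuous_mills[of UNIV]]) auto

lemma gauss_const_bounds: "0 < gauss_const" "gauss_const \<le> 1"
proof -
  have "1 \<le> 2 * pi" using pi_gt3 by linarith
  then show "gauss_const \<le> 1" by (simp add: gauss_const_def)
qed (simp add: gauss_const_def)

text \<open>On the negative half line \<open>chi\<close> is \<open>- gauss_const * g\<close>, and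
  the Rayleigh mean is \<open>sqrt (pi / 2)\<close>; the product is the mean of \<open>chi\<close>
  after a limiting jump.\<close>

lemma gauss_const_sqrt: "gauss_const * sqrt (pi / 2) = 1 / 2"
  by (simp add: gauss_const_def real_sqrt_divide real_sqrt_mult)

lemma chi_bound: "\<bar>chi g\<bar> \<le> \<bar>g\<bar> + 1"
proof (cases "g \<le> 0")
  case True
  have "gauss_const * \<bar>g\<bar> \<le> 1 * \<bar>g\<bar>" by (intro mult_right_mono gauss_const_bounds) auto
  then show ?thesis using True gauss_const_bounds by (simp add: chi_def abs_mult)
qed (use mills_bounds[of g] in \<open>auto simp: chi_def\<close>)

lemma chi'_bound: "\<bar>chi' g\<bar> \<le> \<bar>g\<bar> + 1"
proof -
  have "0 \<le> max g 0 * mills (max g 0)" using mills_bounds[of "max g 0"] by auto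
  moreover have "max g 0 * mills (max g 0) \<le> \<bar>g\<bar> * 1"
    using mills_bounds[of "max g 0"] by (intro mult_mono) auto
  ultimately show ?thesis using gauss_const_bounds unfolding chi'_def by linarith
qed

text \<open>The left side is the generator of the limiting radial velocity applied to
  \<open>chi\<close>: derivative along the flow, loss at rate \<open>max g 0\<close>, and gain with
  the post-jump mean \<open>1 / 2\<close>. On the positive half line the identity is the
  differential equation of \<open>mills\<close>.\<close>

lemma chi_poisson: "chi' g - max g 0 * chi g + max g 0 * (1 / 2) = max g 0 - gauss_const"
  by (auto simp: chi_def chi'_def max_def algebra_simps)

lemma phi_bound: "\<bar>phi g\<bar> \<le> g\<^sup>2"
  by (auto simp: phi_def max_def)

text \<open>The probability that no jump occurs within time \<open>r\<close> when the radial
  velocity starts at \<open>g\<close>: the exponential of minus the integral of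
  \<open>max (g + s) 0\<close> over \<open>s\<close> from 0 to \<open>r\<close>, in closed
  form.\<close>

definition survival :: "real \<Rightarrow> real \<Rightarrow> real" where
  "survival g r = exp (- (((max (g + r) 0)\<^sup>2 - (max g 0)\<^sup>2) / 2))"

lemma survival_le: "0 \<le> r \<Longrightarrow> survival g r \<le> 1"
  by (auto simp: survival_def intro!: power_mono)

lemma survival_nonneg: "0 \<le> survival g r" by (simp add: survival_def)

lemma DERIV_survival: "((\<lambda>r. survival g r) has_real_derivative - (max (g + r) 0 * survival g r)) (at r)"
proof -
  have "((\<lambda>r. (max (g + r) 0)\<^sup>2 / 2) has_real_derivative max (g + r) 0 * 1) (at r)"
    by (rule DERIV_chain2[OF DERIV_pos_part_sq]) (auto intro!: derivative_eq_intros)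
  then have "((\<lambda>r. exp (- ((max (g + r) 0)\<^sup>2 / 2 - (max g 0)\<^sup>2 / 2))) has_real_derivative
       exp (- ((max (g + r) 0)\<^sup>2 / 2 - (max g 0)\<^sup>2 / 2)) * - (max (g + r) 0 * 1 - 0)) (at r)"
    by (intro DERIV_fun_exp DERIV_minus DERIV_diff) auto
  then show ?thesis unfolding survival_def diff_divide_distrib by (simp add: mult.commute)
qed

lemma survival_tendsto_0: "((\<lambda>r. survival g r) \<longlongrightarrow> 0) at_top"
proof -
  have "((\<lambda>r. exp (- (((g + r)\<^sup>2 - c) / 2))) \<longlongrightarrow> 0) at_top" for c by real_asymp
  then have "((\<lambda>r. exp (- (((g + r)\<^sup>2 - (max g 0)\<^sup>2) / 2))) \<longlongrightarrow> 0) at_top" .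
  moreover have "\<forall>\<^sub>F r in at_top. exp (- (((g + r)\<^sup>2 - (max g 0)\<^sup>2) / 2)) = survival g r"
    using eventually_ge_at_top[of "- g"] by eventually_elim (auto simp: survival_def max_def)
  ultimately show ?thesis by (rule Lim_transform_eventually)
qed

text \<open>The integrand is minus the derivative of \<open>survival g\<close>, which tends to 0.
  Thus rate times survival is the density of the waiting time.\<close>

lemma nn_integral_hazard:
  "(\<integral>\<^sup>+s. ennreal (max (g + s) 0 * survival g s) * indicator {t..} s \<partial>lborel) = ennreal (survival g t)"
proof -
  have "(\<integral>\<^sup>+s. ennreal (max (g + s) 0 * survival g s) * indicator {t..} s \<partial>lborel) = ennreal (0 - (- survival g t))"
  proof (rule nn_integral_FTC_atLeast)
    show "(\<lambda>s. max (g + s) 0 * survival g s) \<in> borel_measurable borel" unfolding survival_def by measurable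
    show "((\<lambda>r. - survival g r) \<longlongrightarrow> 0) at_top" using tendsto_minus[OF survival_tendsto_0] by simp
    show "DERIV (\<lambda>r. - survival g r) x :> max (g + x) 0 * survival g x" for x
      using DERIV_minus[OF DERIV_survival[of g x]] by simp
    show "0 \<le> max (g + x) 0 * survival g x" for x using survival_nonneg by simp
  qed
  then show ?thesis by simp
qed

lemma integral_hazard:
  assumes "0 \<le> t"
  shows "exp (- (LBINT s:{0..t}. max (g + s) 0)) = survival g t"
proof -
  have "(LBINT s:{0..t}. max (g + s) 0) = (\<integral>s. max (g + s) 0 * indicator {0..t} s \<partial>lborel)"
    unfolding set_lebesgue_integral_def by (simp add: mult.commute)
  also have "\<dots> = (max (g + t) 0)\<^sup>2 / 2 - (max (g + 0) 0)\<^sup>2 / 2"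
  proof (rule integral_FTC_Icc_real[OF assms])
    show "DERIV (\<lambda>r. (max (g + r) 0)\<^sup>2 / 2) x :> max (g + x) 0" for x
    proof -
      have "((\<lambda>r. (max (g + r) 0)\<^sup>2 / 2) has_real_derivative max (g + x) 0 * 1) (at x)"
        by (rule DERIV_chain2[OF DERIV_pos_part_sq]) (auto intro!: derivative_eq_intros)
      then show ?thesis by simp
    qed
  qed (auto intro!: continuous_intros)
  finally show ?thesis by (simp add: survival_def diff_divide_distrib)
qed

text \<open>The derivative \<open>(1 - z^2) * exp (- z^2 / 2)\<close> is at most 1 in absolute
  value, by the quadratic Taylor bound for \<open>exp (z^2 / 2)\<close>. With constant 1 the
  coupling error passes through the test functions unchanged.\<close>

lemma lipschitz_mult_exp_neg_sq: "\<bar>x * exp (- x\<^sup>2 / 2) - y * exp (- y\<^sup>2 / 2)\<bar> \<le> \<bar>x - y :: real\<bar>"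
proof -
  have "norm ((\<lambda>x. x * exp (- x\<^sup>2 / 2)) x - (\<lambda>x. x * exp (- x\<^sup>2 / 2)) y) \<le> 1 * norm (x - y)"
  proof (rule field_differentiable_bound[where f'="\<lambda>z. (1 - z\<^sup>2) * exp (- z\<^sup>2 / 2)" and S=UNIV])
    show "((\<lambda>x. x * exp (- x\<^sup>2 / 2)) has_field_derivative (1 - z\<^sup>2) * exp (- z\<^sup>2 / 2)) (at z within UNIV)" for z :: real
      by (auto intro!: derivative_eq_intros simp: algebra_simps power2_eq_square)
    show "norm ((1 - z\<^sup>2) * exp (- z\<^sup>2 / 2)) \<le> 1" for z :: real
    proof -
      have "1 + z\<^sup>2 / 2 + (z\<^sup>2 / 2)\<^sup>2 / 2 \<le> exp (z\<^sup>2 / 2)" by (rule exp_lower_Taylor_quadratic) simp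
      moreover have "0 \<le> (z\<^sup>2 / 2 - 1)\<^sup>2" by simp
      moreover have "(z\<^sup>2 / 2 - 1)\<^sup>2 = (z\<^sup>2 / 2)\<^sup>2 - z\<^sup>2 + 1" by (simp add: power2_diff)
      moreover have "0 \<le> z\<^sup>2" "0 \<le> (z\<^sup>2 / 2)\<^sup>2" by simp_all
      ultimately have "1 - z\<^sup>2 \<le> exp (z\<^sup>2 / 2)" "z\<^sup>2 - 1 \<le> exp (z\<^sup>2 / 2)" by linarith+
      then have "\<bar>1 - z\<^sup>2\<bar> \<le> exp (z\<^sup>2 / 2)" by linarith
      then have "\<bar>1 - z\<^sup>2\<bar> * exp (- z\<^sup>2 / 2) \<le> exp (z\<^sup>2 / 2) * exp (- z\<^sup>2 / 2)"
        by (intro mult_right_mono) auto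
      then show ?thesis by (simp add: abs_mult exp_minus)
    qed
  qed auto
  then show ?thesis by simp
qed

section \<open>The jump kernel\<close>

text \<open>Rectangles whose second side runs through an intersection-stable generator form an
  intersection-stable generator of the product. This matches the integrated form in which the
  conditional laws are prescribed: half lines for waiting times, all measurable sets for
  velocities.\<close>

lemma measure_eqI_pair_generator:
  assumes sets: "sets N1 = sets (A \<Otimes>\<^sub>M B)" "sets N2 = sets (A \<Otimes>\<^sub>M B)"
    and B: "Int_stable \<B>" "\<B> \<subseteq> Pow (space B)" "sets B = sigma_sets (space B) \<B>"
    and C: "range (C :: nat \<Rightarrow> _) \<subseteq> \<B>" "(\<Union>n. C n) = space B"
    and fin: "finite_measure N1"
    and eq: "\<And>a b. a \<in> sets A \<Longrightarrow> b \<in> \<B> \<Longrightarrow> emeasure N1 (a \<times> b) = emeasure N2 (a \<times> b)"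
  shows "N1 = N2"
proof (rule measure_eqI_generator_eq)
  let ?E = "{a \<times> b | a b. a \<in> sets A \<and> b \<in> \<B>}"
  have "sets (A \<Otimes>\<^sub>M B) = sets (sigma (space A \<times> space B) ?E)"
  proof (rule sets_pair_eq)
    show "sets A \<subseteq> Pow (space A)" by (rule sets.space_closed)
    show "sets A = sigma_sets (space A) (sets A)" by (simp add: sets.sigma_sets_eq)
    show "countable {space A}" "{space A} \<subseteq> sets A" "\<Union>{space A} = space A" by auto
    show "countable (range C)" "range C \<subseteq> \<B>" "\<Union>(range C) = space B" using C by auto
  qed (use B in auto)
  also have "\<dots> = sigma_sets (space A \<times> space B) ?E"
    using B sets.space_closed[of A] by (subst sets_measure_of) auto
  finally show "sets N1 = sigma_sets (space A \<times> space B) ?E" "sets N2 = sigma_sets (space A \<times> space B) ?E"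
    using sets by auto
  show "Int_stable ?E"
  proof (rule Int_stableI)
    fix p q assume "p \<in> ?E" "q \<in> ?E"
    then obtain a b a' b' where "p = a \<times> b" "q = a' \<times> b'" "a \<in> sets A" "a' \<in> sets A" "b \<in> \<B>" "b' \<in> \<B>"
      by blast
    then have "p \<inter> q = (a \<inter> a') \<times> (b \<inter> b')" "a \<inter> a' \<in> sets A" "b \<inter> b' \<in> \<B>"
      using Int_stableD[OF B(1)] by (auto simp: Times_Int_Times)
    then show "p \<inter> q \<in> ?E" by blast
  qed
  show "?E \<subseteq> Pow (space A \<times> space B)" using B sets.space_closed[of A] by blast
  show "range (\<lambda>n. space A \<times> C n) \<subseteq> ?E" using C by auto
  show "(\<Union>n. space A \<times> C n) = space A \<times> space B" using C by auto
  show "emeasure N1 (space A \<times> C i) \<noteq> \<infinity>" for i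
    using fin by (simp add: finite_measure.emeasure_finite)
qed (use eq in auto)

section \<open>Linear algebra and measurability for extensional vectors\<close>

lemma measurable_component_Rd:
  "i < d \<Longrightarrow> f \<in> M \<rightarrow>\<^sub>M Rd d \<Longrightarrow> (\<lambda>\<omega>. f \<omega> i) \<in> borel_measurable M"
  unfolding Rd_def by (rule measurable_compose[OF _ measurable_component_singleton]) auto

lemma measurable_component_Rdd:
  "i < d \<Longrightarrow> j < d \<Longrightarrow> f \<in> M \<rightarrow>\<^sub>M Rdd d \<Longrightarrow> (\<lambda>\<omega>. f \<omega> (i, j)) \<in> borel_measurable M"
  unfolding Rdd_def by (rule measurable_compose[OF _ measurable_component_singleton]) auto

lemma measurable_ip [measurable]:
  "f \<in> M \<rightarrow>\<^sub>M Rd d \<Longrightarrow> g \<in> M \<rightarrow>\<^sub>M Rd d \<Longrightarrow> (\<lambda>\<omega>. ip d (f \<omega>) (g \<omega>)) \<in> borel_measurable M"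
  unfolding ip_def by (intro borel_measurable_sum borel_measurable_times) (auto intro: measurable_component_Rd)

lemma measurable_vnorm [measurable]:
  "f \<in> M \<rightarrow>\<^sub>M Rd d \<Longrightarrow> (\<lambda>\<omega>. vnorm d (f \<omega>)) \<in> borel_measurable M"
proof -
  assume f: "f \<in> M \<rightarrow>\<^sub>M Rd d"
  have "(\<lambda>\<omega>. \<Sum>i<d. (f \<omega> i)\<^sup>2) \<in> borel_measurable M"
    by (intro borel_measurable_sum borel_measurable_power) (auto intro: measurable_component_Rd[OF _ f])
  moreover have "sqrt \<in> borel_measurable borel" by measurable
  ultimately show ?thesis unfolding L2_set_def by (rule measurable_compose)
qed

lemma measurable_RdI:
  "(\<And>i. i < d \<Longrightarrow> (\<lambda>\<omega>. f \<omega> i) \<in> borel_measurable L) \<Longrightarrow> (\<lambda>\<omega>. \<lambda>i\<in>{..<d}. f \<omega> i) \<in> L \<rightarrow>\<^sub>M Rd d"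
  unfolding Rd_def by (intro measurable_restrict) auto

lemma vnorm_sq: "(vnorm d x)\<^sup>2 = ip d x x"
  by (simp add: L2_set_def ip_def sum_nonneg power2_eq_square)

lemma ip_commute: "ip d x y = ip d y x"
  by (simp add: ip_def mult.commute)

lemma ip_restrict: "ip d (\<lambda>i\<in>{..<d}. f i) y = (\<Sum>i<d. f i * y i)" "ip d y (\<lambda>i\<in>{..<d}. f i) = (\<Sum>i<d. y i * f i)"
  by (simp_all add: ip_def)

lemma ip_drift: "ip d v (drift d s x v) = ip d x v + s * ip d v v"
  unfolding drift_def ip_restrict by (simp add: ip_def sum.distrib sum_distrib_left algebra_simps)

lemma ip_drift_self: "ip d (drift d s x v) (drift d s x v) = ip d x x + 2 * ip d x v * s + s\<^sup>2 * ip d v v"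
  unfolding drift_def ip_restrict by (simp add: ip_def sum.distrib sum_distrib_left algebra_simps power2_eq_square)

lemma unit_sphere_ip: "v \<in> unit_sphere d \<Longrightarrow> ip d v v = 1"
  unfolding unit_sphere_def by (simp add: vnorm_sq[symmetric])

lemma ip_sq_le: "(ip d x v)\<^sup>2 \<le> ip d x x * ip d v v"
  using Cauchy_Schwarz_ineq_sum[of x v "{..<d}"] unfolding ip_def by (simp add: power2_eq_square)

lemma measurable_new_velocity:
  assumes [measurable]: "x \<in> L \<rightarrow>\<^sub>M Rd d" "v \<in> L \<rightarrow>\<^sub>M Rd d" "w \<in> borel_measurable L" "A \<in> L \<rightarrow>\<^sub>M Rdd d"
  shows "(\<lambda>\<omega>. new_velocity d (x \<omega>) (v \<omega>) (w \<omega>) (A \<omega>)) \<in> L \<rightarrow>\<^sub>M Rd d"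
proof -
  note c = measurable_ip measurable_vnorm
    measurable_component_Rd[OF _ assms(1)] measurable_component_Rd[OF _ assms(2)] measurable_component_Rdd[OF _ _ assms(4)]
  have n: "(\<lambda>\<omega>. normalize_vec d (x \<omega>)) \<in> L \<rightarrow>\<^sub>M Rd d"
    unfolding normalize_vec_def by (intro measurable_RdI borel_measurable_divide c assms)
  have p: "(\<lambda>\<omega>. perp_part d (x \<omega>) (v \<omega>)) \<in> L \<rightarrow>\<^sub>M Rd d"
    unfolding perp_part_def
    by (intro measurable_RdI borel_measurable_diff borel_measurable_times c assms n measurable_component_Rd[OF _ n])
  have m: "(\<lambda>\<omega>. mat_vec d (A \<omega>) (perp_part d (x \<omega>) (v \<omega>))) \<in> L \<rightarrow>\<^sub>M Rd d"
    unfolding mat_vec_def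
    by (intro measurable_RdI borel_measurable_sum borel_measurable_times c assms p measurable_component_Rd[OF _ p]) auto
  show ?thesis
    unfolding new_velocity_def
    by (intro measurable_RdI borel_measurable_add borel_measurable_times borel_measurable_divide c n m p measurable_component_Rd[OF _ n] measurable_component_Rd[OF _ m])
      measurable
qed

text \<open>The rotation \<open>A\<close> fixes the direction of \<open>x\<close> and hence preserves its orthogonal complement, so
  only the radial draw \<open>w\<close> is seen by the inner product with \<open>x\<close>.\<close>

lemma ip_new_velocity:
  assumes x: "vnorm d x \<noteq> 0" and A: "A \<in> hyperplane_orthogonal d x"
  shows "ip d x (new_velocity d x v w A) = - (vnorm d x * w)"
proof -
  let ?u = "normalize_vec d x"
  let ?p = "perp_part d x v"
  have xu: "x i = vnorm d x * ?u i" if "i < d" for i using x that by (simp add: normalize_vec_def)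
  have "ip d x x = (vnorm d x)\<^sup>2 * ip d ?u ?u"
    by (simp add: ip_def xu sum_distrib_left power2_eq_square algebra_simps)
  then have uu: "ip d ?u ?u = 1" using x by (simp add: vnorm_sq[symmetric])
  have up: "ip d ?u ?p = 0"
  proof -
    have "ip d ?u ?p = ip d ?u v - ip d v ?u * ip d ?u ?u"
      unfolding perp_part_def ip_restrict by (simp add: ip_def sum_subtractf sum_distrib_left algebra_simps)
    then show ?thesis using uu by (simp add: ip_commute)
  qed
  have orth: "(\<Sum>k<d. A (k, i) * A (k, j)) = (if i = j then 1 else 0)" if "i < d" "j < d" for i j
    using A that unfolding hyperplane_orthogonal_def by blast
  have fix_u: "?u = mat_vec d A ?u" using A unfolding hyperplane_orthogonal_def by auto
  have "ip d ?u (mat_vec d A ?p) = ip d (mat_vec d A ?u) (mat_vec d A ?p)" using fix_u by simp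
  also have "\<dots> = (\<Sum>i<d. (\<Sum>j<d. A (i, j) * ?u j) * (\<Sum>k<d. A (i, k) * ?p k))"
    unfolding ip_def by (simp add: mat_vec_def)
  also have "\<dots> = (\<Sum>i<d. \<Sum>j<d. \<Sum>k<d. (A (i, j) * A (i, k)) * (?u j * ?p k))"
    by (simp add: sum_product mult_ac)
  also have "\<dots> = (\<Sum>j<d. \<Sum>i<d. \<Sum>k<d. (A (i, j) * A (i, k)) * (?u j * ?p k))"
    by (rule sum.swap)
  also have "\<dots> = (\<Sum>j<d. \<Sum>k<d. \<Sum>i<d. (A (i, j) * A (i, k)) * (?u j * ?p k))"
    by (intro sum.cong refl sum.swap)
  also have "\<dots> = (\<Sum>j<d. \<Sum>k<d. (if j = k then 1 else 0) * (?u j * ?p k))"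
    by (intro sum.cong refl) (simp add: sum_distrib_right[symmetric] orth)
  also have "\<dots> = (\<Sum>j<d. \<Sum>k<d. (if j = k then ?u j * ?p k else 0))"
    by (intro sum.cong refl) auto
  also have "\<dots> = ip d ?u ?p" by (simp add: ip_def)
  finally have uAp: "ip d ?u (mat_vec d A ?p) = 0" using up by simp
  \<comment> \<open>If the perpendicular part vanishes, division by zero yields 0 and the identity
    still holds, so parallel \<open>x\<close> and \<open>v\<close> need no separate
    treatment.\<close>
  have "ip d ?u (new_velocity d x v w A) = - w * ip d ?u ?u + sqrt (1 - w\<^sup>2) / vnorm d ?p * ip d ?u (mat_vec d A ?p)"
    unfolding new_velocity_def ip_restrict unfolding ip_def sum_distrib_left sum.distrib[symmetric]
    by (intro sum.cong refl) (simp add: algebra_simps)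
  then have "ip d ?u (new_velocity d x v w A) = - w" using uu uAp by simp
  moreover have "ip d x y = vnorm d x * ip d ?u y" for y
    by (simp add: ip_def xu sum_distrib_left mult.assoc)
  ultimately show ?thesis by simp
qed

text \<open>The rotation kernel is only a measurable family away from the origin, hence the
  restricted space.\<close>

lemma jump_kernel_prob_measurable:
  assumes "orthogonal_kernel d \<nu>" "4 \<le> d"
    and [measurable]: "x \<in> M \<rightarrow>\<^sub>M Rd d" "v \<in> M \<rightarrow>\<^sub>M Rd d"
  shows "(\<lambda>\<omega>. jump_kernel d \<nu> (x \<omega>) (v \<omega>)) \<in> restrict_space M {\<omega>. vnorm d (x \<omega>) \<noteq> 0} \<rightarrow>\<^sub>M subprob_algebra (Rd d)"
proof -
  let ?M = "restrict_space M {\<omega>. vnorm d (x \<omega>) \<noteq> 0}"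
  have "x \<in> ?M \<rightarrow>\<^sub>M restrict_space (Rd d) {x. vnorm d x \<noteq> 0}"
    by (intro measurable_restrict_space2 measurable_restrict_space1) (auto simp: space_restrict_space)
  then have \<nu>: "(\<lambda>\<omega>. \<nu> (x \<omega>)) \<in> ?M \<rightarrow>\<^sub>M prob_algebra (Rdd d)"
    using assms(1) unfolding orthogonal_kernel_def by (auto intro: measurable_compose)
  let ?D = "density lborel (parallel_density d)"
  have "prob_space ?D"
    unfolding parallel_density_eq_distr_rayleigh[OF assms(2)] by (rule rayleigh.prob_space_distr) measurable
  then have "(\<lambda>_. ?D) \<in> ?M \<rightarrow>\<^sub>M prob_algebra borel"
    by (intro measurable_const) (simp add: space_prob_algebra)
  from measurable_pair_prob[OF this \<nu>]
  have p: "(\<lambda>\<omega>. ?D \<Otimes>\<^sub>M \<nu> (x \<omega>)) \<in> ?M \<rightarrow>\<^sub>M subprob_algebra (borel \<Otimes>\<^sub>M Rdd d)"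
    by (rule measurable_prob_algebraD)
  have [measurable]: "x \<in> ?M \<rightarrow>\<^sub>M Rd d" "v \<in> ?M \<rightarrow>\<^sub>M Rd d"
    by (auto intro: measurable_restrict_space1)
  have "(\<lambda>(\<omega>, w, A). new_velocity d (x \<omega>) (v \<omega>) w A) \<in> ?M \<Otimes>\<^sub>M (borel \<Otimes>\<^sub>M Rdd d) \<rightarrow>\<^sub>M Rd d"
    unfolding split_def by (intro measurable_new_velocity) measurable
  then show ?thesis
    unfolding jump_kernel_def
    by (intro measurable_distr2[OF _ p]) (simp add: split_def)
qed

text \<open>By Fubini the integral over the rotation is taken first; by
  \<open>ip_new_velocity\<close> its integrand is almost surely constant. What remains is the radial
  draw, which the quantile coupling moves to \<open>rayleigh\<close>.\<close>

lemma nn_integral_jump_kernel: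
  assumes \<nu>: "orthogonal_kernel d \<nu>" "4 \<le> d" and x: "x \<in> space (Rd d)" "vnorm d x \<noteq> 0" and v: "v \<in> space (Rd d)"
    and [measurable]: "F \<in> borel_measurable borel"
  shows "(\<integral>\<^sup>+v'. F (ip d x v') \<partial>jump_kernel d \<nu> x v) = (\<integral>\<^sup>+b. F (- (vnorm d x * rayleigh_quantile d b)) \<partial>rayleigh)"
proof -
  let ?D = "density lborel (parallel_density d)"
  have "\<nu> x \<in> space (prob_algebra (Rdd d))"
    using \<nu>(1) x unfolding orthogonal_kernel_def by (auto dest!: measurable_space simp: space_restrict_space)
  then have \<nu>x: "prob_space (\<nu> x)" "sets (\<nu> x) = sets (Rdd d)" by (auto simp: space_prob_algebra)
  interpret N: prob_space "\<nu> x" by fact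
  have [measurable_cong]: "sets (\<nu> x) = sets (Rdd d)" by fact
  have AE: "AE A in \<nu> x. A \<in> hyperplane_orthogonal d x"
    using \<nu>(1) x unfolding orthogonal_kernel_def by blast
  have c[measurable]: "(\<lambda>_. x) \<in> L \<rightarrow>\<^sub>M Rd d" "(\<lambda>_. v) \<in> L \<rightarrow>\<^sub>M Rd d" for L :: "'z measure"
    using x v by auto
  have nv[measurable]: "(\<lambda>(w, A). new_velocity d x v w A) \<in> ?D \<Otimes>\<^sub>M \<nu> x \<rightarrow>\<^sub>M Rd d"
    unfolding split_def by (intro measurable_new_velocity c) measurable
  have ipm: "(\<lambda>v'. F (ip d x v')) \<in> borel_measurable (Rd d)"
    by (intro measurable_compose[OF measurable_ip assms(6)] c) auto
  have "(\<integral>\<^sup>+v'. F (ip d x v') \<partial>jump_kernel d \<nu> x v)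
      = (\<integral>\<^sup>+p. F (ip d x (new_velocity d x v (fst p) (snd p))) \<partial>(?D \<Otimes>\<^sub>M \<nu> x))"
    unfolding jump_kernel_def by (subst nn_integral_distr[OF nv]) (use ipm in \<open>simp_all add: split_def\<close>)
  also have "\<dots> = (\<integral>\<^sup>+w. \<integral>\<^sup>+A. F (ip d x (new_velocity d x v w A)) \<partial>\<nu> x \<partial>?D)"
    using measurable_compose[OF nv ipm]
    by (subst N.nn_integral_fst[symmetric]) (auto simp: split_def)
  also have "\<dots> = (\<integral>\<^sup>+w. F (- (vnorm d x * w)) \<partial>?D)"
  proof (rule nn_integral_cong)
    fix w
    have "(\<integral>\<^sup>+A. F (ip d x (new_velocity d x v w A)) \<partial>\<nu> x) = (\<integral>\<^sup>+A. F (- (vnorm d x * w)) \<partial>\<nu> x)"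
      using AE by (intro nn_integral_cong_AE) (auto simp: ip_new_velocity[OF x(2)])
    then show "(\<integral>\<^sup>+A. F (ip d x (new_velocity d x v w A)) \<partial>\<nu> x) = F (- (vnorm d x * w))"
      by (simp add: N.emeasure_space_1)
  qed
  also have "\<dots> = (\<integral>\<^sup>+b. F (- (vnorm d x * rayleigh_quantile d b)) \<partial>rayleigh)"
    unfolding parallel_density_eq_distr_rayleigh[OF \<nu>(2)] by (subst nn_integral_distr) auto
  finally show ?thesis .
qed

section \<open>The process of squared radius and radial velocity\<close>

text \<open>Only large dimensions matter for the limits; for \<open>d\<close> at least 4 the exponent in
  \<open>parallel_density\<close> is positive.\<close>

locale fecmc = prob_space M for M :: "'a measure" +
  fixes d :: nat and \<nu> :: "rvec \<Rightarrow> rmat measure" and X V :: "real \<Rightarrow> 'a \<Rightarrow> rvec" and \<tau> :: "nat \<Rightarrow> 'a \<Rightarrow> real"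
  assumes d: "4 \<le> d"
    and kernel: "orthogonal_kernel d \<nu>"
    and X_measurable: "(\<lambda>(t, \<omega>). X t \<omega>) \<in> restrict_space borel {0..} \<Otimes>\<^sub>M M \<rightarrow>\<^sub>M Rd d"
    and V_measurable: "(\<lambda>(t, \<omega>). V t \<omega>) \<in> restrict_space borel {0..} \<Otimes>\<^sub>M M \<rightarrow>\<^sub>M Rd d"
    and V_unit: "\<And>t \<omega>. 0 \<le> t \<Longrightarrow> \<omega> \<in> space M \<Longrightarrow> V t \<omega> \<in> unit_sphere d"
    and \<tau>_measurable [measurable]: "\<And>n. \<tau> n \<in> borel_measurable M"
    and \<tau>_0: "\<And>\<omega>. \<omega> \<in> space M \<Longrightarrow> \<tau> 0 \<omega> = 0"
    and \<tau>_strict_mono: "\<And>\<omega>. \<omega> \<in> space M \<Longrightarrow> strict_mono (\<lambda>n. \<tau> n \<omega>)"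
    and \<tau>_at_top: "\<And>\<omega>. \<omega> \<in> space M \<Longrightarrow> filterlim (\<lambda>n. \<tau> n \<omega>) at_top sequentially"
    and path: "AE \<omega> in M. \<forall>n. \<forall>t. \<tau> n \<omega> \<le> t \<and> t \<le> \<tau> (Suc n) \<omega> \<longrightarrow>
           X t \<omega> = drift d (t - \<tau> n \<omega>) (X (\<tau> n \<omega>) \<omega>) (V (\<tau> n \<omega>) \<omega>) \<and>
           (t < \<tau> (Suc n) \<omega> \<longrightarrow> V t \<omega> = V (\<tau> n \<omega>) \<omega>)"
    and waiting: "\<And>n t E. 0 \<le> t \<Longrightarrow> E \<in> sets (history_space d n) \<Longrightarrow>
           emeasure M {\<omega> \<in> space M. history X V \<tau> n \<omega> \<in> E \<and> \<tau> (Suc n) \<omega> - \<tau> n \<omega> > t} =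
           (\<integral>\<^sup>+\<omega>. indicator E (history X V \<tau> n \<omega>) *
              ennreal (exp (- (LBINT s:{0..t}.
                jump_rate d (drift d s (X (\<tau> n \<omega>) \<omega>) (V (\<tau> n \<omega>) \<omega>)) (V (\<tau> n \<omega>) \<omega>)))) \<partial>M)"
    and jump: "\<And>n E B. E \<in> sets (history_space d n \<Otimes>\<^sub>M borel) \<Longrightarrow> B \<in> sets (Rd d) \<Longrightarrow>
           emeasure M {\<omega> \<in> space M. (history X V \<tau> n \<omega>, \<tau> (Suc n) \<omega>) \<in> E \<and> V (\<tau> (Suc n) \<omega>) \<omega> \<in> B} =
           (\<integral>\<^sup>+\<omega>. indicator E (history X V \<tau> n \<omega>, \<tau> (Suc n) \<omega>) *
              emeasure (jump_kernel d \<nu> (X (\<tau> (Suc n) \<omega>) \<omega>) (V (\<tau> n \<omega>) \<omega>)) B \<partial>M)"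
begin

definition Y :: "real \<Rightarrow> 'a \<Rightarrow> real" where "Y t \<omega> = ip d (X t \<omega>) (X t \<omega>)"
definition G :: "real \<Rightarrow> 'a \<Rightarrow> real" where "G t \<omega> = ip d (X t \<omega>) (V t \<omega>)"

abbreviation Yj :: "nat \<Rightarrow> 'a \<Rightarrow> real" where "Yj n \<omega> \<equiv> Y (\<tau> n \<omega>) \<omega>"
abbreviation Gj :: "nat \<Rightarrow> 'a \<Rightarrow> real" where "Gj n \<omega> \<equiv> G (\<tau> n \<omega>) \<omega>"
abbreviation \<delta> :: "nat \<Rightarrow> 'a \<Rightarrow> real" where "\<delta> n \<omega> \<equiv> \<tau> (Suc n) \<omega> - \<tau> n \<omega>"
abbreviation H :: "nat \<Rightarrow> 'a \<Rightarrow> nat \<Rightarrow> real \<times> rvec \<times> rvec" where "H \<equiv> history X V \<tau>"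

lemma \<tau>_mono: "\<omega> \<in> space M \<Longrightarrow> m \<le> n \<Longrightarrow> \<tau> m \<omega> \<le> \<tau> n \<omega>"
  using monoD[OF strict_mono_mono[OF \<tau>_strict_mono]] .

lemma \<tau>_nonneg: "\<omega> \<in> space M \<Longrightarrow> 0 \<le> \<tau> n \<omega>"
  using \<tau>_mono[of \<omega> 0 n] \<tau>_0 by simp

lemma \<delta>_pos: "\<omega> \<in> space M \<Longrightarrow> 0 < \<delta> n \<omega>"
  using \<tau>_strict_mono[of \<omega>] by (simp add: strict_mono_Suc_iff)

lemma XV_measurable_at:
  assumes f: "f \<in> N \<rightarrow>\<^sub>M borel" "g \<in> N \<rightarrow>\<^sub>M M" and nn: "\<And>x. x \<in> space N \<Longrightarrow> 0 \<le> f x"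
  shows "(\<lambda>x. X (f x) (g x)) \<in> N \<rightarrow>\<^sub>M Rd d" "(\<lambda>x. V (f x) (g x)) \<in> N \<rightarrow>\<^sub>M Rd d"
proof -
  have "f \<in> N \<rightarrow>\<^sub>M restrict_space borel {0..}" using f nn by (intro measurable_restrict_space2) auto
  from measurable_Pair[OF this f(2)]
  have p: "(\<lambda>x. (f x, g x)) \<in> N \<rightarrow>\<^sub>M restrict_space borel {0..} \<Otimes>\<^sub>M M" .
  show "(\<lambda>x. X (f x) (g x)) \<in> N \<rightarrow>\<^sub>M Rd d" "(\<lambda>x. V (f x) (g x)) \<in> N \<rightarrow>\<^sub>M Rd d"
    using measurable_compose[OF p X_measurable] measurable_compose[OF p V_measurable] by simp_all
qed

lemma XVj_measurable [measurable]:
  "(\<lambda>\<omega>. X (\<tau> n \<omega>) \<omega>) \<in> M \<rightarrow>\<^sub>M Rd d" "(\<lambda>\<omega>. V (\<tau> n \<omega>) \<omega>) \<in> M \<rightarrow>\<^sub>M Rd d"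
  using \<tau>_nonneg by (auto intro: XV_measurable_at)

lemma YGj_measurable [measurable]: "Yj n \<in> borel_measurable M" "Gj n \<in> borel_measurable M"
  unfolding Y_def G_def by measurable

lemma H_measurable [measurable]: "H n \<in> M \<rightarrow>\<^sub>M history_space d n"
  unfolding history_def history_space_def by (intro measurable_restrict) measurable

lemma V_ip: "0 \<le> t \<Longrightarrow> \<omega> \<in> space M \<Longrightarrow> ip d (V t \<omega>) (V t \<omega>) = 1"
  using V_unit unit_sphere_ip by blast

lemma G_sq_le: "0 \<le> t \<Longrightarrow> \<omega> \<in> space M \<Longrightarrow> (G t \<omega>)\<^sup>2 \<le> Y t \<omega>"
  using ip_sq_le[of d "X t \<omega>" "V t \<omega>"] V_ip unfolding Y_def G_def by simp

lemma Y_nonneg: "0 \<le> Y t \<omega>" unfolding Y_def vnorm_sq[symmetric] by simp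

text \<open>The quadratic formula uses that velocities are unit vectors. The middle clause takes the
  inner product with the velocity before the jump and therefore stays valid at the jump time, where
  \<open>G\<close> already has its new value.\<close>

lemma path_YG: "AE \<omega> in M. \<forall>n. \<forall>t. \<tau> n \<omega> \<le> t \<and> t \<le> \<tau> (Suc n) \<omega> \<longrightarrow>
    Y t \<omega> = Yj n \<omega> + 2 * Gj n \<omega> * (t - \<tau> n \<omega>) + (t - \<tau> n \<omega>)\<^sup>2 \<and>
    ip d (X t \<omega>) (V (\<tau> n \<omega>) \<omega>) = Gj n \<omega> + (t - \<tau> n \<omega>) \<and>
    (t < \<tau> (Suc n) \<omega> \<longrightarrow> G t \<omega> = Gj n \<omega> + (t - \<tau> n \<omega>))"
  using path AE_space
proof eventually_elim
  case (elim \<omega>)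
  then have v: "ip d (V (\<tau> n \<omega>) \<omega>) (V (\<tau> n \<omega>) \<omega>) = 1" for n using V_ip \<tau>_nonneg by blast
  have x: "X t \<omega> = drift d (t - \<tau> n \<omega>) (X (\<tau> n \<omega>) \<omega>) (V (\<tau> n \<omega>) \<omega>)"
    and vt: "t < \<tau> (Suc n) \<omega> \<Longrightarrow> V t \<omega> = V (\<tau> n \<omega>) \<omega>"
    if "\<tau> n \<omega> \<le> t" "t \<le> \<tau> (Suc n) \<omega>" for n t using elim that by auto
  have g: "ip d (X t \<omega>) (V (\<tau> n \<omega>) \<omega>) = Gj n \<omega> + (t - \<tau> n \<omega>)" if "\<tau> n \<omega> \<le> t" "t \<le> \<tau> (Suc n) \<omega>" for n t
    unfolding x[OF that] using v by (subst ip_commute) (simp add: ip_drift G_def)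
  show ?case
  proof (intro allI impI)
    fix n t assume t: "\<tau> n \<omega> \<le> t \<and> t \<le> \<tau> (Suc n) \<omega>"
    have "Y t \<omega> = Yj n \<omega> + 2 * Gj n \<omega> * (t - \<tau> n \<omega>) + (t - \<tau> n \<omega>)\<^sup>2"
      using x[of n t] t by (simp add: Y_def ip_drift_self v G_def)
    moreover have "G t \<omega> = Gj n \<omega> + (t - \<tau> n \<omega>)" if "t < \<tau> (Suc n) \<omega>"
      using g[of n t] vt[of n t] t that unfolding G_def[of t] by simp
    ultimately show "Y t \<omega> = Yj n \<omega> + 2 * Gj n \<omega> * (t - \<tau> n \<omega>) + (t - \<tau> n \<omega>)\<^sup>2 \<and>
      ip d (X t \<omega>) (V (\<tau> n \<omega>) \<omega>) = Gj n \<omega> + (t - \<tau> n \<omega>) \<and>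
      (t < \<tau> (Suc n) \<omega> \<longrightarrow> G t \<omega> = Gj n \<omega> + (t - \<tau> n \<omega>))"
      using g[of n t] t by blast
  qed
qed

lemma hazard_drift:
  assumes "\<omega> \<in> space M" "0 \<le> t"
  shows "exp (- (LBINT s:{0..t}. jump_rate d (drift d s (X (\<tau> n \<omega>) \<omega>) (V (\<tau> n \<omega>) \<omega>)) (V (\<tau> n \<omega>) \<omega>)))
     = survival (Gj n \<omega>) t"
proof -
  have "jump_rate d (drift d s (X (\<tau> n \<omega>) \<omega>) (V (\<tau> n \<omega>) \<omega>)) (V (\<tau> n \<omega>) \<omega>) = max (Gj n \<omega> + s) 0" for s
    unfolding jump_rate_def ip_drift using V_ip[OF \<tau>_nonneg] assms by (simp add: G_def)
  then show ?thesis using integral_hazard[OF assms(2)] by simp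
qed

text \<open>The prescribed tails of the waiting time, jointly with the history, determine the joint
  law because open half lines generate the Borel sets. By \<open>nn_integral_hazard\<close> this law
  has the stated density with respect to the history and Lebesgue measure.\<close>

lemma nn_integral_waiting:
  assumes F[measurable]: "F \<in> borel_measurable (history_space d n \<Otimes>\<^sub>M borel)"
  shows "(\<integral>\<^sup>+\<omega>. F (H n \<omega>, \<delta> n \<omega>) \<partial>M) =
    (\<integral>\<^sup>+\<omega>. \<integral>\<^sup>+s. F (H n \<omega>, s) * (ennreal (max (Gj n \<omega> + s) 0 * survival (Gj n \<omega>) s) * indicator {0..} s) \<partial>lborel \<partial>M)"
proof -
  let ?B = "history_space d n \<Otimes>\<^sub>M (borel :: real measure)"
  let ?p = "\<lambda>g s. ennreal (max (g + s) 0 * survival g s) * indicator {0..} s"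
  let ?N1 = "distr M ?B (\<lambda>\<omega>. (H n \<omega>, \<delta> n \<omega>))"
  let ?N2 = "distr (density (M \<Otimes>\<^sub>M lborel) (\<lambda>(\<omega>, s). ?p (Gj n \<omega>) s)) ?B (\<lambda>(\<omega>, s). (H n \<omega>, s))"
  have pm[measurable]: "(\<lambda>(\<omega>, s). ?p (Gj n \<omega>) s) \<in> borel_measurable (M \<Otimes>\<^sub>M lborel)"
    unfolding survival_def split_def by measurable
  have N2: "(\<integral>\<^sup>+x. f x \<partial>?N2) = (\<integral>\<^sup>+\<omega>. \<integral>\<^sup>+s. f (H n \<omega>, s) * ?p (Gj n \<omega>) s \<partial>lborel \<partial>M)"
    if [measurable]: "f \<in> borel_measurable ?B" for f
  proof -
    have "(\<integral>\<^sup>+x. f x \<partial>?N2) = (\<integral>\<^sup>+x. (\<lambda>(\<omega>, s). ?p (Gj n \<omega>) s * f (H n \<omega>, s)) x \<partial>(M \<Otimes>\<^sub>M lborel))"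
      by (subst nn_integral_distr, measurable, subst nn_integral_density) (auto simp: split_def)
    also have "\<dots> = (\<integral>\<^sup>+\<omega>. \<integral>\<^sup>+s. ?p (Gj n \<omega>) s * f (H n \<omega>, s) \<partial>lborel \<partial>M)"
      by (subst lborel.nn_integral_fst[symmetric]) (auto simp: split_def)
    finally show ?thesis by (simp add: mult.commute)
  qed
  have "?N1 = ?N2"
  proof (rule measure_eqI_pair_generator)
    show "Int_stable (range (greaterThan :: real \<Rightarrow> _))"
      by (auto simp: Int_stable_def lessThan_Int_lessThan)
    show "sets borel = sigma_sets (space borel) (range (greaterThan :: real \<Rightarrow> _))"
      by (subst borel_Ioi) simp
    show "range (\<lambda>n. {- real n<..}) \<subseteq> range greaterThan" by auto
    show "(\<Union>n. {- real n<..}) = space borel"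
      by (auto, metis minus_less_iff reals_Archimedean2)
    show "finite_measure ?N1" by (rule finite_measure_distr) measurable
    fix E and b :: "real set" assume E[measurable]: "E \<in> sets (history_space d n)" and "b \<in> range greaterThan"
    then obtain t where b: "b = {t<..}" by auto
    \<comment> \<open>Waiting times are positive, so a negative threshold describes the same event
      as 0, and the tail formula is only given for nonnegative thresholds.\<close>
    let ?t = "max t 0"
    have "emeasure ?N1 (E \<times> b) = emeasure M {\<omega> \<in> space M. H n \<omega> \<in> E \<and> \<delta> n \<omega> > ?t}"
      using \<delta>_pos unfolding b by (subst emeasure_distr) (auto intro!: arg_cong[where f="emeasure M"])
    also have "\<dots> = (\<integral>\<^sup>+\<omega>. indicator E (H n \<omega>) * ennreal (survival (Gj n \<omega>) ?t) \<partial>M)"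
      by (subst waiting) (auto intro!: nn_integral_cong simp: hazard_drift)
    also have "\<dots> = (\<integral>\<^sup>+\<omega>. \<integral>\<^sup>+s. indicator (E \<times> b) (H n \<omega>, s) * ?p (Gj n \<omega>) s \<partial>lborel \<partial>M)"
    proof (rule nn_integral_cong)
      fix \<omega>
      have "(\<integral>\<^sup>+s. indicator (E \<times> b) (H n \<omega>, s) * ?p (Gj n \<omega>) s \<partial>lborel)
        = (\<integral>\<^sup>+s. indicator E (H n \<omega>) * (ennreal (max (Gj n \<omega> + s) 0 * survival (Gj n \<omega>) s) * indicator {?t..} s) \<partial>lborel)"
        by (rule nn_integral_cong_AE, rule AE_mp[OF AE_lborel_singleton[of t]])
          (auto simp: b indicator_def)
      also have "\<dots> = indicator E (H n \<omega>) * (\<integral>\<^sup>+s. ennreal (max (Gj n \<omega> + s) 0 * survival (Gj n \<omega>) s) * indicator {?t..} s \<partial>lborel)"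
        by (rule nn_integral_cmult) (unfold survival_def, measurable)
      also have "\<dots> = indicator E (H n \<omega>) * ennreal (survival (Gj n \<omega>) ?t)"
        by (simp only: nn_integral_hazard)
      finally show "indicator E (H n \<omega>) * ennreal (survival (Gj n \<omega>) ?t) =
        (\<integral>\<^sup>+s. indicator (E \<times> b) (H n \<omega>, s) * ?p (Gj n \<omega>) s \<partial>lborel)" ..
    qed
    also have "\<dots> = (\<integral>\<^sup>+x. indicator (E \<times> b) x \<partial>?N2)"
      by (subst N2) (auto simp: b)
    also have "\<dots> = emeasure ?N2 (E \<times> b)"
      by (subst nn_integral_indicator) (auto simp: b)
    finally show "emeasure ?N1 (E \<times> b) = emeasure ?N2 (E \<times> b)" .
  qed auto
  then have "(\<integral>\<^sup>+x. F x \<partial>?N1) = (\<integral>\<^sup>+x. F x \<partial>?N2)" by simp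
  then show ?thesis by (subst (asm) N2) (auto simp: nn_integral_distr)
qed

text \<open>The waiting-time density vanishes where the radial velocity is not positive, so jumps
  almost surely happen at positive radial velocity and hence away from the origin, where the jump
  kernel is under control.\<close>

lemma AE_jump_Y_nonzero: "AE \<omega> in M. vnorm d (X (\<tau> (Suc n) \<omega>) \<omega>) \<noteq> 0"
proof -
  let ?q = "\<lambda>h :: nat \<Rightarrow> real \<times> rvec \<times> rvec. ip d (fst (snd (h n))) (snd (snd (h n)))"
  have hn: "(\<lambda>h. h n) \<in> history_space d n \<rightarrow>\<^sub>M borel \<Otimes>\<^sub>M Rd d \<Otimes>\<^sub>M Rd d"
    unfolding history_space_def by (rule measurable_component_singleton) simp
  have q[measurable]: "?q \<in> borel_measurable (history_space d n)"
    by (intro measurable_ip measurable_compose[OF hn]) measurable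
  let ?F = "\<lambda>(h, s). indicator {..0} (?q h + s) :: ennreal"
  have "(\<integral>\<^sup>+\<omega>. ?F (H n \<omega>, \<delta> n \<omega>) \<partial>M) = 0"
  proof (subst nn_integral_waiting)
    show "?F \<in> borel_measurable (history_space d n \<Otimes>\<^sub>M borel)" unfolding split_def by measurable
    have "?q (H n \<omega>) = Gj n \<omega>" for \<omega> by (simp add: history_def G_def)
    then have "?F (H n \<omega>, s) * (ennreal (max (Gj n \<omega> + s) 0 * survival (Gj n \<omega>) s) * indicator {0..} s) = 0" for \<omega> s
      by (auto simp: indicator_def max_def)
    then show "(\<integral>\<^sup>+\<omega>. \<integral>\<^sup>+s. ?F (H n \<omega>, s) * (ennreal (max (Gj n \<omega> + s) 0 * survival (Gj n \<omega>) s) * indicator {0..} s) \<partial>lborel \<partial>M) = 0"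
      by (simp only: nn_integral_const mult_zero_left)
  qed
  then have "AE \<omega> in M. ?F (H n \<omega>, \<delta> n \<omega>) = 0"
    by (subst (asm) nn_integral_0_iff_AE) (unfold split_def, measurable)
  then show ?thesis using path_YG AE_space
  proof eventually_elim
    case (elim \<omega>)
    have "Gj n \<omega> + \<delta> n \<omega> > 0" using elim(1) by (auto simp: history_def G_def indicator_def split: if_splits)
    moreover have "ip d (X (\<tau> (Suc n) \<omega>) \<omega>) (V (\<tau> n \<omega>) \<omega>) = Gj n \<omega> + \<delta> n \<omega>"
      using elim(2) \<delta>_pos[OF elim(3), of n] by auto
    moreover have "ip d (X (\<tau> (Suc n) \<omega>) \<omega>) (V (\<tau> n \<omega>) \<omega>) = 0" if "vnorm d (X (\<tau> (Suc n) \<omega>) \<omega>) = 0"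
      using that ip_sq_le[of d "X (\<tau> (Suc n) \<omega>) \<omega>" "V (\<tau> n \<omega>) \<omega>"] by (simp add: vnorm_sq[symmetric])
    ultimately show ?case by auto
  qed
qed

text \<open>The joint law of history, jump time and new velocity is identified on rectangles;
  integrating a function of the inner product with the position then leaves the radial draw
  alone.\<close>

lemma nn_integral_jump:
  assumes F[measurable]: "F \<in> borel_measurable ((history_space d n \<Otimes>\<^sub>M borel) \<Otimes>\<^sub>M borel)"
  shows "(\<integral>\<^sup>+\<omega>. F ((H n \<omega>, \<tau> (Suc n) \<omega>), Gj (Suc n) \<omega>) \<partial>M) =
    (\<integral>\<^sup>+\<omega>. \<integral>\<^sup>+b. F ((H n \<omega>, \<tau> (Suc n) \<omega>), - (sqrt (Yj (Suc n) \<omega>) * rayleigh_quantile d b)) \<partial>rayleigh \<partial>M)"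
proof -
  let ?T = "history_space d n \<Otimes>\<^sub>M (borel :: real measure)"
  let ?x = "\<lambda>\<omega>. X (\<tau> (Suc n) \<omega>) \<omega>" and ?v = "\<lambda>\<omega>. V (\<tau> n \<omega>) \<omega>" and ?v' = "\<lambda>\<omega>. V (\<tau> (Suc n) \<omega>) \<omega>"
  let ?h = "\<lambda>\<omega>. (H n \<omega>, \<tau> (Suc n) \<omega>)"
  \<comment> \<open>On the null event that the jump happens at the origin the kernel is replaced by
    a point mass, which makes it measurable everywhere.\<close>
  define K where "K \<omega> = (if vnorm d (?x \<omega>) \<noteq> 0 then jump_kernel d \<nu> (?x \<omega>) (?v \<omega>) else return (Rd d) (?v \<omega>))" for \<omega>
  have K[measurable]: "K \<in> M \<rightarrow>\<^sub>M subprob_algebra (Rd d)"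
    unfolding K_def
  proof (subst measurable_If_restrict_space_iff, goal_cases)
    case 2
    show ?case
      by (intro conjI jump_kernel_prob_measurable[OF kernel d] measurable_restrict_space1) measurable
  qed measurable
  let ?P = "?T \<Otimes>\<^sub>M Rd d"
  let ?N1 = "distr M ?P (\<lambda>\<omega>. (?h \<omega>, ?v' \<omega>))"
  let ?k = "\<lambda>\<omega>. distr (K \<omega>) ?P (\<lambda>v. (?h \<omega>, v))"
  have k: "?k \<in> M \<rightarrow>\<^sub>M subprob_algebra ?P"
    by (rule measurable_distr2[OF _ K]) measurable
  let ?N2 = "M \<bind> ?k"
  have sK[measurable_cong]: "sets (K \<omega>) = sets (Rd d)" if "\<omega> \<in> space M" for \<omega>
    using measurable_space[OF K that] by (simp add: space_subprob_algebra)
  have "?N1 = ?N2"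
  proof (rule measure_eqI_pair_generator)
    show "Int_stable (sets (Rd d))" by (rule Int_stableI) auto
    show "sets (Rd d) \<subseteq> Pow (space (Rd d))" by (rule sets.space_closed)
    show "sets (Rd d) = sigma_sets (space (Rd d)) (sets (Rd d))" by (simp add: sets.sigma_sets_eq)
    show "range (\<lambda>_::nat. space (Rd d)) \<subseteq> sets (Rd d)" "(\<Union>_::nat. space (Rd d)) = space (Rd d)" by auto
    show "finite_measure ?N1" by (rule finite_measure_distr) measurable
    show "sets ?N2 = sets ?P" by (rule sets_bind[OF sets_kernel[OF k]]) (use not_empty in auto)
    fix E B assume E[measurable]: "E \<in> sets ?T" and B[measurable]: "B \<in> sets (Rd d)"
    have "emeasure ?N1 (E \<times> B) = emeasure M {\<omega> \<in> space M. ?h \<omega> \<in> E \<and> ?v' \<omega> \<in> B}"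
      by (subst emeasure_distr) (auto intro!: arg_cong[where f="emeasure M"])
    also have "\<dots> = (\<integral>\<^sup>+\<omega>. indicator E (?h \<omega>) * emeasure (jump_kernel d \<nu> (?x \<omega>) (?v \<omega>)) B \<partial>M)"
      by (rule jump) auto
    also have "\<dots> = (\<integral>\<^sup>+\<omega>. emeasure (?k \<omega>) (E \<times> B) \<partial>M)"
    proof (rule nn_integral_cong_AE)
      show "AE \<omega> in M. indicator E (?h \<omega>) * emeasure (jump_kernel d \<nu> (?x \<omega>) (?v \<omega>)) B = emeasure (?k \<omega>) (E \<times> B)"
        using AE_jump_Y_nonzero[of n] AE_space
      proof eventually_elim
        case (elim \<omega>)
        note [measurable_cong] = sK[OF elim(2)]
        have h: "?h \<omega> \<in> space ?T" using measurable_space[OF H_measurable elim(2)] by (auto simp: space_pair_measure)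
        have "emeasure (?k \<omega>) (E \<times> B) = emeasure (K \<omega>) ((\<lambda>v. (?h \<omega>, v)) -` (E \<times> B) \<inter> space (K \<omega>))"
          using measurable_Pair1'[OF h, of "Rd d"]
          by (intro emeasure_distr) (auto simp: measurable_cong_sets[OF sK[OF elim(2)] refl])
        also have "(\<lambda>v. (?h \<omega>, v)) -` (E \<times> B) \<inter> space (K \<omega>) = (if ?h \<omega> \<in> E then B else {})"
          using sets.sets_into_space[OF B] sets_eq_imp_space_eq[OF sK[OF elim(2)]] by auto
        finally show ?case using elim(1) by (simp add: K_def)
      qed
    qed
    also have "\<dots> = emeasure ?N2 (E \<times> B)"
      by (rule emeasure_bind[symmetric, OF not_empty k]) auto
    finally show "emeasure ?N1 (E \<times> B) = emeasure ?N2 (E \<times> B)" .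
  qed auto
  \<comment> \<open>The position at the jump is computed from the history and the jump time along
    the flow. The integrand thereby depends only on the conditioning variables and the new
    velocity.\<close>
  define xf where "xf = (\<lambda>(h :: nat \<Rightarrow> real \<times> rvec \<times> rvec, t). drift d (t - fst (h n)) (fst (snd (h n))) (snd (snd (h n))))"
  have hn: "(\<lambda>p. fst p n) \<in> ?T \<rightarrow>\<^sub>M borel \<Otimes>\<^sub>M Rd d \<Otimes>\<^sub>M Rd d"
    by (rule measurable_compose[OF measurable_fst]) (auto simp: history_space_def intro: measurable_component_singleton)
  have hx: "(\<lambda>p. fst (snd (fst p n))) \<in> ?T \<rightarrow>\<^sub>M Rd d" and hv: "(\<lambda>p. snd (snd (fst p n))) \<in> ?T \<rightarrow>\<^sub>M Rd d"
    and ht: "(\<lambda>p. fst (fst p n)) \<in> ?T \<rightarrow>\<^sub>M borel"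
    by (rule measurable_compose[OF hn measurable_compose[OF measurable_snd measurable_fst]]
        measurable_compose[OF hn measurable_compose[OF measurable_snd measurable_snd]]
        measurable_compose[OF hn measurable_fst])+
  have [measurable]: "xf \<in> ?T \<rightarrow>\<^sub>M Rd d"
  proof -
    have "(\<lambda>p. \<lambda>i\<in>{..<d}. fst (snd (fst p n)) i + (snd p - fst (fst p n)) * snd (snd (fst p n)) i) \<in> ?T \<rightarrow>\<^sub>M Rd d"
    proof (rule measurable_RdI)
      fix i assume i: "i < d"
      note [measurable] = measurable_component_Rd[OF i hx] measurable_component_Rd[OF i hv] ht
      show "(\<lambda>p. fst (snd (fst p n)) i + (snd p - fst (fst p n)) * snd (snd (fst p n)) i) \<in> borel_measurable ?T"
        by measurable
    qed
    then show ?thesis unfolding xf_def split_def drift_def .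
  qed
  have xf: "AE \<omega> in M. ?x \<omega> = xf (?h \<omega>)"
    using path AE_space
  proof eventually_elim
    case (elim \<omega>)
    then have "X (\<tau> (Suc n) \<omega>) \<omega> = drift d (\<delta> n \<omega>) (X (\<tau> n \<omega>) \<omega>) (V (\<tau> n \<omega>) \<omega>)"
      using \<delta>_pos[OF elim(2), of n] by auto
    then show ?case by (simp add: xf_def history_def)
  qed
  let ?F = "\<lambda>p. F (fst p, ip d (xf (fst p)) (snd p))"
  have F'[measurable]: "?F \<in> borel_measurable ?P"
  proof -
    have [measurable]: "(\<lambda>p. ip d (xf (fst p)) (snd p)) \<in> borel_measurable ?P"
      by (rule measurable_ip) measurable
    show ?thesis by measurable
  qed
  have "(\<integral>\<^sup>+\<omega>. F (?h \<omega>, Gj (Suc n) \<omega>) \<partial>M) = (\<integral>\<^sup>+\<omega>. ?F (?h \<omega>, ?v' \<omega>) \<partial>M)"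
    by (rule nn_integral_cong_AE, rule AE_mp[OF xf]) (auto simp: G_def)
  also have "\<dots> = (\<integral>\<^sup>+p. ?F p \<partial>?N1)" by (subst nn_integral_distr) auto
  also have "\<dots> = (\<integral>\<^sup>+p. ?F p \<partial>?N2)" using \<open>?N1 = ?N2\<close> by simp
  also have "\<dots> = (\<integral>\<^sup>+\<omega>. \<integral>\<^sup>+p. ?F p \<partial>?k \<omega> \<partial>M)"
    by (rule nn_integral_bind[OF F' k])
  also have "\<dots> = (\<integral>\<^sup>+\<omega>. \<integral>\<^sup>+b. F (?h \<omega>, - (sqrt (Yj (Suc n) \<omega>) * rayleigh_quantile d b)) \<partial>rayleigh \<partial>M)"
  proof (rule nn_integral_cong_AE)
    show "AE \<omega> in M. (\<integral>\<^sup>+p. ?F p \<partial>?k \<omega>) = (\<integral>\<^sup>+b. F (?h \<omega>, - (sqrt (Yj (Suc n) \<omega>) * rayleigh_quantile d b)) \<partial>rayleigh)"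
      using AE_jump_Y_nonzero[of n] xf AE_space
    proof eventually_elim
      case (elim \<omega>)
      have h: "?h \<omega> \<in> space ?T" using measurable_space[OF H_measurable elim(3)] by (auto simp: space_pair_measure)
      have pm: "Pair (?h \<omega>) \<in> K \<omega> \<rightarrow>\<^sub>M ?P"
        using measurable_Pair1'[OF h, of "Rd d"] by (simp only: measurable_cong_sets[OF sK[OF elim(3)] refl])
      have "?F \<in> borel_measurable (?k \<omega>)" using F' by (simp only: measurable_distr_eq1)
      then have "(\<integral>\<^sup>+p. ?F p \<partial>?k \<omega>) = (\<integral>\<^sup>+v. ?F (?h \<omega>, v) \<partial>K \<omega>)"
        by (rule nn_integral_distr[OF pm])
      also have "\<dots> = (\<integral>\<^sup>+v. F (?h \<omega>, ip d (?x \<omega>) v) \<partial>jump_kernel d \<nu> (?x \<omega>) (?v \<omega>))"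
        using elim by (simp add: K_def)
      also have "\<dots> = (\<integral>\<^sup>+b. F (?h \<omega>, - (vnorm d (?x \<omega>) * rayleigh_quantile d b)) \<partial>rayleigh)"
        by (rule nn_integral_jump_kernel[OF kernel d measurable_space[OF XVj_measurable(1) elim(3)] elim(1)
              measurable_space[OF XVj_measurable(2) elim(3)] measurable_compose[OF measurable_Pair1'[OF h] F]])
      also have "vnorm d (?x \<omega>) = sqrt (Yj (Suc n) \<omega>)" unfolding Y_def vnorm_sq[symmetric] by simp
      finally show ?case .
    qed
  qed
  finally show ?thesis .
qed

end

lemma measurable_indicator_Ico [measurable]:
  fixes f g h :: "'z \<Rightarrow> real"
  assumes [measurable]: "f \<in> borel_measurable N" "g \<in> borel_measurable N" "h \<in> borel_measurable N"
  shows "(\<lambda>x. indicator {f x..<g x} (h x) :: real) \<in> borel_measurable N"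
  unfolding indicator_def atLeastLessThan_iff by measurable

section \<open>Laws of waiting times and jumps as image measures, and pathwise bounds\<close>

context fecmc
begin

text \<open>Since \<open>survival (Gj n) u\<close> is the conditional probability that the waiting
  time exceeds \<open>u\<close>, the survival factor of the density may be traded for the indicator
  of \<open>u < \<delta> n\<close>. The right side then integrates the jump rate over the actual
  flight, as a compensator does. Equality of laws makes it applicable to signed functions.\<close>

lemma law_waiting:
  "distr M (history_space d n \<Otimes>\<^sub>M borel) (\<lambda>\<omega>. (H n \<omega>, \<delta> n \<omega>)) =
   distr (density (M \<Otimes>\<^sub>M lborel) (\<lambda>p. ennreal (max (Gj n (fst p) + snd p) 0 * indicator {0..<\<delta> n (fst p)} (snd p))))
     (history_space d n \<Otimes>\<^sub>M borel) (\<lambda>p. (H n (fst p), snd p))" (is "?N1 = ?N2")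
proof (rule measure_eqI)
  let ?T = "history_space d n \<Otimes>\<^sub>M (borel :: real measure)"
  fix E assume "E \<in> sets ?N1"
  then have E[measurable]: "E \<in> sets ?T" by simp
  define gh where "gh h = ip d (fst (snd (h n))) (snd (snd (h n)))" for h :: "nat \<Rightarrow> real \<times> rvec \<times> rvec"
  have hn: "(\<lambda>h. h n) \<in> history_space d n \<rightarrow>\<^sub>M borel \<Otimes>\<^sub>M Rd d \<Otimes>\<^sub>M Rd d"
    unfolding history_space_def by (rule measurable_component_singleton) simp
  have [measurable]: "gh \<in> borel_measurable (history_space d n)"
    unfolding gh_def by (intro measurable_ip measurable_compose[OF hn]) measurable
  have gh: "gh (H n \<omega>) = Gj n \<omega>" for \<omega> by (simp add: gh_def history_def G_def)
  let ?w = "\<lambda>g u. ennreal (max (g + u) 0)"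
  \<comment> \<open>\<open>F (h, s)\<close> is the rate integrated over flight times before
    \<open>s\<close>. The law of the waiting time is applied both to the indicator of
    \<open>E\<close> and to \<open>F\<close>; exchanging the integrals over \<open>s\<close> and
    \<open>u\<close> shows that the results agree.\<close>
  define F where "F = (\<lambda>(h, s). \<integral>\<^sup>+u. indicator E (h, u) * ?w (gh h) u * indicator {0..<s} u \<partial>lborel)"
  have F[measurable]: "F \<in> borel_measurable ?T"
  proof -
    have "(\<lambda>p. \<integral>\<^sup>+u. indicator E (fst p, u) * ?w (gh (fst p)) u * (indicator {0..} u * indicator {0<..} (snd p - u)) \<partial>lborel) \<in> borel_measurable ?T"
      by measurable
    moreover have "indicator {0..} u * indicator {0<..} (s - u) = (indicator {0..<s} u :: ennreal)" for u s :: real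
      by (auto simp: indicator_def)
    ultimately show ?thesis by (simp add: F_def split_def)
  qed
  have "emeasure ?N1 E = (\<integral>\<^sup>+\<omega>. indicator E (H n \<omega>, \<delta> n \<omega>) \<partial>M)"
    by (subst nn_integral_indicator[symmetric], simp, subst nn_integral_distr) auto
  also have "\<dots> = (\<integral>\<^sup>+\<omega>. \<integral>\<^sup>+s. indicator E (H n \<omega>, s) * (ennreal (max (Gj n \<omega> + s) 0 * survival (Gj n \<omega>) s) * indicator {0..} s) \<partial>lborel \<partial>M)"
    by (rule nn_integral_waiting) simp
  also have "\<dots> = (\<integral>\<^sup>+\<omega>. \<integral>\<^sup>+s. F (H n \<omega>, s) * (ennreal (max (Gj n \<omega> + s) 0 * survival (Gj n \<omega>) s) * indicator {0..} s) \<partial>lborel \<partial>M)"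
  proof (rule nn_integral_cong)
    fix \<omega> assume \<omega>: "\<omega> \<in> space M"
    let ?g = "Gj n \<omega>" and ?h = "H n \<omega>"
    let ?p = "\<lambda>s. ennreal (max (?g + s) 0 * survival ?g s)"
    have [measurable]: "?h \<in> space (history_space d n)" using measurable_space[OF H_measurable \<omega>] .
    have [measurable]: "(\<lambda>s. indicator E (?h, s) :: ennreal) \<in> borel_measurable borel"
      by measurable
    have [measurable]: "?p \<in> borel_measurable borel" unfolding survival_def by measurable
    have "(\<integral>\<^sup>+s. F (?h, s) * (?p s * indicator {0..} s) \<partial>lborel)
       = (\<integral>\<^sup>+s. \<integral>\<^sup>+u. indicator E (?h, u) * ?w ?g u * (indicator {0..} u * indicator {0<..} (s - u)) * (?p s * indicator {0..} s) \<partial>lborel \<partial>lborel)"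
    proof (rule nn_integral_cong)
      fix s
      have "F (?h, s) = (\<integral>\<^sup>+u. indicator E (?h, u) * ?w ?g u * (indicator {0..} u * indicator {0<..} (s - u)) \<partial>lborel)"
        unfolding F_def by (auto simp: gh indicator_def intro!: nn_integral_cong)
      then show "F (?h, s) * (?p s * indicator {0..} s) =
          (\<integral>\<^sup>+u. indicator E (?h, u) * ?w ?g u * (indicator {0..} u * indicator {0<..} (s - u)) * (?p s * indicator {0..} s) \<partial>lborel)"
        by (simp only:) (rule nn_integral_multc[symmetric], measurable)
    qed
    also have "\<dots> = (\<integral>\<^sup>+u. \<integral>\<^sup>+s. indicator E (?h, u) * ?w ?g u * (indicator {0..} u * indicator {0<..} (s - u)) * (?p s * indicator {0..} s) \<partial>lborel \<partial>lborel)"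
      by (rule lborel_pair.Fubini') measurable
    also have "\<dots> = (\<integral>\<^sup>+u. indicator E (?h, u) * (ennreal (max (?g + u) 0 * survival ?g u) * indicator {0..} u) \<partial>lborel)"
    proof (rule nn_integral_cong)
      fix u :: real
      have "(\<integral>\<^sup>+s. indicator E (?h, u) * ?w ?g u * (indicator {0..} u * indicator {0<..} (s - u)) * (?p s * indicator {0..} s) \<partial>lborel)
        = (\<integral>\<^sup>+s. (indicator E (?h, u) * ?w ?g u * indicator {0..} u) * (?p s * indicator {u..} s) \<partial>lborel)"
        by (rule nn_integral_cong_AE, rule AE_mp[OF AE_lborel_singleton[of u]]) (auto simp: indicator_def)
      also have "\<dots> = (indicator E (?h, u) * ?w ?g u * indicator {0..} u) * ennreal (survival ?g u)"
        by (subst nn_integral_cmult) (auto simp: nn_integral_hazard)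
      also have "\<dots> = indicator E (?h, u) * (ennreal (max (?g + u) 0 * survival ?g u) * indicator {0..} u)"
        by (simp add: ennreal_mult survival_nonneg mult_ac)
      finally show "(\<integral>\<^sup>+s. indicator E (?h, u) * ?w ?g u * (indicator {0..} u * indicator {0<..} (s - u)) * (?p s * indicator {0..} s) \<partial>lborel)
        = indicator E (?h, u) * (ennreal (max (?g + u) 0 * survival ?g u) * indicator {0..} u)" .
    qed
    finally show "(\<integral>\<^sup>+s. indicator E (H n \<omega>, s) * (ennreal (max (Gj n \<omega> + s) 0 * survival (Gj n \<omega>) s) * indicator {0..} s) \<partial>lborel) =
       (\<integral>\<^sup>+s. F (H n \<omega>, s) * (ennreal (max (Gj n \<omega> + s) 0 * survival (Gj n \<omega>) s) * indicator {0..} s) \<partial>lborel)" ..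
  qed
  also have "\<dots> = (\<integral>\<^sup>+\<omega>. F (H n \<omega>, \<delta> n \<omega>) \<partial>M)"
    by (rule nn_integral_waiting[symmetric]) simp
  also have "\<dots> = (\<integral>\<^sup>+\<omega>. \<integral>\<^sup>+u. ennreal (max (Gj n \<omega> + u) 0 * indicator {0..<\<delta> n \<omega>} u) * indicator E (H n \<omega>, u) \<partial>lborel \<partial>M)"
    unfolding F_def by (auto intro!: nn_integral_cong simp: gh indicator_def)
  also have "\<dots> = (\<integral>\<^sup>+p. ennreal (max (Gj n (fst p) + snd p) 0 * indicator {0..<\<delta> n (fst p)} (snd p)) * indicator E (H n (fst p), snd p) \<partial>(M \<Otimes>\<^sub>M lborel))"
    by (subst lborel.nn_integral_fst[symmetric]) auto
  also have "\<dots> = emeasure ?N2 E"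
    by (subst nn_integral_indicator[symmetric], simp, subst nn_integral_distr, measurable, subst nn_integral_density) auto
  finally show "emeasure ?N1 E = emeasure ?N2 E" .
qed simp

text \<open>The formula for nonnegative integrands is recast as an equality of image measures, so
  that Bochner integrals of signed functions can be transported.\<close>

lemma law_jump:
  "distr M ((history_space d n \<Otimes>\<^sub>M borel) \<Otimes>\<^sub>M borel) (\<lambda>\<omega>. ((H n \<omega>, \<tau> (Suc n) \<omega>), Gj (Suc n) \<omega>)) =
   distr (M \<Otimes>\<^sub>M rayleigh) ((history_space d n \<Otimes>\<^sub>M borel) \<Otimes>\<^sub>M borel)
     (\<lambda>p. ((H n (fst p), \<tau> (Suc n) (fst p)), - (sqrt (Yj (Suc n) (fst p)) * rayleigh_quantile d (snd p))))"
   (is "?N1 = ?N2")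
proof (rule measure_eqI)
  let ?T = "(history_space d n \<Otimes>\<^sub>M (borel :: real measure)) \<Otimes>\<^sub>M (borel :: real measure)"
  fix E assume "E \<in> sets ?N1"
  then have E[measurable]: "E \<in> sets ?T" by simp
  have "emeasure ?N1 E = (\<integral>\<^sup>+\<omega>. indicator E ((H n \<omega>, \<tau> (Suc n) \<omega>), Gj (Suc n) \<omega>) \<partial>M)"
    by (subst nn_integral_indicator[symmetric], simp, subst nn_integral_distr) auto
  also have "\<dots> = (\<integral>\<^sup>+\<omega>. \<integral>\<^sup>+b. indicator E ((H n \<omega>, \<tau> (Suc n) \<omega>), - (sqrt (Yj (Suc n) \<omega>) * rayleigh_quantile d b)) \<partial>rayleigh \<partial>M)"
    by (rule nn_integral_jump) simp
  also have "\<dots> = (\<integral>\<^sup>+p. indicator E ((H n (fst p), \<tau> (Suc n) (fst p)), - (sqrt (Yj (Suc n) (fst p)) * rayleigh_quantile d (snd p))) \<partial>(M \<Otimes>\<^sub>M rayleigh))"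
    by (subst rayleigh.nn_integral_fst[symmetric]) auto
  also have "\<dots> = emeasure ?N2 E"
    by (subst nn_integral_indicator[symmetric], simp, subst nn_integral_distr) auto
  finally show "emeasure ?N1 E = emeasure ?N2 E" .
qed simp

text \<open>The processes are only jointly measurable on nonnegative times, hence the truncation.\<close>

definition Yt :: "real \<Rightarrow> 'a \<Rightarrow> real" where "Yt t \<omega> = Y (max 0 t) \<omega>"
definition Gt :: "real \<Rightarrow> 'a \<Rightarrow> real" where "Gt t \<omega> = G (max 0 t) \<omega>"

lemma YGt_measurable [measurable]:
  assumes [measurable]: "f \<in> borel_measurable N" "g \<in> N \<rightarrow>\<^sub>M M"
  shows "(\<lambda>x. Yt (f x) (g x)) \<in> borel_measurable N" "(\<lambda>x. Gt (f x) (g x)) \<in> borel_measurable N"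
proof -
  have "(\<lambda>x. max 0 (f x)) \<in> borel_measurable N" by measurable
  note XV = XV_measurable_at[OF this assms(2)]
  show "(\<lambda>x. Yt (f x) (g x)) \<in> borel_measurable N" "(\<lambda>x. Gt (f x) (g x)) \<in> borel_measurable N"
    unfolding Yt_def Gt_def Y_def G_def by (intro measurable_ip XV; simp)+
qed

lemma Gt_sq_le: "\<omega> \<in> space M \<Longrightarrow> (Gt t \<omega>)\<^sup>2 \<le> Yt t \<omega>"
  unfolding Yt_def Gt_def by (rule G_sq_le) auto

lemma Yt_nonneg: "0 \<le> Yt t \<omega>" unfolding Yt_def by (rule Y_nonneg)

lemma jump_interval:
  assumes "\<omega> \<in> space M" "0 \<le> t"
  obtains n where "\<tau> n \<omega> \<le> t" "t < \<tau> (Suc n) \<omega>"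
proof -
  have "\<exists>n. t < \<tau> n \<omega>"
    using \<tau>_at_top[OF assms(1)] by (auto simp: filterlim_at_top_dense eventually_sequentially)
  then obtain n where n: "t < \<tau> n \<omega>" "\<And>m. m < n \<Longrightarrow> \<not> t < \<tau> m \<omega>"
    using exists_least_iff[of "\<lambda>n. t < \<tau> n \<omega>"] by auto
  then obtain m where "n = Suc m" using \<tau>_0[OF assms(1)] assms(2) by (cases n) auto
  then show thesis using n that[of m] by (auto simp: not_less)
qed

text \<open>One event of full measure on which the path description holds at all times, so that
  bounds can be stated path by path.\<close>

definition good :: "'a \<Rightarrow> bool" where
  "good \<omega> \<longleftrightarrow> \<omega> \<in> space M \<and> (\<forall>n. \<forall>t. \<tau> n \<omega> \<le> t \<and> t \<le> \<tau> (Suc n) \<omega> \<longrightarrow>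
    Yt t \<omega> = Yj n \<omega> + 2 * Gj n \<omega> * (t - \<tau> n \<omega>) + (t - \<tau> n \<omega>)\<^sup>2 \<and>
    (t < \<tau> (Suc n) \<omega> \<longrightarrow> Gt t \<omega> = Gj n \<omega> + (t - \<tau> n \<omega>)))"

lemma AE_good: "AE \<omega> in M. good \<omega>"
  using path_YG AE_space
proof eventually_elim
  case (elim \<omega>)
  have "max 0 t = t" if "\<tau> n \<omega> \<le> t" for n t using \<tau>_nonneg[OF elim(2), of n] that by simp
  then show ?case using elim unfolding good_def Yt_def Gt_def by fastforce
qed

lemma good_space: "good \<omega> \<Longrightarrow> \<omega> \<in> space M" by (simp add: good_def)

lemma good_Y: "good \<omega> \<Longrightarrow> \<tau> n \<omega> \<le> t \<Longrightarrow> t \<le> \<tau> (Suc n) \<omega> \<Longrightarrow>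
    Yt t \<omega> = Yj n \<omega> + 2 * Gj n \<omega> * (t - \<tau> n \<omega>) + (t - \<tau> n \<omega>)\<^sup>2"
  and good_G: "good \<omega> \<Longrightarrow> \<tau> n \<omega> \<le> t \<Longrightarrow> t < \<tau> (Suc n) \<omega> \<Longrightarrow> Gt t \<omega> = Gj n \<omega> + (t - \<tau> n \<omega>)"
  by (auto simp: good_def)

lemma YGt_\<tau>: "\<omega> \<in> space M \<Longrightarrow> Yt (\<tau> n \<omega>) \<omega> = Yj n \<omega>" "\<omega> \<in> space M \<Longrightarrow> Gt (\<tau> n \<omega>) \<omega> = Gj n \<omega>"
  using \<tau>_nonneg by (simp_all add: Yt_def Gt_def)

lemma flow_sqrt_le: "g\<^sup>2 \<le> y \<Longrightarrow> 0 \<le> u \<Longrightarrow> y + 2 * g * u + u\<^sup>2 \<le> (sqrt y + u)\<^sup>2"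
proof -
  assume a: "g\<^sup>2 \<le> y" "0 \<le> u"
  then have "0 \<le> y" using zero_le_power2 order_trans by blast
  moreover have "g \<le> sqrt y" using a by (simp add: real_le_rsqrt)
  then have "2 * g * u \<le> 2 * sqrt y * u" using a by (simp add: mult_right_mono)
  ultimately show ?thesis by (simp add: power2_sum)
qed

lemma flow_nonneg: fixes g y u :: real shows "g\<^sup>2 \<le> y \<Longrightarrow> (g + u)\<^sup>2 \<le> y + 2 * g * u + u\<^sup>2"
  by (simp add: power2_sum)

text \<open>The position moves at unit speed and does not jump, so its norm \<open>sqrt Y\<close>
  grows at most linearly; the induction runs over the jumps.\<close>

lemma Yt_le:
  assumes "good \<omega>" "0 \<le> t"
  shows "Yt t \<omega> \<le> (sqrt (Yt 0 \<omega>) + t)\<^sup>2"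
proof -
  have \<omega>: "\<omega> \<in> space M" using assms(1) by (rule good_space)
  have step: "sqrt (Yt t \<omega>) \<le> sqrt (Yj n \<omega>) + (t - \<tau> n \<omega>)" if "\<tau> n \<omega> \<le> t" "t \<le> \<tau> (Suc n) \<omega>" for n t
    unfolding good_Y[OF assms(1) that]
    using that G_sq_le[OF \<tau>_nonneg[OF \<omega>] \<omega>, of n] Y_nonneg by (intro real_le_lsqrt flow_sqrt_le) auto
  have ind: "sqrt (Yj n \<omega>) \<le> sqrt (Yt 0 \<omega>) + \<tau> n \<omega>" for n
  proof (induction n)
    case 0
    show ?case using \<tau>_0[OF \<omega>] by (simp add: Yt_def)
  next
    case (Suc n)
    then show ?case using step[of n "\<tau> (Suc n) \<omega>"] \<tau>_mono[OF \<omega>, of n "Suc n"] YGt_\<tau>(1)[OF \<omega>] by fastforce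
  qed
  obtain n where "\<tau> n \<omega> \<le> t" "t < \<tau> (Suc n) \<omega>" using jump_interval[OF \<omega> assms(2)] .
  with step[of n t] ind[of n] have "sqrt (Yt t \<omega>) \<le> sqrt (Yt 0 \<omega>) + t" by simp
  then show ?thesis using sqrt_le_D by blast
qed

text \<open>The bound depends on the path only through its starting point and is uniform over the
  number of jumps. This supplies the integrable dominating functions for Dynkin's formula.\<close>

lemma one_plus_Yt_le:
  assumes "good \<omega>" "0 \<le> s" "s \<le> t"
  shows "1 + Yt s \<omega> \<le> (2 + 2 * t\<^sup>2) * (1 + Yt 0 \<omega>)"
proof -
  have "Yt s \<omega> \<le> (sqrt (Yt 0 \<omega>) + s)\<^sup>2" by (rule Yt_le) fact+
  also have "\<dots> \<le> 2 * (sqrt (Yt 0 \<omega>))\<^sup>2 + 2 * s\<^sup>2"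
    using zero_le_power2[of "sqrt (Yt 0 \<omega>) - s"] by (simp only: power2_sum power2_diff)
  also have "\<dots> = 2 * Yt 0 \<omega> + 2 * s\<^sup>2" using Yt_nonneg by simp
  also have "s\<^sup>2 \<le> t\<^sup>2" using assms by (simp add: power_mono)
  finally have "Yt s \<omega> \<le> 2 * Yt 0 \<omega> + 2 * t\<^sup>2" by simp
  moreover have "0 \<le> t\<^sup>2 * Yt 0 \<omega>" using Yt_nonneg by simp
  ultimately show ?thesis by (simp add: algebra_simps)
qed

end

section \<open>Dynkin's formula\<close>

definition resample :: "nat \<Rightarrow> (real \<Rightarrow> real) \<Rightarrow> real \<Rightarrow> real" where
  "resample d F y = (\<integral>b. F (- (sqrt y * rayleigh_quantile d b)) \<partial>rayleigh)"

lemma integrable_indicator_Icc [simp]: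
  fixes a b :: real shows "integrable lborel (indicat_real {a..b})"
  by (rule integrable_real_indicator) (auto simp: emeasure_lborel_Icc_eq)

lemma integrable_Icc_bounded:
  fixes F :: "real \<Rightarrow> real"
  assumes [measurable]: "F \<in> borel_measurable borel" and bound: "\<And>s. \<bar>F s\<bar> \<le> indicator {0..t} s * K"
  shows "integrable lborel F"
proof (rule Bochner_Integration.integrable_bound)
  show "integrable lborel (\<lambda>s. indicator {0..t} s * K)" by simp
  show "AE s in lborel. norm (F s) \<le> norm (indicator {0..t} s * K)"
    by (rule AE_I2, unfold real_norm_def, rule order_trans[OF bound abs_ge_self])
qed measurable

lemma integrable_pair_dominated:
  fixes F :: "'x \<times> 'y \<Rightarrow> real" and K :: "'x \<Rightarrow> real" and k :: "'y \<Rightarrow> real"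
  assumes N: "sigma_finite_measure N" and F[measurable]: "F \<in> borel_measurable (M \<Otimes>\<^sub>M N)"
    and K: "integrable M K" and k: "integrable N k"
    and bound: "AE x in M. \<forall>y. \<bar>F (x, y)\<bar> \<le> \<bar>k y\<bar> * \<bar>K x\<bar>"
  shows "integrable (M \<Otimes>\<^sub>M N) F"
  unfolding integrable_iff_bounded
proof
  interpret N: sigma_finite_measure N by fact
  have [measurable]: "K \<in> borel_measurable M" "k \<in> borel_measurable N" using K k by auto
  have "(\<integral>\<^sup>+p. ennreal (norm (F p)) \<partial>(M \<Otimes>\<^sub>M N)) = (\<integral>\<^sup>+x. \<integral>\<^sup>+y. ennreal (norm (F (x, y))) \<partial>N \<partial>M)"
    by (rule N.nn_integral_fst[symmetric]) measurable
  also have "\<dots> \<le> (\<integral>\<^sup>+x. (\<integral>\<^sup>+y. ennreal (norm (k y)) \<partial>N) * ennreal (norm (K x)) \<partial>M)"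
  proof (rule nn_integral_mono_AE, rule AE_mp[OF bound], rule AE_I2, rule impI)
    fix x assume x: "\<forall>y. \<bar>F (x, y)\<bar> \<le> \<bar>k y\<bar> * \<bar>K x\<bar>"
    have "(\<integral>\<^sup>+y. ennreal (norm (F (x, y))) \<partial>N) \<le> (\<integral>\<^sup>+y. ennreal (norm (k y)) * ennreal (norm (K x)) \<partial>N)"
      using x by (intro nn_integral_mono) (simp add: ennreal_mult[symmetric])
    also have "\<dots> = (\<integral>\<^sup>+y. ennreal (norm (k y)) \<partial>N) * ennreal (norm (K x))"
      by (rule nn_integral_multc) measurable
    finally show "(\<integral>\<^sup>+y. ennreal (norm (F (x, y))) \<partial>N) \<le> \<dots>" .
  qed
  also have "\<dots> = (\<integral>\<^sup>+y. ennreal (norm (k y)) \<partial>N) * (\<integral>\<^sup>+x. ennreal (norm (K x)) \<partial>M)"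
    by (rule nn_integral_cmult) measurable
  also have "\<dots> < \<infinity>" using K k by (simp add: integrable_iff_bounded ennreal_mult_less_top)
  finally show "(\<integral>\<^sup>+p. ennreal (norm (F p)) \<partial>(M \<Otimes>\<^sub>M N)) < \<infinity>" .
qed measurable

text \<open>Along the flow started at \<open>(y, g)\<close> the pair is \<open>(y + 2 * g * u + u\<^sup>2, g + u)\<close> at time \<open>u\<close>;
  there \<open>I y g u\<close> is the integral of \<open>a\<close> up to time \<open>u\<close>.\<close>

locale fecmc_functional = fecmc M d \<nu> X V \<tau>
  for M :: "'a measure" and d \<nu> X V \<tau> +
  fixes a :: "real \<Rightarrow> real \<Rightarrow> real" and I :: "real \<Rightarrow> real \<Rightarrow> real \<Rightarrow> real" and Ca :: real and ka :: nat
  assumes a_measurable: "(\<lambda>p. a (fst p) (snd p)) \<in> borel_measurable (borel \<Otimes>\<^sub>M borel)"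
    and I_measurable: "(\<lambda>p. I (fst p) (fst (snd p)) (snd (snd p))) \<in> borel_measurable (borel \<Otimes>\<^sub>M borel \<Otimes>\<^sub>M borel)"
    and I_0: "\<And>y g. I y g 0 = 0"
    and I_deriv: "\<And>y g u. ((\<lambda>u. I y g u) has_real_derivative a (y + 2 * g * u + u\<^sup>2) (g + u)) (at u)"
    and a_cont: "\<And>y g u. isCont (\<lambda>u. a (y + 2 * g * u + u\<^sup>2) (g + u)) u"
    and a_bound: "\<And>y g. g\<^sup>2 \<le> y \<Longrightarrow> \<bar>a y g\<bar> \<le> Ca * (1 + y) ^ ka"
    and Y_moments: "\<And>m. integrable M (\<lambda>\<omega>. (1 + Yt 0 \<omega>) ^ m)"
begin

lemma a_measurable' [measurable]:
  "f \<in> borel_measurable N \<Longrightarrow> g \<in> borel_measurable N \<Longrightarrow> (\<lambda>x. a (f x) (g x)) \<in> borel_measurable N"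
  using measurable_compose[OF measurable_Pair a_measurable, of f N g] by simp

lemma I_measurable' [measurable]:
  "f \<in> borel_measurable N \<Longrightarrow> g \<in> borel_measurable N \<Longrightarrow> h \<in> borel_measurable N \<Longrightarrow> (\<lambda>x. I (f x) (g x) (h x)) \<in> borel_measurable N"
  using measurable_compose[OF measurable_Pair[OF _ measurable_Pair] I_measurable, of f N g h] by simp

definition A :: "real \<Rightarrow> 'a \<Rightarrow> real" where
  "A t \<omega> = (\<integral>s. indicator {0..t} s * a (Yt s \<omega>) (Gt s \<omega>) \<partial>lborel)"

text \<open>The pathwise bound of \<open>1 + Yt s\<close> for \<open>s\<close> up to
  \<open>t\<close>. All its powers are integrable.\<close>

definition W :: "real \<Rightarrow> 'a \<Rightarrow> real" where
  "W t \<omega> = (2 + 2 * t\<^sup>2) * (1 + Yt 0 \<omega>)"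

lemma W_measurable [measurable]: "W t \<in> borel_measurable M"
  unfolding W_def by measurable

lemma integrable_W_power: "integrable M (\<lambda>\<omega>. W t \<omega> ^ m)"
  unfolding W_def power_mult_distrib by (intro integrable_mult_right Y_moments)

lemma W_ge_1: "1 \<le> W t \<omega>"
proof -
  have "1 * 1 \<le> (2 + 2 * t\<^sup>2) * (1 + Yt 0 \<omega>)" using Yt_nonneg by (intro mult_mono) auto
  then show ?thesis by (simp add: W_def)
qed

lemma Ca_nonneg: "0 \<le> Ca"
  using a_bound[of 0 0] by simp

lemma A_measurable [measurable]:
  assumes [measurable]: "f \<in> borel_measurable N" "g \<in> N \<rightarrow>\<^sub>M M"
  shows "(\<lambda>x. A (f x) (g x)) \<in> borel_measurable N"
proof -
  have [measurable]: "(\<lambda>p. indicator {0..f (fst p)} (snd p) :: real) \<in> borel_measurable (N \<Otimes>\<^sub>M lborel)"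
    unfolding indicator_def atLeastAtMost_iff by measurable
  show ?thesis
    unfolding A_def
    by (rule lborel.borel_measurable_lebesgue_integral) (simp add: split_def)
qed

lemma a_path_bound:
  assumes "good \<omega>" "0 \<le> s" "s \<le> t"
  shows "\<bar>a (Yt s \<omega>) (Gt s \<omega>)\<bar> \<le> Ca * W t \<omega> ^ ka"
proof -
  have "\<bar>a (Yt s \<omega>) (Gt s \<omega>)\<bar> \<le> Ca * (1 + Yt s \<omega>) ^ ka"
    by (intro a_bound Gt_sq_le good_space[OF assms(1)])
  also have "\<dots> \<le> Ca * W t \<omega> ^ ka"
    using one_plus_Yt_le[OF assms] Yt_nonneg Ca_nonneg unfolding W_def
    by (intro mult_left_mono power_mono) (auto simp: add_nonneg_nonneg)
  finally show ?thesis .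
qed

lemma a_path_integrable:
  assumes "good \<omega>"
  shows "integrable lborel (\<lambda>s. indicator {0..t} s * a (Yt s \<omega>) (Gt s \<omega>))"
proof (rule Bochner_Integration.integrable_bound)
  show "integrable lborel (\<lambda>s. indicator {0..t} s * (Ca * W t \<omega> ^ ka))" by simp
  show "AE s in lborel. norm (indicator {0..t} s * a (Yt s \<omega>) (Gt s \<omega>)) \<le> norm (indicator {0..t} s * (Ca * W t \<omega> ^ ka))"
    using a_path_bound[OF assms, of _ t] by (intro AE_I2) (auto simp: indicator_def intro: order_trans[OF _ abs_ge_self])
  show "(\<lambda>s. indicator {0..t} s * a (Yt s \<omega>) (Gt s \<omega>)) \<in> borel_measurable lborel"
    using good_space[OF assms] by measurable
qed

lemma A_bound:
  assumes "good \<omega>" "0 \<le> s" "s \<le> t"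
  shows "\<bar>A s \<omega>\<bar> \<le> t * Ca * W t \<omega> ^ ka"
proof -
  have "\<bar>A s \<omega>\<bar> \<le> (\<integral>r. \<bar>indicator {0..s} r * a (Yt r \<omega>) (Gt r \<omega>)\<bar> \<partial>lborel)"
    unfolding A_def by (rule integral_abs_bound)
  also have "\<dots> \<le> (\<integral>r. indicator {0..t} r * (Ca * W t \<omega> ^ ka) \<partial>lborel)"
  proof (rule integral_mono)
    show "integrable lborel (\<lambda>r. \<bar>indicator {0..s} r * a (Yt r \<omega>) (Gt r \<omega>)\<bar>)"
      using a_path_integrable[OF assms(1)] by (rule integrable_abs)
    show "\<bar>indicator {0..s} r * a (Yt r \<omega>) (Gt r \<omega>)\<bar> \<le> indicator {0..t} r * (Ca * W t \<omega> ^ ka)" for r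
      using a_path_bound[OF assms(1), of r t] assms Ca_nonneg W_ge_1[of t \<omega>] by (auto simp: indicator_def)
  qed simp
  also have "\<dots> = t * Ca * W t \<omega> ^ ka" using assms by simp
  finally show ?thesis .
qed

lemma path_integral_shift:
  fixes F :: "real \<Rightarrow> real"
  assumes [measurable]: "F \<in> borel_measurable borel" "F' \<in> borel_measurable borel"
    and eq: "\<And>u. 0 < u \<Longrightarrow> u < e \<Longrightarrow> F (c + u) = F' u" "0 \<le> e"
  shows "(\<integral>s. indicator {c<..<c + e} s * F s \<partial>lborel) = (\<integral>u. F' u * indicator {0..e} u \<partial>lborel)"
proof -
  have "(\<integral>s. indicator {c<..<c + e} s * F s \<partial>lborel) = \<bar>1\<bar> *\<^sub>R (\<integral>u. indicator {c<..<c + e} (c + 1 * u) * F (c + 1 * u) \<partial>lborel)"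
    by (rule lborel_integral_real_affine) simp
  also have "\<dots> = (\<integral>u. indicator {c<..<c + e} (c + 1 * u) * F (c + 1 * u) \<partial>lborel)" by simp
  also have "\<dots> = (\<integral>u. F' u * indicator {0..e} u \<partial>lborel)"
    by (rule integral_cong_AE, measurable, rule AE_mp[OF AE_lborel_singleton[of 0]], rule AE_mp[OF AE_lborel_singleton[of e]])
      (auto simp: indicator_def eq)
  finally show ?thesis .
qed

text \<open>Between two jumps the path is the explicit flow, whose integral of \<open>a\<close> is
  \<open>I\<close>; a single endpoint, where \<open>G\<close> may already have jumped, does not
  affect the integral.\<close>

lemma A_increment:
  assumes "good \<omega>" "\<tau> n \<omega> \<le> t" "t \<le> \<tau> (Suc n) \<omega>"
  shows "A t \<omega> = A (\<tau> n \<omega>) \<omega> + I (Yj n \<omega>) (Gj n \<omega>) (t - \<tau> n \<omega>)"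
proof -
  have \<omega>[measurable]: "\<omega> \<in> space M" using assms(1) by (rule good_space)
  let ?a = "\<lambda>s. a (Yt s \<omega>) (Gt s \<omega>)" and ?c = "\<tau> n \<omega>"
  have c: "0 \<le> ?c" by (rule \<tau>_nonneg[OF \<omega>])
  have am: "?a \<in> borel_measurable borel" by measurable
  let ?f = "\<lambda>u. a (Yj n \<omega> + 2 * Gj n \<omega> * u + u\<^sup>2) (Gj n \<omega> + u)"
  have i: "integrable lborel (\<lambda>s. indicator {?c<..<?c + (t - ?c)} s * ?a s)"
    using a_path_integrable[OF assms(1), of t] am c
    by (rule_tac Bochner_Integration.integrable_bound[OF a_path_integrable[OF assms(1), of t]]) (auto simp: indicator_def)
  have "A t \<omega> = (\<integral>s. indicator {0..?c} s * ?a s + indicator {?c<..<?c + (t - ?c)} s * ?a s \<partial>lborel)"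
    unfolding A_def using am c assms
    by (intro integral_cong_AE, measurable, rule_tac AE_mp[OF AE_lborel_singleton[of t]]) (auto simp: indicator_def)
  also have "\<dots> = A ?c \<omega> + (\<integral>s. indicator {?c<..<?c + (t - ?c)} s * ?a s \<partial>lborel)"
    unfolding A_def by (rule Bochner_Integration.integral_add[OF a_path_integrable[OF assms(1)] i])
  also have "(\<integral>s. indicator {?c<..<?c + (t - ?c)} s * ?a s \<partial>lborel) = (\<integral>u. ?f u * indicator {0..t - ?c} u \<partial>lborel)"
    using am good_Y[OF assms(1), of n] good_G[OF assms(1), of n] assms
    by (intro path_integral_shift) auto
  also have "\<dots> = I (Yj n \<omega>) (Gj n \<omega>) (t - ?c) - I (Yj n \<omega>) (Gj n \<omega>) 0"
    using assms by (intro integral_FTC_Icc_real I_deriv a_cont) auto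
  finally show ?thesis by (simp add: I_0)
qed

text \<open>The laws of waiting times and jumps are conditional on the history. These functions
  recover time, squared radius, radial velocity and the accumulated functional from it.\<close>

definition hist_t :: "nat \<Rightarrow> (nat \<Rightarrow> real \<times> rvec \<times> rvec) \<Rightarrow> real" where "hist_t n h = fst (h n)"
definition hist_y :: "nat \<Rightarrow> (nat \<Rightarrow> real \<times> rvec \<times> rvec) \<Rightarrow> real" where "hist_y n h = ip d (fst (snd (h n))) (fst (snd (h n)))"
definition hist_g :: "nat \<Rightarrow> (nat \<Rightarrow> real \<times> rvec \<times> rvec) \<Rightarrow> real" where "hist_g n h = ip d (fst (snd (h n))) (snd (snd (h n)))"
definition hist_A :: "nat \<Rightarrow> (nat \<Rightarrow> real \<times> rvec \<times> rvec) \<Rightarrow> real" where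
  "hist_A n h = (\<Sum>k<n. I (hist_y k h) (hist_g k h) (hist_t (Suc k) h - hist_t k h))"

lemma hist_measurable [measurable]:
  assumes "k \<le> n"
  shows "hist_t k \<in> borel_measurable (history_space d n)" "hist_y k \<in> borel_measurable (history_space d n)"
    "hist_g k \<in> borel_measurable (history_space d n)"
proof -
  have hn: "(\<lambda>h. h k) \<in> history_space d n \<rightarrow>\<^sub>M borel \<Otimes>\<^sub>M Rd d \<Otimes>\<^sub>M Rd d"
    unfolding history_space_def using assms by (intro measurable_component_singleton) simp
  have x: "(\<lambda>h. fst (snd (h k))) \<in> history_space d n \<rightarrow>\<^sub>M Rd d" and v: "(\<lambda>h. snd (snd (h k))) \<in> history_space d n \<rightarrow>\<^sub>M Rd d"
    by (rule measurable_compose[OF hn measurable_compose[OF measurable_snd measurable_fst]]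
        measurable_compose[OF hn measurable_compose[OF measurable_snd measurable_snd]])+
  show "hist_t k \<in> borel_measurable (history_space d n)"
    unfolding hist_t_def[abs_def] by (rule measurable_compose[OF hn measurable_fst])
  show "hist_y k \<in> borel_measurable (history_space d n)" "hist_g k \<in> borel_measurable (history_space d n)"
    unfolding hist_y_def[abs_def] hist_g_def[abs_def] by (intro measurable_ip x v)+
qed

lemma hist_A_measurable [measurable]: "hist_A n \<in> borel_measurable (history_space d n)"
  unfolding hist_A_def[abs_def]
  by (intro borel_measurable_sum I_measurable' borel_measurable_diff hist_measurable) auto

lemma hist_H:
  assumes "k \<le> n" shows "hist_t k (H n \<omega>) = \<tau> k \<omega>" "hist_y k (H n \<omega>) = Yj k \<omega>" "hist_g k (H n \<omega>) = Gj k \<omega>"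
  using assms by (simp_all add: hist_t_def hist_y_def hist_g_def history_def Y_def G_def)

lemma A_0: "A 0 \<omega> = 0"
  unfolding A_def by (rule integral_eq_zero_AE, rule AE_mp[OF AE_lborel_singleton[of 0]]) (auto simp: indicator_def)

lemma hist_A_H:
  assumes "good \<omega>" shows "hist_A n (H n \<omega>) = A (\<tau> n \<omega>) \<omega>"
proof -
  have \<omega>: "\<omega> \<in> space M" using assms by (rule good_space)
  have "(\<Sum>k<n. I (Yj k \<omega>) (Gj k \<omega>) (\<tau> (Suc k) \<omega> - \<tau> k \<omega>)) = A (\<tau> n \<omega>) \<omega>"
  proof (induction n)
    case 0
    then show ?case using \<tau>_0[OF \<omega>] A_0 by simp
  next
    case (Suc n)
    then show ?case using A_increment[OF assms, of n "\<tau> (Suc n) \<omega>"] \<tau>_mono[OF \<omega>, of n "Suc n"] by simp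
  qed
  moreover have "hist_A n (H n \<omega>) = (\<Sum>k<n. I (Yj k \<omega>) (Gj k \<omega>) (\<tau> (Suc k) \<omega> - \<tau> k \<omega>))"
    unfolding hist_A_def by (intro sum.cong) (auto simp: hist_H)
  ultimately show ?thesis by simp
qed

lemma resample_measurable:
  assumes [measurable]: "(\<lambda>p. F (fst p) (snd p)) \<in> borel_measurable (N \<Otimes>\<^sub>M borel)" "f \<in> borel_measurable N"
  shows "(\<lambda>x. resample d (F x) (f x)) \<in> borel_measurable N"
  unfolding resample_def
proof (rule rayleigh.borel_measurable_lebesgue_integral)
  have "(\<lambda>p. (fst p, - (sqrt (f (fst p)) * rayleigh_quantile d (snd p)))) \<in> N \<Otimes>\<^sub>M rayleigh \<rightarrow>\<^sub>M N \<Otimes>\<^sub>M borel"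
    by measurable
  from measurable_compose[OF this assms(1)]
  show "(\<lambda>(x, b). F x (- (sqrt (f x) * rayleigh_quantile d b))) \<in> borel_measurable (N \<Otimes>\<^sub>M rayleigh)"
    by (simp add: split_def)
qed

text \<open>Growth bounds are assumed only on the region \<open>g\<^sup>2 \<le> y\<close>; as the
  radial draw is at most 1 in absolute value, a jump does not leave this region.\<close>

lemma post_jump_sq_le: "0 \<le> y \<Longrightarrow> (- (sqrt y * rayleigh_quantile d b))\<^sup>2 \<le> y"
proof -
  assume y: "0 \<le> y"
  have "(rayleigh_quantile d b)\<^sup>2 \<le> 1"
    using rayleigh_quantile_bounds(1,2)[of d b] d by (simp add: abs_square_le_1)
  then have "y * (rayleigh_quantile d b)\<^sup>2 \<le> y * 1" using y by (intro mult_left_mono) auto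
  then show ?thesis using y by (simp add: power_mult_distrib)
qed

lemma resample_bound:
  assumes F: "\<And>g. g\<^sup>2 \<le> y \<Longrightarrow> \<bar>F g\<bar> \<le> B" and y: "0 \<le> y"
  shows "\<bar>resample d F y\<bar> \<le> B"
proof (cases "integrable rayleigh (\<lambda>b. F (- (sqrt y * rayleigh_quantile d b)))")
  case True
  have "\<bar>resample d F y\<bar> \<le> (\<integral>b. \<bar>F (- (sqrt y * rayleigh_quantile d b))\<bar> \<partial>rayleigh)"
    unfolding resample_def by (rule integral_abs_bound)
  also have "\<dots> \<le> (\<integral>b. B \<partial>rayleigh)"
    using True F[OF post_jump_sq_le[OF y]] by (intro integral_mono integrable_abs) auto
  finally show ?thesis using rayleigh.prob_space by simp
next
  case False
  \<comment> \<open>The integral of a nonintegrable function is 0 by convention, and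
    \<open>B\<close> is nonnegative by the bound at 0.\<close>
  then show ?thesis using F[of 0] y unfolding resample_def by (simp add: not_integrable_integral_eq)
qed

text \<open>\<open>D\<close> is the derivative of \<open>\<Psi>\<close> along the flow, so that the generator maps \<open>\<Psi>\<close> to \<open>D\<close> plus the jump part.\<close>

context
  fixes \<Psi> D :: "real \<Rightarrow> real \<Rightarrow> real \<Rightarrow> real \<Rightarrow> real" and C :: real and k :: nat and t :: real
  assumes t: "0 \<le> t"
    and \<Psi>_measurable: "(\<lambda>p. \<Psi> (fst p) (fst (snd p)) (fst (snd (snd p))) (snd (snd (snd p)))) \<in> borel_measurable (borel \<Otimes>\<^sub>M borel \<Otimes>\<^sub>M borel \<Otimes>\<^sub>M borel)"
    and D_measurable: "(\<lambda>p. D (fst p) (fst (snd p)) (fst (snd (snd p))) (snd (snd (snd p)))) \<in> borel_measurable (borel \<Otimes>\<^sub>M borel \<Otimes>\<^sub>M borel \<Otimes>\<^sub>M borel)"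
    and \<Psi>_bound: "\<And>s x y g. 0 \<le> s \<Longrightarrow> s \<le> t \<Longrightarrow> g\<^sup>2 \<le> y \<Longrightarrow> \<bar>\<Psi> s x y g\<bar> \<le> C * (1 + x\<^sup>2) * (1 + y) ^ k"
    and D_bound: "\<And>s x y g. 0 \<le> s \<Longrightarrow> s \<le> t \<Longrightarrow> g\<^sup>2 \<le> y \<Longrightarrow> \<bar>D s x y g\<bar> \<le> C * (1 + x\<^sup>2) * (1 + y) ^ k"
    and \<Psi>_deriv: "\<And>s x y g u. ((\<lambda>u. \<Psi> (s + u) (x + I y g u) (y + 2 * g * u + u\<^sup>2) (g + u)) has_real_derivative
        D (s + u) (x + I y g u) (y + 2 * g * u + u\<^sup>2) (g + u)) (at u)"
    and D_cont: "\<And>s x y g u. isCont (\<lambda>u. D (s + u) (x + I y g u) (y + 2 * g * u + u\<^sup>2) (g + u)) u"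
begin

lemma \<Psi>_measurable' [measurable]:
  "f \<in> borel_measurable N \<Longrightarrow> g \<in> borel_measurable N \<Longrightarrow> h \<in> borel_measurable N \<Longrightarrow> l \<in> borel_measurable N \<Longrightarrow>
    (\<lambda>x. \<Psi> (f x) (g x) (h x) (l x)) \<in> borel_measurable N"
  using measurable_compose[OF measurable_Pair[OF _ measurable_Pair[OF _ measurable_Pair]] \<Psi>_measurable, of f N g h l] by simp

lemma D_measurable' [measurable]:
  "f \<in> borel_measurable N \<Longrightarrow> g \<in> borel_measurable N \<Longrightarrow> h \<in> borel_measurable N \<Longrightarrow> l \<in> borel_measurable N \<Longrightarrow>
    (\<lambda>x. D (f x) (g x) (h x) (l x)) \<in> borel_measurable N"
  using measurable_compose[OF measurable_Pair[OF _ measurable_Pair[OF _ measurable_Pair]] D_measurable, of f N g h l] by simp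

lemma R_measurable [measurable]:
  assumes [measurable]: "f \<in> borel_measurable N" "g \<in> borel_measurable N" "h \<in> borel_measurable N"
  shows "(\<lambda>x. resample d (\<Psi> (f x) (g x) (h x)) (h x)) \<in> borel_measurable N"
  by (rule resample_measurable) measurable

text \<open>The polynomial growth bound with the functional and the squared radius replaced by their
  pathwise bounds up to time \<open>t\<close>. It is a polynomial in \<open>W t\<close>, hence
  integrable, and dominates all terms below.\<close>

definition B :: "'a \<Rightarrow> real" where "B \<omega> = C * (1 + (t * Ca * W t \<omega> ^ ka)\<^sup>2) * W t \<omega> ^ k"

lemma C_nonneg: "0 \<le> C"
  using \<Psi>_bound[of 0 0 0 0] t by simp

lemma integrable_W_B: "integrable M (\<lambda>\<omega>. W t \<omega> * B \<omega>)" "integrable M B"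
proof -
  have 1: "W t \<omega> * B \<omega> = C * W t \<omega> ^ (k + 1) + C * (t * Ca)\<^sup>2 * W t \<omega> ^ (2 * ka + k + 1)" for \<omega>
    by (simp add: B_def power_add power_mult power2_eq_square algebra_simps)
  show "integrable M (\<lambda>\<omega>. W t \<omega> * B \<omega>)"
    unfolding 1 by (intro Bochner_Integration.integrable_add integrable_mult_right integrable_W_power)
  have 2: "B \<omega> = C * W t \<omega> ^ k + C * (t * Ca)\<^sup>2 * W t \<omega> ^ (2 * ka + k)" for \<omega>
    by (simp add: B_def power_add power_mult power2_eq_square algebra_simps)
  have "B = (\<lambda>\<omega>. C * W t \<omega> ^ k + C * (t * Ca)\<^sup>2 * W t \<omega> ^ (2 * ka + k))" using 2 by auto
  then show "integrable M B"
    by (simp only:) (intro Bochner_Integration.integrable_add integrable_mult_right integrable_W_power)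
qed

lemma B_bound:
  assumes "good \<omega>" "0 \<le> s" "s \<le> t" and F: "\<And>g. g\<^sup>2 \<le> Yt s \<omega> \<Longrightarrow> \<bar>F g\<bar> \<le> C * (1 + (A s \<omega>)\<^sup>2) * (1 + Yt s \<omega>) ^ k"
    and g: "g\<^sup>2 \<le> Yt s \<omega>"
  shows "\<bar>F g\<bar> \<le> B \<omega>"
proof -
  have "\<bar>A s \<omega>\<bar> \<le> \<bar>t * Ca * W t \<omega> ^ ka\<bar>" using A_bound[OF assms(1-3)] by linarith
  then have "(A s \<omega>)\<^sup>2 \<le> (t * Ca * W t \<omega> ^ ka)\<^sup>2" by (simp only: abs_le_square_iff)
  then have "C * (1 + (A s \<omega>)\<^sup>2) * (1 + Yt s \<omega>) ^ k \<le> B \<omega>"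
    unfolding B_def using one_plus_Yt_le[OF assms(1-3)] Yt_nonneg C_nonneg
    by (intro mult_mono power_mono mult_left_mono) (auto simp: W_def add_nonneg_nonneg)
  then show ?thesis using F[OF g] by linarith
qed

lemma B_nonneg: "0 \<le> B \<omega>" using C_nonneg W_ge_1[of t \<omega>] by (auto simp: B_def intro!: mult_nonneg_nonneg add_nonneg_nonneg)

lemma \<Psi>_path_bound: "good \<omega> \<Longrightarrow> 0 \<le> s \<Longrightarrow> s \<le> t \<Longrightarrow> g\<^sup>2 \<le> Yt s \<omega> \<Longrightarrow> \<bar>\<Psi> s (A s \<omega>) (Yt s \<omega>) g\<bar> \<le> B \<omega>"
  by (rule B_bound) (auto intro: \<Psi>_bound)

lemma D_path_bound: "good \<omega> \<Longrightarrow> 0 \<le> s \<Longrightarrow> s \<le> t \<Longrightarrow> g\<^sup>2 \<le> Yt s \<omega> \<Longrightarrow> \<bar>D s (A s \<omega>) (Yt s \<omega>) g\<bar> \<le> B \<omega>"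
  by (rule B_bound) (auto intro: D_bound)

lemma resample_path_bound: "good \<omega> \<Longrightarrow> 0 \<le> s \<Longrightarrow> s \<le> t \<Longrightarrow> \<bar>resample d (\<Psi> s (A s \<omega>) (Yt s \<omega>)) (Yt s \<omega>)\<bar> \<le> B \<omega>"
  by (rule resample_bound) (auto intro: \<Psi>_path_bound Yt_nonneg)

text \<open>The jump part of the generator applied to \<open>\<Psi>\<close>, along the path: the
  rate of change in mean that the jumps cause.\<close>

definition J :: "real \<Rightarrow> 'a \<Rightarrow> real" where
  "J s \<omega> = max (Gt s \<omega>) 0 * (resample d (\<Psi> s (A s \<omega>) (Yt s \<omega>)) (Yt s \<omega>) - \<Psi> s (A s \<omega>) (Yt s \<omega>) (Gt s \<omega>))"

definition Dp :: "real \<Rightarrow> 'a \<Rightarrow> real" where "Dp s \<omega> = D s (A s \<omega>) (Yt s \<omega>) (Gt s \<omega>)"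

lemma J_measurable [measurable]:
  assumes [measurable]: "f \<in> borel_measurable N" "g \<in> N \<rightarrow>\<^sub>M M"
  shows "(\<lambda>x. J (f x) (g x)) \<in> borel_measurable N" "(\<lambda>x. Dp (f x) (g x)) \<in> borel_measurable N"
  unfolding J_def Dp_def by measurable

lemma max_Gt_le: "good \<omega> \<Longrightarrow> 0 \<le> s \<Longrightarrow> s \<le> t \<Longrightarrow> max (Gt s \<omega>) 0 \<le> W t \<omega>"
proof -
  assume a: "good \<omega>" "0 \<le> s" "s \<le> t"
  have "0 \<le> (Gt s \<omega> - 1)\<^sup>2" by simp
  then have "2 * Gt s \<omega> \<le> 1 + (Gt s \<omega>)\<^sup>2" by (simp only: power2_diff) simp
  then have "2 * Gt s \<omega> \<le> 1 + Yt s \<omega>" using Gt_sq_le[OF good_space[OF a(1)], of s] by linarith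
  then show ?thesis using one_plus_Yt_le[OF a] Yt_nonneg[of s \<omega>] by (auto simp: W_def)
qed

lemma J_bound: "good \<omega> \<Longrightarrow> 0 \<le> s \<Longrightarrow> s \<le> t \<Longrightarrow> \<bar>J s \<omega>\<bar> \<le> 2 * (W t \<omega> * B \<omega>)"
proof -
  assume a: "good \<omega>" "0 \<le> s" "s \<le> t"
  have "\<bar>J s \<omega>\<bar> \<le> W t \<omega> * (B \<omega> + B \<omega>)"
    unfolding J_def abs_mult
    using max_Gt_le[OF a] resample_path_bound[OF a] \<Psi>_path_bound[OF a Gt_sq_le[OF good_space[OF a(1)]]] W_ge_1[of t \<omega>]
    by (intro mult_mono abs_triangle_ineq4[THEN order_trans] add_mono) auto
  then show ?thesis by simp
qed

text \<open>The last factor of the density turns the law of the waiting time into the compensator of the jump.\<close>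

lemma jump_increment:
  "integrable M (\<lambda>\<omega>. indicator {..t} (\<tau> (Suc n) \<omega>) * (\<Psi> (\<tau> (Suc n) \<omega>) (A (\<tau> (Suc n) \<omega>) \<omega>) (Yj (Suc n) \<omega>) (Gj (Suc n) \<omega>)
     - \<Psi> (\<tau> (Suc n) \<omega>) (A (\<tau> (Suc n) \<omega>) \<omega>) (Yj (Suc n) \<omega>) (Gj n \<omega> + \<delta> n \<omega>)))" (is ?I)
  "(\<integral>\<omega>. indicator {..t} (\<tau> (Suc n) \<omega>) * (\<Psi> (\<tau> (Suc n) \<omega>) (A (\<tau> (Suc n) \<omega>) \<omega>) (Yj (Suc n) \<omega>) (Gj (Suc n) \<omega>)
     - \<Psi> (\<tau> (Suc n) \<omega>) (A (\<tau> (Suc n) \<omega>) \<omega>) (Yj (Suc n) \<omega>) (Gj n \<omega> + \<delta> n \<omega>)) \<partial>M)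
   = (\<integral>\<omega>. (\<integral>s. indicator {\<tau> n \<omega><..<\<tau> (Suc n) \<omega>} s * (indicator {0..t} s * J s \<omega>) \<partial>lborel) \<partial>M)" (is ?E)
proof -
  interpret PR: pair_sigma_finite M rayleigh ..
  interpret PL: pair_sigma_finite M lborel ..
  let ?T = "history_space d n \<Otimes>\<^sub>M (borel :: real measure)"
  \<comment> \<open>Both integrands are rewritten in terms of the history and the time (and, for
    \<open>post\<close>, the new radial velocity), the variables whose joint laws are known from
    \<open>law_jump\<close> and \<open>law_waiting\<close>.\<close>
  define post where "post = (\<lambda>p :: ((nat \<Rightarrow> real \<times> rvec \<times> rvec) \<times> real) \<times> real.
    let h = fst (fst p); u = snd (fst p) - hist_t n h in
    indicator {..t} (snd (fst p)) * \<Psi> (snd (fst p)) (hist_A n h + I (hist_y n h) (hist_g n h) u)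
      (hist_y n h + 2 * hist_g n h * u + u\<^sup>2) (snd p))"
  define pre where "pre = (\<lambda>p :: (nat \<Rightarrow> real \<times> rvec \<times> rvec) \<times> real.
    let h = fst p; u = snd p; s = hist_t n h + u; x = hist_A n h + I (hist_y n h) (hist_g n h) u;
      y = hist_y n h + 2 * hist_g n h * u + u\<^sup>2 in
    indicator {..t} s * (resample d (\<Psi> s x y) y - \<Psi> s x y (hist_g n h + u)))"
  have hm[measurable]: "hist_t n \<in> borel_measurable (history_space d n)" "hist_y n \<in> borel_measurable (history_space d n)"
    "hist_g n \<in> borel_measurable (history_space d n)" by (rule hist_measurable; simp)+
  have post_m[measurable]: "post \<in> borel_measurable (?T \<Otimes>\<^sub>M borel)"
    unfolding post_def Let_def by measurable
  have pre_m[measurable]: "pre \<in> borel_measurable ?T"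
    unfolding pre_def Let_def by measurable
  have good_Suc: "A (\<tau> (Suc n) \<omega>) \<omega> = A (\<tau> n \<omega>) \<omega> + I (Yj n \<omega>) (Gj n \<omega>) (\<delta> n \<omega>)"
    "Yj (Suc n) \<omega> = Yj n \<omega> + 2 * Gj n \<omega> * \<delta> n \<omega> + (\<delta> n \<omega>)\<^sup>2" if "good \<omega>" for \<omega>
    using A_increment[OF that, of n "\<tau> (Suc n) \<omega>"] good_Y[OF that, of n "\<tau> (Suc n) \<omega>"]
      YGt_\<tau>[OF good_space[OF that]] \<tau>_mono[OF good_space[OF that], of n "Suc n"] by auto
  have post_eq: "post ((H n \<omega>, \<tau> (Suc n) \<omega>), g) = indicator {..t} (\<tau> (Suc n) \<omega>) * \<Psi> (\<tau> (Suc n) \<omega>) (A (\<tau> (Suc n) \<omega>) \<omega>) (Yj (Suc n) \<omega>) g"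
    if "good \<omega>" for \<omega> g
    unfolding post_def Let_def using good_Suc[OF that] by (simp add: hist_H hist_A_H[OF that])
  have pre_eq: "pre (H n \<omega>, u) = indicator {..t} (\<tau> n \<omega> + u) * (resample d (\<Psi> (\<tau> n \<omega> + u) (A (\<tau> n \<omega> + u) \<omega>) (Yt (\<tau> n \<omega> + u) \<omega>)) (Yt (\<tau> n \<omega> + u) \<omega>)
      - \<Psi> (\<tau> n \<omega> + u) (A (\<tau> n \<omega> + u) \<omega>) (Yt (\<tau> n \<omega> + u) \<omega>) (Gj n \<omega> + u))" if "good \<omega>" "0 \<le> u" "u \<le> \<delta> n \<omega>" for \<omega> u
    unfolding pre_def Let_def using A_increment[OF that(1), of n "\<tau> n \<omega> + u"] good_Y[OF that(1), of n "\<tau> n \<omega> + u"] that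
    by (simp add: hist_H hist_A_H[OF that(1)])
  \<comment> \<open>The radial velocity immediately before the jump, still given by the
    flow.\<close>
  define e where "e \<omega> = Gj n \<omega> + \<delta> n \<omega>" for \<omega>
  have e: "(e \<omega>)\<^sup>2 \<le> Yj (Suc n) \<omega>" if "good \<omega>" for \<omega>
    unfolding good_Suc[OF that] e_def by (rule flow_nonneg[OF G_sq_le[OF \<tau>_nonneg good_space[OF that]]]) (rule good_space[OF that])
  have bd: "indicator {..t} (\<tau> (Suc n) \<omega>) * \<bar>\<Psi> (\<tau> (Suc n) \<omega>) (A (\<tau> (Suc n) \<omega>) \<omega>) (Yj (Suc n) \<omega>) g\<bar> \<le> B \<omega>" if "good \<omega>" "g\<^sup>2 \<le> Yj (Suc n) \<omega>" for \<omega> g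
    using \<Psi>_path_bound[OF that(1), of "\<tau> (Suc n) \<omega>" g] \<tau>_nonneg[OF good_space[OF that(1)]] that B_nonneg[of \<omega>] YGt_\<tau>[OF good_space[OF that(1)]]
    by (auto simp: indicator_def)
  have post_int: "integrable M (\<lambda>\<omega>. indicator {..t} (\<tau> (Suc n) \<omega>) * \<Psi> (\<tau> (Suc n) \<omega>) (A (\<tau> (Suc n) \<omega>) \<omega>) (Yj (Suc n) \<omega>) (G' \<omega>))"
    if [measurable]: "G' \<in> borel_measurable M" and G': "\<And>\<omega>. good \<omega> \<Longrightarrow> (G' \<omega>)\<^sup>2 \<le> Yj (Suc n) \<omega>" for G'
    by (rule Bochner_Integration.integrable_bound[OF integrable_W_B(2)], measurable, rule AE_mp[OF AE_good])
      (use bd G' B_nonneg in \<open>auto simp: abs_mult\<close>)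
  have Gj_le: "(Gj m \<omega>)\<^sup>2 \<le> Yj m \<omega>" if "good \<omega>" for m \<omega>
    by (rule G_sq_le[OF \<tau>_nonneg good_space[OF that]]) (rule good_space[OF that])
  have e_m[measurable]: "e \<in> borel_measurable M" unfolding e_def by measurable
  note int1 = post_int[of "Gj (Suc n)", OF YGj_measurable(2) Gj_le] and int2 = post_int[of e, OF e_m e]
  show ?I
    using Bochner_Integration.integrable_diff[OF int1 int2] by (simp add: e_def right_diff_distrib)
  have int3: "integrable (M \<Otimes>\<^sub>M rayleigh) (\<lambda>p. post ((H n (fst p), \<tau> (Suc n) (fst p)), - (sqrt (Yj (Suc n) (fst p)) * rayleigh_quantile d (snd p))))"
  proof (rule integrable_pair_dominated[OF rayleigh.sigma_finite_measure_axioms _ integrable_W_B(2), where k="\<lambda>_. 1"])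
    show "AE \<omega> in M. \<forall>b. \<bar>post ((H n (fst (\<omega>, b)), \<tau> (Suc n) (fst (\<omega>, b))), - (sqrt (Yj (Suc n) (fst (\<omega>, b))) * rayleigh_quantile d (snd (\<omega>, b))))\<bar> \<le> \<bar>1\<bar> * \<bar>B \<omega>\<bar>"
      using AE_good
    proof eventually_elim
      case (elim \<omega>)
      show ?case
      proof
        fix b
        show "\<bar>post ((H n (fst (\<omega>, b)), \<tau> (Suc n) (fst (\<omega>, b))), - (sqrt (Yj (Suc n) (fst (\<omega>, b))) * rayleigh_quantile d (snd (\<omega>, b))))\<bar> \<le> \<bar>1\<bar> * \<bar>B \<omega>\<bar>"
          using bd[OF elim post_jump_sq_le[OF Y_nonneg], of b] B_nonneg[of \<omega>]
          unfolding fst_conv snd_conv post_eq[OF elim] abs_mult by simp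
      qed
    qed
    show "(\<lambda>p. post ((H n (fst p), \<tau> (Suc n) (fst p)), - (sqrt (Yj (Suc n) (fst p)) * rayleigh_quantile d (snd p)))) \<in> borel_measurable (M \<Otimes>\<^sub>M rayleigh)"
      by measurable
  qed simp
  have "(\<integral>\<omega>. indicator {..t} (\<tau> (Suc n) \<omega>) * \<Psi> (\<tau> (Suc n) \<omega>) (A (\<tau> (Suc n) \<omega>) \<omega>) (Yj (Suc n) \<omega>) (Gj (Suc n) \<omega>) \<partial>M)
    = (\<integral>\<omega>. post ((H n \<omega>, \<tau> (Suc n) \<omega>), Gj (Suc n) \<omega>) \<partial>M)"
    by (rule integral_cong_AE, measurable, rule AE_mp[OF AE_good]) (auto simp: post_eq)
  also have "\<dots> = (\<integral>p. post p \<partial>distr M (?T \<Otimes>\<^sub>M borel) (\<lambda>\<omega>. ((H n \<omega>, \<tau> (Suc n) \<omega>), Gj (Suc n) \<omega>)))"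
    by (subst integral_distr) auto
  also have "\<dots> = (\<integral>p. post ((H n (fst p), \<tau> (Suc n) (fst p)), - (sqrt (Yj (Suc n) (fst p)) * rayleigh_quantile d (snd p))) \<partial>(M \<Otimes>\<^sub>M rayleigh))"
    unfolding law_jump by (subst integral_distr) auto
  also have "\<dots> = (\<integral>\<omega>. \<integral>b. post ((H n \<omega>, \<tau> (Suc n) \<omega>), - (sqrt (Yj (Suc n) \<omega>) * rayleigh_quantile d b)) \<partial>rayleigh \<partial>M)"
    using PR.integral_fst'[OF int3] by simp
  also have "\<dots> = (\<integral>\<omega>. indicator {..t} (\<tau> (Suc n) \<omega>) * resample d (\<Psi> (\<tau> (Suc n) \<omega>) (A (\<tau> (Suc n) \<omega>) \<omega>) (Yj (Suc n) \<omega>)) (Yj (Suc n) \<omega>) \<partial>M)"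
    unfolding resample_def
    by (rule integral_cong_AE, measurable, rule AE_mp[OF AE_good]) (auto simp: post_eq)
  finally have post_E: "(\<integral>\<omega>. indicator {..t} (\<tau> (Suc n) \<omega>) * \<Psi> (\<tau> (Suc n) \<omega>) (A (\<tau> (Suc n) \<omega>) \<omega>) (Yj (Suc n) \<omega>) (Gj (Suc n) \<omega>) \<partial>M) = \<dots>" .
  let ?w = "\<lambda>\<omega> u. max (Gj n \<omega> + u) 0 * indicator {0..<\<delta> n \<omega>} u"
  \<comment> \<open>Before the next jump the flow value \<open>Gj n + u\<close> is the radial
    velocity of the path, so rate times mean change is \<open>J\<close> at time
    \<open>\<tau> n + u\<close>.\<close>
  have shift: "?w \<omega> u * pre (H n \<omega>, u) = indicator {0..<\<delta> n \<omega>} u * (indicator {0..t} (\<tau> n \<omega> + u) * J (\<tau> n \<omega> + u) \<omega>)"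
    if "good \<omega>" for \<omega> u
    using pre_eq[OF that, of u] good_G[OF that, of n "\<tau> n \<omega> + u"] \<tau>_nonneg[OF good_space[OF that], of n]
    by (auto simp: indicator_def J_def)
  have int4: "integrable (M \<Otimes>\<^sub>M lborel) (\<lambda>p. ?w (fst p) (snd p) * pre (H n (fst p), snd p))"
  proof (rule integrable_pair_dominated[OF _ _ integrable_W_B(1), where k="\<lambda>u. 2 * indicator {0..t} u"])
    show "AE \<omega> in M. \<forall>u. \<bar>?w (fst (\<omega>, u)) (snd (\<omega>, u)) * pre (H n (fst (\<omega>, u)), snd (\<omega>, u))\<bar> \<le> \<bar>2 * indicator {0..t} u\<bar> * \<bar>W t \<omega> * B \<omega>\<bar>"
      using AE_good
    proof eventually_elim
      case (elim \<omega>)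
      have "0 \<le> \<tau> n \<omega>" by (rule \<tau>_nonneg[OF good_space[OF elim]])
      then show ?case
        using J_bound[OF elim] W_ge_1[of t \<omega>] B_nonneg[of \<omega>] unfolding fst_conv snd_conv shift[OF elim]
        by (auto simp: indicator_def abs_mult)
    qed
    show "(\<lambda>p. ?w (fst p) (snd p) * pre (H n (fst p), snd p)) \<in> borel_measurable (M \<Otimes>\<^sub>M lborel)"
      by measurable
  qed (simp_all add: lborel.sigma_finite_measure_axioms)
  have "(\<integral>\<omega>. indicator {..t} (\<tau> (Suc n) \<omega>) * (resample d (\<Psi> (\<tau> (Suc n) \<omega>) (A (\<tau> (Suc n) \<omega>) \<omega>) (Yj (Suc n) \<omega>)) (Yj (Suc n) \<omega>)
      - \<Psi> (\<tau> (Suc n) \<omega>) (A (\<tau> (Suc n) \<omega>) \<omega>) (Yj (Suc n) \<omega>) (e \<omega>)) \<partial>M) = (\<integral>\<omega>. pre (H n \<omega>, \<delta> n \<omega>) \<partial>M)"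
  proof (rule integral_cong_AE)
    show "AE \<omega> in M. indicator {..t} (\<tau> (Suc n) \<omega>) * (resample d (\<Psi> (\<tau> (Suc n) \<omega>) (A (\<tau> (Suc n) \<omega>) \<omega>) (Yj (Suc n) \<omega>)) (Yj (Suc n) \<omega>)
      - \<Psi> (\<tau> (Suc n) \<omega>) (A (\<tau> (Suc n) \<omega>) \<omega>) (Yj (Suc n) \<omega>) (e \<omega>)) = pre (H n \<omega>, \<delta> n \<omega>)"
      using AE_good
    proof eventually_elim
      case (elim \<omega>)
      have "0 \<le> \<delta> n \<omega>" using \<delta>_pos[OF good_space[OF elim], of n] by simp
      from pre_eq[OF elim this order_refl] show ?case
        using YGt_\<tau>(1)[OF good_space[OF elim], of "Suc n"] by (simp add: e_def)
    qed
  qed measurable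
  also have "\<dots> = (\<integral>p. pre p \<partial>distr M ?T (\<lambda>\<omega>. (H n \<omega>, \<delta> n \<omega>)))"
    by (subst integral_distr) auto
  also have "\<dots> = (\<integral>p. ?w (fst p) (snd p) * pre (H n (fst p), snd p) \<partial>(M \<Otimes>\<^sub>M lborel))"
    unfolding law_waiting by (subst integral_distr, measurable, subst integral_density) auto
  also have "\<dots> = (\<integral>\<omega>. \<integral>u. ?w \<omega> u * pre (H n \<omega>, u) \<partial>lborel \<partial>M)"
    using PL.integral_fst'[OF int4] by simp
  also have "\<dots> = (\<integral>\<omega>. (\<integral>s. indicator {\<tau> n \<omega><..<\<tau> (Suc n) \<omega>} s * (indicator {0..t} s * J s \<omega>) \<partial>lborel) \<partial>M)"
  proof (rule integral_cong_AE)
    show "AE \<omega> in M. (\<integral>u. ?w \<omega> u * pre (H n \<omega>, u) \<partial>lborel) = (\<integral>s. indicator {\<tau> n \<omega><..<\<tau> (Suc n) \<omega>} s * (indicator {0..t} s * J s \<omega>) \<partial>lborel)"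
      using AE_good
    proof eventually_elim
      case (elim \<omega>)
      have \<omega>[measurable]: "\<omega> \<in> space M" by (rule good_space[OF elim])
      have "(\<integral>s. indicator {\<tau> n \<omega><..<\<tau> n \<omega> + \<delta> n \<omega>} s * (indicator {0..t} s * J s \<omega>) \<partial>lborel)
        = (\<integral>u. (indicator {0..t} (\<tau> n \<omega> + u) * J (\<tau> n \<omega> + u) \<omega>) * indicator {0..\<delta> n \<omega>} u \<partial>lborel)"
        using less_imp_le[OF \<delta>_pos[OF \<omega>], of n] by (intro path_integral_shift) auto
      also have "\<dots> = (\<integral>u. ?w \<omega> u * pre (H n \<omega>, u) \<partial>lborel)"
        unfolding shift[OF elim]
        by (rule integral_cong_AE, measurable, rule AE_mp[OF AE_lborel_singleton[of "\<delta> n \<omega>"]]) (auto simp: indicator_def)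
      finally show ?case by simp
    qed
    show "(\<lambda>\<omega>. \<integral>u. ?w \<omega> u * pre (H n \<omega>, u) \<partial>lborel) \<in> borel_measurable M"
      by (rule lborel.borel_measurable_lebesgue_integral) (simp add: split_def)
    have [measurable]: "(\<lambda>p. indicator {\<tau> n (fst p)<..<\<tau> (Suc n) (fst p)} (snd p) :: real) \<in> borel_measurable (M \<Otimes>\<^sub>M lborel)"
      unfolding indicator_def greaterThanLessThan_iff by measurable
    show "(\<lambda>\<omega>. \<integral>s. indicator {\<tau> n \<omega><..<\<tau> (Suc n) \<omega>} s * (indicator {0..t} s * J s \<omega>) \<partial>lborel) \<in> borel_measurable M"
      by (rule lborel.borel_measurable_lebesgue_integral) (simp add: split_def)
  qed
  finally have pre_E: "(\<integral>\<omega>. indicator {..t} (\<tau> (Suc n) \<omega>) * (resample d (\<Psi> (\<tau> (Suc n) \<omega>) (A (\<tau> (Suc n) \<omega>) \<omega>) (Yj (Suc n) \<omega>)) (Yj (Suc n) \<omega>)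
      - \<Psi> (\<tau> (Suc n) \<omega>) (A (\<tau> (Suc n) \<omega>) \<omega>) (Yj (Suc n) \<omega>) (e \<omega>)) \<partial>M) = \<dots>" .
  have int5: "integrable M (\<lambda>\<omega>. indicator {..t} (\<tau> (Suc n) \<omega>) * resample d (\<Psi> (\<tau> (Suc n) \<omega>) (A (\<tau> (Suc n) \<omega>) \<omega>) (Yj (Suc n) \<omega>)) (Yj (Suc n) \<omega>))"
  proof (rule Bochner_Integration.integrable_bound[OF integrable_W_B(2)])
    show "AE \<omega> in M. norm (indicator {..t} (\<tau> (Suc n) \<omega>) * resample d (\<Psi> (\<tau> (Suc n) \<omega>) (A (\<tau> (Suc n) \<omega>) \<omega>) (Yj (Suc n) \<omega>)) (Yj (Suc n) \<omega>)) \<le> norm (B \<omega>)"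
      using AE_good
    proof eventually_elim
      case (elim \<omega>)
      show ?case
        using resample_path_bound[OF elim \<tau>_nonneg[OF good_space[OF elim]], of "Suc n"] YGt_\<tau>[OF good_space[OF elim]] B_nonneg[of \<omega>]
        by (auto simp: indicator_def)
    qed
  qed measurable
  \<comment> \<open>The law of the jump replaces the post-jump value by its resampled mean; the law
    of the waiting time then turns the mean change at the jump into the time integral of
    \<open>J\<close>.\<close>
  have "(\<integral>\<omega>. indicator {..t} (\<tau> (Suc n) \<omega>) * (\<Psi> (\<tau> (Suc n) \<omega>) (A (\<tau> (Suc n) \<omega>) \<omega>) (Yj (Suc n) \<omega>) (Gj (Suc n) \<omega>)
     - \<Psi> (\<tau> (Suc n) \<omega>) (A (\<tau> (Suc n) \<omega>) \<omega>) (Yj (Suc n) \<omega>) (e \<omega>)) \<partial>M)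
    = (\<integral>\<omega>. indicator {..t} (\<tau> (Suc n) \<omega>) * (resample d (\<Psi> (\<tau> (Suc n) \<omega>) (A (\<tau> (Suc n) \<omega>) \<omega>) (Yj (Suc n) \<omega>)) (Yj (Suc n) \<omega>)
      - \<Psi> (\<tau> (Suc n) \<omega>) (A (\<tau> (Suc n) \<omega>) \<omega>) (Yj (Suc n) \<omega>) (e \<omega>)) \<partial>M)"
    unfolding right_diff_distrib
    by (simp only: Bochner_Integration.integral_diff[OF int1 int2] Bochner_Integration.integral_diff[OF int5 int2] post_E)
  from trans[OF this pre_E] show ?E unfolding e_def .
qed

text \<open>\<open>\<Psi>\<close> along the path stopped at the \<open>n\<close>-th jump or at
  \<open>t\<close>, whichever comes first.\<close>

definition Ps :: "nat \<Rightarrow> 'a \<Rightarrow> real" where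
  "Ps n \<omega> = \<Psi> (min t (\<tau> n \<omega>)) (A (min t (\<tau> n \<omega>)) \<omega>) (Yt (min t (\<tau> n \<omega>)) \<omega>) (Gt (min t (\<tau> n \<omega>)) \<omega>)"

lemma Ps_measurable [measurable]: "Ps n \<in> borel_measurable M"
  unfolding Ps_def by measurable

lemma Dp_bound: "good \<omega> \<Longrightarrow> 0 \<le> s \<Longrightarrow> s \<le> t \<Longrightarrow> \<bar>Dp s \<omega>\<bar> \<le> W t \<omega> * B \<omega>"
proof -
  assume a: "good \<omega>" "0 \<le> s" "s \<le> t"
  have "\<bar>Dp s \<omega>\<bar> \<le> B \<omega>"
    unfolding Dp_def using D_path_bound[OF a Gt_sq_le[OF good_space[OF a(1)]]] .
  also have "\<dots> \<le> W t \<omega> * B \<omega>"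
    using mult_right_mono[OF W_ge_1[of t \<omega>] B_nonneg[of \<omega>]] by simp
  finally show ?thesis .
qed

text \<open>Up to the next jump or \<open>t\<close> the fundamental theorem gives the integral of
  \<open>D\<close>; a jump term is added exactly when the next jump happens by time
  \<open>t\<close>. If the current jump time is already past \<open>t\<close>, all terms
  vanish.\<close>

lemma path_increment:
  assumes "good \<omega>"
  shows "Ps (Suc n) \<omega> - Ps n \<omega> = (\<integral>s. indicator {\<tau> n \<omega><..<\<tau> (Suc n) \<omega>} s * (indicator {0..t} s * Dp s \<omega>) \<partial>lborel)
    + indicator {..t} (\<tau> (Suc n) \<omega>) * (\<Psi> (\<tau> (Suc n) \<omega>) (A (\<tau> (Suc n) \<omega>) \<omega>) (Yj (Suc n) \<omega>) (Gj (Suc n) \<omega>)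
     - \<Psi> (\<tau> (Suc n) \<omega>) (A (\<tau> (Suc n) \<omega>) \<omega>) (Yj (Suc n) \<omega>) (Gj n \<omega> + \<delta> n \<omega>))"
proof -
  have \<omega>[measurable]: "\<omega> \<in> space M" using assms by (rule good_space)
  have \<delta>: "0 < \<delta> n \<omega>" by (rule \<delta>_pos[OF \<omega>])
  have \<tau>0: "0 \<le> \<tau> n \<omega>" by (rule \<tau>_nonneg[OF \<omega>])
  show ?thesis
  proof (cases "\<tau> n \<omega> < t")
    case False
    have "(\<integral>s. indicator {\<tau> n \<omega><..<\<tau> (Suc n) \<omega>} s * (indicator {0..t} s * Dp s \<omega>) \<partial>lborel) = 0"
      using False by (intro integral_eq_zero_AE AE_I2) (auto simp: indicator_def)
    moreover have "min t (\<tau> n \<omega>) = t" "min t (\<tau> (Suc n) \<omega>) = t" using False \<delta> by auto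
    ultimately show ?thesis using False \<delta> by (simp add: Ps_def indicator_def)
  next
    case True
    \<comment> \<open>Length of the piece of flight between the two stopped times.\<close>
    define e where "e = min t (\<tau> (Suc n) \<omega>) - \<tau> n \<omega>"
    have e: "0 < e" "e \<le> \<delta> n \<omega>" "\<tau> n \<omega> + e \<le> t" "\<tau> n \<omega> + e = min t (\<tau> (Suc n) \<omega>)" using True \<delta> by (auto simp: e_def)
    let ?D = "\<lambda>u. D (\<tau> n \<omega> + u) (A (\<tau> n \<omega>) \<omega> + I (Yj n \<omega>) (Gj n \<omega>) u) (Yj n \<omega> + 2 * Gj n \<omega> * u + u\<^sup>2) (Gj n \<omega> + u)"
    let ?P = "\<lambda>u. \<Psi> (\<tau> n \<omega> + u) (A (\<tau> n \<omega>) \<omega> + I (Yj n \<omega>) (Gj n \<omega>) u) (Yj n \<omega> + 2 * Gj n \<omega> * u + u\<^sup>2) (Gj n \<omega> + u)"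
    have AY: "A (\<tau> n \<omega> + u) \<omega> = A (\<tau> n \<omega>) \<omega> + I (Yj n \<omega>) (Gj n \<omega>) u"
      "Yt (\<tau> n \<omega> + u) \<omega> = Yj n \<omega> + 2 * Gj n \<omega> * u + u\<^sup>2" if "0 \<le> u" "u \<le> \<delta> n \<omega>" for u
      using that A_increment[OF assms, of n "\<tau> n \<omega> + u"] good_Y[OF assms, of n "\<tau> n \<omega> + u"] by simp_all
    have "(\<integral>s. indicator {\<tau> n \<omega><..<\<tau> (Suc n) \<omega>} s * (indicator {0..t} s * Dp s \<omega>) \<partial>lborel)
      = (\<integral>s. indicator {\<tau> n \<omega><..<\<tau> n \<omega> + e} s * Dp s \<omega> \<partial>lborel)"
      by (rule integral_cong_AE, measurable, rule AE_mp[OF AE_lborel_singleton[of t]])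
        (use \<tau>0 in \<open>auto simp: e(4) indicator_def\<close>)
    also have "\<dots> = (\<integral>u. ?D u * indicator {0..e} u \<partial>lborel)"
    proof (rule path_integral_shift)
      show "Dp (\<tau> n \<omega> + u) \<omega> = ?D u" if "0 < u" "u < e" for u
        using AY[of u] that e good_G[OF assms, of n "\<tau> n \<omega> + u"] by (simp add: Dp_def)
    qed (use e in auto)
    also have "\<dots> = ?P e - ?P 0"
      using e by (intro integral_FTC_Icc_real \<Psi>_deriv D_cont) auto
    also have "?P 0 = Ps n \<omega>"
      using True YGt_\<tau>[OF \<omega>, of n] by (simp add: Ps_def I_0)
    also have "?P e = \<Psi> (min t (\<tau> (Suc n) \<omega>)) (A (min t (\<tau> (Suc n) \<omega>)) \<omega>) (Yt (min t (\<tau> (Suc n) \<omega>)) \<omega>) (Gj n \<omega> + e)"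
      using AY[of e] e by simp
    finally have *: "(\<integral>s. indicator {\<tau> n \<omega><..<\<tau> (Suc n) \<omega>} s * (indicator {0..t} s * Dp s \<omega>) \<partial>lborel) =
        \<Psi> (min t (\<tau> (Suc n) \<omega>)) (A (min t (\<tau> (Suc n) \<omega>)) \<omega>) (Yt (min t (\<tau> (Suc n) \<omega>)) \<omega>) (Gj n \<omega> + e) - Ps n \<omega>" .
    show ?thesis
    proof (cases "\<tau> (Suc n) \<omega> \<le> t")
      case True
      then have "min t (\<tau> (Suc n) \<omega>) = \<tau> (Suc n) \<omega>" "e = \<delta> n \<omega>" by (auto simp: e_def)
      then show ?thesis using True YGt_\<tau>[OF \<omega>, of "Suc n"] unfolding * by (simp add: Ps_def)
    next
      case False
      then have "min t (\<tau> (Suc n) \<omega>) = t" "e = t - \<tau> n \<omega>" by (auto simp: e_def)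
      then show ?thesis using False True good_G[OF assms, of n t] unfolding * by (simp add: Ps_def)
    qed
  qed
qed

definition L :: "real \<Rightarrow> 'a \<Rightarrow> real" where "L s \<omega> = indicator {0..t} s * (Dp s \<omega> + J s \<omega>)"

lemma L_measurable [measurable]:
  assumes [measurable]: "f \<in> borel_measurable N" "g \<in> N \<rightarrow>\<^sub>M M"
  shows "(\<lambda>x. L (f x) (g x)) \<in> borel_measurable N"
  unfolding L_def by measurable

lemma L_bound: "good \<omega> \<Longrightarrow> \<bar>L s \<omega>\<bar> \<le> 3 * indicator {0..t} s * (W t \<omega> * B \<omega>)"
  using Dp_bound[of \<omega> s] J_bound[of \<omega> s] by (auto simp: L_def indicator_def)

lemma W_B_nonneg: "0 \<le> W t \<omega> * B \<omega>"
  using W_ge_1[of t \<omega>] B_nonneg[of \<omega>] by (intro mult_nonneg_nonneg) auto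

lemma L_pair_integrable: "integrable (M \<Otimes>\<^sub>M lborel) (\<lambda>p. L (snd p) (fst p))"
proof (rule integrable_pair_dominated[OF lborel.sigma_finite_measure_axioms _ integrable_W_B(1), where k="\<lambda>s. 3 * indicator {0..t} s"])
  show "AE \<omega> in M. \<forall>s. \<bar>L (snd (\<omega>, s)) (fst (\<omega>, s))\<bar> \<le> \<bar>3 * indicator {0..t} s\<bar> * \<bar>W t \<omega> * B \<omega>\<bar>"
    using AE_good
  proof eventually_elim
    case (elim \<omega>)
    show ?case using L_bound[OF elim] W_B_nonneg[of \<omega>] by (simp add: abs_mult[of 3])
  qed
  show "(\<lambda>p. L (snd p) (fst p)) \<in> borel_measurable (M \<Otimes>\<^sub>M lborel)" by measurable
qed simp

lemma L_path_integrable: "good \<omega> \<Longrightarrow> integrable lborel (\<lambda>s. L s \<omega>)"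
proof -
  assume g: "good \<omega>"
  note [measurable] = good_space[OF g]
  show ?thesis
    by (rule integrable_Icc_bounded[where t=t and K="3 * (W t \<omega> * B \<omega>)"], measurable)
      (use L_bound[OF g] in \<open>simp add: mult_ac\<close>)
qed

lemma path_integral_bounded:
  assumes "good \<omega>" "S \<in> sets borel"
  shows "\<bar>\<integral>s. indicator S s * L s \<omega> \<partial>lborel\<bar> \<le> t * (3 * (W t \<omega> * B \<omega>))"
proof -
  have "\<bar>\<integral>s. indicator S s * L s \<omega> \<partial>lborel\<bar> \<le> (\<integral>s. \<bar>indicator S s * L s \<omega>\<bar> \<partial>lborel)"
    by (rule integral_abs_bound)
  also have "\<dots> \<le> (\<integral>s. indicator {0..t} s * (3 * (W t \<omega> * B \<omega>)) \<partial>lborel)"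
  proof (rule integral_mono)
    show "integrable lborel (\<lambda>s. \<bar>indicator S s * L s \<omega>\<bar>)"
      using integrable_mult_indicator[of S lborel "\<lambda>s. L s \<omega>"] L_path_integrable[OF assms(1)] assms(2)
      by (intro integrable_abs) simp
    show "\<bar>indicator S s * L s \<omega>\<bar> \<le> indicator {0..t} s * (3 * (W t \<omega> * B \<omega>))" for s
      using L_bound[OF assms(1), of s] W_B_nonneg[of \<omega>] by (auto simp: indicator_def split: if_splits)
  qed simp
  also have "\<dots> = t * (3 * (W t \<omega> * B \<omega>))" using t by simp
  finally show ?thesis .
qed

lemma Ps_bound: "good \<omega> \<Longrightarrow> \<bar>Ps n \<omega>\<bar> \<le> B \<omega>"
  unfolding Ps_def using t \<tau>_nonneg[OF good_space, of \<omega> n]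
  by (intro \<Psi>_path_bound Gt_sq_le good_space) auto

lemma Ps_integrable: "integrable M (Ps n)"
  by (rule Bochner_Integration.integrable_bound[OF integrable_W_B(2)], measurable, rule AE_mp[OF AE_good])
    (use Ps_bound B_nonneg in auto)

definition Q :: "nat \<Rightarrow> 'a \<Rightarrow> real" where "Q n \<omega> = (\<integral>s. indicator {..<\<tau> n \<omega>} s * L s \<omega> \<partial>lborel)"

lemma Q_measurable [measurable]: "Q n \<in> borel_measurable M"
proof -
  have [measurable]: "(\<lambda>p. indicator {..<\<tau> n (fst p)} (snd p) :: real) \<in> borel_measurable (M \<Otimes>\<^sub>M lborel)"
    unfolding indicator_def lessThan_iff by measurable
  show ?thesis unfolding Q_def[abs_def]
    by (rule lborel.borel_measurable_lebesgue_integral) (simp add: split_def)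
qed

lemma Q_integrable: "integrable M (Q n)"
proof (rule Bochner_Integration.integrable_bound)
  show "integrable M (\<lambda>\<omega>. t * (3 * (W t \<omega> * B \<omega>)))" by (intro integrable_mult_right integrable_W_B)
  show "AE \<omega> in M. norm (Q n \<omega>) \<le> norm (t * (3 * (W t \<omega> * B \<omega>)))"
    using AE_good
    by eventually_elim (unfold real_norm_def Q_def, rule order_trans[OF path_integral_bounded abs_ge_self], auto)
qed measurable

lemma Q_increment:
  assumes "good \<omega>"
  shows "Q (Suc n) \<omega> - Q n \<omega> = (\<integral>s. indicator {\<tau> n \<omega><..<\<tau> (Suc n) \<omega>} s * (indicator {0..t} s * Dp s \<omega>) \<partial>lborel)
     + (\<integral>s. indicator {\<tau> n \<omega><..<\<tau> (Suc n) \<omega>} s * (indicator {0..t} s * J s \<omega>) \<partial>lborel)"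
proof -
  have \<omega>[measurable]: "\<omega> \<in> space M" using assms by (rule good_space)
  let ?S = "{\<tau> n \<omega><..<\<tau> (Suc n) \<omega>}"
  have i: "integrable lborel (\<lambda>s. indicator S s * L s \<omega>)" if "S \<in> sets borel" for S
    using integrable_mult_indicator[of S lborel "\<lambda>s. L s \<omega>"] L_path_integrable[OF assms] that by simp
  have i2: "integrable lborel (\<lambda>s. indicator ?S s * (indicator {0..t} s * F s))"
    if F: "\<And>s. 0 \<le> s \<Longrightarrow> s \<le> t \<Longrightarrow> \<bar>F s\<bar> \<le> 2 * (W t \<omega> * B \<omega>)" and [measurable]: "F \<in> borel_measurable borel" for F
  proof (rule integrable_Icc_bounded[where t=t and K="2 * (W t \<omega> * B \<omega>)"])
    show "\<bar>indicator ?S s * (indicator {0..t} s * F s)\<bar> \<le> indicator {0..t} s * (2 * (W t \<omega> * B \<omega>))" for s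
      using F[of s] W_B_nonneg[of \<omega>] by (auto simp: indicator_def)
  qed measurable
  have iD: "integrable lborel (\<lambda>s. indicator ?S s * (indicator {0..t} s * Dp s \<omega>))"
    using Dp_bound[OF assms] W_B_nonneg[of \<omega>] by (intro i2) (force intro: order_trans[OF Dp_bound[OF assms]], measurable)
  have iJ: "integrable lborel (\<lambda>s. indicator ?S s * (indicator {0..t} s * J s \<omega>))"
    using J_bound[OF assms] by (intro i2) auto
  have "Q (Suc n) \<omega> = (\<integral>s. indicator {..<\<tau> n \<omega>} s * L s \<omega> + indicator ?S s * L s \<omega> \<partial>lborel)"
    unfolding Q_def
    by (rule integral_cong_AE, measurable, rule AE_mp[OF AE_lborel_singleton[of "\<tau> n \<omega>"]])
      (use \<delta>_pos[OF \<omega>, of n] in \<open>auto simp: indicator_def\<close>)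
  also have "\<dots> = Q n \<omega> + (\<integral>s. indicator ?S s * L s \<omega> \<partial>lborel)"
    unfolding Q_def by (intro Bochner_Integration.integral_add i) auto
  also have "(\<integral>s. indicator ?S s * L s \<omega> \<partial>lborel) = (\<integral>s. indicator ?S s * (indicator {0..t} s * Dp s \<omega>) + indicator ?S s * (indicator {0..t} s * J s \<omega>) \<partial>lborel)"
    by (simp add: L_def algebra_simps)
  also have "\<dots> = (\<integral>s. indicator ?S s * (indicator {0..t} s * Dp s \<omega>) \<partial>lborel) + (\<integral>s. indicator ?S s * (indicator {0..t} s * J s \<omega>) \<partial>lborel)"
    by (rule Bochner_Integration.integral_add[OF iD iJ])
  finally show ?thesis by simp
qed

text \<open>Summation over jumps: each pathwise increment differs from that of \<open>Q\<close> by a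
  jump minus its compensator, and these two have the same mean. Only expectations are compared, so
  no martingale is introduced.\<close>

lemma dynkin_stopped: "(\<integral>\<omega>. Ps n \<omega> \<partial>M) - (\<integral>\<omega>. Ps 0 \<omega> \<partial>M) = (\<integral>\<omega>. Q n \<omega> \<partial>M)"
proof (induction n)
  case 0
  have "AE \<omega> in M. Q 0 \<omega> = 0"
    using AE_space by eventually_elim
      (auto simp: Q_def \<tau>_0 L_def indicator_def intro!: integral_eq_zero_AE AE_I2)
  then have "(\<integral>\<omega>. Q 0 \<omega> \<partial>M) = 0" by (rule integral_eq_zero_AE)
  then show ?case by simp
next
  case (Suc n)
  let ?jump = "\<lambda>\<omega>. indicator {..t} (\<tau> (Suc n) \<omega>) * (\<Psi> (\<tau> (Suc n) \<omega>) (A (\<tau> (Suc n) \<omega>) \<omega>) (Yj (Suc n) \<omega>) (Gj (Suc n) \<omega>)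
     - \<Psi> (\<tau> (Suc n) \<omega>) (A (\<tau> (Suc n) \<omega>) \<omega>) (Yj (Suc n) \<omega>) (Gj n \<omega> + \<delta> n \<omega>))"
  let ?comp = "\<lambda>\<omega>. \<integral>s. indicator {\<tau> n \<omega><..<\<tau> (Suc n) \<omega>} s * (indicator {0..t} s * J s \<omega>) \<partial>lborel"
  have [measurable]: "(\<lambda>p. indicator {\<tau> n (fst p)<..<\<tau> (Suc n) (fst p)} (snd p) :: real) \<in> borel_measurable (M \<Otimes>\<^sub>M lborel)"
    unfolding indicator_def greaterThanLessThan_iff by measurable
  have [measurable]: "?comp \<in> borel_measurable M"
    by (rule lborel.borel_measurable_lebesgue_integral) (simp add: split_def)
  have [measurable]: "?jump \<in> borel_measurable M" using jump_increment(1)[of n] by auto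
  have eq: "AE \<omega> in M. ?comp \<omega> = (Q (Suc n) \<omega> - Q n \<omega>) - (Ps (Suc n) \<omega> - Ps n \<omega>) + ?jump \<omega>"
    using AE_good by eventually_elim (simp only: Q_increment path_increment)
  have "(\<integral>\<omega>. ?comp \<omega> \<partial>M) = (\<integral>\<omega>. (Q (Suc n) \<omega> - Q n \<omega>) - (Ps (Suc n) \<omega> - Ps n \<omega>) + ?jump \<omega> \<partial>M)"
    by (rule integral_cong_AE[OF _ _ eq]) measurable
  also have "\<dots> = ((\<integral>\<omega>. Q (Suc n) \<omega> \<partial>M) - (\<integral>\<omega>. Q n \<omega> \<partial>M)) - ((\<integral>\<omega>. Ps (Suc n) \<omega> \<partial>M) - (\<integral>\<omega>. Ps n \<omega> \<partial>M)) + (\<integral>\<omega>. ?jump \<omega> \<partial>M)"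
    using Q_integrable Ps_integrable jump_increment(1)[of n]
    by (simp only: Bochner_Integration.integral_add Bochner_Integration.integral_diff Bochner_Integration.integrable_diff)
  finally show ?case using Suc jump_increment(2)[of n] by linarith
qed

text \<open>For every good path all but finitely many jump times exceed \<open>t\<close>, so the
  stopped quantities become constant. The dominating variable does not depend on \<open>n\<close>,
  and Fubini then exchanges time and expectation.\<close>

lemma dynkin':
  "(\<integral>\<omega>. \<Psi> t (A t \<omega>) (Yt t \<omega>) (Gt t \<omega>) \<partial>M) - (\<integral>\<omega>. \<Psi> 0 0 (Yt 0 \<omega>) (Gt 0 \<omega>) \<partial>M) = (\<integral>s. \<integral>\<omega>. L s \<omega> \<partial>M \<partial>lborel)"
proof -
  interpret PL: pair_sigma_finite M lborel ..
  have ev: "\<forall>\<^sub>F n in sequentially. t < \<tau> n \<omega>" if "good \<omega>" for \<omega>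
    using \<tau>_at_top[OF good_space[OF that]] by (simp add: filterlim_at_top_dense)
  have P: "(\<lambda>n. \<integral>\<omega>. Ps n \<omega> \<partial>M) \<longlonglongrightarrow> (\<integral>\<omega>. \<Psi> t (A t \<omega>) (Yt t \<omega>) (Gt t \<omega>) \<partial>M)"
  proof (rule integral_dominated_convergence[where w=B])
    show "AE \<omega> in M. (\<lambda>n. Ps n \<omega>) \<longlonglongrightarrow> \<Psi> t (A t \<omega>) (Yt t \<omega>) (Gt t \<omega>)"
      using AE_good
    proof eventually_elim
      case (elim \<omega>)
      show ?case by (rule tendsto_eventually) (use ev[OF elim] in \<open>auto elim!: eventually_mono simp: Ps_def\<close>)
    qed
    show "AE \<omega> in M. norm (Ps n \<omega>) \<le> B \<omega>" for n using AE_good by eventually_elim (simp add: Ps_bound)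
  qed (auto simp: integrable_W_B)
  have Q: "(\<lambda>n. \<integral>\<omega>. Q n \<omega> \<partial>M) \<longlonglongrightarrow> (\<integral>\<omega>. (\<integral>s. L s \<omega> \<partial>lborel) \<partial>M)"
  proof (rule integral_dominated_convergence[where w="\<lambda>\<omega>. t * (3 * (W t \<omega> * B \<omega>))"])
    show "AE \<omega> in M. (\<lambda>n. Q n \<omega>) \<longlonglongrightarrow> (\<integral>s. L s \<omega> \<partial>lborel)"
      using AE_good
    proof eventually_elim
      case (elim \<omega>)
      have "Q n \<omega> = (\<integral>s. L s \<omega> \<partial>lborel)" if "t < \<tau> n \<omega>" for n
        unfolding Q_def using that by (intro Bochner_Integration.integral_cong) (auto simp: L_def indicator_def)
      then show ?case by (intro tendsto_eventually eventually_mono[OF ev[OF elim]])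
    qed
    show "AE \<omega> in M. norm (Q n \<omega>) \<le> t * (3 * (W t \<omega> * B \<omega>))" for n
      using AE_good by eventually_elim (simp add: Q_def path_integral_bounded)
    show "(\<lambda>\<omega>. \<integral>s. L s \<omega> \<partial>lborel) \<in> borel_measurable M"
      by (rule lborel.borel_measurable_lebesgue_integral) (simp add: split_def)
    show "integrable M (\<lambda>\<omega>. t * (3 * (W t \<omega> * B \<omega>)))"
      by (intro integrable_mult_right integrable_W_B)
  qed measurable
  have "(\<integral>\<omega>. Ps 0 \<omega> \<partial>M) = (\<integral>\<omega>. \<Psi> 0 0 (Yt 0 \<omega>) (Gt 0 \<omega>) \<partial>M)"
    using t by (intro Bochner_Integration.integral_cong) (auto simp: Ps_def \<tau>_0 A_0)
  moreover have "(\<integral>\<omega>. (\<integral>s. L s \<omega> \<partial>lborel) \<partial>M) = (\<integral>s. \<integral>\<omega>. L s \<omega> \<partial>M \<partial>lborel)"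
    using L_pair_integrable by (intro PL.Fubini_integral[symmetric]) (simp add: split_def)
  moreover have "(\<lambda>n. \<integral>\<omega>. Q n \<omega> \<partial>M) \<longlonglongrightarrow> (\<integral>\<omega>. \<Psi> t (A t \<omega>) (Yt t \<omega>) (Gt t \<omega>) \<partial>M) - (\<integral>\<omega>. Ps 0 \<omega> \<partial>M)"
    using tendsto_diff[OF P tendsto_const[of "\<integral>\<omega>. Ps 0 \<omega> \<partial>M"]] by (simp add: dynkin_stopped)
  ultimately show ?thesis using LIMSEQ_unique[OF Q] by simp
qed

lemma dynkin:
  "(\<integral>\<omega>. \<Psi> t (A t \<omega>) (Yt t \<omega>) (Gt t \<omega>) \<partial>M) - (\<integral>\<omega>. \<Psi> 0 0 (Yt 0 \<omega>) (Gt 0 \<omega>) \<partial>M) =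
   (\<integral>s. indicator {0..t} s * (\<integral>\<omega>. D s (A s \<omega>) (Yt s \<omega>) (Gt s \<omega>) + max (Gt s \<omega>) 0 *
      (resample d (\<Psi> s (A s \<omega>) (Yt s \<omega>)) (Yt s \<omega>) - \<Psi> s (A s \<omega>) (Yt s \<omega>) (Gt s \<omega>)) \<partial>M) \<partial>lborel)"
proof -
  have "(\<integral>\<omega>. L s \<omega> \<partial>M) = indicator {0..t} s * (\<integral>\<omega>. D s (A s \<omega>) (Yt s \<omega>) (Gt s \<omega>) + max (Gt s \<omega>) 0 *
      (resample d (\<Psi> s (A s \<omega>) (Yt s \<omega>)) (Yt s \<omega>) - \<Psi> s (A s \<omega>) (Yt s \<omega>) (Gt s \<omega>)) \<partial>M)" for s
    unfolding L_def Dp_def J_def by (rule integral_mult_right_zero)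
  then show ?thesis using dynkin' by simp
qed

end

declare \<Psi>_measurable' [measurable del] D_measurable' [measurable del] R_measurable [measurable del]
  J_measurable [measurable del] Ps_measurable [measurable del]
  L_measurable [measurable del] Q_measurable [measurable del]

end

section \<open>Stationary moments\<close>

text \<open>Adding one independent centred summand changes the fourth moment by exactly
  \<open>6 * v\<^sup>2 * n + w\<close>, since the terms linear in the summand or in the partial sum
  vanish. The quadratic bound leaves a slack of \<open>3 * v\<^sup>2\<close> in every step.\<close>

lemma (in prob_space) indep_sum_moments:
  fixes X :: "nat \<Rightarrow> 'a \<Rightarrow> real"
  assumes indep: "indep_vars (\<lambda>_. borel) X {..<N}"
    and int: "\<And>i k. i < N \<Longrightarrow> integrable M (\<lambda>\<omega>. X i \<omega> ^ k)"
    and m1: "\<And>i. i < N \<Longrightarrow> expectation (X i) = 0"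
    and m2: "\<And>i. i < N \<Longrightarrow> expectation (\<lambda>\<omega>. X i \<omega> ^ 2) = v"
    and m4: "\<And>i. i < N \<Longrightarrow> expectation (\<lambda>\<omega>. X i \<omega> ^ 4) = w"
    and n: "n \<le> N"
  defines "S \<equiv> \<lambda>n \<omega>. \<Sum>i<n. X i \<omega>"
  shows "(\<forall>k\<le>4. integrable M (\<lambda>\<omega>. S n \<omega> ^ k)) \<and> expectation (S n) = 0 \<and> expectation (\<lambda>\<omega>. S n \<omega> ^ 2) = v * n
    \<and> expectation (\<lambda>\<omega>. S n \<omega> ^ 4) \<le> w * n + 3 * v\<^sup>2 * n\<^sup>2"
  using n
proof (induction n)
  case 0
  then show ?case by (simp add: S_def power_0_left)
next
  case (Suc n)
  then have IH: "\<And>k. k \<le> 4 \<Longrightarrow> integrable M (\<lambda>\<omega>. S n \<omega> ^ k)" "expectation (S n) = 0"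
    "expectation (\<lambda>\<omega>. S n \<omega> ^ 2) = v * n" "expectation (\<lambda>\<omega>. S n \<omega> ^ 4) \<le> w * n + 3 * v\<^sup>2 * n\<^sup>2" and nN: "n < N"
    by auto
  have "indep_var borel (X n) borel (S n)"
    unfolding S_def using nN
    by (intro indep_vars_sum indep_vars_subset[OF indep]) auto
  then have ind: "indep_var borel (\<lambda>\<omega>. X n \<omega> ^ j) borel (\<lambda>\<omega>. S n \<omega> ^ k)" for j k
    using indep_var_compose[of borel "X n" borel "S n" "\<lambda>x. x ^ j" borel "\<lambda>x. x ^ k" borel] by (simp add: comp_def)
  have pi: "integrable M (\<lambda>\<omega>. X n \<omega> ^ j * S n \<omega> ^ k)"
    and pe: "expectation (\<lambda>\<omega>. X n \<omega> ^ j * S n \<omega> ^ k) = expectation (\<lambda>\<omega>. X n \<omega> ^ j) * expectation (\<lambda>\<omega>. S n \<omega> ^ k)"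
    if "k \<le> 4" for j k
    by (rule indep_var_integrable[OF ind int[OF nN] IH(1)[OF that]] indep_var_lebesgue_integral[OF ind int[OF nN] IH(1)[OF that]])+
  note pi' = pi[of 0 1] pi[of 1 0] pi[of 0 2] pi[of 2 0] pi[of 1 1] pi[of 0 3] pi[of 1 2] pi[of 2 1] pi[of 3 0]
    pi[of 0 4] pi[of 1 3] pi[of 2 2] pi[of 3 1] pi[of 4 0]
  have p2: "(x + s) ^ 2 = s ^ 2 + 2 * (x * s) + x ^ 2" for x s :: real by (simp add: power2_sum)
  have p3: "(x + s) ^ 3 = s ^ 3 + 3 * (x * s ^ 2) + 3 * (x ^ 2 * s) + x ^ 3" for x s :: real by (simp add: power3_eq_cube algebra_simps power2_eq_square)
  have p4: "(x + s) ^ 4 = s ^ 4 + 4 * (x * s ^ 3) + 6 * (x ^ 2 * s ^ 2) + 4 * (x ^ 3 * s) + x ^ 4" for x s :: real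
    by (simp add: power4_eq_xxxx power3_eq_cube algebra_simps power2_eq_square)
  have S: "S (Suc n) \<omega> = X n \<omega> + S n \<omega>" for \<omega> by (simp add: S_def)
  have i1: "integrable M (\<lambda>\<omega>. S (Suc n) \<omega>)" "integrable M (\<lambda>\<omega>. S (Suc n) \<omega> ^ 2)"
    "integrable M (\<lambda>\<omega>. S (Suc n) \<omega> ^ 3)" "integrable M (\<lambda>\<omega>. S (Suc n) \<omega> ^ 4)"
    unfolding S p2 p3 p4 using pi' by simp_all
  have "\<forall>k\<le>4. integrable M (\<lambda>\<omega>. S (Suc n) \<omega> ^ k)"
  proof (intro allI impI)
    fix k :: nat assume "k \<le> 4"
    then consider "k = 0" | "k = 1" | "k = 2" | "k = 3" | "k = 4" by linarith
    then show "integrable M (\<lambda>\<omega>. S (Suc n) \<omega> ^ k)" using i1 by cases auto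
  qed
  moreover have "expectation (S (Suc n)) = 0"
    unfolding S using pi[of 0 1] pi[of 1 0] m1[OF nN] IH(2) by (subst Bochner_Integration.integral_add) auto
  moreover have "expectation (\<lambda>\<omega>. S (Suc n) \<omega> ^ 2) = v * Suc n"
    unfolding S p2 using pi' pe[of 1 1] m1[OF nN] m2[OF nN] IH(2,3) by (simp add: algebra_simps)
  moreover have "expectation (\<lambda>\<omega>. S (Suc n) \<omega> ^ 4) \<le> w * Suc n + 3 * v\<^sup>2 * (Suc n)\<^sup>2"
  proof -
    have "expectation (\<lambda>\<omega>. S (Suc n) \<omega> ^ 4) = expectation (\<lambda>\<omega>. S n \<omega> ^ 4) + 4 * (0 * expectation (\<lambda>\<omega>. S n \<omega> ^ 3))
       + 6 * (v * (v * n)) + 4 * (expectation (\<lambda>\<omega>. X n \<omega> ^ 3) * 0) + w"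
      unfolding S p4 using pi' pe[of 3 1] pe[of 2 2] pe[of 1 3] m1[OF nN] m2[OF nN] m4[OF nN] IH(2,3) by simp
    moreover have "(w * Suc n + 3 * v\<^sup>2 * (Suc n)\<^sup>2) - (w * n + 3 * v\<^sup>2 * n\<^sup>2 + 6 * (v * (v * n)) + w) = 3 * v\<^sup>2"
      by (simp add: power2_eq_square algebra_simps)
    ultimately show ?thesis using IH(4) zero_le_power2[of v] by linarith
  qed
  ultimately show ?case by blast
qed

section \<open>Moments under the Gaussian law\<close>

lemma prob_space_std_normal: "prob_space std_normal_distribution"
  by (rule prob_space_normal_density) simp

lemma gauss_law_prob: "prob_space (gauss_law d)"
  unfolding gauss_law_def by (intro prob_space_PiM prob_space_std_normal)

lemma sets_gauss_law [measurable_cong, simp]: "sets (gauss_law d) = sets (Rd d)"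
  unfolding gauss_law_def Rd_def by (intro sets_PiM_cong) auto

lemma gauss_law_component:
  assumes "i < d" shows "distr (gauss_law d) std_normal_distribution (\<lambda>x. x i) = std_normal_distribution"
  unfolding gauss_law_def using assms by (intro distr_PiM_component prob_space_std_normal) auto

lemma gauss_law_component_measurable: "i < d \<Longrightarrow> (\<lambda>x. x i) \<in> borel_measurable (gauss_law d)"
  by (rule measurable_component_Rd) auto

lemma gauss_law_indep:
  assumes "d \<noteq> 0" shows "prob_space.indep_vars (gauss_law d) (\<lambda>_. borel) (\<lambda>i x. x i) {..<d}"
proof -
  interpret prob_space "gauss_law d" by (rule gauss_law_prob)
  show ?thesis
    proof (subst indep_vars_iff_distr_eq_PiM')
      show "{..<d} \<noteq> {}" using assms by auto
      show "random_variable borel (\<lambda>x. x i)" if "i \<in> {..<d}" for i using that gauss_law_component_measurable by auto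
      have "distr (gauss_law d) (\<Pi>\<^sub>M i\<in>{..<d}. borel) (\<lambda>x. \<lambda>i\<in>{..<d}. x i) = distr (gauss_law d) (gauss_law d) (\<lambda>x. x)"
      proof (rule distr_cong)
        show "(\<lambda>i\<in>{..<d}. x i) = x" if "x \<in> space (gauss_law d)" for x
          using that unfolding gauss_law_def space_PiM by (auto simp: PiE_def extensional_def)
      qed (auto simp: Rd_def)
      also have "\<dots> = gauss_law d" by (rule distr_id)
      also have "\<dots> = (\<Pi>\<^sub>M i\<in>{..<d}. distr (gauss_law d) borel (\<lambda>x. x i))"
        unfolding gauss_law_def[of d, symmetric]
      proof (subst gauss_law_def, rule PiM_cong)
        fix i assume "i \<in> {..<d}"
        then have "distr (gauss_law d) std_normal_distribution (\<lambda>x. x i) = std_normal_distribution"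
          using gauss_law_component by auto
        moreover have "distr (gauss_law d) std_normal_distribution (\<lambda>x. x i) = distr (gauss_law d) borel (\<lambda>x. x i)"
          by (rule distr_cong) auto
        ultimately show "std_normal_distribution = distr (gauss_law d) borel (\<lambda>x. x i)" by simp
      qed simp
      finally show "distr (gauss_law d) (\<Pi>\<^sub>M i\<in>{..<d}. borel) (\<lambda>x. \<lambda>i\<in>{..<d}. x i) = (\<Pi>\<^sub>M i\<in>{..<d}. distr (gauss_law d) borel (\<lambda>x. x i))" .
  qed
qed

lemma gauss_law_integral_component:
  fixes f :: "real \<Rightarrow> real"
  assumes "i < d" and [measurable]: "f \<in> borel_measurable borel"
  shows "(\<integral>x. f (x i) \<partial>gauss_law d) = (\<integral>z. std_normal_density z * f z \<partial>lborel)"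
    "integrable (gauss_law d) (\<lambda>x. f (x i)) \<longleftrightarrow> integrable lborel (\<lambda>z. std_normal_density z * f z)"
proof -
  have m: "(\<lambda>x. x i) \<in> gauss_law d \<rightarrow>\<^sub>M std_normal_distribution" using gauss_law_component_measurable[OF assms(1)] by simp
  have "(\<integral>x. f (x i) \<partial>gauss_law d) = (\<integral>z. f z \<partial>std_normal_distribution)"
    by (subst gauss_law_component[OF assms(1), symmetric], subst integral_distr[OF m]) auto
  then show "(\<integral>x. f (x i) \<partial>gauss_law d) = (\<integral>z. std_normal_density z * f z \<partial>lborel)"
    by (subst (asm) integral_density) auto
  have "integrable (gauss_law d) (\<lambda>x. f (x i)) \<longleftrightarrow> integrable (distr (gauss_law d) std_normal_distribution (\<lambda>x. x i)) f"
    by (rule integrable_distr_eq[OF m, symmetric]) simp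
  also have "\<dots> \<longleftrightarrow> integrable lborel (\<lambda>z. std_normal_density z * f z)"
    unfolding gauss_law_component[OF assms(1)] by (subst integrable_density) auto
  finally show "integrable (gauss_law d) (\<lambda>x. f (x i)) \<longleftrightarrow> integrable lborel (\<lambda>z. std_normal_density z * f z)" .
qed

text \<open>A sum of independent normal variables whose variances add up to 1. Coordinates with
  \<open>v i = 0\<close> are discarded first because they contribute a degenerate variable without a
  density.\<close>

lemma gauss_law_ip:
  assumes "vnorm d v = 1"
  shows "distr (gauss_law d) borel (\<lambda>x. ip d x v) = std_normal_distribution"
proof -
  interpret prob_space "gauss_law d" by (rule gauss_law_prob)
  let ?I = "{i. i < d \<and> v i \<noteq> 0}"
  have v1: "(\<Sum>i<d. (v i)\<^sup>2) = 1" using assms by (simp add: L2_set_def)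
  have sI: "(\<Sum>i\<in>?I. (v i)\<^sup>2) = 1"
    unfolding v1[symmetric] by (rule sum.mono_neutral_left) auto
  have "?I \<noteq> {}" using sI by force
  have dist: "distributed (gauss_law d) lborel (\<lambda>x. 0 + v i * x i) (normal_density (0 + v i * 0) (\<bar>v i\<bar> * 1))" if "i \<in> ?I" for i
  proof (rule normal_density_affine)
    have "distr (gauss_law d) lborel (\<lambda>x. x i) = distr (gauss_law d) std_normal_distribution (\<lambda>x. x i)"
      by (rule distr_cong) auto
    also have "\<dots> = std_normal_distribution" using that gauss_law_component by auto
    finally have "distr (gauss_law d) lborel (\<lambda>x. x i) = std_normal_distribution" .
    then show "distributed (gauss_law d) lborel (\<lambda>x. x i) std_normal_density"
      using that gauss_law_component_measurable[of i d] unfolding distributed_def by simp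
  qed (use that in auto)
  have "d \<noteq> 0" using v1 by (intro notI) simp
  then have indep: "indep_vars (\<lambda>_. borel) (\<lambda>i x. v i * x i) ?I"
    by (rule indep_vars_compose2[OF indep_vars_subset[OF gauss_law_indep]]) auto
  have "distributed (gauss_law d) lborel (\<lambda>x. \<Sum>i\<in>?I. v i * x i) (normal_density (\<Sum>i\<in>?I. 0) (sqrt (\<Sum>i\<in>?I. (\<bar>v i\<bar>)\<^sup>2)))"
    by (rule sum_indep_normal[OF _ \<open>?I \<noteq> {}\<close> indep]) (use dist in auto)
  then have "distributed (gauss_law d) lborel (\<lambda>x. \<Sum>i\<in>?I. v i * x i) std_normal_density"
    using sI by simp
  moreover have "(\<lambda>x. \<Sum>i\<in>?I. v i * x i) = (\<lambda>x. ip d x v)"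
    unfolding ip_def by (intro ext sum.mono_neutral_cong_left) auto
  ultimately have "distr (gauss_law d) lborel (\<lambda>x. ip d x v) = std_normal_distribution"
    by (simp add: distributed_def)
  moreover have "distr (gauss_law d) lborel (\<lambda>x. ip d x v) = distr (gauss_law d) borel (\<lambda>x. ip d x v)"
    by (rule distr_cong) auto
  ultimately show ?thesis by simp
qed

lemma std_normal_moments:
  "(\<integral>z. std_normal_density z * (z\<^sup>2 - 1) \<partial>lborel) = 0"
  "(\<integral>z. std_normal_density z * (z\<^sup>2 - 1)\<^sup>2 \<partial>lborel) = 2"
  "(\<integral>z. std_normal_density z * (z\<^sup>2 - 1) ^ 4 \<partial>lborel) = 60"
  "integrable lborel (\<lambda>z. std_normal_density z * (z\<^sup>2 - 1) ^ k)"
proof -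
  have e: "(\<integral>z. std_normal_density z * z ^ (2 * k) \<partial>lborel) = fact (2 * k) / (2 ^ k * fact k)" for k
    by (rule integral_std_normal_moment_even)
  have e0: "(\<integral>z. std_normal_density z \<partial>lborel) = 1" using e[of 0] by simp
  have e2: "(\<integral>z. std_normal_density z * z\<^sup>2 \<partial>lborel) = 1" using e[of 1] by simp
  have e4: "(\<integral>z. std_normal_density z * z ^ 4 \<partial>lborel) = 3" using e[of 2] by (simp add: fact_numeral)
  have e6: "(\<integral>z. std_normal_density z * z ^ 6 \<partial>lborel) = 15" using e[of 3] by (simp add: fact_numeral)
  have e8: "(\<integral>z. std_normal_density z * z ^ 8 \<partial>lborel) = 105" using e[of 4] by (simp add: fact_numeral)
  note i = integrable_std_normal_moment
  have "std_normal_density z * (z\<^sup>2 - 1) = std_normal_density z * z\<^sup>2 - std_normal_density z" for z by (simp add: algebra_simps)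
  then show "(\<integral>z. std_normal_density z * (z\<^sup>2 - 1) \<partial>lborel) = 0"
    using i[of 2] e0 e2 by simp
  have "std_normal_density z * (z\<^sup>2 - 1)\<^sup>2 = std_normal_density z * z ^ 4 - 2 * (std_normal_density z * z\<^sup>2) + std_normal_density z" for z
    by (simp add: algebra_simps power2_eq_square power4_eq_xxxx)
  then show "(\<integral>z. std_normal_density z * (z\<^sup>2 - 1)\<^sup>2 \<partial>lborel) = 2"
    using i[of 2] i[of 4] e0 e2 e4 by simp
  have p8: "(z\<^sup>2 - 1) ^ 4 = z ^ 8 - 4 * z ^ 6 + 6 * z ^ 4 - 4 * z\<^sup>2 + 1" for z :: real
    by (simp add: power2_eq_square eval_nat_numeral algebra_simps)
  have "std_normal_density z * (z\<^sup>2 - 1) ^ 4 = std_normal_density z * z ^ 8 - 4 * (std_normal_density z * z ^ 6) + 6 * (std_normal_density z * z ^ 4)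
     - 4 * (std_normal_density z * z\<^sup>2) + std_normal_density z" for z
    unfolding p8 by (simp add: algebra_simps)
  then show "(\<integral>z. std_normal_density z * (z\<^sup>2 - 1) ^ 4 \<partial>lborel) = 60"
    using i[of 2] i[of 4] i[of 6] i[of 8] e0 e2 e4 e6 e8 by simp
  have "std_normal_density z * (z\<^sup>2 - 1) ^ k = (\<Sum>j\<le>k. of_nat (k choose j) * (- 1) ^ (k - j) * (std_normal_density z * z ^ (2 * j)))" for z
  proof -
    have "(z\<^sup>2 - 1) ^ k = (\<Sum>j\<le>k. of_nat (k choose j) * (z\<^sup>2) ^ j * (- 1) ^ (k - j))"
      using binomial_ring[of "z\<^sup>2" "- 1" k] by simp
    then show ?thesis by (simp only: sum_distrib_left power_mult) (intro sum.cong refl, simp)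
  qed
  then show "integrable lborel (\<lambda>z. std_normal_density z * (z\<^sup>2 - 1) ^ k)"
    using i by simp
qed

lemma gauss_law_norm_moments:
  assumes "4 \<le> d"
  defines "h \<equiv> \<lambda>x. (ip d x x - d) / sqrt (2 * d)"
  shows "(\<integral>x. h x \<partial>gauss_law d) = 0" "(\<integral>x. (h x)\<^sup>2 \<partial>gauss_law d) = 1" "(\<integral>x. (h x) ^ 4 \<partial>gauss_law d) \<le> 18"
    "integrable (gauss_law d) h" "integrable (gauss_law d) (\<lambda>x. (h x)\<^sup>2)" "integrable (gauss_law d) (\<lambda>x. (h x) ^ 4)"
proof -
  interpret prob_space "gauss_law d" by (rule gauss_law_prob)
  let ?X = "\<lambda>i x. (x i)\<^sup>2 - 1 :: real"
  let ?S = "\<lambda>x. \<Sum>i<d. ?X i x"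
  have indep: "indep_vars (\<lambda>_. borel) ?X {..<d}"
    by (rule indep_vars_compose2[OF gauss_law_indep]) (use assms in auto)
  have X1: "expectation (?X i) = 0" and X2: "expectation (\<lambda>x. ?X i x ^ 2) = 2" and X4: "expectation (\<lambda>x. ?X i x ^ 4) = 60"
    and Xi: "integrable (gauss_law d) (\<lambda>x. ?X i x ^ k)" if "i < d" for i k
    using gauss_law_integral_component[OF that, of "\<lambda>z. z\<^sup>2 - 1"] gauss_law_integral_component[OF that, of "\<lambda>z. (z\<^sup>2 - 1) ^ 2"]
      gauss_law_integral_component[OF that, of "\<lambda>z. (z\<^sup>2 - 1) ^ 4"] gauss_law_integral_component[OF that, of "\<lambda>z. (z\<^sup>2 - 1) ^ k"]
      std_normal_moments by auto
  have S: "(\<forall>k\<le>4. integrable (gauss_law d) (\<lambda>x. ?S x ^ k)) \<and> expectation ?S = 0 \<and> expectation (\<lambda>x. ?S x ^ 2) = 2 * real d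
    \<and> expectation (\<lambda>x. ?S x ^ 4) \<le> 60 * real d + 3 * 2\<^sup>2 * (real d)\<^sup>2"
    using indep_sum_moments[OF indep Xi X1 X2 X4 order_refl] by simp
  have h: "h x = ?S x / sqrt (2 * d)" for x
    by (simp add: h_def ip_def sum_subtractf power2_eq_square)
  have q2: "(h x)\<^sup>2 = ?S x ^ 2 / (2 * d)" for x unfolding h by (simp add: power_divide)
  have "(sqrt (2 * d)) ^ 4 = ((sqrt (2 * d))\<^sup>2)\<^sup>2" by (simp only: power_mult[symmetric]) simp
  then have q4: "(h x) ^ 4 = ?S x ^ 4 / (4 * d\<^sup>2)" for x unfolding h by (simp add: power_divide power_mult_distrib)
  have int: "integrable (gauss_law d) ?S" "integrable (gauss_law d) (\<lambda>x. ?S x ^ 2)" "integrable (gauss_law d) (\<lambda>x. ?S x ^ 4)"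
    using S[THEN conjunct1, rule_format, of 1] S[THEN conjunct1, rule_format, of 2] S[THEN conjunct1, rule_format, of 4] by simp_all
  show "integrable (gauss_law d) h" "integrable (gauss_law d) (\<lambda>x. (h x)\<^sup>2)" "integrable (gauss_law d) (\<lambda>x. (h x) ^ 4)"
    unfolding q2 q4 using int by (auto simp: h[abs_def])
  show "(\<integral>x. h x \<partial>gauss_law d) = 0" unfolding h using S by simp
  show "(\<integral>x. (h x)\<^sup>2 \<partial>gauss_law d) = 1" unfolding q2 using S assms(1) by simp
  have "(\<integral>x. (h x) ^ 4 \<partial>gauss_law d) = expectation (\<lambda>x. ?S x ^ 4) / (4 * d\<^sup>2)" unfolding q4 by simp
  also have "\<dots> \<le> (60 * real d + 3 * 2\<^sup>2 * (real d)\<^sup>2) / (4 * d\<^sup>2)" using S by (intro divide_right_mono) auto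
  \<comment> \<open>The quotient is \<open>15 / d + 3\<close>, and \<open>d\<close> is at least
    1.\<close>
  also have "\<dots> \<le> 18" using assms(1) by (simp add: field_simps power2_eq_square)
  finally show "(\<integral>x. (h x) ^ 4 \<partial>gauss_law d) \<le> 18" .
qed

text \<open>With \<open>K\<close> the largest of 1 and the squared coordinates,
  \<open>1 + |x|^2\<close> is at most \<open>(d + 1) * K\<close>, and \<open>K ^ m\<close> is at
  most 1 plus the sum of the coordinate moments of order \<open>2 * m\<close>.\<close>

lemma gauss_law_norm_power_integrable: "integrable (gauss_law d) (\<lambda>x. (1 + ip d x x) ^ m)"
proof -
  interpret prob_space "gauss_law d" by (rule gauss_law_prob)
  have bd: "(1 + ip d x x) ^ m \<le> (real d + 1) ^ m * (1 + (\<Sum>i<d. (x i) ^ (2 * m)))" for x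
  proof -
    define K where "K = Max (insert 1 ((\<lambda>i. (x i)\<^sup>2) ` {..<d}))"
    have K1: "1 \<le> K" "\<And>i. i < d \<Longrightarrow> (x i)\<^sup>2 \<le> K" unfolding K_def by auto
    have "1 + ip d x x \<le> K + (\<Sum>i<d. K)" unfolding ip_def using K1
      by (intro add_mono sum_mono) (auto simp: power2_eq_square)
    also have "\<dots> = (real d + 1) * K" by (simp add: algebra_simps)
    finally have "(1 + ip d x x) ^ m \<le> ((real d + 1) * K) ^ m"
      by (intro power_mono) (auto simp: ip_def intro!: add_nonneg_nonneg sum_nonneg)
    also have "\<dots> = (real d + 1) ^ m * K ^ m" by (simp add: power_mult_distrib)
    also have "K ^ m \<le> 1 + (\<Sum>i<d. (x i) ^ (2 * m))"
    proof -
      have "K \<in> insert 1 ((\<lambda>i. (x i)\<^sup>2) ` {..<d})" unfolding K_def by (rule Max_in) auto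
      then consider "K = 1" | i where "i < d" "K = (x i)\<^sup>2" by auto
      then show ?thesis
      proof cases
        case 1
        then show ?thesis by (auto intro!: sum_nonneg simp: power_mult)
      next
        case 2
        have "(x i) ^ (2 * m) \<le> (\<Sum>i<d. (x i) ^ (2 * m))"
          using 2 by (intro member_le_sum) (auto simp: power_mult)
        then show ?thesis using 2 by (simp add: power_mult)
      qed
    qed
    finally show ?thesis by (simp add: mult_left_mono)
  qed
  have int: "integrable (gauss_law d) (\<lambda>x. (x i) ^ (2 * m))" if "i < d" for i
    using gauss_law_integral_component(2)[OF that, of "\<lambda>z. z ^ (2 * m)"] integrable_std_normal_moment[of "2 * m"] by simp
  show ?thesis
  proof (rule Bochner_Integration.integrable_bound)
    show "integrable (gauss_law d) (\<lambda>x. (real d + 1) ^ m * (1 + (\<Sum>i<d. (x i) ^ (2 * m))))"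
      using int by (intro integrable_mult_right Bochner_Integration.integrable_add Bochner_Integration.integrable_sum) auto
    show "AE x in gauss_law d. norm ((1 + ip d x x) ^ m) \<le> norm ((real d + 1) ^ m * (1 + (\<Sum>i<d. (x i) ^ (2 * m))))"
    proof (rule AE_I2)
      fix x
      have "0 \<le> (1 + ip d x x) ^ m" by (auto simp: ip_def intro!: zero_le_power add_nonneg_nonneg sum_nonneg)
      then show "norm ((1 + ip d x x) ^ m) \<le> norm ((real d + 1) ^ m * (1 + (\<Sum>i<d. (x i) ^ (2 * m))))"
        unfolding real_norm_def using bd[of x] by linarith
    qed
  qed measurable
qed

text \<open>Normalization requires the ball to have positive finite volume. It lies in the cube of
  half side 1 and contains the cube of half side \<open>1 / d\<close>.\<close>

lemma sphere_unif_prob: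
  assumes "0 < d" shows "prob_space (sphere_unif d)"
proof -
  interpret product_sigma_finite "\<lambda>_::nat. lborel :: real measure" by standard
  let ?N = "\<Pi>\<^sub>M i\<in>{..<d}. (lborel :: real measure)"
  let ?A = "{x \<in> space (Rd d). vnorm d x \<le> 1}"
  have s: "sets ?N = sets (Rd d)" unfolding Rd_def by (intro sets_PiM_cong) auto
  have vm: "(\<lambda>x. vnorm d x) \<in> borel_measurable (Rd d)" by (rule measurable_vnorm) simp
  have A: "?A \<in> sets ?N" unfolding s using vm by measurable
  have cube: "emeasure ?N (PiE {..<d} (\<lambda>_. {- r..r})) = ennreal ((2 * r) ^ d)" if "0 \<le> r" for r :: real
    using that by (subst emeasure_PiM) (auto simp: prod_constant ennreal_power)
  have cm: "PiE {..<d} (\<lambda>_. {- r..r}) \<in> sets ?N" for r :: real by (rule sets_PiM_I_finite) auto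
  have "?A \<subseteq> PiE {..<d} (\<lambda>_. {- 1..1})"
  proof
    fix x assume x: "x \<in> ?A"
    have "\<bar>x i\<bar> \<le> 1" if "i < d" for i
    proof -
      have "\<bar>x i\<bar> \<le> L2_set (\<lambda>i. \<bar>x i\<bar>) {..<d}" using that by (intro member_le_L2_set) auto
      moreover have "L2_set (\<lambda>i. \<bar>x i\<bar>) {..<d} = vnorm d x" by (simp add: L2_set_def)
      ultimately show ?thesis using x by simp
    qed
    then show "x \<in> PiE {..<d} (\<lambda>_. {- 1..1})"
      using x by (auto simp: Rd_def space_PiM PiE_iff abs_le_iff)
  qed
  then have "emeasure ?N ?A \<le> ennreal ((2 * 1) ^ d)"
    using emeasure_mono[OF _ cm[of 1]] cube[of 1] by simp
  then have fin: "emeasure ?N ?A \<noteq> \<infinity>" by (auto simp: top_unique)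
  have "PiE {..<d} (\<lambda>_. {- (1 / real d)..1 / real d}) \<subseteq> ?A"
  proof
    fix x assume x: "x \<in> PiE {..<d} (\<lambda>_. {- (1 / real d)..1 / real d})"
    have "vnorm d x \<le> (\<Sum>i<d. \<bar>x i\<bar>)" by (rule L2_set_le_sum_abs)
    also have "\<dots> \<le> (\<Sum>i<d. 1 / real d)" using x by (intro sum_mono) (force simp: PiE_iff abs_le_iff)
    also have "\<dots> = 1" using assms by simp
    finally show "x \<in> ?A" using x by (auto simp: Rd_def space_PiM PiE_iff)
  qed
  then have "emeasure ?N (PiE {..<d} (\<lambda>_. {- (1 / real d)..1 / real d})) \<le> emeasure ?N ?A"
    by (rule emeasure_mono[OF _ A])
  moreover have "0 < ennreal ((2 * (1 / real d)) ^ d)" using assms by simp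
  ultimately have pos: "emeasure ?N ?A \<noteq> 0" using cube[of "1 / real d"] assms by auto
  interpret U: prob_space "uniform_measure ?N ?A" by (rule prob_space_uniform_measure[OF pos fin])
  have "(\<lambda>x. normalize_vec d x) \<in> Rd d \<rightarrow>\<^sub>M Rd d"
    unfolding normalize_vec_def
    by (intro measurable_RdI borel_measurable_divide vm measurable_component_Rd) auto
  then have "normalize_vec d \<in> uniform_measure ?N ?A \<rightarrow>\<^sub>M Rd d"
    by (subst measurable_cong_sets[OF _ refl, of _ "Rd d"]) (auto simp: s)
  then show ?thesis unfolding sphere_unif_def by (rule U.prob_space_distr)
qed

text \<open>Cauchy-Schwarz, from the pointwise inequality
  \<open>2 * |x * y| \<le> c * x^2 + y^2 / c\<close> with the optimal weight
  \<open>c = q / p\<close>.\<close>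

lemma (in prob_space) expectation_mult_le:
  fixes F H :: "'a \<Rightarrow> real"
  assumes [measurable]: "F \<in> borel_measurable M" "H \<in> borel_measurable M"
    and iF: "integrable M (\<lambda>\<omega>. (F \<omega>)\<^sup>2)" and iH: "integrable M (\<lambda>\<omega>. (H \<omega>)\<^sup>2)"
    and F: "expectation (\<lambda>\<omega>. (F \<omega>)\<^sup>2) \<le> p\<^sup>2" and H: "expectation (\<lambda>\<omega>. (H \<omega>)\<^sup>2) \<le> q\<^sup>2" and pq: "0 \<le> p" "0 \<le> q"
  shows "integrable M (\<lambda>\<omega>. F \<omega> * H \<omega>)" "\<bar>expectation (\<lambda>\<omega>. F \<omega> * H \<omega>)\<bar> \<le> p * q"
proof -
  have am: "\<bar>x * y\<bar> \<le> (c * x\<^sup>2 + y\<^sup>2 / c) / 2" if "0 < c" for c x y :: real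
  proof -
    have "0 \<le> (sqrt c * \<bar>x\<bar> - \<bar>y\<bar> / sqrt c)\<^sup>2" by simp
    also have "\<dots> = c * x\<^sup>2 + y\<^sup>2 / c - 2 * \<bar>x * y\<bar>"
      using that by (simp add: power2_diff power_mult_distrib power_divide abs_mult)
    finally show ?thesis by simp
  qed
  have bnd: "integrable M (\<lambda>\<omega>. (c * (F \<omega>)\<^sup>2 + (H \<omega>)\<^sup>2 / c) / 2)" for c using iF iH by simp
  show i: "integrable M (\<lambda>\<omega>. F \<omega> * H \<omega>)"
    by (rule Bochner_Integration.integrable_bound[OF bnd[of 1]]) (use am[of 1] in \<open>auto intro: order_trans[OF _ abs_ge_self]\<close>)
  have main: "\<bar>expectation (\<lambda>\<omega>. F \<omega> * H \<omega>)\<bar> \<le> p' * q'" if "0 < p'" "0 < q'" "p \<le> p'" "q \<le> q'" for p' q'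
  proof -
    have "\<bar>expectation (\<lambda>\<omega>. F \<omega> * H \<omega>)\<bar> \<le> expectation (\<lambda>\<omega>. \<bar>F \<omega> * H \<omega>\<bar>)" by (rule integral_abs_bound)
    also have "\<dots> \<le> expectation (\<lambda>\<omega>. (q' / p' * (F \<omega>)\<^sup>2 + (H \<omega>)\<^sup>2 / (q' / p')) / 2)"
      using am[of "q' / p'"] that by (intro integral_mono integrable_abs i bnd) auto
    also have "\<dots> = (q' / p' * expectation (\<lambda>\<omega>. (F \<omega>)\<^sup>2) + expectation (\<lambda>\<omega>. (H \<omega>)\<^sup>2) / (q' / p')) / 2"
      using iF iH by simp
    also have "\<dots> \<le> (q' / p' * p'\<^sup>2 + q'\<^sup>2 / (q' / p')) / 2"
    proof -
      have "expectation (\<lambda>\<omega>. (F \<omega>)\<^sup>2) \<le> p'\<^sup>2" "expectation (\<lambda>\<omega>. (H \<omega>)\<^sup>2) \<le> q'\<^sup>2"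
        using pq that by (auto intro: order_trans[OF F power_mono] order_trans[OF H power_mono])
      then show ?thesis using that by (intro divide_right_mono add_mono mult_left_mono) auto
    qed
    also have "\<dots> = p' * q'" using that by (simp add: power2_eq_square)
    finally show ?thesis .
  qed
  \<comment> \<open>The optimal weight needs positive bounds; a zero bound is reached as a limit of
    positive ones.\<close>
  have "(\<lambda>n. (p + 1 / real (Suc n)) * (q + 1 / real (Suc n))) \<longlonglongrightarrow> (p + 0) * (q + 0)"
    by (intro tendsto_intros LIMSEQ_Suc lim_1_over_n)
  then have lim: "(\<lambda>n. (p + 1 / real (Suc n)) * (q + 1 / real (Suc n))) \<longlonglongrightarrow> p * q" by simp
  show "\<bar>expectation (\<lambda>\<omega>. F \<omega> * H \<omega>)\<bar> \<le> p * q"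
    by (rule LIMSEQ_le_const[OF lim], intro exI[of _ 0] allI impI main) (use pq in \<open>auto intro!: add_nonneg_pos\<close>)
qed

section \<open>One-time laws of the stationary process\<close>

locale fecmc_stationary = fecmc M d \<nu> X V \<tau> for M :: "'a measure" and d \<nu> X V \<tau> +
  assumes stationary: "\<And>t. 0 \<le> t \<Longrightarrow> state_law d M X V t = gauss_law d \<Otimes>\<^sub>M sphere_unif d"
begin

text \<open>The standardized potential \<open>h\<close> as a function of the squared radius;
  \<open>2 * d\<close> is the variance of the squared radius.\<close>

definition hc :: "real \<Rightarrow> real" where "hc y = (y - d) / sqrt (2 * d)"

lemma hc_measurable [measurable]: "hc \<in> borel_measurable borel"
  unfolding hc_def by measurable

lemma XV_law:
  assumes "0 \<le> t"
  shows "(\<lambda>\<omega>. (X t \<omega>, V t \<omega>)) \<in> M \<rightarrow>\<^sub>M Rd d \<Otimes>\<^sub>M Rd d"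
    "distr M (Rd d \<Otimes>\<^sub>M Rd d) (\<lambda>\<omega>. (X t \<omega>, V t \<omega>)) = gauss_law d \<Otimes>\<^sub>M sphere_unif d"
proof -
  show "(\<lambda>\<omega>. (X t \<omega>, V t \<omega>)) \<in> M \<rightarrow>\<^sub>M Rd d \<Otimes>\<^sub>M Rd d"
    using assms by (intro measurable_Pair XV_measurable_at) auto
  show "distr M (Rd d \<Otimes>\<^sub>M Rd d) (\<lambda>\<omega>. (X t \<omega>, V t \<omega>)) = gauss_law d \<Otimes>\<^sub>M sphere_unif d"
    using stationary[OF assms] unfolding state_law_def .
qed

lemma sphere: "prob_space (sphere_unif d)" "sets (sphere_unif d) = sets (Rd d)"
proof -
  show "prob_space (sphere_unif d)" using d by (intro sphere_unif_prob) simp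
  show "sets (sphere_unif d) = sets (Rd d)" by (simp add: sphere_unif_def)
qed

lemma X_law:
  assumes "0 \<le> t" shows "distr M (Rd d) (X t) = gauss_law d"
proof -
  interpret S: prob_space "sphere_unif d" by (rule sphere)
  have "gauss_law d = distr (gauss_law d \<Otimes>\<^sub>M sphere_unif d) (gauss_law d) fst"
    by (rule S.distr_pair_fst[symmetric])
  also have "\<dots> = distr (distr M (Rd d \<Otimes>\<^sub>M Rd d) (\<lambda>\<omega>. (X t \<omega>, V t \<omega>))) (Rd d) fst"
    unfolding XV_law(2)[OF assms] by (rule distr_cong) auto
  also have "\<dots> = distr M (Rd d) (X t)"
    by (subst distr_distr[OF _ XV_law(1)[OF assms]]) (auto simp: comp_def)
  finally show ?thesis ..
qed

text \<open>For a fixed unit vector the inner product with a Gaussian vector is standard normal,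
  whatever the vector, so integrating over the direction changes nothing.\<close>

lemma G_law: "distr M borel (Gt t) = std_normal_distribution"
proof (rule measure_eqI)
  interpret S: prob_space "sphere_unif d" by (rule sphere)
  interpret P: prob_space "gauss_law d" by (rule gauss_law_prob)
  interpret PS: pair_sigma_finite "gauss_law d" "sphere_unif d" ..
  note [measurable_cong] = sphere(2)
  let ?t = "max 0 t"
  have t: "0 \<le> ?t" by simp
  fix E assume "E \<in> sets (distr M borel (Gt t))"
  then have E[measurable]: "E \<in> sets borel" by simp
  have ipm: "(\<lambda>p. ip d (fst p) (snd p)) \<in> borel_measurable (gauss_law d \<Otimes>\<^sub>M sphere_unif d)"
    by (rule measurable_ip) measurable
  have vm: "(\<lambda>p. vnorm d (snd p)) \<in> borel_measurable (Rd d \<Otimes>\<^sub>M Rd d)"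
    by (rule measurable_vnorm) measurable
  \<comment> \<open>That the direction is almost surely a unit vector is read off from the process,
    whose velocities lie on the sphere and have this law.\<close>
  have "AE p in distr M (Rd d \<Otimes>\<^sub>M Rd d) (\<lambda>\<omega>. (X ?t \<omega>, V ?t \<omega>)). vnorm d (snd p) = 1"
    using V_unit[OF t] vm by (subst AE_distr_iff[OF XV_law(1)[OF t]]) (auto simp: unit_sphere_def intro!: AE_I2)
  then have "AE p in gauss_law d \<Otimes>\<^sub>M sphere_unif d. vnorm d (snd p) = 1" unfolding XV_law(2)[OF t] .
  from PS.AE_pair[OF this] have "AE x in gauss_law d. AE v in sphere_unif d. vnorm d v = 1" by simp
  then have "\<exists>x. AE v in sphere_unif d. vnorm d v = 1"
    using P.AE_False by (metis (no_types, lifting) AE_mp eventually_mono)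
  then have AE: "AE v in sphere_unif d. vnorm d v = 1" by simp
  have "emeasure (distr M borel (Gt t)) E = (\<integral>\<^sup>+\<omega>. indicator E (ip d (X ?t \<omega>) (V ?t \<omega>)) \<partial>M)"
    by (subst nn_integral_indicator[symmetric], simp, subst nn_integral_distr) (auto simp: Gt_def G_def)
  also have "\<dots> = (\<integral>\<^sup>+p. indicator E (ip d (fst p) (snd p)) \<partial>distr M (Rd d \<Otimes>\<^sub>M Rd d) (\<lambda>\<omega>. (X ?t \<omega>, V ?t \<omega>)))"
    by (subst nn_integral_distr[OF XV_law(1)[OF t]]) (auto intro!: measurable_compose[OF measurable_ip])
  also have "\<dots> = (\<integral>\<^sup>+p. indicator E (ip d (fst p) (snd p)) \<partial>(gauss_law d \<Otimes>\<^sub>M sphere_unif d))"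
    unfolding XV_law(2)[OF t] ..
  also have "\<dots> = (\<integral>\<^sup>+v. \<integral>\<^sup>+x. indicator E (ip d x v) \<partial>gauss_law d \<partial>sphere_unif d)"
    using measurable_compose[OF ipm, of "indicator E"] by (subst PS.nn_integral_snd[symmetric]) (auto simp: split_def)
  also have "\<dots> = (\<integral>\<^sup>+v. emeasure std_normal_distribution E \<partial>sphere_unif d)"
  proof (rule nn_integral_cong_AE)
    show "AE v in sphere_unif d. (\<integral>\<^sup>+x. indicator E (ip d x v) \<partial>gauss_law d) = emeasure std_normal_distribution E"
      using AE AE_space
    proof eventually_elim
      case (elim v)
      have "v \<in> space (Rd d)" using elim(2) sets_eq_imp_space_eq[OF sphere(2)] by simp
      then have [measurable]: "(\<lambda>x. ip d x v) \<in> borel_measurable (gauss_law d)" by (intro measurable_ip) auto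
      have "(\<integral>\<^sup>+x. indicator E (ip d x v) \<partial>gauss_law d) = (\<integral>\<^sup>+z. indicator E z \<partial>distr (gauss_law d) borel (\<lambda>x. ip d x v))"
        by (subst nn_integral_distr) auto
      then show ?case unfolding gauss_law_ip[OF elim(1)] by simp
    qed
  qed
  also have "\<dots> = emeasure std_normal_distribution E" by (simp add: S.emeasure_space_1)
  finally show "emeasure (distr M borel (Gt t)) E = emeasure std_normal_distribution E" .
qed simp

lemma expectation_G:
  fixes f :: "real \<Rightarrow> real"
  assumes [measurable]: "f \<in> borel_measurable borel"
  shows "expectation (\<lambda>\<omega>. f (Gt t \<omega>)) = (\<integral>z. std_normal_density z * f z \<partial>lborel)"
    "integrable M (\<lambda>\<omega>. f (Gt t \<omega>)) \<longleftrightarrow> integrable lborel (\<lambda>z. std_normal_density z * f z)"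
proof -
  have m: "Gt t \<in> borel_measurable M" by measurable
  have "expectation (\<lambda>\<omega>. f (Gt t \<omega>)) = (\<integral>z. f z \<partial>distr M borel (Gt t))"
    by (rule integral_distr[OF m, symmetric]) measurable
  then show "expectation (\<lambda>\<omega>. f (Gt t \<omega>)) = (\<integral>z. std_normal_density z * f z \<partial>lborel)"
    unfolding G_law by (subst (asm) integral_density) auto
  have "integrable M (\<lambda>\<omega>. f (Gt t \<omega>)) \<longleftrightarrow> integrable (distr M borel (Gt t)) f"
    by (rule integrable_distr_eq[OF m, symmetric]) measurable
  then show "integrable M (\<lambda>\<omega>. f (Gt t \<omega>)) \<longleftrightarrow> integrable lborel (\<lambda>z. std_normal_density z * f z)"
    unfolding G_law by (subst (asm) integrable_density) auto
qed

lemma expectation_Y: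
  fixes f :: "real \<Rightarrow> real"
  assumes [measurable]: "f \<in> borel_measurable borel"
  shows "expectation (\<lambda>\<omega>. f (Yt t \<omega>)) = (\<integral>x. f (ip d x x) \<partial>gauss_law d)"
    "integrable M (\<lambda>\<omega>. f (Yt t \<omega>)) \<longleftrightarrow> integrable (gauss_law d) (\<lambda>x. f (ip d x x))"
proof -
  have m: "X (max 0 t) \<in> M \<rightarrow>\<^sub>M Rd d" by (intro XV_measurable_at) auto
  have fm: "(\<lambda>x. f (ip d x x)) \<in> borel_measurable (Rd d)"
    by (rule measurable_compose[OF measurable_ip assms]) auto
  show "expectation (\<lambda>\<omega>. f (Yt t \<omega>)) = (\<integral>x. f (ip d x x) \<partial>gauss_law d)"
    unfolding Yt_def Y_def X_law[of "max 0 t", simplified, symmetric] by (rule integral_distr[OF m fm, symmetric])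
  show "integrable M (\<lambda>\<omega>. f (Yt t \<omega>)) \<longleftrightarrow> integrable (gauss_law d) (\<lambda>x. f (ip d x x))"
    unfolding Yt_def Y_def X_law[of "max 0 t", simplified, symmetric] by (rule integrable_distr_eq[OF m fm, symmetric])
qed

lemma Y_moments: "integrable M (\<lambda>\<omega>. (1 + Yt t \<omega>) ^ m)"
  by (subst expectation_Y(2)[of "\<lambda>y. (1 + y) ^ m"]) (auto intro: gauss_law_norm_power_integrable)

lemma hc_moments:
  "expectation (\<lambda>\<omega>. hc (Yt t \<omega>)) = 0" "expectation (\<lambda>\<omega>. (hc (Yt t \<omega>))\<^sup>2) = 1" "expectation (\<lambda>\<omega>. hc (Yt t \<omega>) ^ 4) \<le> 18"
  "integrable M (\<lambda>\<omega>. hc (Yt t \<omega>))" "integrable M (\<lambda>\<omega>. (hc (Yt t \<omega>))\<^sup>2)" "integrable M (\<lambda>\<omega>. hc (Yt t \<omega>) ^ 4)"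
  using gauss_law_norm_moments[OF d, folded hc_def]
    expectation_Y[of hc t] expectation_Y[of "\<lambda>y. (hc y)\<^sup>2" t] expectation_Y[of "\<lambda>y. hc y ^ 4" t] by simp_all

lemma G_moments:
  "integrable M (\<lambda>\<omega>. Gt t \<omega> ^ k)" "expectation (\<lambda>\<omega>. Gt t \<omega>) = 0" "expectation (\<lambda>\<omega>. (Gt t \<omega>)\<^sup>2) = 1"
  "expectation (\<lambda>\<omega>. Gt t \<omega> ^ 4) = 3" "expectation (\<lambda>\<omega>. Gt t \<omega> ^ 8) = 105"
  using expectation_G(2)[of "\<lambda>z. z ^ k" t] integrable_std_normal_moment[of k]
    expectation_G(1)[of "\<lambda>z. z" t] integral_std_normal_moment_odd[of 0]
    expectation_G(1)[of "\<lambda>z. z\<^sup>2" t] integral_std_normal_moment_even[of 1]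
    expectation_G(1)[of "\<lambda>z. z ^ 4" t] integral_std_normal_moment_even[of 2]
    expectation_G(1)[of "\<lambda>z. z ^ 8" t] integral_std_normal_moment_even[of 4]
  by (simp_all add: fact_numeral)

end

section \<open>Correlations with an additive functional\<close>

lemma resample_const: "resample d (\<lambda>g. c) y = c"
  using rayleigh.prob_space by (simp add: resample_def)

lemma resample_mult: "resample d (\<lambda>g. c * F g) y = c * resample d F y"
  by (simp add: resample_def)

locale fecmc_observable = fecmc_functional M d \<nu> X V \<tau> a I Ca ka + fecmc_stationary M d \<nu> X V \<tau>
  for M :: "'a measure" and d \<nu> X V \<tau> a I Ca ka +
  assumes a_mean: "\<And>t. expectation (\<lambda>\<omega>. a (Yt t \<omega>) (Gt t \<omega>)) = 0"
    and a_sq: "\<And>t. expectation (\<lambda>\<omega>. (a (Yt t \<omega>) (Gt t \<omega>))\<^sup>2) = 1"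
begin

lemma poly_integrable:
  assumes [measurable]: "F \<in> borel_measurable M" and s: "0 \<le> s"
    and F: "\<And>\<omega>. good \<omega> \<Longrightarrow> \<bar>F \<omega>\<bar> \<le> C * (1 + (A s \<omega>)\<^sup>2) * (1 + Yt s \<omega>) ^ k"
  shows "integrable M F"
proof (rule Bochner_Integration.integrable_bound)
  let ?B = "\<lambda>\<omega>. \<bar>C\<bar> * W s \<omega> ^ k + \<bar>C\<bar> * (s * Ca)\<^sup>2 * W s \<omega> ^ (2 * ka + k)"
  show "integrable M ?B"
    by (intro Bochner_Integration.integrable_add integrable_mult_right integrable_W_power)
  show "AE \<omega> in M. norm (F \<omega>) \<le> norm (?B \<omega>)"
    using AE_good
  proof eventually_elim
    case (elim \<omega>)
    have "\<bar>A s \<omega>\<bar> \<le> \<bar>s * Ca * W s \<omega> ^ ka\<bar>" using A_bound[OF elim s order_refl] by linarith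
    then have A2: "(A s \<omega>)\<^sup>2 \<le> (s * Ca * W s \<omega> ^ ka)\<^sup>2" by (simp only: abs_le_square_iff)
    have "\<bar>F \<omega>\<bar> \<le> C * (1 + (A s \<omega>)\<^sup>2) * (1 + Yt s \<omega>) ^ k" by (rule F[OF elim])
    also have "\<dots> \<le> \<bar>C\<bar> * (1 + (A s \<omega>)\<^sup>2) * (1 + Yt s \<omega>) ^ k"
      using Yt_nonneg[of s \<omega>] by (intro mult_right_mono) auto
    also have "\<dots> \<le> \<bar>C\<bar> * (1 + (s * Ca * W s \<omega> ^ ka)\<^sup>2) * W s \<omega> ^ k"
    proof -
      have "1 + Yt s \<omega> \<le> W s \<omega>" using one_plus_Yt_le[OF elim s order_refl] by (simp add: W_def)
      then show ?thesis using Yt_nonneg[of s \<omega>]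
        by (intro mult_mono[OF mult_left_mono[OF add_left_mono[OF A2]]] power_mono) auto
    qed
    also have "\<dots> = ?B \<omega>"
    proof -
      have "c * (1 + (e * w ^ ka)\<^sup>2) * w ^ k = c * w ^ k + c * e\<^sup>2 * w ^ (2 * ka + k)" for c e w :: real
        by (simp add: power_add power_even_eq power_mult_distrib distrib_left distrib_right)
      then show ?thesis .
    qed
    finally show ?case unfolding real_norm_def by (rule order_trans[OF _ abs_ge_self])
  qed
qed measurable

lemma A_sq_integrable: "0 \<le> t \<Longrightarrow> integrable M (\<lambda>\<omega>. (A t \<omega>)\<^sup>2)"
  by (rule poly_integrable[where s=t and C=1 and k=0]) auto

lemma a_sq_pair_integrable: "integrable (M \<Otimes>\<^sub>M lborel) (\<lambda>p. indicator {0..t} (snd p) * (a (Yt (snd p) (fst p)) (Gt (snd p) (fst p)))\<^sup>2)"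
  and a_pair_integrable: "integrable (M \<Otimes>\<^sub>M lborel) (\<lambda>p. indicator {0..t} (snd p) * a (Yt (snd p) (fst p)) (Gt (snd p) (fst p)))"
proof -
  have W2: "integrable M (\<lambda>\<omega>. (Ca * W t \<omega> ^ ka)\<^sup>2)"
    unfolding power_mult_distrib power_mult[symmetric] by (intro integrable_mult_right integrable_W_power)
  have W1: "integrable M (\<lambda>\<omega>. Ca * W t \<omega> ^ ka)" by (intro integrable_mult_right integrable_W_power)
  have bd: "AE \<omega> in M. \<forall>s. \<bar>indicator {0..t} s * (a (Yt s \<omega>) (Gt s \<omega>))\<^sup>2\<bar> \<le> \<bar>indicator {0..t} s\<bar> * \<bar>(Ca * W t \<omega> ^ ka)\<^sup>2\<bar>"
    using AE_good
  proof eventually_elim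
    case (elim \<omega>)
    have "(a (Yt s \<omega>) (Gt s \<omega>))\<^sup>2 \<le> (Ca * W t \<omega> ^ ka)\<^sup>2" if "0 \<le> s" "s \<le> t" for s
      using order_trans[OF a_path_bound[OF elim that] abs_ge_self] by (simp only: abs_le_square_iff)
    then show ?case by (auto simp: indicator_def)
  qed
  have bd1: "AE \<omega> in M. \<forall>s. \<bar>indicator {0..t} s * a (Yt s \<omega>) (Gt s \<omega>)\<bar> \<le> \<bar>indicator {0..t} s\<bar> * \<bar>Ca * W t \<omega> ^ ka\<bar>"
    using AE_good
  proof eventually_elim
    case (elim \<omega>)
    show ?case using order_trans[OF a_path_bound[OF elim] abs_ge_self] by (auto simp: indicator_def)
  qed
  show "integrable (M \<Otimes>\<^sub>M lborel) (\<lambda>p. indicator {0..t} (snd p) * (a (Yt (snd p) (fst p)) (Gt (snd p) (fst p)))\<^sup>2)"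
    by (rule integrable_pair_dominated[OF lborel.sigma_finite_measure_axioms _ W2 integrable_indicator_Icc]) (use bd in auto)
  show "integrable (M \<Otimes>\<^sub>M lborel) (\<lambda>p. indicator {0..t} (snd p) * a (Yt (snd p) (fst p)) (Gt (snd p) (fst p)))"
    by (rule integrable_pair_dominated[OF lborel.sigma_finite_measure_axioms _ W1 integrable_indicator_Icc]) (use bd1 in auto)
qed

lemma A_mean: "expectation (A t) = 0"
proof -
  interpret PL: pair_sigma_finite M lborel ..
  have "expectation (A t) = (\<integral>s. \<integral>\<omega>. indicator {0..t} s * a (Yt s \<omega>) (Gt s \<omega>) \<partial>M \<partial>lborel)"
    unfolding A_def by (rule PL.Fubini_integral[symmetric]) (use a_pair_integrable in \<open>simp add: split_def\<close>)
  also have "\<dots> = 0" by (simp add: a_mean)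
  finally show ?thesis .
qed

text \<open>Path by path, the square of a time integral is at most \<open>t\<close> times the
  integral of the square, from the nonnegativity of the empirical variance over time. By
  stationarity the integrand then has mean 1.\<close>

lemma A_sq_le:
  assumes t: "0 \<le> t" shows "expectation (\<lambda>\<omega>. (A t \<omega>)\<^sup>2) \<le> t\<^sup>2"
proof (cases "t = 0")
  case True
  then show ?thesis by (simp add: A_0)
next
  case False
  then have t: "0 < t" using t by simp
  interpret PL: pair_sigma_finite M lborel ..
  let ?a2 = "\<lambda>\<omega>. \<integral>s. indicator {0..t} s * (a (Yt s \<omega>) (Gt s \<omega>))\<^sup>2 \<partial>lborel"
  have int2: "integrable M ?a2"
    using PL.integrable_fst'[OF a_sq_pair_integrable] by simp
  have "expectation (\<lambda>\<omega>. (A t \<omega>)\<^sup>2) \<le> expectation (\<lambda>\<omega>. t * ?a2 \<omega>)"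
  proof (rule integral_mono_AE)
    show "integrable M (\<lambda>\<omega>. t * ?a2 \<omega>)" using int2 by simp
    have "AE \<omega> in M. integrable lborel (\<lambda>s. indicator {0..t} s * (a (Yt s \<omega>) (Gt s \<omega>))\<^sup>2)"
      using PL.AE_integrable_fst'[OF a_sq_pair_integrable] by simp
    then show "AE \<omega> in M. (A t \<omega>)\<^sup>2 \<le> t * ?a2 \<omega>"
      using AE_good
    proof eventually_elim
      case (elim \<omega>)
      let ?a = "\<lambda>s. a (Yt s \<omega>) (Gt s \<omega>)" and ?c = "A t \<omega> / t"
      have "0 \<le> (\<integral>s. indicator {0..t} s * (?a s - ?c)\<^sup>2 \<partial>lborel)" by (intro integral_nonneg_AE AE_I2) auto
      also have "\<dots> = (\<integral>s. indicator {0..t} s * (?a s)\<^sup>2 - 2 * ?c * (indicator {0..t} s * ?a s) + ?c\<^sup>2 * indicator {0..t} s \<partial>lborel)"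
        by (intro Bochner_Integration.integral_cong refl) (simp add: power2_diff algebra_simps)
      also have "\<dots> = ?a2 \<omega> - 2 * ?c * A t \<omega> + ?c\<^sup>2 * t"
        using elim(1) a_path_integrable[OF elim(2), of t] t unfolding A_def by simp
      also have "\<dots> = ?a2 \<omega> - (A t \<omega>)\<^sup>2 / t" using t by (simp add: power2_eq_square field_simps)
      finally show ?case using t by (simp add: field_simps)
    qed
  qed (use A_sq_integrable t in auto)
  also have "\<dots> = t * (\<integral>s. \<integral>\<omega>. indicator {0..t} s * (a (Yt s \<omega>) (Gt s \<omega>))\<^sup>2 \<partial>M \<partial>lborel)"
    using PL.Fubini_integral[of "\<lambda>\<omega> s. indicator {0..t} s * (a (Yt s \<omega>) (Gt s \<omega>))\<^sup>2"] a_sq_pair_integrable by (simp add: split_def)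
  also have "\<dots> = t\<^sup>2" using t by (simp add: a_sq) (simp add: power2_eq_square)
  finally show ?thesis .
qed

text \<open>The estimate that absorbs all errors: a generator error with L2 norm \<open>q\<close>
  contributes at most \<open>t * q\<close> to a correlation with the functional at time
  \<open>t\<close>.\<close>

lemma A_mult_le:
  assumes [measurable]: "F \<in> borel_measurable M" and "0 \<le> t" "integrable M (\<lambda>\<omega>. (F \<omega>)\<^sup>2)" "expectation (\<lambda>\<omega>. (F \<omega>)\<^sup>2) \<le> q\<^sup>2" "0 \<le> q"
  shows "integrable M (\<lambda>\<omega>. A t \<omega> * F \<omega>)" "\<bar>expectation (\<lambda>\<omega>. A t \<omega> * F \<omega>)\<bar> \<le> t * q"
  by (rule expectation_mult_le(1)[OF _ assms(1) A_sq_integrable[OF assms(2)] assms(3) A_sq_le[OF assms(2)] assms(4,2,5)],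
      measurable)
    (rule expectation_mult_le(2)[OF _ assms(1) A_sq_integrable[OF assms(2)] assms(3) A_sq_le[OF assms(2)] assms(4,2,5)],
      measurable)

text \<open>Dynkin's formula for the square of the functional. The functional itself does not jump,
  so the jump part is zero.\<close>

lemma A_sq_eq:
  assumes t: "0 \<le> t"
  shows "expectation (\<lambda>\<omega>. (A t \<omega>)\<^sup>2) = (\<integral>s. indicator {0..t} s * (2 * expectation (\<lambda>\<omega>. A s \<omega> * a (Yt s \<omega>) (Gt s \<omega>))) \<partial>lborel)"
proof -
  have I_along: "((\<lambda>u. I y g u) has_real_derivative a (y + 2 * g * u + u\<^sup>2) (g + u)) (at u)" for y g u by (rule I_deriv)
  have I_cont: "isCont (\<lambda>u. I y g u) u" for y g u by (rule DERIV_isCont[OF I_along])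
  have "expectation (\<lambda>\<omega>. (A t \<omega>)\<^sup>2) - expectation (\<lambda>\<omega>. 0\<^sup>2) =
    (\<integral>s. indicator {0..t} s * expectation (\<lambda>\<omega>. 2 * A s \<omega> * a (Yt s \<omega>) (Gt s \<omega>) + max (Gt s \<omega>) 0 *
      (resample d (\<lambda>g. (A s \<omega>)\<^sup>2) (Yt s \<omega>) - (A s \<omega>)\<^sup>2)) \<partial>lborel)"
  proof (rule dynkin[where \<Psi>="\<lambda>s x y g. x\<^sup>2" and D="\<lambda>s x y g. 2 * x * a y g" and C="1 + Ca" and k=ka, OF t])
    show "\<bar>x\<^sup>2\<bar> \<le> (1 + Ca) * (1 + x\<^sup>2) * (1 + y) ^ ka" if "g\<^sup>2 \<le> y" for x y g :: real
    proof -
      have y: "0 \<le> y" using that zero_le_power2 order_trans by blast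
      have "1 * (1 + x\<^sup>2) * 1 \<le> (1 + Ca) * (1 + x\<^sup>2) * (1 + y) ^ ka"
        using y Ca_nonneg by (intro mult_mono one_le_power) auto
      then show ?thesis by simp
    qed
    show "\<bar>2 * x * a y g\<bar> \<le> (1 + Ca) * (1 + x\<^sup>2) * (1 + y) ^ ka" if "g\<^sup>2 \<le> y" for x y g :: real
    proof -
      have y: "0 \<le> y" using that zero_le_power2 order_trans by blast
      have "0 \<le> (\<bar>x\<bar> - 1)\<^sup>2" by simp
      then have "2 * \<bar>x\<bar> \<le> 1 + x\<^sup>2" by (simp add: power2_diff)
      then have "\<bar>2 * x\<bar> * \<bar>a y g\<bar> \<le> (1 + x\<^sup>2) * (Ca * (1 + y) ^ ka)"
        using a_bound[OF that] by (intro mult_mono) auto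
      also have "\<dots> \<le> (1 + Ca) * (1 + x\<^sup>2) * (1 + y) ^ ka" using y by (simp add: algebra_simps)
      finally show ?thesis by (simp add: abs_mult)
    qed
    show "((\<lambda>u. (x + I y g u)\<^sup>2) has_real_derivative 2 * (x + I y g u) * a (y + 2 * g * u + u\<^sup>2) (g + u)) (at u)" for x y g u
      by (auto intro!: derivative_eq_intros I_along)
    show "isCont (\<lambda>u. 2 * (x + I y g u) * a (y + 2 * g * u + u\<^sup>2) (g + u)) u" for x y g u
      by (intro continuous_intros I_cont a_cont)
  qed measurable
  then show ?thesis by (simp add: resample_const mult.assoc)
qed

text \<open>Dynkin's formula for the product of the functional and \<open>f\<close>. The functional
  moves only by \<open>a\<close> and factors out of the jump part, which leaves the source
  \<open>a * f\<close> and the generator of \<open>f\<close> weighted by the functional. There is no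
  initial term because the functional starts at 0.\<close>

lemma dynkin_mult:
  assumes t: "0 \<le> t"
    and f_m: "(\<lambda>p. f (fst p) (fst (snd p)) (snd (snd p))) \<in> borel_measurable (borel \<Otimes>\<^sub>M borel \<Otimes>\<^sub>M borel)"
    and Df_m: "(\<lambda>p. Df (fst p) (fst (snd p)) (snd (snd p))) \<in> borel_measurable (borel \<Otimes>\<^sub>M borel \<Otimes>\<^sub>M borel)"
    and f_b: "\<And>s y g. 0 \<le> s \<Longrightarrow> s \<le> t \<Longrightarrow> g\<^sup>2 \<le> y \<Longrightarrow> \<bar>f s y g\<bar> \<le> C * (1 + y) ^ k"
    and Df_b: "\<And>s y g. 0 \<le> s \<Longrightarrow> s \<le> t \<Longrightarrow> g\<^sup>2 \<le> y \<Longrightarrow> \<bar>Df s y g\<bar> \<le> C * (1 + y) ^ k"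
    and f_d: "\<And>s y g u. ((\<lambda>u. f (s + u) (y + 2 * g * u + u\<^sup>2) (g + u)) has_real_derivative
        Df (s + u) (y + 2 * g * u + u\<^sup>2) (g + u)) (at u)"
    and Df_c: "\<And>s y g u. isCont (\<lambda>u. Df (s + u) (y + 2 * g * u + u\<^sup>2) (g + u)) u"
  shows "expectation (\<lambda>\<omega>. A t \<omega> * f t (Yt t \<omega>) (Gt t \<omega>)) =
    (\<integral>s. indicator {0..t} s * (expectation (\<lambda>\<omega>. a (Yt s \<omega>) (Gt s \<omega>) * f s (Yt s \<omega>) (Gt s \<omega>)) +
      expectation (\<lambda>\<omega>. A s \<omega> * (Df s (Yt s \<omega>) (Gt s \<omega>) + max (Gt s \<omega>) 0 *
         (resample d (f s (Yt s \<omega>)) (Yt s \<omega>) - f s (Yt s \<omega>) (Gt s \<omega>))))) \<partial>lborel)"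
proof -
  have fm[measurable]: "(\<lambda>x. f (p x) (q x) (r x)) \<in> borel_measurable N" "(\<lambda>x. Df (p x) (q x) (r x)) \<in> borel_measurable N"
    if "p \<in> borel_measurable N" "q \<in> borel_measurable N" "r \<in> borel_measurable N" for p q r N
    using measurable_compose[OF measurable_Pair[OF that(1) measurable_Pair[OF that(2,3)]] f_m]
      measurable_compose[OF measurable_Pair[OF that(1) measurable_Pair[OF that(2,3)]] Df_m] by simp_all
  have I_cont: "isCont (\<lambda>u. I y g u) u" for y g u by (rule DERIV_isCont[OF I_deriv])
  have f_cont: "isCont (\<lambda>u. f (s + u) (y + 2 * g * u + u\<^sup>2) (g + u)) u" for s y g u by (rule DERIV_isCont[OF f_d])
  have C: "0 \<le> C" using f_b[of 0 0 0] t by simp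
  define C' where "C' = C * (1 + Ca)"
  have C': "C \<le> C'" unfolding C'_def using C Ca_nonneg mult_left_mono[of 1 "1 + Ca" C] by simp
  define k' where "k' = ka + k"
  have xf: "\<bar>x * f s y g\<bar> \<le> C' * (1 + x\<^sup>2) * (1 + y) ^ k'"
    and Dxf: "\<bar>a y g * f s y g + x * Df s y g\<bar> \<le> C' * (1 + x\<^sup>2) * (1 + y) ^ k'"
    and af: "\<bar>a y g * f s y g\<bar> \<le> C' * (1 + x\<^sup>2) * (1 + y) ^ k'"
    if s: "0 \<le> s" "s \<le> t" and g: "g\<^sup>2 \<le> y" for x s y g
  proof -
    have y: "0 \<le> y" using g zero_le_power2 order_trans by blast
    have x: "\<bar>x\<bar> \<le> 1 + x\<^sup>2"
    proof -
      have "0 \<le> (\<bar>x\<bar> - 1)\<^sup>2" by simp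
      then show ?thesis by (simp add: power2_diff)
    qed
    have yk: "1 \<le> (1 + y) ^ ka" using y by (intro one_le_power) simp
    have pk: "(1 + y) ^ k \<le> (1 + y) ^ k'" using y unfolding k'_def by (intro power_increasing) auto
    have "\<bar>x\<bar> * \<bar>f s y g\<bar> \<le> (1 + x\<^sup>2) * (C * (1 + y) ^ k)" using f_b[OF s g] x by (intro mult_mono) auto
    also have le: "(1 + x\<^sup>2) * (C * (1 + y) ^ k) \<le> (1 + x\<^sup>2) * (C * (1 + y) ^ k')" using pk C by (intro mult_left_mono) auto
    also have "\<dots> \<le> (1 + x\<^sup>2) * (C' * (1 + y) ^ k')" using C' y by (intro mult_left_mono mult_right_mono) auto
    finally show "\<bar>x * f s y g\<bar> \<le> C' * (1 + x\<^sup>2) * (1 + y) ^ k'" by (simp add: abs_mult mult_ac)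
    have "\<bar>a y g\<bar> * \<bar>f s y g\<bar> \<le> (Ca * (1 + y) ^ ka) * (C * (1 + y) ^ k)"
      using a_bound[OF g] f_b[OF s g] by (intro mult_mono) auto
    also have "\<dots> = Ca * C * (1 + y) ^ k'" by (simp add: k'_def power_add)
    also have "\<dots> \<le> (1 + x\<^sup>2) * (Ca * C * (1 + y) ^ k')" using mult_right_mono[of 1 "1 + x\<^sup>2" "Ca * C * (1 + y) ^ k'"] Ca_nonneg C y by simp
    finally have 1: "\<bar>a y g\<bar> * \<bar>f s y g\<bar> \<le> (1 + x\<^sup>2) * (Ca * C * (1 + y) ^ k')" .
    have "\<bar>x\<bar> * \<bar>Df s y g\<bar> \<le> (1 + x\<^sup>2) * (C * (1 + y) ^ k)" using Df_b[OF s g] x by (intro mult_mono) auto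
    also note le
    finally have 2: "\<bar>x\<bar> * \<bar>Df s y g\<bar> \<le> (1 + x\<^sup>2) * (C * (1 + y) ^ k')" .
    have "\<bar>a y g * f s y g + x * Df s y g\<bar> \<le> \<bar>a y g\<bar> * \<bar>f s y g\<bar> + \<bar>x\<bar> * \<bar>Df s y g\<bar>"
      by (metis abs_mult abs_triangle_ineq)
    also have "\<dots> \<le> (1 + x\<^sup>2) * (Ca * C * (1 + y) ^ k') + (1 + x\<^sup>2) * (C * (1 + y) ^ k')" using 1 2 by linarith
    also have "\<dots> = C' * (1 + x\<^sup>2) * (1 + y) ^ k'" by (simp add: C'_def algebra_simps)
    finally show "\<bar>a y g * f s y g + x * Df s y g\<bar> \<le> C' * (1 + x\<^sup>2) * (1 + y) ^ k'" .
    have "0 \<le> (1 + x\<^sup>2) * (C * (1 + y) ^ k')" using C y by simp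
    then have "\<bar>a y g\<bar> * \<bar>f s y g\<bar> \<le> (1 + x\<^sup>2) * (Ca * C * (1 + y) ^ k') + (1 + x\<^sup>2) * (C * (1 + y) ^ k')" using 1 by linarith
    also have "\<dots> = C' * (1 + x\<^sup>2) * (1 + y) ^ k'" by (simp add: C'_def algebra_simps)
    finally show "\<bar>a y g * f s y g\<bar> \<le> C' * (1 + x\<^sup>2) * (1 + y) ^ k'" by (simp add: abs_mult)
  qed
  have D: "expectation (\<lambda>\<omega>. A t \<omega> * f t (Yt t \<omega>) (Gt t \<omega>)) - expectation (\<lambda>\<omega>. 0 * f 0 (Yt 0 \<omega>) (Gt 0 \<omega>)) =
    (\<integral>s. indicator {0..t} s * expectation (\<lambda>\<omega>. (a (Yt s \<omega>) (Gt s \<omega>) * f s (Yt s \<omega>) (Gt s \<omega>) + A s \<omega> * Df s (Yt s \<omega>) (Gt s \<omega>)) + max (Gt s \<omega>) 0 *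
      (resample d (\<lambda>g. A s \<omega> * f s (Yt s \<omega>) g) (Yt s \<omega>) - A s \<omega> * f s (Yt s \<omega>) (Gt s \<omega>))) \<partial>lborel)"
  proof (rule dynkin[where \<Psi>="\<lambda>s x y g. x * f s y g" and D="\<lambda>s x y g. a y g * f s y g + x * Df s y g" and C=C' and k=k', OF t])
    show "((\<lambda>u. (x + I y g u) * f (s + u) (y + 2 * g * u + u\<^sup>2) (g + u)) has_real_derivative
       a (y + 2 * g * u + u\<^sup>2) (g + u) * f (s + u) (y + 2 * g * u + u\<^sup>2) (g + u) + (x + I y g u) * Df (s + u) (y + 2 * g * u + u\<^sup>2) (g + u)) (at u)" for s x y g u
    proof -
      have "((\<lambda>u. x + I y g u) has_real_derivative a (y + 2 * g * u + u\<^sup>2) (g + u)) (at u)"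
        using DERIV_add[OF DERIV_const I_deriv] by simp
      from DERIV_mult[OF this f_d[of s y g u]] show ?thesis by (rule DERIV_cong) simp
    qed
    show "isCont (\<lambda>u. a (y + 2 * g * u + u\<^sup>2) (g + u) * f (s + u) (y + 2 * g * u + u\<^sup>2) (g + u) + (x + I y g u) * Df (s + u) (y + 2 * g * u + u\<^sup>2) (g + u)) u" for s x y g u
      by (intro continuous_intros I_cont a_cont f_cont Df_c)
  qed (use xf Dxf in measurable)
  have split: "expectation (\<lambda>\<omega>. (a (Yt s \<omega>) (Gt s \<omega>) * f s (Yt s \<omega>) (Gt s \<omega>) + A s \<omega> * Df s (Yt s \<omega>) (Gt s \<omega>)) + max (Gt s \<omega>) 0 *
      (resample d (\<lambda>g. A s \<omega> * f s (Yt s \<omega>) g) (Yt s \<omega>) - A s \<omega> * f s (Yt s \<omega>) (Gt s \<omega>)))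
    = expectation (\<lambda>\<omega>. a (Yt s \<omega>) (Gt s \<omega>) * f s (Yt s \<omega>) (Gt s \<omega>)) +
      expectation (\<lambda>\<omega>. A s \<omega> * (Df s (Yt s \<omega>) (Gt s \<omega>) + max (Gt s \<omega>) 0 *
         (resample d (f s (Yt s \<omega>)) (Yt s \<omega>) - f s (Yt s \<omega>) (Gt s \<omega>))))" if s: "0 \<le> s" "s \<le> t" for s
  proof -
    have [measurable]: "(\<lambda>\<omega>. resample d (f s (Yt s \<omega>)) (Yt s \<omega>)) \<in> borel_measurable M"
      by (rule resample_measurable) measurable
    have i1: "integrable M (\<lambda>\<omega>. a (Yt s \<omega>) (Gt s \<omega>) * f s (Yt s \<omega>) (Gt s \<omega>))"
      by (rule poly_integrable[OF _ s(1), where C=C' and k=k'], measurable)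
        (rule af[OF s Gt_sq_le[OF good_space]])
    have i2: "integrable M (\<lambda>\<omega>. A s \<omega> * (Df s (Yt s \<omega>) (Gt s \<omega>) + max (Gt s \<omega>) 0 *
         (resample d (f s (Yt s \<omega>)) (Yt s \<omega>) - f s (Yt s \<omega>) (Gt s \<omega>))))"
    proof (rule poly_integrable[OF _ s(1), where C="3 * C" and k="k + 1"])
      fix \<omega> assume g: "good \<omega>"
      define x y z where "x = A s \<omega>" and "y = Yt s \<omega>" and "z = Gt s \<omega>"
      have zy: "z\<^sup>2 \<le> y" unfolding y_def z_def by (rule Gt_sq_le[OF good_space[OF g]])
      have y: "0 \<le> y" unfolding y_def by (rule Yt_nonneg)
      have R: "\<bar>resample d (f s y) y\<bar> \<le> C * (1 + y) ^ k" by (rule resample_bound[OF f_b[OF s] y])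
      have z: "\<bar>max z 0\<bar> \<le> 1 + y"
      proof -
        have "0 \<le> (z - 1)\<^sup>2" by simp
        then have "2 * z \<le> 1 + z\<^sup>2" by (simp add: power2_diff)
        then show ?thesis using zy y by auto
      qed
      have x: "\<bar>x\<bar> \<le> 1 + x\<^sup>2"
      proof -
        have "0 \<le> (\<bar>x\<bar> - 1)\<^sup>2" by simp
        then show ?thesis by (simp add: power2_diff)
      qed
      have P: "C * (1 + y) ^ k \<le> C * (1 + y) ^ (k + 1)" using y C by (intro mult_left_mono power_increasing) auto
      have "\<bar>max z 0 * (resample d (f s y) y - f s y z)\<bar> \<le> (1 + y) * (C * (1 + y) ^ k + C * (1 + y) ^ k)"
        unfolding abs_mult using z R f_b[OF s zy] by (intro mult_mono order_trans[OF abs_triangle_ineq4] add_mono) auto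
      then have "\<bar>Df s y z + max z 0 * (resample d (f s y) y - f s y z)\<bar> \<le> 3 * C * (1 + y) ^ (k + 1)"
        using Df_b[OF s zy] P by (simp add: mult_ac)
      then have "\<bar>x\<bar> * \<bar>Df s y z + max z 0 * (resample d (f s y) y - f s y z)\<bar> \<le> (1 + x\<^sup>2) * (3 * C * (1 + y) ^ (k + 1))"
        using x by (intro mult_mono) auto
      then show "\<bar>A s \<omega> * (Df s (Yt s \<omega>) (Gt s \<omega>) + max (Gt s \<omega>) 0 *
         (resample d (f s (Yt s \<omega>)) (Yt s \<omega>) - f s (Yt s \<omega>) (Gt s \<omega>)))\<bar> \<le> 3 * C * (1 + (A s \<omega>)\<^sup>2) * (1 + Yt s \<omega>) ^ (k + 1)"
        unfolding x_def[symmetric] y_def[symmetric] z_def[symmetric] by (simp only: abs_mult mult_ac)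
    qed measurable
    show ?thesis
      unfolding Bochner_Integration.integral_add[OF i1 i2, symmetric]
      by (intro Bochner_Integration.integral_cong refl) (simp add: resample_mult algebra_simps)
  qed
  have "expectation (\<lambda>\<omega>. A t \<omega> * f t (Yt t \<omega>) (Gt t \<omega>)) =
    (\<integral>s. indicator {0..t} s * expectation (\<lambda>\<omega>. (a (Yt s \<omega>) (Gt s \<omega>) * f s (Yt s \<omega>) (Gt s \<omega>) + A s \<omega> * Df s (Yt s \<omega>) (Gt s \<omega>)) + max (Gt s \<omega>) 0 *
      (resample d (\<lambda>g. A s \<omega> * f s (Yt s \<omega>) g) (Yt s \<omega>) - A s \<omega> * f s (Yt s \<omega>) (Gt s \<omega>))) \<partial>lborel)"
    using D by simp
  also have "\<dots> = (\<integral>s. indicator {0..t} s * (expectation (\<lambda>\<omega>. a (Yt s \<omega>) (Gt s \<omega>) * f s (Yt s \<omega>) (Gt s \<omega>)) +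
      expectation (\<lambda>\<omega>. A s \<omega> * (Df s (Yt s \<omega>) (Gt s \<omega>) + max (Gt s \<omega>) 0 *
         (resample d (f s (Yt s \<omega>)) (Yt s \<omega>) - f s (Yt s \<omega>) (Gt s \<omega>))))) \<partial>lborel)"
  proof (rule Bochner_Integration.integral_cong[OF refl], goal_cases)
    case (1 s)
    show ?case
    proof (cases "s \<in> {0..t}")
      case True
      then show ?thesis using split[of s] by simp
    qed simp
  qed
  finally show ?thesis .
qed

declare a_measurable' [measurable del] I_measurable' [measurable del]

end

section \<open>The radial velocity: a Volterra equation\<close>

text \<open>The value of \<open>f\<close> at \<open>z\<close> after free flight from a nonpositive
  radial velocity, times the probability of no jump on the way. From such a start this probability
  depends only on the endpoint.\<close>

definition damped :: "(real \<Rightarrow> real) \<Rightarrow> real \<Rightarrow> real" where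
  "damped f z = exp (- (max z 0)\<^sup>2 / 2) * f z"

text \<open>Mean of \<open>f\<close> at time \<open>r\<close> after a jump to minus a Rayleigh
  variable, on the event of no further jump: the kernel of the Volterra equation, free of the
  dimension.\<close>

definition restart_mean :: "(real \<Rightarrow> real) \<Rightarrow> real \<Rightarrow> real" where
  "restart_mean f r = (\<integral>b. damped f (r - b) \<partial>rayleigh)"

text \<open>Equilibrium mean of the radial velocity now times \<open>f\<close> of it at time
  \<open>r\<close> later, on the event of no jump in between: the source term of the Volterra
  equation.\<close>

definition no_jump_cov :: "(real \<Rightarrow> real) \<Rightarrow> real \<Rightarrow> real" where
  "no_jump_cov f r = (\<integral>z. std_normal_density z * (z * (survival z r * f (z + r))) \<partial>lborel)"

text \<open>L2 bound for the error made when the true restart is replaced by the limiting one. The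
  constant is \<open>84 = 8 * 21 / 2\<close>, with \<open>21 / 2\<close> from
  \<open>GH_sq\<close>.\<close>

definition volterra_error :: "nat \<Rightarrow> real" where
  "volterra_error d = sqrt (84 / (real d + 1) + 2 * (rayleigh_gap d)\<^sup>2)"

lemma volterra_error_nonneg: "0 \<le> volterra_error d"
  by (simp add: volterra_error_def)

lemma volterra_error_tendsto: "volterra_error \<longlonglongrightarrow> 0"
proof -
  have "(\<lambda>d. 84 / (real d + 1)) \<longlonglongrightarrow> 0" by real_asymp
  then have "(\<lambda>d. sqrt (84 / (real d + 1) + 2 * (rayleigh_gap d)\<^sup>2)) \<longlonglongrightarrow> sqrt (0 + 2 * 0\<^sup>2)"
    by (intro tendsto_intros rayleigh_gap_tendsto)
  then show ?thesis by (simp add: volterra_error_def[abs_def])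
qed

text \<open>The Lipschitz bound is put on the damped function, since it is the integrand over the
  post-jump law and has to absorb the coupling error.\<close>

locale test_function =
  fixes f0 :: "real \<Rightarrow> real"
  assumes f0_cont: "continuous_on UNIV f0" and f0_bound: "\<And>z. \<bar>f0 z\<bar> \<le> \<bar>z\<bar>"
    and damped_lipschitz: "\<And>x y. \<bar>damped f0 x - damped f0 y\<bar> \<le> \<bar>x - y\<bar>"
begin

lemma f0_measurable [measurable]: "f0 \<in> borel_measurable borel"
  by (rule borel_measurable_continuous_onI[OF f0_cont])

lemma damped_measurable [measurable]: "damped f0 \<in> borel_measurable borel"
  unfolding damped_def[abs_def] by measurable

lemma damped_bound: "\<bar>damped f0 z\<bar> \<le> \<bar>z\<bar>"
proof -
  have "exp (- (max z 0)\<^sup>2 / 2) * \<bar>f0 z\<bar> \<le> 1 * \<bar>z\<bar>" using f0_bound by (intro mult_mono) auto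
  then show ?thesis by (simp add: damped_def abs_mult)
qed

lemma survival_eq_damped: "0 \<le> x \<Longrightarrow> survival (- x) r * f0 (- x + r) = damped f0 (r - x)"
  by (simp add: survival_def damped_def)

lemma integrable_damped: "integrable rayleigh (\<lambda>b. damped f0 (r - b))"
proof (rule Bochner_Integration.integrable_bound[where f="\<lambda>b. \<bar>r\<bar> + \<bar>b\<bar>"])
  show "integrable rayleigh (\<lambda>b. \<bar>r\<bar> + \<bar>b\<bar>)" using rayleigh_mean(1) by simp
  have "(\<lambda>b. r - b) \<in> borel_measurable rayleigh" by measurable
  then show "(\<lambda>b. damped f0 (r - b)) \<in> borel_measurable rayleigh" by (rule measurable_compose[OF _ damped_measurable])
  show "AE b in rayleigh. norm (damped f0 (r - b)) \<le> norm (\<bar>r\<bar> + \<bar>b\<bar>)"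
  proof (rule AE_I2)
    fix b show "norm (damped f0 (r - b)) \<le> norm (\<bar>r\<bar> + \<bar>b\<bar>)" using damped_bound[of "r - b"] by simp
  qed
qed

lemma restart_mean_measurable [measurable]: "restart_mean f0 \<in> borel_measurable borel"
proof -
  have "(\<lambda>p. fst p - snd p) \<in> borel \<Otimes>\<^sub>M rayleigh \<rightarrow>\<^sub>M (borel :: real measure)" by measurable
  from measurable_compose[OF this damped_measurable] show ?thesis
    unfolding restart_mean_def[abs_def]
    by (intro rayleigh.borel_measurable_lebesgue_integral) (simp only: split_def)
qed

lemma restart_mean_bound: "0 \<le> r \<Longrightarrow> \<bar>restart_mean f0 r\<bar> \<le> r + 2"
proof -
  assume r: "0 \<le> r"
  have "\<bar>restart_mean f0 r\<bar> \<le> (\<integral>b. \<bar>damped f0 (r - b)\<bar> \<partial>rayleigh)"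
    unfolding restart_mean_def by (rule integral_abs_bound)
  also have "\<dots> \<le> (\<integral>b. r + b \<partial>rayleigh)"
  proof (rule integral_mono_AE)
    show "AE b in rayleigh. \<bar>damped f0 (r - b)\<bar> \<le> r + b"
      using AE_rayleigh_nonneg
    proof eventually_elim
      case (elim b)
      show ?case using damped_bound[of "r - b"] r elim by linarith
    qed
    show "integrable rayleigh (\<lambda>b. \<bar>damped f0 (r - b)\<bar>)" by (rule integrable_abs[OF integrable_damped])
    show "integrable rayleigh (\<lambda>b. r + b)" using rayleigh_mean(1) by simp
  qed
  also have "\<dots> = r + sqrt (pi / 2)" using rayleigh_mean rayleigh.prob_space by simp
  also have "sqrt (pi / 2) \<le> sqrt 4" using pi_less_4 by (intro real_sqrt_le_mono) simp
  finally show ?thesis by simp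
qed

lemma no_jump_cov_measurable [measurable]: "no_jump_cov f0 \<in> borel_measurable borel"
proof -
  have [measurable]: "(\<lambda>p. f0 (snd p + fst p)) \<in> borel_measurable (borel \<Otimes>\<^sub>M lborel)"
    by (rule measurable_compose[OF _ f0_measurable]) measurable
  have "(\<lambda>p. std_normal_density (snd p) * (snd p * (survival (snd p) (fst p) * f0 (snd p + fst p)))) \<in> borel_measurable (borel \<Otimes>\<^sub>M lborel)"
    unfolding survival_def by measurable
  then show ?thesis
    unfolding no_jump_cov_def[abs_def]
    by (intro lborel.borel_measurable_lebesgue_integral) (simp only: split_def)
qed

lemma no_jump_cov_bound: "0 \<le> r \<Longrightarrow> \<bar>no_jump_cov f0 r\<bar> \<le> 2 * (1 + r)"
proof -
  assume r: "0 \<le> r"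
  have i: "integrable lborel (\<lambda>z. (1 + r) * (std_normal_density z + std_normal_density z * z\<^sup>2))"
    using integrable_std_normal_moment[of 2] by simp
  have le: "\<bar>std_normal_density z * (z * (survival z r * f0 (z + r)))\<bar> \<le> (1 + r) * (std_normal_density z + std_normal_density z * z\<^sup>2)" for z
  proof -
    have "\<bar>survival z r * f0 (z + r)\<bar> \<le> 1 * \<bar>z + r\<bar>"
      unfolding abs_mult using survival_le[OF r, of z] survival_nonneg[of z r] f0_bound[of "z + r"] by (intro mult_mono) auto
    then have "\<bar>z\<bar> * \<bar>survival z r * f0 (z + r)\<bar> \<le> \<bar>z\<bar> * (\<bar>z\<bar> + r)" using r by (intro mult_left_mono) auto
    also have "\<dots> = z\<^sup>2 + r * \<bar>z\<bar>" by (simp add: power2_eq_square algebra_simps)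
    also have "\<dots> \<le> (1 + r) * (1 + z\<^sup>2)"
    proof -
      have "0 \<le> (\<bar>z\<bar> - 1)\<^sup>2" by simp
      then have "\<bar>z\<bar> \<le> 1 + z\<^sup>2" by (simp add: power2_diff)
      then have "r * \<bar>z\<bar> \<le> r * (1 + z\<^sup>2)" using r by (rule mult_left_mono)
      then show ?thesis by (simp add: algebra_simps)
    qed
    finally have "std_normal_density z * (\<bar>z\<bar> * \<bar>survival z r * f0 (z + r)\<bar>) \<le> std_normal_density z * ((1 + r) * (1 + z\<^sup>2))"
      by (intro mult_left_mono) auto
    then show ?thesis by (simp add: abs_mult algebra_simps)
  qed
  have "\<bar>no_jump_cov f0 r\<bar> \<le> (\<integral>z. \<bar>std_normal_density z * (z * (survival z r * f0 (z + r)))\<bar> \<partial>lborel)"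
    unfolding no_jump_cov_def by (rule integral_abs_bound)
  also have "\<dots> \<le> (\<integral>z. (1 + r) * (std_normal_density z + std_normal_density z * z\<^sup>2) \<partial>lborel)"
    by (rule integral_mono'[OF i le]) (use r in auto)
  also have "\<dots> = 2 * (1 + r)"
    using integrable_std_normal_moment[of 2] integral_std_normal_moment_even[of 1] integral_std_normal_moment_even[of 0] by simp
  finally show ?thesis .
qed

end

text \<open>This instance closes the equation for the correlation with the jump rate; the identity
  function then gives the correlation with the observable itself.\<close>

lemma max_0_test_function: "test_function (\<lambda>z. max z 0)"
proof
  show "\<bar>damped (\<lambda>z. max z 0) x - damped (\<lambda>z. max z 0) y\<bar> \<le> \<bar>x - y\<bar>" for x y
  proof -
    have "damped (\<lambda>z. max z 0) z = max z 0 * exp (- (max z 0)\<^sup>2 / 2)" for z by (simp add: damped_def)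
    moreover have "\<bar>max x 0 - max y 0\<bar> \<le> \<bar>x - y\<bar>" by linarith
    ultimately show ?thesis using lipschitz_mult_exp_neg_sq[of "max x 0" "max y 0"] by (simp only:)
  qed
  show "continuous_on UNIV (\<lambda>z::real. max z 0)" by (intro continuous_intros)
qed auto

lemma ident_test_function: "test_function (\<lambda>z. z)"
proof
  have eq: "damped (\<lambda>z. z) x = max x 0 * exp (- (max x 0)\<^sup>2 / 2) + min x 0" for x
    by (auto simp: damped_def max_def min_def)
  show "\<bar>damped (\<lambda>z. z) x - damped (\<lambda>z. z) y\<bar> \<le> \<bar>x - y\<bar>" for x y
    using lipschitz_mult_exp_neg_sq[of "max x 0" "max y 0"] unfolding eq by linarith
  show "continuous_on UNIV (\<lambda>z::real. z)" by (intro continuous_intros)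
qed auto

lemma integrable_nonneg_bound:
  fixes F K :: "'x \<Rightarrow> real"
  assumes "integrable M K" "F \<in> borel_measurable M" "\<And>x. x \<in> space M \<Longrightarrow> 0 \<le> F x" "\<And>x. x \<in> space M \<Longrightarrow> F x \<le> K x"
  shows "integrable M F"
proof (rule Bochner_Integration.integrable_bound[OF assms(1,2)])
  show "AE x in M. norm (F x) \<le> norm (K x)"
  proof (rule AE_I2)
    fix x assume "x \<in> space M"
    then show "norm (F x) \<le> norm (K x)" using assms(3,4)[of x] by simp
  qed
qed

lemma nonneg_le_of_sq_le: "g\<^sup>2 \<le> y \<Longrightarrow> \<bar>g\<bar> \<le> 1 + (y::real)"
proof -
  assume "g\<^sup>2 \<le> y"
  moreover have "0 \<le> (\<bar>g\<bar> - 1)\<^sup>2" by simp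
  then have "2 * \<bar>g\<bar> \<le> 1 + g\<^sup>2" by (simp add: power2_diff)
  ultimately show ?thesis by linarith
qed

context fecmc_stationary
begin

lemma g_observable: "fecmc_observable M d \<nu> X V \<tau> (\<lambda>y g. g) (\<lambda>y g u. g * u + u\<^sup>2 / 2) 1 1"
proof unfold_locales
  show "((\<lambda>u. g * u + u\<^sup>2 / 2) has_real_derivative g + u) (at u)" for g u :: real
    by (auto intro!: derivative_eq_intros)
  show "\<bar>g\<bar> \<le> 1 * (1 + y) ^ 1" if "g\<^sup>2 \<le> y" for y g :: real
    using nonneg_le_of_sq_le[OF that] by simp
  show "isCont (\<lambda>u. g + u) u" for g u :: real by (intro continuous_intros)
  show "(\<lambda>p :: real \<times> real. snd p) \<in> borel_measurable (borel \<Otimes>\<^sub>M borel)" by measurable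
  show "(\<lambda>p :: real \<times> real \<times> real. fst (snd p) * snd (snd p) + (snd (snd p))\<^sup>2 / 2) \<in> borel_measurable (borel \<Otimes>\<^sub>M borel \<Otimes>\<^sub>M borel)"
    by measurable
  show "expectation (\<lambda>\<omega>. Gt t \<omega>) = 0" for t by (rule G_moments(2))
  show "expectation (\<lambda>\<omega>. (Gt t \<omega>)\<^sup>2) = 1" for t by (rule G_moments(3))
  show "integrable M (\<lambda>\<omega>. (1 + Yt 0 \<omega>) ^ m)" for m by (rule Y_moments)
  show "g * 0 + 0\<^sup>2 / 2 = 0" for g :: real by simp
qed

interpretation gobs: fecmc_observable M d \<nu> X V \<tau> "\<lambda>y g. g" "\<lambda>y g u. g * u + u\<^sup>2 / 2" 1 1
  by (rule g_observable)

text \<open>\<open>G\<close> and \<open>Y\<close> are dependent, so the product is split by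
  \<open>2 * u * v \<le> u^2 + v^2\<close> into the fourth moments 3 and 18.\<close>

lemma GH_sq: "integrable M (\<lambda>\<omega>. (Gt t \<omega>)\<^sup>2 * (hc (Yt t \<omega>))\<^sup>2)" "expectation (\<lambda>\<omega>. (Gt t \<omega>)\<^sup>2 * (hc (Yt t \<omega>))\<^sup>2) \<le> 21 / 2"
proof -
  have le: "(Gt t \<omega>)\<^sup>2 * (hc (Yt t \<omega>))\<^sup>2 \<le> (Gt t \<omega> ^ 4 + hc (Yt t \<omega>) ^ 4) / 2" for \<omega>
    using zero_le_power2[of "(Gt t \<omega>)\<^sup>2 - (hc (Yt t \<omega>))\<^sup>2"] by (simp add: power2_diff power_mult[symmetric])
  have i: "integrable M (\<lambda>\<omega>. (Gt t \<omega> ^ 4 + hc (Yt t \<omega>) ^ 4) / 2)" using G_moments hc_moments by simp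
  show 1: "integrable M (\<lambda>\<omega>. (Gt t \<omega>)\<^sup>2 * (hc (Yt t \<omega>))\<^sup>2)"
    by (rule integrable_nonneg_bound[OF i]) (use le in simp_all)
  have "expectation (\<lambda>\<omega>. (Gt t \<omega>)\<^sup>2 * (hc (Yt t \<omega>))\<^sup>2) \<le> expectation (\<lambda>\<omega>. (Gt t \<omega> ^ 4 + hc (Yt t \<omega>) ^ 4) / 2)"
    by (rule integral_mono[OF 1 i le])
  also have "\<dots> = (expectation (\<lambda>\<omega>. Gt t \<omega> ^ 4) + expectation (\<lambda>\<omega>. hc (Yt t \<omega>) ^ 4)) / 2" using G_moments(1) hc_moments by simp
  also have "\<dots> \<le> 21 / 2" using G_moments(4)[of t] hc_moments(3)[of t] by simp
  finally show "expectation (\<lambda>\<omega>. (Gt t \<omega>)\<^sup>2 * (hc (Yt t \<omega>))\<^sup>2) \<le> 21 / 2" .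
qed

lemma sq_integral_bound:
  fixes F K :: "'a \<Rightarrow> real"
  assumes [measurable]: "F \<in> borel_measurable M" and i: "integrable M K"
    and le: "\<And>\<omega>. \<omega> \<in> space M \<Longrightarrow> (F \<omega>)\<^sup>2 \<le> K \<omega>" and K: "expectation K \<le> c"
  shows "integrable M (\<lambda>\<omega>. (F \<omega>)\<^sup>2)" "expectation (\<lambda>\<omega>. (F \<omega>)\<^sup>2) \<le> c"
proof -
  show 1: "integrable M (\<lambda>\<omega>. (F \<omega>)\<^sup>2)"
    using i by (rule integrable_nonneg_bound) (use le in auto)
  show "expectation (\<lambda>\<omega>. (F \<omega>)\<^sup>2) \<le> c"
    using integral_mono[OF 1 i] le K by force
qed

text \<open>Two replacements: \<open>sqrt y\<close> by \<open>sqrt d\<close>, which costs the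
  difference times the mean radial draw, and the scaled draw by its Rayleigh partner, which costs
  \<open>rayleigh_gap\<close>.\<close>

lemma resample_restart:
  assumes "test_function f0" and y: "0 \<le> y"
  shows "\<bar>resample d (\<lambda>g. survival g r * f0 (g + r)) y - restart_mean f0 r\<bar>
    \<le> \<bar>sqrt y - sqrt d\<bar> * sqrt (2 / (real d + 1)) + rayleigh_gap d"
proof -
  interpret test_function f0 by fact
  let ?q = "rayleigh_quantile d"
  have d2: "2 \<le> d" using d by simp
  have q: "0 \<le> ?q b" "?q b < 1" for b using rayleigh_quantile_bounds[OF d2] by auto
  have eq: "survival (- (sqrt y * ?q b)) r * f0 (- (sqrt y * ?q b) + r) = damped f0 (r - sqrt y * ?q b)" for b
    using y q(1)[of b] by (intro survival_eq_damped) auto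
  have i1: "integrable rayleigh (\<lambda>b. damped f0 (r - sqrt y * ?q b))"
  proof (rule rayleigh.integrable_const_bound[where B="\<bar>r\<bar> + sqrt y"])
    show "AE b in rayleigh. norm (damped f0 (r - sqrt y * ?q b)) \<le> \<bar>r\<bar> + sqrt y"
    proof (rule AE_I2)
      fix b
      have "0 \<le> sqrt y * ?q b" "sqrt y * ?q b \<le> sqrt y" using y q[of b] by (auto simp: mult_left_le)
      then show "norm (damped f0 (r - sqrt y * ?q b)) \<le> \<bar>r\<bar> + sqrt y"
        using damped_bound[of "r - sqrt y * ?q b"] by simp
    qed
    have "(\<lambda>b. r - sqrt y * ?q b) \<in> borel_measurable rayleigh" by measurable
    then show "(\<lambda>b. damped f0 (r - sqrt y * ?q b)) \<in> borel_measurable rayleigh"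
      by (rule measurable_compose[OF _ damped_measurable])
  qed
  have iq: "integrable rayleigh ?q" by (rule integrable_rayleigh_quantile[OF d2])
  have ig: "integrable rayleigh (\<lambda>b. \<bar>sqrt d * ?q b - b\<bar>)" by (rule rayleigh_gap_integrable[OF d2])
  have "\<bar>resample d (\<lambda>g. survival g r * f0 (g + r)) y - restart_mean f0 r\<bar> = \<bar>\<integral>b. damped f0 (r - sqrt y * ?q b) - damped f0 (r - b) \<partial>rayleigh\<bar>"
    unfolding resample_def restart_mean_def eq using i1 integrable_damped by simp
  also have "\<dots> \<le> (\<integral>b. \<bar>damped f0 (r - sqrt y * ?q b) - damped f0 (r - b)\<bar> \<partial>rayleigh)" by (rule integral_abs_bound)
  also have "\<dots> \<le> (\<integral>b. \<bar>sqrt y - sqrt d\<bar> * ?q b + \<bar>sqrt d * ?q b - b\<bar> \<partial>rayleigh)"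
  proof (rule integral_mono)
    show "integrable rayleigh (\<lambda>b. \<bar>damped f0 (r - sqrt y * ?q b) - damped f0 (r - b)\<bar>)"
      using i1 integrable_damped by auto
    show "integrable rayleigh (\<lambda>b. \<bar>sqrt y - sqrt d\<bar> * ?q b + \<bar>sqrt d * ?q b - b\<bar>)" using iq ig by simp
    fix b
    have "\<bar>damped f0 (r - sqrt y * ?q b) - damped f0 (r - b)\<bar> \<le> \<bar>(r - sqrt y * ?q b) - (r - b)\<bar>" by (rule damped_lipschitz)
    also have "\<dots> = \<bar>(sqrt y - sqrt d) * ?q b + (sqrt d * ?q b - b)\<bar>" by (simp add: algebra_simps abs_minus_commute)
    also have "\<dots> \<le> \<bar>(sqrt y - sqrt d) * ?q b\<bar> + \<bar>sqrt d * ?q b - b\<bar>" by (rule abs_triangle_ineq)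
    finally show "\<bar>damped f0 (r - sqrt y * ?q b) - damped f0 (r - b)\<bar> \<le> \<bar>sqrt y - sqrt d\<bar> * ?q b + \<bar>sqrt d * ?q b - b\<bar>"
      using q(1)[of b] by (simp add: abs_mult)
  qed
  also have "\<dots> = \<bar>sqrt y - sqrt d\<bar> * (\<integral>b. ?q b \<partial>rayleigh) + rayleigh_gap d"
    unfolding rayleigh_gap_def using iq ig by simp
  also have "\<dots> \<le> \<bar>sqrt y - sqrt d\<bar> * sqrt (2 / (real d + 1)) + rayleigh_gap d"
    using rayleigh_quantile_mean_le(2)[OF d] by (intro add_right_mono mult_left_mono) auto
  finally show ?thesis .
qed

text \<open>Multiply \<open>sqrt y - sqrt d\<close> by \<open>sqrt y + sqrt d\<close>, whose square
  is at least \<open>d\<close>.\<close>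

lemma sqrt_diff_sq_le: "0 \<le> y \<Longrightarrow> (sqrt y - sqrt d)\<^sup>2 \<le> 2 * (hc y)\<^sup>2"
proof -
  assume y: "0 \<le> y"
  have d0: "0 < real d" using d by simp
  have "(sqrt y - sqrt d) * (sqrt y + sqrt d) = y - d" using y d0 by (simp add: algebra_simps)
  then have "(sqrt y - sqrt d)\<^sup>2 * (sqrt y + sqrt d)\<^sup>2 = (y - d)\<^sup>2" by (simp add: power_mult_distrib[symmetric])
  moreover have "real d \<le> (sqrt y + sqrt d)\<^sup>2" using y d0 by (simp add: power2_sum)
  then have "(sqrt y - sqrt d)\<^sup>2 * d \<le> (sqrt y - sqrt d)\<^sup>2 * (sqrt y + sqrt d)\<^sup>2" by (intro mult_left_mono) auto
  ultimately have "(sqrt y - sqrt d)\<^sup>2 * d \<le> (y - d)\<^sup>2" by simp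
  moreover have "2 * (hc y)\<^sup>2 * d = (y - d)\<^sup>2" using d0 by (simp add: hc_def power_divide)
  ultimately have "(sqrt y - sqrt d)\<^sup>2 * d \<le> 2 * (hc y)\<^sup>2 * d" by simp
  then show ?thesis using d0 by simp
qed

end

text \<open>Only negative \<open>z\<close> contribute, where \<open>z * phi z\<close> equals half of
  \<open>|z|^3\<close>; by reflection this is a quarter of the third absolute moment
  \<open>2 * sqrt (2 / pi)\<close>. Twice the value is the limiting variance, as in the Green-Kubo
  formula.\<close>

lemma std_normal_phi: "(\<integral>z. std_normal_density z * (z * phi z) \<partial>lborel) = sqrt (2 / pi) / 2"
proof -
  let ?f = "\<lambda>z::real. std_normal_density z * \<bar>z\<bar> ^ 3"
  have "has_bochner_integral lborel ?f (2 * sqrt (2 / pi))"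
    using std_normal_moment_abs_odd[of 1] by (simp add: mult.commute numeral_3_eq_3)
  from half_line_integral_even[OF this]
  have "(\<integral>z. indicator {0..} z *\<^sub>R ?f z \<partial>lborel) = sqrt (2 / pi)"
    by (simp add: std_normal_density_def has_bochner_integral_iff)
  moreover have "(\<integral>z. indicator {0..} z *\<^sub>R ?f z \<partial>lborel) = \<bar>- 1\<bar> *\<^sub>R (\<integral>z. indicator {0..} (0 + (- 1) * z) *\<^sub>R ?f (0 + (- 1) * z) \<partial>lborel)"
    by (rule lborel_integral_real_affine) simp
  moreover have "indicator {0..} (0 + (- 1) * z) *\<^sub>R ?f (0 + (- 1) * z) = 2 * (std_normal_density z * (z * phi z))" for z :: real
    by (auto simp: phi_def indicator_def max_def std_normal_density_def power2_eq_square power3_eq_cube)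
  ultimately show ?thesis by simp
qed

section \<open>The functional of the radial velocity in a fixed dimension\<close>

context fecmc_stationary
begin

interpretation gobs: fecmc_observable M d \<nu> X V \<tau> "\<lambda>y g. g" "\<lambda>y g u. g * u + u\<^sup>2 / 2" 1 1
  by (rule g_observable)

text \<open>The unknown of the Volterra equation: the restart term of every correlation involves
  this function, and for the test function \<open>max z 0\<close> it is also the left side.\<close>

definition jump_cov :: "real \<Rightarrow> real" where
  "jump_cov s = expectation (\<lambda>\<omega>. gobs.A s \<omega> * max (Gt s \<omega>) 0)"

lemma expectation_measurable:
  fixes F :: "real \<Rightarrow> 'a \<Rightarrow> real"
  assumes "(\<lambda>p. F (fst p) (snd p)) \<in> borel_measurable (borel \<Otimes>\<^sub>M M)"
  shows "(\<lambda>s. expectation (F s)) \<in> borel_measurable borel"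
  by (rule borel_measurable_lebesgue_integral) (use assms in \<open>simp add: split_def\<close>)

lemma jump_cov_measurable [measurable]: "jump_cov \<in> borel_measurable borel"
  unfolding jump_cov_def[abs_def] by (rule expectation_measurable) measurable

lemma max_G_sq: "integrable M (\<lambda>\<omega>. (max (Gt s \<omega>) 0)\<^sup>2)" "expectation (\<lambda>\<omega>. (max (Gt s \<omega>) 0)\<^sup>2) \<le> 1\<^sup>2"
proof -
  have le: "(max (Gt s \<omega>) 0)\<^sup>2 \<le> (Gt s \<omega>)\<^sup>2" for \<omega> by (simp add: max_def)
  show "integrable M (\<lambda>\<omega>. (max (Gt s \<omega>) 0)\<^sup>2)"
    by (rule sq_integral_bound(1)[OF _ G_moments(1)[of s 2] le]) (auto simp: G_moments)
  show "expectation (\<lambda>\<omega>. (max (Gt s \<omega>) 0)\<^sup>2) \<le> 1\<^sup>2"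
    by (rule sq_integral_bound(2)[OF _ G_moments(1)[of s 2] le]) (auto simp: G_moments)
qed

lemma jump_cov_bound: "0 \<le> s \<Longrightarrow> \<bar>jump_cov s\<bar> \<le> s"
  using gobs.A_mult_le(2)[of "\<lambda>\<omega>. max (Gt s \<omega>) 0" s 1] max_G_sq[of s] unfolding jump_cov_def by simp

text \<open>The test function \<open>survival g (t - s) * f0 (g + (t - s))\<close> is the expectation of \<open>f0\<close> at time
  \<open>t\<close> on the event that no jump occurs between \<open>s\<close> and \<open>t\<close>. Its generator therefore only contains the
  restart after a jump, which leads to a Volterra equation.\<close>

lemma volterra_estimate:
  assumes f0: "test_function f0" and t: "0 \<le> t"
  shows "\<bar>expectation (\<lambda>\<omega>. gobs.A t \<omega> * f0 (Gt t \<omega>)) - ((\<integral>s. indicator {0..t} s * no_jump_cov f0 (t - s) \<partial>lborel) +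
     (\<integral>s. indicator {0..t} s * (restart_mean f0 (t - s) * jump_cov s) \<partial>lborel))\<bar> \<le> t\<^sup>2 * volterra_error d"
proof -
  interpret test_function f0 by fact
  let ?f = "\<lambda>s y g. survival g (t - s) * f0 (g + (t - s))"
  let ?R = "\<lambda>s \<omega>. resample d (\<lambda>g. survival g (t - s) * f0 (g + (t - s))) (Yt s \<omega>)"
  let ?x = "\<lambda>s. expectation (\<lambda>\<omega>. gobs.A s \<omega> * (max (Gt s \<omega>) 0 * (?R s \<omega> - restart_mean f0 (t - s))))"
  have f0m: "(\<lambda>x. f0 (h x)) \<in> borel_measurable N" if "h \<in> borel_measurable N" for h N
    by (rule measurable_compose[OF that f0_measurable])
  have rm: "(\<lambda>x. restart_mean f0 (h x)) \<in> borel_measurable N" if "h \<in> borel_measurable N" for h N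
    by (rule measurable_compose[OF that restart_mean_measurable])
  have nm: "(\<lambda>x. no_jump_cov f0 (h x)) \<in> borel_measurable N" if "h \<in> borel_measurable N" for h N
    by (rule measurable_compose[OF that no_jump_cov_measurable])
  note [measurable] = f0m rm nm
  have fm: "(\<lambda>x. ?f (p x) 0 (q x)) \<in> borel_measurable N" if [measurable]: "p \<in> borel_measurable N" "q \<in> borel_measurable N" for p q N
    unfolding survival_def by measurable
  have Rm[measurable]: "(\<lambda>x. ?R (p x) (q x)) \<in> borel_measurable N" if [measurable]: "p \<in> borel_measurable N" "q \<in> N \<rightarrow>\<^sub>M M" for p q N
    by (rule gobs.resample_measurable) (auto intro!: fm)
  have fb: "\<bar>?f s y g\<bar> \<le> (1 + t) * (1 + y)" if "0 \<le> s" "s \<le> t" "g\<^sup>2 \<le> y" for s y g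
  proof -
    have y: "0 \<le> y" using that zero_le_power2 order_trans by blast
    have "\<bar>?f s y g\<bar> \<le> 1 * \<bar>g + (t - s)\<bar>"
      unfolding abs_mult using survival_le[of "t - s" g] survival_nonneg[of g "t - s"] f0_bound[of "g + (t - s)"] that by (intro mult_mono) auto
    also have "\<dots> \<le> (1 + y) + t" using nonneg_le_of_sq_le[OF that(3)] abs_triangle_ineq[of g "t - s"] that(1,2) by simp
    also have "\<dots> \<le> (1 + t) * (1 + y)" using t y by (simp add: algebra_simps)
    finally show ?thesis .
  qed
  have dyn: "expectation (\<lambda>\<omega>. gobs.A t \<omega> * ?f t (Yt t \<omega>) (Gt t \<omega>)) =
    (\<integral>s. indicator {0..t} s * (expectation (\<lambda>\<omega>. Gt s \<omega> * ?f s (Yt s \<omega>) (Gt s \<omega>)) +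
      expectation (\<lambda>\<omega>. gobs.A s \<omega> * (max (Gt s \<omega>) 0 * ?f s (Yt s \<omega>) (Gt s \<omega>) + max (Gt s \<omega>) 0 *
         (?R s \<omega> - ?f s (Yt s \<omega>) (Gt s \<omega>))))) \<partial>lborel)"
  \<comment> \<open>Along the flow the test function grows at rate \<open>max g 0\<close>, which
    cancels the loss term of the jump part and leaves only the gain from the restart.\<close>
  proof (rule gobs.dynkin_mult[where f="?f" and Df="\<lambda>s y g. max g 0 * ?f s y g" and C="1 + t" and k=2, OF t])
    show "(\<lambda>p :: real \<times> real \<times> real. ?f (fst p) (fst (snd p)) (snd (snd p))) \<in> borel_measurable (borel \<Otimes>\<^sub>M borel \<Otimes>\<^sub>M borel)"
      by (rule fm) measurable
    then show "(\<lambda>p :: real \<times> real \<times> real. max (snd (snd p)) 0 * ?f (fst p) (fst (snd p)) (snd (snd p))) \<in> borel_measurable (borel \<Otimes>\<^sub>M borel \<Otimes>\<^sub>M borel)"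
      by measurable
    show "\<bar>?f s y g\<bar> \<le> (1 + t) * (1 + y) ^ 2" if "0 \<le> s" "s \<le> t" "g\<^sup>2 \<le> y" for s y g
    proof -
      have y: "0 \<le> y" using that zero_le_power2 order_trans by blast
      have "(1 + t) * (1 + y) * 1 \<le> (1 + t) * (1 + y) * (1 + y)" using y t by (intro mult_left_mono) auto
      then show ?thesis using fb[OF that] by (simp add: power2_eq_square mult.assoc)
    qed
    show "\<bar>max g 0 * ?f s y g\<bar> \<le> (1 + t) * (1 + y) ^ 2" if "0 \<le> s" "s \<le> t" "g\<^sup>2 \<le> y" for s y g
    proof -
      have y: "0 \<le> y" using that zero_le_power2 order_trans by blast
      have "\<bar>max g 0\<bar> * \<bar>?f s y g\<bar> \<le> (1 + y) * ((1 + t) * (1 + y))"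
        using fb[OF that] nonneg_le_of_sq_le[OF that(3)] y by (intro mult_mono) auto
      then show ?thesis by (simp add: abs_mult power2_eq_square mult_ac)
    qed
    \<comment> \<open>Along the flow the endpoint \<open>g + t - s\<close> is fixed, so the test
      function is an explicit exponential in \<open>u\<close> times a constant.\<close>
    have eq: "?f (s + u) (y + 2 * g * u + u\<^sup>2) (g + u) = exp ((max (g + u) 0)\<^sup>2 / 2) * (exp (- (max (g + t - s) 0)\<^sup>2 / 2) * f0 (g + t - s))" for s y g u
    proof -
      have "g + u + (t - (s + u)) = g + t - s" by simp
      moreover have "exp (- ((v - w) / 2)) = exp (w / 2) * exp (- v / 2)" for v w :: real
        by (simp add: exp_add[symmetric] diff_divide_distrib)
      ultimately show ?thesis by (simp add: survival_def add_diff_eq)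
    qed
    show "((\<lambda>u. ?f (s + u) (y + 2 * g * u + u\<^sup>2) (g + u)) has_real_derivative max (g + u) 0 * ?f (s + u) (y + 2 * g * u + u\<^sup>2) (g + u)) (at u)" for s y g u
    proof -
      have "((\<lambda>u. (max (g + u) 0)\<^sup>2 / 2) has_real_derivative max (g + u) 0 * 1) (at u)"
        by (rule DERIV_chain2[OF DERIV_pos_part_sq]) (auto intro!: derivative_eq_intros)
      from DERIV_cmult_right[OF DERIV_fun_exp[OF this]] show ?thesis unfolding eq by (rule DERIV_cong) simp
    qed
    show "isCont (\<lambda>u. max (g + u) 0 * ?f (s + u) (y + 2 * g * u + u\<^sup>2) (g + u)) u" for s y g u
      unfolding eq by (intro continuous_intros) auto
  qed
  have L2: "integrable M (\<lambda>\<omega>. (max (Gt s \<omega>) 0 * (?R s \<omega> - restart_mean f0 (t - s)))\<^sup>2)"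
     "expectation (\<lambda>\<omega>. (max (Gt s \<omega>) 0 * (?R s \<omega> - restart_mean f0 (t - s)))\<^sup>2) \<le> (volterra_error d)\<^sup>2" for s
  proof -
    \<comment> \<open>The factor 8 combines \<open>(u + v)^2 \<le> 2 * u^2 + 2 * v^2\<close>, the
      bound \<open>2 * hc^2\<close> of \<open>sqrt_diff_sq_le\<close> and the second moment
      \<open>2 / (d + 1)\<close> of the radial draw.\<close>
    let ?K = "\<lambda>\<omega>. 8 / (real d + 1) * ((Gt s \<omega>)\<^sup>2 * (hc (Yt s \<omega>))\<^sup>2) + 2 * (rayleigh_gap d)\<^sup>2 * (Gt s \<omega>)\<^sup>2"
    have iK: "integrable M ?K" using GH_sq G_moments by simp
    have K: "expectation ?K \<le> (volterra_error d)\<^sup>2"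
    proof -
      have "expectation ?K = 8 / (real d + 1) * expectation (\<lambda>\<omega>. (Gt s \<omega>)\<^sup>2 * (hc (Yt s \<omega>))\<^sup>2) + 2 * (rayleigh_gap d)\<^sup>2"
        using GH_sq G_moments by simp
      also have "\<dots> \<le> 8 / (real d + 1) * (21 / 2) + 2 * (rayleigh_gap d)\<^sup>2"
        using GH_sq(2) by (intro add_right_mono mult_left_mono) auto
      also have "\<dots> = (volterra_error d)\<^sup>2" unfolding volterra_error_def by (subst real_sqrt_pow2) (auto simp: field_simps)
      finally show ?thesis .
    qed
    have le: "(max (Gt s \<omega>) 0 * (?R s \<omega> - restart_mean f0 (t - s)))\<^sup>2 \<le> ?K \<omega>" for \<omega>
    proof -
      let ?e = "sqrt (2 / (real d + 1))" and ?D = "\<bar>sqrt (Yt s \<omega>) - sqrt d\<bar>"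
      have "\<bar>?R s \<omega> - restart_mean f0 (t - s)\<bar> \<le> ?D * ?e + rayleigh_gap d"
        by (rule resample_restart[OF f0 Yt_nonneg])
      from power_mono[OF this abs_ge_zero, of 2]
      have "(?R s \<omega> - restart_mean f0 (t - s))\<^sup>2 \<le> (?D * ?e + rayleigh_gap d)\<^sup>2" by (simp only: power2_abs)
      also have "\<dots> \<le> 2 * (?D * ?e)\<^sup>2 + 2 * (rayleigh_gap d)\<^sup>2"
        using zero_le_power2[of "?D * ?e - rayleigh_gap d"] by (simp only: power2_sum power2_diff)
      also have "(?D * ?e)\<^sup>2 = (sqrt (Yt s \<omega>) - sqrt d)\<^sup>2 * (2 / (real d + 1))" by (simp add: power_mult_distrib)
      also have "\<dots> \<le> 2 * (hc (Yt s \<omega>))\<^sup>2 * (2 / (real d + 1))"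
        by (intro mult_right_mono sqrt_diff_sq_le Yt_nonneg) auto
      finally have "(?R s \<omega> - restart_mean f0 (t - s))\<^sup>2 \<le> 2 * (2 * (hc (Yt s \<omega>))\<^sup>2 * (2 / (real d + 1))) + 2 * (rayleigh_gap d)\<^sup>2" by simp
      moreover have "(max (Gt s \<omega>) 0)\<^sup>2 \<le> (Gt s \<omega>)\<^sup>2" by (simp add: max_def)
      ultimately have "(max (Gt s \<omega>) 0)\<^sup>2 * (?R s \<omega> - restart_mean f0 (t - s))\<^sup>2 \<le>
          (Gt s \<omega>)\<^sup>2 * (2 * (2 * (hc (Yt s \<omega>))\<^sup>2 * (2 / (real d + 1))) + 2 * (rayleigh_gap d)\<^sup>2)"
        by (intro mult_mono) auto
      also have "\<dots> = ?K \<omega>" by (simp add: algebra_simps)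
      finally show ?thesis by (simp add: power_mult_distrib)
    qed
    show "integrable M (\<lambda>\<omega>. (max (Gt s \<omega>) 0 * (?R s \<omega> - restart_mean f0 (t - s)))\<^sup>2)"
      by (rule sq_integral_bound(1)[OF _ iK le K]) measurable
    show "expectation (\<lambda>\<omega>. (max (Gt s \<omega>) 0 * (?R s \<omega> - restart_mean f0 (t - s)))\<^sup>2) \<le> (volterra_error d)\<^sup>2"
      by (rule sq_integral_bound(2)[OF _ iK le K]) measurable
  qed
  have x_i: "integrable M (\<lambda>\<omega>. gobs.A s \<omega> * (max (Gt s \<omega>) 0 * (?R s \<omega> - restart_mean f0 (t - s))))"
    and x_b: "\<bar>?x s\<bar> \<le> s * volterra_error d" if "0 \<le> s" for s
    using gobs.A_mult_le[OF _ that L2 volterra_error_nonneg] by auto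
  have j_i: "integrable M (\<lambda>\<omega>. gobs.A s \<omega> * max (Gt s \<omega>) 0)" if "0 \<le> s" for s
    using gobs.A_mult_le(1)[OF _ that max_G_sq] by auto
  have rhs: "expectation (\<lambda>\<omega>. Gt s \<omega> * ?f s (Yt s \<omega>) (Gt s \<omega>)) +
      expectation (\<lambda>\<omega>. gobs.A s \<omega> * (max (Gt s \<omega>) 0 * ?f s (Yt s \<omega>) (Gt s \<omega>) + max (Gt s \<omega>) 0 *
         (?R s \<omega> - ?f s (Yt s \<omega>) (Gt s \<omega>)))) = no_jump_cov f0 (t - s) + restart_mean f0 (t - s) * jump_cov s + ?x s" if s: "0 \<le> s" for s
  proof -
    have "expectation (\<lambda>\<omega>. Gt s \<omega> * ?f s (Yt s \<omega>) (Gt s \<omega>)) = no_jump_cov f0 (t - s)"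
      unfolding no_jump_cov_def
      by (rule expectation_G(1)[of "\<lambda>z. z * (survival z (t - s) * f0 (z + (t - s)))"]) (unfold survival_def, measurable)
    moreover have "expectation (\<lambda>\<omega>. gobs.A s \<omega> * (max (Gt s \<omega>) 0 * ?f s (Yt s \<omega>) (Gt s \<omega>) + max (Gt s \<omega>) 0 *
         (?R s \<omega> - ?f s (Yt s \<omega>) (Gt s \<omega>)))) =
       expectation (\<lambda>\<omega>. restart_mean f0 (t - s) * (gobs.A s \<omega> * max (Gt s \<omega>) 0) + gobs.A s \<omega> * (max (Gt s \<omega>) 0 * (?R s \<omega> - restart_mean f0 (t - s))))"
      by (intro Bochner_Integration.integral_cong refl) (simp add: algebra_simps)
    moreover have "\<dots> = restart_mean f0 (t - s) * jump_cov s + ?x s"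
      unfolding jump_cov_def using x_i[OF s] j_i[OF s] by simp
    ultimately show ?thesis by simp
  qed
  have x_m: "?x \<in> borel_measurable borel"
    by (rule expectation_measurable) measurable
  have i1: "integrable lborel (\<lambda>s. indicator {0..t} s * no_jump_cov f0 (t - s))"
  proof (rule integrable_Icc_bounded[where t=t and K="2 * (1 + t)"])
    show "\<bar>indicator {0..t} s * no_jump_cov f0 (t - s)\<bar> \<le> indicator {0..t} s * (2 * (1 + t))" for s
      using no_jump_cov_bound[of "t - s"] by (auto simp: indicator_def)
  qed measurable
  have i2: "integrable lborel (\<lambda>s. indicator {0..t} s * (restart_mean f0 (t - s) * jump_cov s))"
  proof (rule integrable_Icc_bounded[where t=t and K="(t + 2) * t"])
    show "\<bar>indicator {0..t} s * (restart_mean f0 (t - s) * jump_cov s)\<bar> \<le> indicator {0..t} s * ((t + 2) * t)" for s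
    proof (cases "s \<in> {0..t}")
      case True
      have "\<bar>restart_mean f0 (t - s)\<bar> * \<bar>jump_cov s\<bar> \<le> (t + 2) * t"
        using True restart_mean_bound[of "t - s"] jump_cov_bound[of s] by (intro mult_mono) auto
      then show ?thesis using True by (simp add: abs_mult)
    qed simp
  qed measurable
  have x_b': "\<bar>indicator {0..t} s * ?x s\<bar> \<le> indicator {0..t} s * (t * volterra_error d)" for s
  proof (cases "s \<in> {0..t}")
    case True
    then have "s * volterra_error d \<le> t * volterra_error d" using volterra_error_nonneg by (intro mult_right_mono) auto
    then show ?thesis using True x_b[of s] by simp
  qed simp
  have i3: "integrable lborel (\<lambda>s. indicator {0..t} s * ?x s)"
    by (rule integrable_Icc_bounded[OF _ x_b']) (intro borel_measurable_times borel_measurable_indicator x_m, simp)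
  have "expectation (\<lambda>\<omega>. gobs.A t \<omega> * f0 (Gt t \<omega>)) = expectation (\<lambda>\<omega>. gobs.A t \<omega> * ?f t (Yt t \<omega>) (Gt t \<omega>))"
    by (simp add: survival_def)
  also have "\<dots> = (\<integral>s. indicator {0..t} s * (no_jump_cov f0 (t - s) + restart_mean f0 (t - s) * jump_cov s + ?x s) \<partial>lborel)"
    unfolding dyn
  proof (rule Bochner_Integration.integral_cong[OF refl], goal_cases)
    case (1 s)
    show ?case
    proof (cases "s \<in> {0..t}")
      case True
      then have "0 \<le> s" by simp
      then show ?thesis by (simp only: rhs)
    next
      case False
      then show ?thesis by simp
    qed
  qed
  also have "\<dots> = (\<integral>s. (indicator {0..t} s * no_jump_cov f0 (t - s) + indicator {0..t} s * (restart_mean f0 (t - s) * jump_cov s)) + indicator {0..t} s * ?x s \<partial>lborel)"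
    by (simp only: distrib_left)
  also have "\<dots> = ((\<integral>s. indicator {0..t} s * no_jump_cov f0 (t - s) \<partial>lborel) +
     (\<integral>s. indicator {0..t} s * (restart_mean f0 (t - s) * jump_cov s) \<partial>lborel)) + (\<integral>s. indicator {0..t} s * ?x s \<partial>lborel)"
    by (simp only: Bochner_Integration.integral_add[OF i1 i2] Bochner_Integration.integral_add[OF Bochner_Integration.integrable_add[OF i1 i2] i3])
  finally have "\<bar>expectation (\<lambda>\<omega>. gobs.A t \<omega> * f0 (Gt t \<omega>)) - ((\<integral>s. indicator {0..t} s * no_jump_cov f0 (t - s) \<partial>lborel) +
     (\<integral>s. indicator {0..t} s * (restart_mean f0 (t - s) * jump_cov s) \<partial>lborel))\<bar> = \<bar>\<integral>s. indicator {0..t} s * ?x s \<partial>lborel\<bar>" by simp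
  also have "\<dots> \<le> (\<integral>s. \<bar>indicator {0..t} s * ?x s\<bar> \<partial>lborel)" by (rule integral_abs_bound)
  also have "\<dots> \<le> (\<integral>s. indicator {0..t} s * (t * volterra_error d) \<partial>lborel)"
    by (rule integral_mono[OF integrable_abs[OF i3] _ x_b']) simp
  also have "\<dots> = t\<^sup>2 * volterra_error d" using t by (simp add: power2_eq_square)
  finally show ?thesis .
qed

text \<open>At negative argument \<open>phi\<close> is quadratic, so only the second moment of the
  radial draw enters.\<close>

lemma resample_phi: "0 \<le> y \<Longrightarrow> resample d phi y = - (y / (real d + 1))"
proof -
  assume y: "0 \<le> y"
  have "phi (- (sqrt y * rayleigh_quantile d b)) = - (y / 2) * (rayleigh_quantile d b)\<^sup>2" for b
    using y rayleigh_quantile_bounds(1)[of d b] d by (simp add: phi_def power_mult_distrib)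
  then have "resample d phi y = - (y / 2) * (2 / (real d + 1))"
    unfolding resample_def by (simp only: integral_mult_right_zero integral_rayleigh_quantile_sq[OF d])
  moreover have "- (y / 2) * (2 / D) = - (y / D)" for D :: real by simp
  ultimately show ?thesis by (simp only:)
qed

text \<open>L2 bound for the defect of \<open>phi\<close> in the Poisson equation, with
  \<open>44 = 4 * 21 / 2 + 2\<close>.\<close>

definition phi_error :: real where "phi_error = sqrt (44 / (real d + 1))"

text \<open>\<open>Y / (d + 1) - 1\<close> equals
  \<open>(sqrt (2 * d) * hc Y - 1) / (d + 1)\<close>, which is of order \<open>1 / sqrt d\<close>.
  The product with \<open>G\<close> is controlled by \<open>GH_sq\<close>.\<close>

lemma phi_error_L2:
  "integrable M (\<lambda>\<omega>. (max (Gt s \<omega>) 0 * (Yt s \<omega> / (real d + 1) - 1))\<^sup>2)"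
  "expectation (\<lambda>\<omega>. (max (Gt s \<omega>) 0 * (Yt s \<omega> / (real d + 1) - 1))\<^sup>2) \<le> phi_error\<^sup>2"
proof -
  let ?K = "\<lambda>\<omega>. 4 / (real d + 1) * ((Gt s \<omega>)\<^sup>2 * (hc (Yt s \<omega>))\<^sup>2) + 2 / (real d + 1) * (Gt s \<omega>)\<^sup>2"
  have iK: "integrable M ?K" using GH_sq G_moments by simp
  have "expectation ?K = 4 / (real d + 1) * expectation (\<lambda>\<omega>. (Gt s \<omega>)\<^sup>2 * (hc (Yt s \<omega>))\<^sup>2) + 2 / (real d + 1)"
    using GH_sq G_moments by simp
  also have "\<dots> \<le> 4 / (real d + 1) * (21 / 2) + 2 / (real d + 1)"
    using GH_sq(2) by (intro add_right_mono mult_left_mono) auto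
  also have "\<dots> = phi_error\<^sup>2"
  proof -
    have "4 / D * (21 / 2) + 2 / D = 44 / D" for D :: real by (simp add: add_divide_distrib[symmetric])
    moreover have "phi_error\<^sup>2 = 44 / (real d + 1)" unfolding phi_error_def by (rule real_sqrt_pow2) simp
    ultimately show ?thesis by (simp only:)
  qed
  finally have K: "expectation ?K \<le> phi_error\<^sup>2" .
  have le: "(max (Gt s \<omega>) 0 * (Yt s \<omega> / (real d + 1) - 1))\<^sup>2 \<le> ?K \<omega>" for \<omega>
  proof -
    define h where "h = hc (Yt s \<omega>)"
    define D where "D = real d + 1"
    have D: "1 \<le> D" "real d \<le> D" by (auto simp: D_def)
    have Y: "Yt s \<omega> / D - 1 = (sqrt (2 * d) * h - 1) / D"
    proof -
      have "sqrt (2 * d) * h = Yt s \<omega> - d" using d by (simp add: h_def hc_def)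
      moreover have "Yt s \<omega> / D - 1 = (Yt s \<omega> - D) / D" using D by (simp add: diff_divide_distrib)
      ultimately show ?thesis by (simp add: D_def)
    qed
    have "(sqrt (2 * d) * h - 1)\<^sup>2 \<le> 2 * (sqrt (2 * d) * h)\<^sup>2 + 2"
      using zero_le_power2[of "sqrt (2 * d) * h + 1"] by (simp add: power2_sum power2_diff)
    also have "\<dots> = 4 * d * h\<^sup>2 + 2" by (simp add: power_mult_distrib)
    also have "\<dots> \<le> 4 * D * h\<^sup>2 + 2 * D" using D by (intro add_mono mult_right_mono) auto
    finally have "(sqrt (2 * d) * h - 1)\<^sup>2 / D\<^sup>2 \<le> (4 * D * h\<^sup>2 + 2 * D) / D\<^sup>2" by (intro divide_right_mono) auto
    also have "\<dots> = 4 / D * h\<^sup>2 + 2 / D" using D by (simp add: power2_eq_square add_divide_distrib)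
    finally have 1: "(Yt s \<omega> / D - 1)\<^sup>2 \<le> 4 / D * h\<^sup>2 + 2 / D" unfolding Y power_divide .
    have "(max (Gt s \<omega>) 0)\<^sup>2 \<le> (Gt s \<omega>)\<^sup>2" by (simp add: max_def)
    then have "(max (Gt s \<omega>) 0)\<^sup>2 * (Yt s \<omega> / D - 1)\<^sup>2 \<le> (Gt s \<omega>)\<^sup>2 * (4 / D * h\<^sup>2 + 2 / D)"
      using 1 by (intro mult_mono) auto
    moreover have "(Gt s \<omega>)\<^sup>2 * (4 / D * h\<^sup>2 + 2 / D) = 4 / D * ((Gt s \<omega>)\<^sup>2 * h\<^sup>2) + 2 / D * (Gt s \<omega>)\<^sup>2" by (simp add: algebra_simps)
    ultimately show ?thesis unfolding D_def[symmetric] h_def[symmetric] by (simp only: power_mult_distrib)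
  qed
  show "integrable M (\<lambda>\<omega>. (max (Gt s \<omega>) 0 * (Yt s \<omega> / (real d + 1) - 1))\<^sup>2)"
    by (rule sq_integral_bound(1)[OF _ iK le K]) measurable
  show "expectation (\<lambda>\<omega>. (max (Gt s \<omega>) 0 * (Yt s \<omega> / (real d + 1) - 1))\<^sup>2) \<le> phi_error\<^sup>2"
    by (rule sq_integral_bound(2)[OF _ iK le K]) measurable
qed

lemma phi_error_nonneg: "0 \<le> phi_error" by (simp add: phi_error_def)

lemma phi_measurable [measurable]: "phi \<in> borel_measurable borel"
  by (rule borel_measurable_continuous_onI[OF continuous_phi])

lemma phi_L2: "integrable M (\<lambda>\<omega>. (phi (Gt s \<omega>))\<^sup>2)" "expectation (\<lambda>\<omega>. (phi (Gt s \<omega>))\<^sup>2) \<le> 1\<^sup>2"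
proof -
  have le: "(phi (Gt s \<omega>))\<^sup>2 \<le> Gt s \<omega> ^ 4 / 4" for \<omega>
    by (auto simp: phi_def max_def power_divide power_mult[symmetric])
  have i: "integrable M (\<lambda>\<omega>. Gt s \<omega> ^ 4 / 4)" using G_moments by simp
  have e: "expectation (\<lambda>\<omega>. Gt s \<omega> ^ 4 / 4) \<le> 1\<^sup>2" using G_moments by simp
  show "integrable M (\<lambda>\<omega>. (phi (Gt s \<omega>))\<^sup>2)" by (rule sq_integral_bound(1)[OF _ i le e]) measurable
  show "expectation (\<lambda>\<omega>. (phi (Gt s \<omega>))\<^sup>2) \<le> 1\<^sup>2" by (rule sq_integral_bound(2)[OF _ i le e]) measurable
qed

text \<open>In Dynkin's formula for the functional times \<open>phi\<close>, the source is the
  constant of \<open>std_normal_phi\<close> and the generator yields \<open>- g\<close> up to the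
  defect. Twice the time integral of the correlation with \<open>g\<close> is the second moment by
  \<open>A_sq_eq\<close>.\<close>

lemma phi_estimate:
  assumes t: "0 \<le> t"
  shows "\<bar>2 * expectation (\<lambda>\<omega>. gobs.A t \<omega> * phi (Gt t \<omega>)) - (sqrt (2 / pi) * t - expectation (\<lambda>\<omega>. (gobs.A t \<omega>)\<^sup>2))\<bar> \<le> 2 * (t\<^sup>2 * phi_error)"
proof -
  let ?x = "\<lambda>s. expectation (\<lambda>\<omega>. gobs.A s \<omega> * (max (Gt s \<omega>) 0 * (Yt s \<omega> / (real d + 1) - 1)))"
  let ?g = "\<lambda>s. expectation (\<lambda>\<omega>. gobs.A s \<omega> * Gt s \<omega>)"
  have dyn: "expectation (\<lambda>\<omega>. gobs.A t \<omega> * phi (Gt t \<omega>)) =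
    (\<integral>s. indicator {0..t} s * (expectation (\<lambda>\<omega>. Gt s \<omega> * phi (Gt s \<omega>)) +
      expectation (\<lambda>\<omega>. gobs.A s \<omega> * (max (- Gt s \<omega>) 0 + max (Gt s \<omega>) 0 * (resample d phi (Yt s \<omega>) - phi (Gt s \<omega>))))) \<partial>lborel)"
  proof (rule gobs.dynkin_mult[where f="\<lambda>s y g. phi g" and Df="\<lambda>s y g. max (- g) 0" and C=1 and k=1, OF t])
    show "\<bar>phi g\<bar> \<le> 1 * (1 + y) ^ 1" if "g\<^sup>2 \<le> y" for y g using phi_bound[of g] that by simp
    show "\<bar>max (- g) 0\<bar> \<le> 1 * (1 + y) ^ 1" if "g\<^sup>2 \<le> y" for y g :: real using nonneg_le_of_sq_le[OF that] by auto
    show "((\<lambda>u. phi (g + u)) has_real_derivative max (- (g + u)) 0) (at u)" for g u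
    proof -
      have "((\<lambda>u. phi (g + u)) has_real_derivative max (- (g + u)) 0 * 1) (at u)"
        by (rule DERIV_chain2[OF DERIV_phi]) (auto intro!: derivative_eq_intros)
      then show ?thesis by simp
    qed
    show "isCont (\<lambda>u. max (- (g + u)) 0) u" for g u :: real by (intro continuous_intros)
  qed measurable
  have G: "expectation (\<lambda>\<omega>. Gt s \<omega> * phi (Gt s \<omega>)) = sqrt (2 / pi) / 2" for s
    using expectation_G(1)[of "\<lambda>z. z * phi z" s] std_normal_phi by simp
  have x_i: "integrable M (\<lambda>\<omega>. gobs.A s \<omega> * (max (Gt s \<omega>) 0 * (Yt s \<omega> / (real d + 1) - 1)))"
    and x_b: "\<bar>?x s\<bar> \<le> s * phi_error" if "0 \<le> s" for s
    using gobs.A_mult_le[OF _ that phi_error_L2 phi_error_nonneg] by auto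
  have g_i: "integrable M (\<lambda>\<omega>. gobs.A s \<omega> * Gt s \<omega>)" and g_b: "\<bar>?g s\<bar> \<le> s" if "0 \<le> s" for s
    using gobs.A_mult_le[of "Gt s" s 1] that G_moments(1)[of s 2] G_moments(3)[of s] by auto
  have rhs: "expectation (\<lambda>\<omega>. gobs.A s \<omega> * (max (- Gt s \<omega>) 0 + max (Gt s \<omega>) 0 * (resample d phi (Yt s \<omega>) - phi (Gt s \<omega>)))) = - ?g s - ?x s"
    if s: "0 \<le> s" for s
  proof -
    have "max (- z) 0 + max z 0 * (- y - phi z) = - z - max z 0 * (y - 1)" for y z by (auto simp: phi_def max_def algebra_simps)
    then have "gobs.A s \<omega> * (max (- Gt s \<omega>) 0 + max (Gt s \<omega>) 0 * (resample d phi (Yt s \<omega>) - phi (Gt s \<omega>))) =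
      - (gobs.A s \<omega> * Gt s \<omega>) - gobs.A s \<omega> * (max (Gt s \<omega>) 0 * (Yt s \<omega> / (real d + 1) - 1))" for \<omega>
      by (simp only: resample_phi[OF Yt_nonneg] right_diff_distrib mult_minus_right)
    then show ?thesis using g_i[OF s] x_i[OF s] by simp
  qed
  have x_m: "?x \<in> borel_measurable borel" and g_m: "?g \<in> borel_measurable borel"
    by (rule expectation_measurable; measurable)+
  have x_b': "\<bar>indicator {0..t} s * ?x s\<bar> \<le> indicator {0..t} s * (t * phi_error)" for s
  proof (cases "s \<in> {0..t}")
    case True
    then have "s * phi_error \<le> t * phi_error" using phi_error_nonneg by (intro mult_right_mono) auto
    then show ?thesis using True x_b[of s] by simp
  qed simp
  have i3: "integrable lborel (\<lambda>s. indicator {0..t} s * ?x s)"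
    by (rule integrable_Icc_bounded[OF _ x_b']) (intro borel_measurable_times borel_measurable_indicator x_m, simp)
  have i2: "integrable lborel (\<lambda>s. indicator {0..t} s * ?g s)"
  proof (rule integrable_Icc_bounded[where t=t and K=t])
    show "\<bar>indicator {0..t} s * ?g s\<bar> \<le> indicator {0..t} s * t" for s
      using g_b[of s] by (auto simp: indicator_def)
  qed (intro borel_measurable_times borel_measurable_indicator g_m, simp)
  have i1: "integrable lborel (\<lambda>s. indicator {0..t} s * (sqrt (2 / pi) / 2))" by simp
  have "expectation (\<lambda>\<omega>. gobs.A t \<omega> * phi (Gt t \<omega>)) = (\<integral>s. indicator {0..t} s * (sqrt (2 / pi) / 2) - indicator {0..t} s * ?g s - indicator {0..t} s * ?x s \<partial>lborel)"
    unfolding dyn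
  proof (rule Bochner_Integration.integral_cong[OF refl], goal_cases)
    case (1 s)
    show ?case
    proof (cases "s \<in> {0..t}")
      case True
      then have "0 \<le> s" by simp
      then show ?thesis using True by (simp only: rhs G indicator_simps) simp
    next
      case False
      then show ?thesis by simp
    qed
  qed
  also have "\<dots> = (\<integral>s. indicator {0..t} s * (sqrt (2 / pi) / 2) \<partial>lborel) - (\<integral>s. indicator {0..t} s * ?g s \<partial>lborel) - (\<integral>s. indicator {0..t} s * ?x s \<partial>lborel)"
    by (simp only: Bochner_Integration.integral_diff[OF i1 i2] Bochner_Integration.integral_diff[OF Bochner_Integration.integrable_diff[OF i1 i2] i3])
  finally have E: "expectation (\<lambda>\<omega>. gobs.A t \<omega> * phi (Gt t \<omega>)) = t * (sqrt (2 / pi) / 2) - (\<integral>s. indicator {0..t} s * ?g s \<partial>lborel) - (\<integral>s. indicator {0..t} s * ?x s \<partial>lborel)"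
    using t by simp
  have "expectation (\<lambda>\<omega>. (gobs.A t \<omega>)\<^sup>2) = (\<integral>s. 2 * (indicator {0..t} s * ?g s) \<partial>lborel)"
    unfolding gobs.A_sq_eq[OF t] by (intro Bochner_Integration.integral_cong refl) simp
  also have "\<dots> = 2 * (\<integral>s. indicator {0..t} s * ?g s \<partial>lborel)" by (rule integral_mult_right_zero)
  finally have "2 * expectation (\<lambda>\<omega>. gobs.A t \<omega> * phi (Gt t \<omega>)) - (sqrt (2 / pi) * t - expectation (\<lambda>\<omega>. (gobs.A t \<omega>)\<^sup>2)) =
    - (2 * (\<integral>s. indicator {0..t} s * ?x s \<partial>lborel))" unfolding E by (simp add: algebra_simps)
  moreover have "\<bar>\<integral>s. indicator {0..t} s * ?x s \<partial>lborel\<bar> \<le> t\<^sup>2 * phi_error"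
  proof -
    have "\<bar>\<integral>s. indicator {0..t} s * ?x s \<partial>lborel\<bar> \<le> (\<integral>s. \<bar>indicator {0..t} s * ?x s\<bar> \<partial>lborel)" by (rule integral_abs_bound)
    also have "\<dots> \<le> (\<integral>s. indicator {0..t} s * (t * phi_error) \<partial>lborel)"
      by (rule integral_mono[OF integrable_abs[OF i3] _ x_b']) simp
    also have "\<dots> = t\<^sup>2 * phi_error" using t by (simp add: power2_eq_square)
    finally show ?thesis .
  qed
  ultimately show ?thesis by linarith
qed

text \<open>Since \<open>phi\<close> has L2 norm at most 1, its correlation with the functional is
  at most \<open>sqrt e\<close>, of lower order than \<open>e\<close> for large times. This
  determines the growth rate of \<open>e\<close> without solving the Volterra equation.\<close>

lemma A_sq_estimate:
  assumes t: "0 \<le> t"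
  defines "e \<equiv> expectation (\<lambda>\<omega>. (gobs.A t \<omega>)\<^sup>2)"
  shows "0 \<le> e" "\<bar>e - sqrt (2 / pi) * t\<bar> \<le> 2 * sqrt e + 2 * (t\<^sup>2 * phi_error)"
proof -
  show e: "0 \<le> e" unfolding e_def by simp
  have "\<bar>expectation (\<lambda>\<omega>. gobs.A t \<omega> * phi (Gt t \<omega>))\<bar> \<le> sqrt e * 1"
    using e by (intro expectation_mult_le(2)[OF _ _ gobs.A_sq_integrable[OF t] phi_L2(1) _ phi_L2(2)])
      (auto simp: e_def)
  then show "\<bar>e - sqrt (2 / pi) * t\<bar> \<le> 2 * sqrt e + 2 * (t\<^sup>2 * phi_error)"
    using phi_estimate[OF t] unfolding e_def by linarith
qed

end

section \<open>The potential: an approximate eigenfunction\<close>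

lemma square_sum_le: "(x + y)\<^sup>2 \<le> 2 * x\<^sup>2 + 2 * (y::real)\<^sup>2"
  using zero_le_power2[of "x - y"] by (simp add: power2_sum power2_diff)

text \<open>L2 bound of \<open>remainder\<close>. The constants are
  \<open>168 = 4 * (18 + 8 * 3)\<close>, \<open>3936 = 32 * (18 + 105)\<close> and
  \<open>168 = 16 * 21 / 2\<close>, from the moments of \<open>G\<close> and
  \<open>hc\<close>.\<close>

definition relax_error :: "nat \<Rightarrow> real" where
  "relax_error d = sqrt (168 / real d + 3936 * (sqrt (2 * real d) / (real d + 1)) + 168 * (rayleigh_gap d)\<^sup>2)"

text \<open>L2 bound of \<open>corrector\<close>, with
  \<open>187 = 3 + 16 * 21 / 2 + 16\<close>.\<close>

definition corrector_error :: "nat \<Rightarrow> real" where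
  "corrector_error d = sqrt (187 / real d)"

lemma relax_error_nonneg: "0 \<le> relax_error d"
  by (simp add: relax_error_def)

lemma corrector_error_nonneg: "0 \<le> corrector_error d"
  by (simp add: corrector_error_def)

lemma relax_error_tendsto: "relax_error \<longlonglongrightarrow> 0"
proof -
  have "(\<lambda>d. 168 / real d) \<longlonglongrightarrow> 0" "(\<lambda>d. sqrt (2 * real d) / (real d + 1)) \<longlonglongrightarrow> 0" by real_asymp+
  then have "(\<lambda>d. sqrt (168 / real d + 3936 * (sqrt (2 * real d) / (real d + 1)) + 168 * (rayleigh_gap d)\<^sup>2)) \<longlonglongrightarrow> sqrt (0 + 3936 * 0 + 168 * 0\<^sup>2)"
    by (intro tendsto_intros rayleigh_gap_tendsto)
  then show ?thesis by (simp add: relax_error_def[abs_def])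
qed

lemma corrector_error_tendsto: "corrector_error \<longlonglongrightarrow> 0"
  unfolding corrector_error_def by real_asymp

context fecmc_stationary
begin

lemma d_pos: "0 < real d" using d by simp

lemma h_observable: "fecmc_observable M d \<nu> X V \<tau> (\<lambda>y g. hc y)
    (\<lambda>y g u. ((y - d) * u + g * u\<^sup>2 + u ^ 3 / 3) / sqrt (2 * real d)) (real d) 1"
proof unfold_locales
  show "((\<lambda>u. ((y - d) * u + g * u\<^sup>2 + u ^ 3 / 3) / sqrt (2 * real d)) has_real_derivative hc (y + 2 * g * u + u\<^sup>2)) (at u)" for y g u :: real
  proof -
    have "((\<lambda>u. ((y - d) * u + g * u\<^sup>2 + u ^ 3 / 3) / sqrt (2 * real d)) has_real_derivative ((y - d) + 2 * g * u + u\<^sup>2) / sqrt (2 * real d)) (at u)"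
      by (rule DERIV_cdivide) (auto intro!: derivative_eq_intros)
    then show ?thesis by (simp add: hc_def algebra_simps)
  qed
  show "\<bar>hc y\<bar> \<le> real d * (1 + y) ^ 1" if "g\<^sup>2 \<le> y" for y g :: real
  proof -
    have y: "0 \<le> y" using that zero_le_power2 order_trans by blast
    have "\<bar>hc y\<bar> = \<bar>y - d\<bar> / sqrt (2 * real d)" using d_pos by (simp add: hc_def)
    also have "\<dots> \<le> \<bar>y - d\<bar> / 1" using d by (intro divide_left_mono) auto
    also have "\<dots> \<le> y + d" using y by simp
    also have "\<dots> \<le> real d * (1 + y)" using mult_right_mono[of 1 "real d" y] y d by (simp add: algebra_simps)
    finally show ?thesis by simp
  qed
  show "isCont (\<lambda>u. hc (y + 2 * g * u + u\<^sup>2)) u" for y g u :: real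
    unfolding hc_def using d_pos by (intro continuous_intros) auto
  show "expectation (\<lambda>\<omega>. hc (Yt t \<omega>)) = 0" "expectation (\<lambda>\<omega>. (hc (Yt t \<omega>))\<^sup>2) = 1" for t
    using hc_moments by simp_all
qed (use Y_moments in \<open>simp_all\<close>)

interpretation hobs: fecmc_observable M d \<nu> X V \<tau> "\<lambda>y g. hc y"
    "\<lambda>y g u. ((y - d) * u + g * u\<^sup>2 + u ^ 3 / 3) / sqrt (2 * real d)" "real d" 1
  by (rule h_observable)

text \<open>\<open>hc + corrector\<close> is an approximate eigenfunction of the generator: the term with \<open>phi\<close> removes
  the leading part of the drift of \<open>hc\<close>, and the term with \<open>chi\<close> averages out the jump rate.\<close>

definition corrector :: "real \<Rightarrow> real \<Rightarrow> real" where
  "corrector y g = sqrt (2 / d) * phi g + 2 / (real d + 1) * (hc y * chi g)"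

definition quantile_mean :: real where "quantile_mean = (\<integral>b. rayleigh_quantile d b \<partial>rayleigh)"

text \<open>\<open>d + 1\<close> times the defect in the eigenvalue equation. Its first part comes
  from the mismatch of \<open>d\<close> and \<open>d + 1\<close> and from differentiating
  \<open>hc\<close> in the product with \<open>chi\<close>; its second from the true post-jump mean
  of \<open>chi\<close> not being \<open>1 / 2\<close>.\<close>

definition remainder :: "real \<Rightarrow> real \<Rightarrow> real" where
  "remainder y g = sqrt (2 / d) * (max g 0 + 2 * g * chi g) + 2 * (hc y * (max g 0 * (gauss_const * sqrt y * quantile_mean - 1 / 2)))"

lemma chi_measurable [measurable]:
  "chi \<in> borel_measurable borel" "chi' \<in> borel_measurable borel"
  by (intro borel_measurable_continuous_onI continuous_chi continuous_chi')+

text \<open>After a jump the radial velocity is not positive, where \<open>phi\<close> is quadratic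
  and \<open>chi\<close> linear. Hence only the first two moments of the radial draw enter.\<close>

lemma resample_corrector:
  assumes y: "0 \<le> y"
  shows "resample d (\<lambda>g. hc y + corrector y g) y =
    hc y - sqrt (2 / d) * (y / (real d + 1)) + 2 / (real d + 1) * (hc y * (gauss_const * sqrt y * quantile_mean))"
proof -
  let ?q = "rayleigh_quantile d"
  have d2: "2 \<le> d" using d by simp
  have q: "0 \<le> ?q b" "?q b < 1" for b using rayleigh_quantile_bounds[OF d2] by auto
  have iq: "integrable rayleigh ?q" by (rule integrable_rayleigh_quantile[OF d2])
  have iq2: "integrable rayleigh (\<lambda>b. (?q b)\<^sup>2)"
    using q by (intro rayleigh.integrable_const_bound[where B=1] AE_I2) (auto simp: abs_square_le_1 intro: less_imp_le)
  have "hc y + corrector y (- (sqrt y * ?q b)) = hc y + (- (sqrt (2 / d) * (y / 2))) * (?q b)\<^sup>2 + (2 / (real d + 1) * (hc y * (gauss_const * sqrt y))) * ?q b" for b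
  proof -
    have "0 \<le> sqrt y * ?q b" using y q(1)[of b] by simp
    then have "phi (- (sqrt y * ?q b)) = - (y / 2 * (?q b)\<^sup>2)" "chi (- (sqrt y * ?q b)) = gauss_const * sqrt y * ?q b"
      using y by (simp_all add: phi_def chi_def power_mult_distrib)
    then show ?thesis unfolding corrector_def by (simp only:) (simp add: algebra_simps)
  qed
  then have "resample d (\<lambda>g. hc y + corrector y g) y =
     hc y + (- (sqrt (2 / d) * (y / 2))) * (2 / (real d + 1)) + (2 / (real d + 1) * (hc y * (gauss_const * sqrt y))) * quantile_mean"
    unfolding resample_def quantile_mean_def integral_rayleigh_quantile_sq[OF d, symmetric]
    using iq iq2 rayleigh.prob_space by simp
  also have "- (sqrt (2 / d) * (y / 2)) * (2 / D) = - (sqrt (2 / d) * (y / D))" for D :: real by simp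
  finally show ?thesis by (simp add: algebra_simps)
qed

text \<open>With \<open>r = sqrt (2 / d)\<close> one has \<open>r * y = r * d + 2 * hc y\<close>.
  The \<open>phi\<close> terms cancel the constant part up to \<open>r / (d + 1)\<close> and leave
  \<open>- 2 / (d + 1) * max g 0 * hc y\<close>; the \<open>chi\<close> term replaces
  \<open>max g 0\<close> by \<open>gauss_const\<close> through \<open>chi_poisson\<close>. The
  product \<open>max g 0 * phi g\<close> vanishes because the supports are disjoint.\<close>

lemma generator_corrector:
  assumes y: "0 \<le> y"
  shows "(sqrt (2 / d) * g + (sqrt (2 / d) * max (- g) 0 + 2 / (real d + 1) * (sqrt (2 / d) * g * chi g + hc y * chi' g)))
    + max g 0 * (resample d (\<lambda>g. hc y + corrector y g) y - (hc y + corrector y g))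
    = - (2 * gauss_const / (real d + 1)) * hc y + 1 / (real d + 1) * remainder y g"
proof -
  define D r h p m c where "D = real d + 1" and "r = sqrt (2 / d)" and "h = hc y" and "p = max g 0"
    and "m = gauss_const" and "c = chi g"
  have D: "D \<noteq> 0" "real d = D - 1" by (simp_all add: D_def)
  have y_eq: "y = d + sqrt (2 * real d) * h" using d_pos by (simp add: h_def hc_def)
  have "r * sqrt (2 * real d) = 2" using d_pos by (simp add: r_def real_sqrt_mult real_sqrt_divide)
  moreover have "r * y = r * real d + (r * sqrt (2 * real d)) * h" by (subst y_eq) (simp add: distrib_left mult.assoc)
  ultimately have ry: "r * y = r * (D - 1) + 2 * h" unfolding D(2) by simp
  have pphi: "p * phi g = 0" by (auto simp: p_def phi_def max_def)
  have g: "g + max (- g) 0 = p" by (simp add: p_def max_def)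
  have chi': "chi' g = p * c + p / 2 - m"
    using chi_poisson[of g] by (simp add: p_def m_def c_def)
  have "(r * g + (r * max (- g) 0 + 2 / D * (r * g * c + h * chi' g)))
    + p * (h - r * (y / D) + 2 / D * (h * (m * sqrt y * quantile_mean)) - (h + (r * phi g + 2 / D * (h * c))))
    = r * (g + max (- g) 0) + 2 / D * (r * g * c + h * chi' g) - p * (r * y) / D + 2 / D * (p * h * (m * sqrt y * quantile_mean)) - r * (p * phi g) - 2 / D * (p * h * c)"
    by (simp add: algebra_simps)
  also have "\<dots> = r * p + 2 / D * (r * g * c + h * (p * c + p / 2 - m)) - p * (r * (D - 1) + 2 * h) / D + 2 / D * (p * h * (m * sqrt y * quantile_mean)) - 2 / D * (p * h * c)"
    unfolding pphi g chi' ry by simp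
  also have "\<dots> = - (2 * m / D) * h + 1 / D * (r * (p + 2 * g * c) + 2 * (h * (p * (m * sqrt y * quantile_mean - 1 / 2))))"
    using D(1) by (simp add: divide_simps) (simp add: algebra_simps)
  finally show ?thesis
    unfolding resample_corrector[OF y] unfolding corrector_def remainder_def
    unfolding D_def r_def h_def p_def m_def c_def .
qed

lemma corrector_L2:
  "integrable M (\<lambda>\<omega>. (corrector (Yt s \<omega>) (Gt s \<omega>))\<^sup>2)"
  "expectation (\<lambda>\<omega>. (corrector (Yt s \<omega>) (Gt s \<omega>))\<^sup>2) \<le> (corrector_error d)\<^sup>2"
proof -
  let ?K = "\<lambda>\<omega>. 1 / real d * Gt s \<omega> ^ 4 + 16 / real d * ((Gt s \<omega>)\<^sup>2 * (hc (Yt s \<omega>))\<^sup>2) + 16 / real d * (hc (Yt s \<omega>))\<^sup>2"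
  have iK: "integrable M ?K" using GH_sq G_moments hc_moments by simp
  have "expectation ?K = 1 / real d * 3 + 16 / real d * expectation (\<lambda>\<omega>. (Gt s \<omega>)\<^sup>2 * (hc (Yt s \<omega>))\<^sup>2) + 16 / real d"
    using GH_sq G_moments hc_moments by simp
  also have "\<dots> \<le> 1 / real d * 3 + 16 / real d * (21 / 2) + 16 / real d"
    using GH_sq(2) by (intro add_mono mult_left_mono order_refl) auto
  also have "\<dots> = (corrector_error d)\<^sup>2"
  proof -
    have "1 / D * 3 + 16 / D * (21 / 2) + 16 / D = 187 / D" for D :: real by (simp add: add_divide_distrib[symmetric])
    moreover have "(corrector_error d)\<^sup>2 = 187 / real d" unfolding corrector_error_def by (rule real_sqrt_pow2) simp
    ultimately show ?thesis by (simp only:)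
  qed
  finally have K: "expectation ?K \<le> (corrector_error d)\<^sup>2" .
  have le: "(corrector (Yt s \<omega>) (Gt s \<omega>))\<^sup>2 \<le> ?K \<omega>" for \<omega>
  proof -
    define h g where "h = hc (Yt s \<omega>)" and "g = Gt s \<omega>"
    have ph: "(phi g)\<^sup>2 \<le> g ^ 4 / 4" by (auto simp: phi_def max_def power_divide power_mult[symmetric])
    have "(chi g)\<^sup>2 \<le> (\<bar>g\<bar> + 1)\<^sup>2" using power_mono[OF chi_bound[of g] abs_ge_zero, of 2] by simp
    also have "\<dots> \<le> 2 * g\<^sup>2 + 2" using square_sum_le[of "\<bar>g\<bar>" 1] by simp
    finally have ch: "(chi g)\<^sup>2 \<le> 2 * g\<^sup>2 + 2" .
    have "real d \<le> (real d + 1)\<^sup>2" by (simp add: power2_eq_square algebra_simps)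
    then have dd: "1 / (real d + 1)\<^sup>2 \<le> 1 / real d" using d_pos by (intro divide_left_mono) auto
    have "(corrector (Yt s \<omega>) g)\<^sup>2 \<le> 2 * (sqrt (2 / d) * phi g)\<^sup>2 + 2 * (2 / (real d + 1) * (h * chi g))\<^sup>2"
      unfolding corrector_def h_def by (rule square_sum_le)
    also have "\<dots> = 4 / d * (phi g)\<^sup>2 + 8 * (1 / (real d + 1)\<^sup>2 * (h\<^sup>2 * (chi g)\<^sup>2))"
      using d_pos by (simp add: power_mult_distrib power_divide)
    also have "\<dots> \<le> 4 / d * (g ^ 4 / 4) + 8 * (1 / real d * (h\<^sup>2 * (2 * g\<^sup>2 + 2)))"
      by (intro add_mono mult_left_mono mult_mono ph ch dd) auto
    also have "\<dots> = 1 / real d * g ^ 4 + 16 / real d * (g\<^sup>2 * h\<^sup>2) + 16 / real d * h\<^sup>2"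
      by (simp add: algebra_simps)
    finally show ?thesis unfolding h_def g_def .
  qed
  have m: "(\<lambda>\<omega>. corrector (Yt s \<omega>) (Gt s \<omega>)) \<in> borel_measurable M"
    unfolding corrector_def by measurable
  show "integrable M (\<lambda>\<omega>. (corrector (Yt s \<omega>) (Gt s \<omega>))\<^sup>2)" by (rule sq_integral_bound(1)[OF m iK le K])
  show "expectation (\<lambda>\<omega>. (corrector (Yt s \<omega>) (Gt s \<omega>))\<^sup>2) \<le> (corrector_error d)\<^sup>2" by (rule sq_integral_bound(2)[OF m iK le K])
qed

text \<open>The bound is linear in \<open>\<bar>hc y\<bar>\<close>, so that fourth moments of \<open>hc\<close> suffice below.\<close>

lemma drift_mean_sq_le:
  assumes y: "0 \<le> y"
  shows "(gauss_const * sqrt y * quantile_mean - 1 / 2)\<^sup>2 \<le> 4 * (sqrt (2 * real d) / (real d + 1)) * \<bar>hc y\<bar> + 2 * (rayleigh_gap d)\<^sup>2"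
proof -
  have d2: "2 \<le> d" using d by simp
  have m: "0 < gauss_const" "gauss_const \<le> 1" by (rule gauss_const_bounds)+
  have m2: "gauss_const\<^sup>2 \<le> 1" using m by (simp add: power_le_one)
  \<comment> \<open>The constant \<open>1 / 2\<close> is written as
    \<open>gauss_const * sqrt (pi / 2)\<close>, which separates the fluctuation of the radius from
    the error of the mean radial draw.\<close>
  have eq: "gauss_const * sqrt y * quantile_mean - 1 / 2 =
     gauss_const * ((sqrt y - sqrt d) * quantile_mean) + gauss_const * (sqrt d * quantile_mean - sqrt (pi / 2))"
    unfolding gauss_const_sqrt[symmetric] by (simp add: algebra_simps)
  have 1: "(sqrt y - sqrt d)\<^sup>2 \<le> sqrt (2 * real d) * \<bar>hc y\<bar>"
  proof -
    have "(sqrt y - sqrt d)\<^sup>2 = \<bar>sqrt y - sqrt d\<bar> * \<bar>sqrt y - sqrt d\<bar>" by (simp add: power2_eq_square)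
    also have "\<dots> \<le> \<bar>sqrt y - sqrt d\<bar> * (sqrt y + sqrt d)" using y real_sqrt_ge_zero[OF y] real_sqrt_ge_zero[of "real d"] by (intro mult_left_mono; linarith)
    also have "\<dots> = \<bar>(sqrt y - sqrt d) * (sqrt y + sqrt d)\<bar>" using y by (simp add: abs_mult)
    also have "(sqrt y - sqrt d) * (sqrt y + sqrt d) = y - d" using y by (simp add: algebra_simps)
    also have "\<bar>y - d\<bar> = sqrt (2 * real d) * \<bar>hc y\<bar>" using d_pos by (simp add: hc_def)
    finally show ?thesis .
  qed
  have "quantile_mean\<^sup>2 \<le> (sqrt (2 / (real d + 1)))\<^sup>2"
    unfolding quantile_mean_def by (intro power_mono rayleigh_quantile_mean_le[OF d])
  then have 2: "quantile_mean\<^sup>2 \<le> 2 / (real d + 1)" by simp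
  have "(sqrt y - sqrt d)\<^sup>2 * quantile_mean\<^sup>2 \<le> (sqrt (2 * real d) * \<bar>hc y\<bar>) * (2 / (real d + 1))"
    using 1 2 by (intro mult_mono) auto
  also have "\<dots> = 2 * (sqrt (2 * real d) / (real d + 1)) * \<bar>hc y\<bar>" by simp
  finally have 3: "(sqrt y - sqrt d)\<^sup>2 * quantile_mean\<^sup>2 \<le> 2 * (sqrt (2 * real d) / (real d + 1)) * \<bar>hc y\<bar>" .
  have 4: "(sqrt d * quantile_mean - sqrt (pi / 2))\<^sup>2 \<le> (rayleigh_gap d)\<^sup>2"
    using power_mono[OF rayleigh_gap_mean[OF d2] abs_ge_zero, of 2] unfolding quantile_mean_def by simp
  have "(gauss_const * sqrt y * quantile_mean - 1 / 2)\<^sup>2 \<le>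
     2 * (gauss_const * ((sqrt y - sqrt d) * quantile_mean))\<^sup>2 + 2 * (gauss_const * (sqrt d * quantile_mean - sqrt (pi / 2)))\<^sup>2"
    unfolding eq by (rule square_sum_le)
  also have "\<dots> = gauss_const\<^sup>2 * (2 * ((sqrt y - sqrt d)\<^sup>2 * quantile_mean\<^sup>2) + 2 * (sqrt d * quantile_mean - sqrt (pi / 2))\<^sup>2)"
    by (simp only: power_mult_distrib distrib_left mult_ac)
  also have "\<dots> \<le> 1 * (2 * ((sqrt y - sqrt d)\<^sup>2 * quantile_mean\<^sup>2) + 2 * (sqrt d * quantile_mean - sqrt (pi / 2))\<^sup>2)"
    by (rule mult_right_mono[OF m2]) simp
  also have "\<dots> \<le> 2 * (2 * (sqrt (2 * real d) / (real d + 1)) * \<bar>hc y\<bar>) + 2 * (rayleigh_gap d)\<^sup>2"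
    unfolding mult_1 by (intro add_mono mult_left_mono 3 4) auto
  finally show ?thesis by simp
qed

lemma remainder_L2:
  "integrable M (\<lambda>\<omega>. (remainder (Yt s \<omega>) (Gt s \<omega>))\<^sup>2)"
  "expectation (\<lambda>\<omega>. (remainder (Yt s \<omega>) (Gt s \<omega>))\<^sup>2) \<le> (relax_error d)\<^sup>2"
proof -
  let ?e = "sqrt (2 * real d) / (real d + 1)" and ?r = "rayleigh_gap d"
  let ?K = "\<lambda>\<omega>. 4 / real d * (18 * (Gt s \<omega>)\<^sup>2 + 8 * Gt s \<omega> ^ 4) + 32 * ?e * (hc (Yt s \<omega>) ^ 4 + Gt s \<omega> ^ 8)
     + 16 * ?r\<^sup>2 * ((Gt s \<omega>)\<^sup>2 * (hc (Yt s \<omega>))\<^sup>2)"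
  have iK: "integrable M ?K"
    using GH_sq(1) G_moments(1)[of s 2] G_moments(1)[of s 4] G_moments(1)[of s 8] hc_moments(6)
    by (intro Bochner_Integration.integrable_add integrable_mult_right) auto
  have "expectation ?K = 4 / real d * 42 + 32 * ?e * (expectation (\<lambda>\<omega>. hc (Yt s \<omega>) ^ 4) + 105)
      + 16 * ?r\<^sup>2 * expectation (\<lambda>\<omega>. (Gt s \<omega>)\<^sup>2 * (hc (Yt s \<omega>))\<^sup>2)"
    using GH_sq(1)[of s] G_moments(1)[of s 2] G_moments(1)[of s 4] G_moments(1)[of s 8] hc_moments(6)[of s] G_moments(3-5)[of s]
    by simp
  also have "\<dots> \<le> 4 / real d * 42 + 32 * ?e * (18 + 105) + 16 * ?r\<^sup>2 * (21 / 2)"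
    using GH_sq(2) hc_moments(3) by (intro add_mono mult_left_mono order_refl) auto
  also have "\<dots> = (relax_error d)\<^sup>2"
  proof -
    have "(relax_error d)\<^sup>2 = 168 / real d + 3936 * ?e + 168 * ?r\<^sup>2" unfolding relax_error_def by (rule real_sqrt_pow2) simp
    moreover have "4 / D * 42 + 32 * e * (18 + 105) + 16 * r * (21 / 2) = 168 / D + 3936 * e + 168 * r" for D e r :: real by simp
    ultimately show ?thesis by (simp only:)
  qed
  finally have K: "expectation ?K \<le> (relax_error d)\<^sup>2" .
  have le: "(remainder (Yt s \<omega>) (Gt s \<omega>))\<^sup>2 \<le> ?K \<omega>" for \<omega>
  proof -
    define y h g where "y = Yt s \<omega>" and "h = hc y" and "g = Gt s \<omega>"
    define k where "k = gauss_const * sqrt y * quantile_mean - 1 / 2"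
    have y: "0 \<le> y" unfolding y_def by (rule Yt_nonneg)
    have k: "k\<^sup>2 \<le> 4 * ?e * \<bar>h\<bar> + 2 * ?r\<^sup>2" unfolding k_def h_def by (rule drift_mean_sq_le[OF y])
    have "\<bar>max g 0 + 2 * g * chi g\<bar> \<le> \<bar>max g 0\<bar> + 2 * (\<bar>g\<bar> * \<bar>chi g\<bar>)"
      using abs_triangle_ineq[of "max g 0" "2 * g * chi g"] by (simp add: abs_mult)
    also have "\<dots> \<le> \<bar>g\<bar> + 2 * (\<bar>g\<bar> * (\<bar>g\<bar> + 1))"
      using chi_bound[of g] by (intro add_mono mult_left_mono) auto
    also have "\<dots> = 3 * \<bar>g\<bar> + 2 * g\<^sup>2" by (simp add: algebra_simps power2_eq_square)
    finally have "(max g 0 + 2 * g * chi g)\<^sup>2 \<le> (3 * \<bar>g\<bar> + 2 * g\<^sup>2)\<^sup>2"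
      using power_mono[OF _ abs_ge_zero, of "max g 0 + 2 * g * chi g" _ 2] by simp
    also have "\<dots> \<le> 2 * (3 * \<bar>g\<bar>)\<^sup>2 + 2 * (2 * g\<^sup>2)\<^sup>2" by (rule square_sum_le)
    finally have 1: "(max g 0 + 2 * g * chi g)\<^sup>2 \<le> 18 * g\<^sup>2 + 8 * g ^ 4" by (simp add: power_mult_distrib)
    \<comment> \<open>Compare \<open>g\<^sup>2\<close> with \<open>\<bar>h\<bar>\<close>: the larger
      one bounds the product. This keeps \<open>hc\<close> within its fourth moment and leaves the
      higher power to the normal variable.\<close>
    have "\<bar>h\<bar> ^ 3 * g\<^sup>2 \<le> h ^ 4 + g ^ 8"
    proof (cases "g\<^sup>2 \<le> \<bar>h\<bar>")
      case True
      then have "\<bar>h\<bar> ^ 3 * g\<^sup>2 \<le> \<bar>h\<bar> ^ 3 * \<bar>h\<bar>" by (intro mult_left_mono) auto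
      also have "\<dots> = \<bar>h\<bar> ^ 4" by (simp add: eval_nat_numeral)
      also have "\<dots> = h ^ 4" by simp
      finally have "\<bar>h\<bar> ^ 3 * g\<^sup>2 \<le> h ^ 4" .
      moreover have "0 \<le> g ^ 8" by simp
      ultimately show ?thesis by linarith
    next
      case False
      then have "\<bar>h\<bar> ^ 3 * g\<^sup>2 \<le> (g\<^sup>2) ^ 3 * g\<^sup>2" by (intro mult_right_mono power_mono) auto
      also have "\<dots> = g ^ 8" by (simp add: power_mult[symmetric] power_add[symmetric])
      finally have "\<bar>h\<bar> ^ 3 * g\<^sup>2 \<le> g ^ 8" .
      moreover have "0 \<le> h ^ 4" by simp
      ultimately show ?thesis by linarith
    qed
    then have 3: "4 * ?e * (\<bar>h\<bar> ^ 3 * g\<^sup>2) \<le> 4 * ?e * (h ^ 4 + g ^ 8)" by (intro mult_left_mono) auto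
    have "(max g 0)\<^sup>2 \<le> g\<^sup>2" by (simp add: max_def)
    then have "(h * (max g 0 * k))\<^sup>2 \<le> h\<^sup>2 * (g\<^sup>2 * (4 * ?e * \<bar>h\<bar> + 2 * ?r\<^sup>2))"
      unfolding power_mult_distrib using k by (intro mult_left_mono mult_mono) auto
    also have "\<dots> = 4 * ?e * (\<bar>h\<bar> ^ 3 * g\<^sup>2) + 2 * ?r\<^sup>2 * (g\<^sup>2 * h\<^sup>2)"
    proof -
      have "\<bar>h\<bar> ^ 3 = \<bar>h\<bar> * h\<^sup>2" by (simp add: power3_eq_cube power2_eq_square)
      then show ?thesis by (simp only:) (simp add: algebra_simps)
    qed
    finally have 2: "(h * (max g 0 * k))\<^sup>2 \<le> 4 * ?e * (h ^ 4 + g ^ 8) + 2 * ?r\<^sup>2 * (g\<^sup>2 * h\<^sup>2)" using 3 by linarith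
    have "(remainder y g)\<^sup>2 \<le> 2 * (sqrt (2 / d) * (max g 0 + 2 * g * chi g))\<^sup>2 + 2 * (2 * (h * (max g 0 * k)))\<^sup>2"
      unfolding remainder_def h_def[symmetric] k_def[symmetric] by (rule square_sum_le)
    also have "\<dots> = 4 / d * (max g 0 + 2 * g * chi g)\<^sup>2 + 8 * (h * (max g 0 * k))\<^sup>2"
      using d_pos by (simp add: power_mult_distrib[of "sqrt (2 / d)"] power_mult_distrib[of 2])
    also have "\<dots> \<le> 4 / d * (18 * g\<^sup>2 + 8 * g ^ 4) + 8 * (4 * ?e * (h ^ 4 + g ^ 8) + 2 * ?r\<^sup>2 * (g\<^sup>2 * h\<^sup>2))"
      by (intro add_mono mult_left_mono 1 2) auto
    also have "\<dots> = 4 / d * (18 * g\<^sup>2 + 8 * g ^ 4) + 32 * ?e * (h ^ 4 + g ^ 8) + 16 * ?r\<^sup>2 * (g\<^sup>2 * h\<^sup>2)"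
      by simp
    finally show ?thesis unfolding h_def g_def y_def .
  qed
  have m: "(\<lambda>\<omega>. remainder (Yt s \<omega>) (Gt s \<omega>)) \<in> borel_measurable M"
    unfolding remainder_def by measurable
  show "integrable M (\<lambda>\<omega>. (remainder (Yt s \<omega>) (Gt s \<omega>))\<^sup>2)" by (rule sq_integral_bound(1)[OF m iK le K])
  show "expectation (\<lambda>\<omega>. (remainder (Yt s \<omega>) (Gt s \<omega>))\<^sup>2) \<le> (relax_error d)\<^sup>2" by (rule sq_integral_bound(2)[OF m iK le K])
qed

end

text \<open>The solution of \<open>x' = 1 - K * x\<close> with \<open>x 0 = 0\<close>, which is the
  covariance of a unit-variance Ornstein-Uhlenbeck process of rate \<open>K\<close> at time
  \<open>t\<close> with its integral up to \<open>t\<close>.\<close>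

definition relaxation :: "real \<Rightarrow> real \<Rightarrow> real" where
  "relaxation K t = (1 - exp (- (K * t))) / K"

text \<open>Integrate the equation \<open>relaxation K = (1 - (relaxation K)') / K\<close>.\<close>

lemma relaxation_integral:
  assumes K: "0 < K" and t: "0 \<le> t"
  shows "integrable lborel (\<lambda>s. indicator {0..t} s * relaxation K s)"
    "(\<integral>s. indicator {0..t} s * relaxation K s \<partial>lborel) = (t - relaxation K t) / K"
proof -
  have "((\<lambda>u. (u - relaxation K u) / K) has_real_derivative relaxation K u) (at u)" for u
    unfolding relaxation_def using K by (auto intro!: derivative_eq_intros simp: diff_divide_distrib)
  moreover have "isCont (relaxation K) u" for u
    unfolding relaxation_def[abs_def] using K by (intro continuous_intros) auto
  ultimately have "has_bochner_integral lborel (\<lambda>s. relaxation K s * indicator {0..t} s) ((t - relaxation K t) / K - (0 - relaxation K 0) / K)"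
    using t by (intro has_bochner_integral_FTC_Icc_real) auto
  then show "integrable lborel (\<lambda>s. indicator {0..t} s * relaxation K s)"
    "(\<integral>s. indicator {0..t} s * relaxation K s \<partial>lborel) = (t - relaxation K t) / K"
    by (auto simp: has_bochner_integral_iff mult.commute relaxation_def)
qed

lemma relaxation_measurable [measurable]: "relaxation K \<in> borel_measurable borel"
  unfolding relaxation_def[abs_def] by measurable

lemma relaxation_bound: "0 < K \<Longrightarrow> 0 \<le> t \<Longrightarrow> \<bar>relaxation K t\<bar> \<le> 1 / K"
  unfolding relaxation_def by (auto simp: divide_simps)

context fecmc_stationary
begin

interpretation hobs: fecmc_observable M d \<nu> X V \<tau> "\<lambda>y g. hc y"
    "\<lambda>y g u. ((y - d) * u + g * u\<^sup>2 + u ^ 3 / 3) / sqrt (2 * real d)" "real d" 1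
  by (rule h_observable)

lemma hc_bound: "0 \<le> y \<Longrightarrow> \<bar>hc y\<bar> \<le> real d * (1 + y)"
  using hobs.a_bound[of 0 y] by simp

definition corrector_drift :: "real \<Rightarrow> real \<Rightarrow> real" where
  "corrector_drift y g = sqrt (2 / d) * g + (sqrt (2 / d) * max (- g) 0 + 2 / (real d + 1) * (sqrt (2 / d) * g * chi g + hc y * chi' g))"

lemma corrector_bounds:
  fixes y g :: real
  assumes g: "g\<^sup>2 \<le> y"
  shows "\<bar>hc y + corrector y g\<bar> \<le> (4 * real d + 4) * (1 + y) ^ 2" "\<bar>corrector_drift y g\<bar> \<le> (4 * real d + 4) * (1 + y) ^ 2"
proof -
  define w where "w = 1 + y"
  define r where "r = sqrt (2 / d)"
  define q where "q = 2 / (real d + 1)"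
  have y: "0 \<le> y" using g zero_le_power2 order_trans by blast
  have w: "1 \<le> w" using y by (simp add: w_def)
  have ww: "w \<le> w * w" using mult_left_mono[of 1 w w] w by simp
  have r: "0 \<le> r" "r \<le> 1" using d by (auto simp: r_def)
  have q: "0 \<le> q" "q \<le> 1" using d by (auto simp: q_def)
  have gw: "\<bar>g\<bar> \<le> w" using nonneg_le_of_sq_le[OF g] by (simp add: w_def)
  have h: "\<bar>hc y\<bar> \<le> d * w" using hc_bound[OF y] by (simp add: w_def)
  have ph: "\<bar>phi g\<bar> \<le> w" using phi_bound[of g] g by (simp add: w_def)
  have c: "\<bar>chi g\<bar> \<le> 2 * w" "\<bar>chi' g\<bar> \<le> 2 * w" using chi_bound[of g] chi'_bound[of g] gw w by linarith+
  have hc: "\<bar>hc y * chi g\<bar> \<le> (d * w) * (2 * w)" "\<bar>hc y * chi' g\<bar> \<le> (d * w) * (2 * w)"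
    unfolding abs_mult using w by (intro mult_mono h c; simp)+
  have gc: "\<bar>r * g * chi g\<bar> \<le> (1 * w) * (2 * w)"
    unfolding abs_mult using r w gw by (intro mult_mono c) auto
  have le: "\<bar>c * x\<bar> \<le> z" if "0 \<le> c" "c \<le> 1" "\<bar>x\<bar> \<le> z" for c x z :: real
    unfolding abs_mult using that mult_mono[of "\<bar>c\<bar>" 1 "\<bar>x\<bar>" z] by simp
  have dw: "d * w \<le> d * (w * w)" using ww by (intro mult_left_mono) auto
  have "\<bar>hc y + corrector y g\<bar> \<le> \<bar>hc y\<bar> + (\<bar>r * phi g\<bar> + \<bar>q * (hc y * chi g)\<bar>)"
    unfolding corrector_def r_def[symmetric] q_def[symmetric] by linarith
  also have "\<dots> \<le> d * w + (w + (d * w) * (2 * w))"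
    by (intro add_mono h le r q ph hc)
  also have "\<dots> \<le> (4 * real d + 4) * w ^ 2"
  proof -
    have "(4 * real d + 4) * w ^ 2 = 4 * (d * (w * w)) + 4 * (w * w)" by (simp add: algebra_simps power2_eq_square)
    moreover have "(d * w) * (2 * w) = 2 * (d * (w * w))" by simp
    ultimately show ?thesis using dw ww w zero_le_square[of w] mult_nonneg_nonneg[of "real d" "w * w"] by linarith
  qed
  finally show "\<bar>hc y + corrector y g\<bar> \<le> (4 * real d + 4) * (1 + y) ^ 2" by (simp add: w_def)
  have "\<bar>corrector_drift y g\<bar> \<le> \<bar>r * g\<bar> + (\<bar>r * max (- g) 0\<bar> + \<bar>q * (r * g * chi g + hc y * chi' g)\<bar>)"
    unfolding corrector_drift_def r_def[symmetric] q_def[symmetric] by linarith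
  also have "\<dots> \<le> w + (w + ((1 * w) * (2 * w) + (d * w) * (2 * w)))"
    by (intro add_mono le r q order_trans[OF abs_triangle_ineq] gc hc) (use gw w in auto)
  also have "\<dots> \<le> (4 * real d + 4) * w ^ 2"
  proof -
    have "(4 * real d + 4) * w ^ 2 = 4 * (d * (w * w)) + 4 * (w * w)" by (simp add: algebra_simps power2_eq_square)
    moreover have "(d * w) * (2 * w) = 2 * (d * (w * w))" "(1 * w) * (2 * w) = 2 * (w * w)" by simp_all
    ultimately show ?thesis using dw ww w zero_le_square[of w] mult_nonneg_nonneg[of "real d" "w * w"] by linarith
  qed
  finally show "\<bar>corrector_drift y g\<bar> \<le> (4 * real d + 4) * (1 + y) ^ 2" by (simp add: w_def)
qed

lemma corrector_deriv:
  "((\<lambda>u. hc (y + 2 * g * u + u\<^sup>2) + corrector (y + 2 * g * u + u\<^sup>2) (g + u)) has_real_derivative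
     corrector_drift (y + 2 * g * u + u\<^sup>2) (g + u)) (at u)"
proof -
  have h: "((\<lambda>u. hc (y + 2 * g * u + u\<^sup>2)) has_real_derivative sqrt (2 / d) * (g + u)) (at u)"
  proof -
    have "((\<lambda>u. (y + 2 * g * u + u\<^sup>2 - d) / sqrt (2 * real d)) has_real_derivative (2 * g + 2 * u) / sqrt (2 * real d)) (at u)"
      by (rule DERIV_cdivide) (auto intro!: derivative_eq_intros)
    moreover have "(2 * g + 2 * u) / sqrt (2 * real d) = sqrt (2 / d) * (g + u)"
    proof -
      have "sqrt (2 / d) * sqrt (2 * real d) = 2" using d_pos by (simp add: real_sqrt_mult[symmetric])
      then have "sqrt (2 / d) * (g + u) * sqrt (2 * real d) = 2 * g + 2 * u" by (simp add: algebra_simps)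
      then show ?thesis using d_pos by (simp add: divide_eq_eq)
    qed
    ultimately show ?thesis by (simp add: hc_def)
  qed
  have gu: "((\<lambda>u. g + u) has_real_derivative 1) (at u)" by (auto intro!: derivative_eq_intros)
  have p: "((\<lambda>u. phi (g + u)) has_real_derivative max (- (g + u)) 0) (at u)"
    using DERIV_chain2[OF DERIV_phi gu] by simp
  have c: "((\<lambda>u. chi (g + u)) has_real_derivative chi' (g + u)) (at u)"
    using DERIV_chain2[OF DERIV_chi gu] by simp
  show ?thesis
    unfolding corrector_def
    by (rule DERIV_cong[OF DERIV_add[OF h DERIV_add[OF DERIV_cmult[OF p] DERIV_cmult[OF DERIV_mult[OF h c]]]]])
      (simp add: corrector_drift_def mult.commute)
qed

lemma corrector_drift_cont: "isCont (\<lambda>u. corrector_drift (y + 2 * g * u + u\<^sup>2) (g + u)) u"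
proof -
  have "continuous_on UNIV (\<lambda>u. corrector_drift (y + 2 * g * u + u\<^sup>2) (g + u))"
    unfolding corrector_drift_def hc_def using d_pos
    by (intro continuous_intros continuous_on_compose2[OF continuous_chi[of UNIV]] continuous_on_compose2[OF continuous_chi'[of UNIV]]) auto
  then show ?thesis by (simp add: continuous_on_eq_continuous_at)
qed

definition h_cov :: "real \<Rightarrow> real" where
  "h_cov s = expectation (\<lambda>\<omega>. hobs.A s \<omega> * hc (Yt s \<omega>))"

lemma h_cov_measurable [measurable]: "h_cov \<in> borel_measurable borel"
  unfolding h_cov_def[abs_def] by (rule expectation_measurable) measurable

lemma h_cov_bound: "0 \<le> s \<Longrightarrow> \<bar>h_cov s\<bar> \<le> s"
  and h_cov_integrable: "0 \<le> s \<Longrightarrow> integrable M (\<lambda>\<omega>. hobs.A s \<omega> * hc (Yt s \<omega>))"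
  using hobs.A_mult_le[of "\<lambda>\<omega>. hc (Yt s \<omega>)" s 1] hc_moments[of s] unfolding h_cov_def by simp_all

text \<open>Dynkin's formula for the functional times \<open>hc + corrector\<close> is the
  integrated form of \<open>x' = 1 - K * x\<close>. The corrector enters twice, at the endpoint and
  in the source, each time with at most \<open>t * corrector_error d\<close>; the defect enters
  through \<open>remainder\<close>.\<close>

lemma h_cov_estimate:
  assumes t: "0 \<le> t"
  defines "K \<equiv> 2 * gauss_const / (real d + 1)"
  shows "\<bar>h_cov t - t + K * (\<integral>s. indicator {0..t} s * h_cov s \<partial>lborel)\<bar>
    \<le> 2 * t * corrector_error d + t\<^sup>2 / (real d + 1) * relax_error d"
proof -
  let ?D = "real d + 1"
  have cm: "(\<lambda>x. corrector (p x) (q x)) \<in> borel_measurable N" "(\<lambda>x. corrector_drift (p x) (q x)) \<in> borel_measurable N"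
      "(\<lambda>x. remainder (p x) (q x)) \<in> borel_measurable N"
    if [measurable]: "p \<in> borel_measurable N" "q \<in> borel_measurable N" for p q N
    unfolding corrector_def corrector_drift_def remainder_def by measurable
  let ?x = "\<lambda>s. expectation (\<lambda>\<omega>. hc (Yt s \<omega>) * corrector (Yt s \<omega>) (Gt s \<omega>))"
  let ?z = "\<lambda>s. expectation (\<lambda>\<omega>. hobs.A s \<omega> * remainder (Yt s \<omega>) (Gt s \<omega>))"
  let ?w = "\<lambda>s. ?x s + 1 / ?D * ?z s"
  have dyn: "expectation (\<lambda>\<omega>. hobs.A t \<omega> * (hc (Yt t \<omega>) + corrector (Yt t \<omega>) (Gt t \<omega>))) =
    (\<integral>s. indicator {0..t} s * (expectation (\<lambda>\<omega>. hc (Yt s \<omega>) * (hc (Yt s \<omega>) + corrector (Yt s \<omega>) (Gt s \<omega>))) +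
      expectation (\<lambda>\<omega>. hobs.A s \<omega> * (corrector_drift (Yt s \<omega>) (Gt s \<omega>) + max (Gt s \<omega>) 0 *
         (resample d (\<lambda>g. hc (Yt s \<omega>) + corrector (Yt s \<omega>) g) (Yt s \<omega>) - (hc (Yt s \<omega>) + corrector (Yt s \<omega>) (Gt s \<omega>)))))) \<partial>lborel)"
  proof (rule hobs.dynkin_mult[where f="\<lambda>s y g. hc y + corrector y g" and Df="\<lambda>s y g. corrector_drift y g" and C="4 * real d + 4" and k=2, OF t])
    show "(\<lambda>p. hc (fst (snd p)) + corrector (fst (snd p)) (snd (snd p))) \<in> borel_measurable (borel \<Otimes>\<^sub>M borel \<Otimes>\<^sub>M borel)"
      "(\<lambda>p. corrector_drift (fst (snd p)) (snd (snd p))) \<in> borel_measurable (borel \<Otimes>\<^sub>M borel \<Otimes>\<^sub>M borel)"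
      by (intro borel_measurable_add measurable_compose[OF _ hc_measurable] cm; measurable)+
  qed (assumption | rule corrector_bounds corrector_deriv corrector_drift_cont)+
  have cA_i: "integrable M (\<lambda>\<omega>. hobs.A s \<omega> * corrector (Yt s \<omega>) (Gt s \<omega>))"
    and cA_b: "\<bar>expectation (\<lambda>\<omega>. hobs.A s \<omega> * corrector (Yt s \<omega>) (Gt s \<omega>))\<bar> \<le> s * corrector_error d" if "0 \<le> s" for s
    using hobs.A_mult_le[OF _ that corrector_L2 corrector_error_nonneg] cm(1)[of "Yt s" M "Gt s"] by auto
  have x_i: "integrable M (\<lambda>\<omega>. hc (Yt s \<omega>) * corrector (Yt s \<omega>) (Gt s \<omega>))"
    and x_b: "\<bar>?x s\<bar> \<le> 1 * corrector_error d" for s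
    using cm(1)[of "Yt s" M "Gt s"] hc_moments(2)[of s]
      expectation_mult_le[OF _ _ hc_moments(5) corrector_L2(1) _ corrector_L2(2) _ corrector_error_nonneg, of s s 1]
    by auto
  have z_i: "integrable M (\<lambda>\<omega>. hobs.A s \<omega> * remainder (Yt s \<omega>) (Gt s \<omega>))"
    and z_b: "\<bar>?z s\<bar> \<le> s * relax_error d" if "0 \<le> s" for s
    using hobs.A_mult_le[OF _ that remainder_L2 relax_error_nonneg] cm(3)[of "Yt s" M "Gt s"] by auto
  have rhs: "expectation (\<lambda>\<omega>. hc (Yt s \<omega>) * (hc (Yt s \<omega>) + corrector (Yt s \<omega>) (Gt s \<omega>))) +
      expectation (\<lambda>\<omega>. hobs.A s \<omega> * (corrector_drift (Yt s \<omega>) (Gt s \<omega>) + max (Gt s \<omega>) 0 *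
         (resample d (\<lambda>g. hc (Yt s \<omega>) + corrector (Yt s \<omega>) g) (Yt s \<omega>) - (hc (Yt s \<omega>) + corrector (Yt s \<omega>) (Gt s \<omega>)))))
     = 1 - K * h_cov s + ?w s" if s: "0 \<le> s" for s
  proof -
    have "expectation (\<lambda>\<omega>. hc (Yt s \<omega>) * (hc (Yt s \<omega>) + corrector (Yt s \<omega>) (Gt s \<omega>))) =
        expectation (\<lambda>\<omega>. (hc (Yt s \<omega>))\<^sup>2 + hc (Yt s \<omega>) * corrector (Yt s \<omega>) (Gt s \<omega>))"
      by (simp only: power2_eq_square distrib_left)
    also have "\<dots> = 1 + ?x s" using hc_moments[of s] x_i[of s] by simp
    finally have 1: "expectation (\<lambda>\<omega>. hc (Yt s \<omega>) * (hc (Yt s \<omega>) + corrector (Yt s \<omega>) (Gt s \<omega>))) = 1 + ?x s" .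
    have "corrector_drift (Yt s \<omega>) (Gt s \<omega>) + max (Gt s \<omega>) 0 *
         (resample d (\<lambda>g. hc (Yt s \<omega>) + corrector (Yt s \<omega>) g) (Yt s \<omega>) - (hc (Yt s \<omega>) + corrector (Yt s \<omega>) (Gt s \<omega>)))
       = - K * hc (Yt s \<omega>) + 1 / ?D * remainder (Yt s \<omega>) (Gt s \<omega>)" for \<omega>
      unfolding corrector_drift_def K_def by (rule generator_corrector[OF Yt_nonneg])
    then have "expectation (\<lambda>\<omega>. hobs.A s \<omega> * (corrector_drift (Yt s \<omega>) (Gt s \<omega>) + max (Gt s \<omega>) 0 *
         (resample d (\<lambda>g. hc (Yt s \<omega>) + corrector (Yt s \<omega>) g) (Yt s \<omega>) - (hc (Yt s \<omega>) + corrector (Yt s \<omega>) (Gt s \<omega>)))))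
       = expectation (\<lambda>\<omega>. (- K) * (hobs.A s \<omega> * hc (Yt s \<omega>)) + 1 / ?D * (hobs.A s \<omega> * remainder (Yt s \<omega>) (Gt s \<omega>)))"
      by (simp only: distrib_left mult.left_commute)
    also have "\<dots> = (- K) * h_cov s + 1 / ?D * ?z s"
      unfolding h_cov_def
      by (simp only: Bochner_Integration.integral_add[OF integrable_mult_right[OF h_cov_integrable[OF s]] integrable_mult_right[OF z_i[OF s]]]
          integral_mult_right_zero)
    finally show ?thesis using 1 by simp
  qed
  have w_m: "?w \<in> borel_measurable borel"
    by (intro borel_measurable_add borel_measurable_times borel_measurable_const; rule expectation_measurable)
      (intro borel_measurable_times measurable_compose[OF _ hc_measurable] cm hobs.A_measurable; measurable)+
  have w_b: "\<bar>indicator {0..t} s * ?w s\<bar> \<le> indicator {0..t} s * (corrector_error d + t * relax_error d / ?D)" for s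
  proof (cases "s \<in> {0..t}")
    case True
    then have "s * relax_error d \<le> t * relax_error d" using relax_error_nonneg by (intro mult_right_mono) auto
    then have "\<bar>?z s\<bar> \<le> t * relax_error d" using z_b[of s] True by simp
    then have "\<bar>?z s\<bar> / ?D \<le> t * relax_error d / ?D" by (intro divide_right_mono) auto
    moreover have "\<bar>1 / ?D * ?z s\<bar> = \<bar>?z s\<bar> / ?D" by (simp add: abs_mult)
    ultimately have "\<bar>?w s\<bar> \<le> corrector_error d + t * relax_error d / ?D"
      using x_b[of s] abs_triangle_ineq[of "?x s" "1 / ?D * ?z s"] by linarith
    then show ?thesis using True by simp
  next
    case False then show ?thesis by simp
  qed
  have i3: "integrable lborel (\<lambda>s. indicator {0..t} s * ?w s)"
    by (rule integrable_Icc_bounded[OF _ w_b]) (intro borel_measurable_times borel_measurable_indicator w_m, simp)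
  have i2: "integrable lborel (\<lambda>s. indicator {0..t} s * h_cov s)"
  proof (rule integrable_Icc_bounded[where t=t and K=t])
    show "\<bar>indicator {0..t} s * h_cov s\<bar> \<le> indicator {0..t} s * t" for s
      using h_cov_bound[of s] by (auto simp: indicator_def)
  qed measurable
  have i1: "integrable lborel (indicator {0..t} :: real \<Rightarrow> real)" by simp
  have "expectation (\<lambda>\<omega>. hobs.A t \<omega> * (hc (Yt t \<omega>) + corrector (Yt t \<omega>) (Gt t \<omega>))) =
    (\<integral>s. indicator {0..t} s - K * (indicator {0..t} s * h_cov s) + indicator {0..t} s * ?w s \<partial>lborel)"
    unfolding dyn
  proof (rule Bochner_Integration.integral_cong[OF refl], goal_cases)
    case (1 s)
    show ?case
    proof (cases "s \<in> {0..t}")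
      case True
      then have "0 \<le> s" by simp
      then show ?thesis using True by (simp only: rhs indicator_simps mult_1)
    next
      case False then show ?thesis by simp
    qed
  qed
  also have "\<dots> = (\<integral>s. indicator {0..t} s \<partial>lborel) - K * (\<integral>s. indicator {0..t} s * h_cov s \<partial>lborel) + (\<integral>s. indicator {0..t} s * ?w s \<partial>lborel)"
    by (simp only: Bochner_Integration.integral_diff[OF i1 integrable_mult_right[OF i2]] integral_mult_right_zero
        Bochner_Integration.integral_add[OF Bochner_Integration.integrable_diff[OF i1 integrable_mult_right[OF i2]] i3])
  also have "(\<integral>s. indicator {0..t} s \<partial>lborel) = t" using t by simp
  finally have E1: "expectation (\<lambda>\<omega>. hobs.A t \<omega> * (hc (Yt t \<omega>) + corrector (Yt t \<omega>) (Gt t \<omega>))) =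
     t - K * (\<integral>s. indicator {0..t} s * h_cov s \<partial>lborel) + (\<integral>s. indicator {0..t} s * ?w s \<partial>lborel)" .
  have E2: "expectation (\<lambda>\<omega>. hobs.A t \<omega> * (hc (Yt t \<omega>) + corrector (Yt t \<omega>) (Gt t \<omega>))) =
     h_cov t + expectation (\<lambda>\<omega>. hobs.A t \<omega> * corrector (Yt t \<omega>) (Gt t \<omega>))"
    unfolding h_cov_def distrib_left by (rule Bochner_Integration.integral_add[OF h_cov_integrable[OF t] cA_i[OF t]])
  have "\<bar>\<integral>s. indicator {0..t} s * ?w s \<partial>lborel\<bar> \<le> (\<integral>s. \<bar>indicator {0..t} s * ?w s\<bar> \<partial>lborel)" by (rule integral_abs_bound)
  also have "\<dots> \<le> (\<integral>s. indicator {0..t} s * (corrector_error d + t * relax_error d / ?D) \<partial>lborel)"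
    by (rule integral_mono[OF integrable_abs[OF i3] _ w_b]) simp
  also have "\<dots> = t * (corrector_error d + t * relax_error d / ?D)" using t by simp
  also have "\<dots> = t * corrector_error d + t\<^sup>2 / ?D * relax_error d" by (simp add: distrib_left power2_eq_square)
  finally have "\<bar>\<integral>s. indicator {0..t} s * ?w s \<partial>lborel\<bar> \<le> t * corrector_error d + t\<^sup>2 / ?D * relax_error d" .
  moreover note cA_b[OF t]
  moreover have "2 * t * corrector_error d = t * corrector_error d + t * corrector_error d" by simp
  ultimately show ?thesis using E1 E2 by linarith
qed

text \<open>The difference of the correlation from \<open>relaxation K\<close> satisfies a
  homogeneous Gronwall inequality with small inhomogeneity. The factor
  \<open>exp (2 * K * T)\<close> stays bounded for times of order \<open>d\<close>, since
  \<open>K\<close> is of order \<open>1 / d\<close>.\<close>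

lemma h_cov_integral_estimate:
  assumes T: "0 \<le> T"
  defines "K \<equiv> 2 * gauss_const / (real d + 1)"
    and "\<epsilon> \<equiv> 2 * T * corrector_error d + T\<^sup>2 / (real d + 1) * relax_error d"
  shows "\<bar>expectation (\<lambda>\<omega>. (hobs.A T \<omega>)\<^sup>2) - 2 * ((T - relaxation K T) / K)\<bar> \<le> 4 * T * \<epsilon> * exp (2 * K * T)"
proof -
  have K: "0 < K" unfolding K_def using gauss_const_bounds by simp
  have ih: "integrable lborel (\<lambda>s. indicator {0..t} s * h_cov s)" for t
  proof (rule integrable_Icc_bounded[where t=t and K=t])
    show "\<bar>indicator {0..t} s * h_cov s\<bar> \<le> indicator {0..t} s * t" for s
      using h_cov_bound[of s] by (auto simp: indicator_def)
  qed measurable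
  let ?x = "\<lambda>t. h_cov t - relaxation K t"
  have ix: "integrable lborel (\<lambda>s. indicator {0..t} s * ?x s)"
    and ex: "(\<integral>s. indicator {0..t} s * ?x s \<partial>lborel) = (\<integral>s. indicator {0..t} s * h_cov s \<partial>lborel) - (t - relaxation K t) / K"
    if "0 \<le> t" for t
    unfolding right_diff_distrib relaxation_integral(2)[OF K that, symmetric]
    using ih[of t] relaxation_integral(1)[OF K that] by auto
  have ex_le: "\<bar>\<integral>s. indicator {0..t} s * ?x s \<partial>lborel\<bar> \<le> (LBINT s:{0..t}. \<bar>?x s\<bar>)" for t
    using integral_abs_bound[of lborel "\<lambda>s. indicator {0..t} s * ?x s"]
    unfolding set_lebesgue_integral_def by (simp add: abs_mult)
  have step: "\<bar>?x t\<bar> \<le> \<epsilon> + K * (LBINT s:{0..t}. \<bar>?x s\<bar>)" if t: "t \<in> {0..T}" for t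
  proof -
    have t0: "0 \<le> t" "t \<le> T" using t by auto
    have "2 * t * corrector_error d + t\<^sup>2 / (real d + 1) * relax_error d \<le> \<epsilon>"
      unfolding \<epsilon>_def using t0 corrector_error_nonneg relax_error_nonneg
      by (intro add_mono mult_right_mono divide_right_mono power_mono) auto
    then have "\<bar>h_cov t - t + K * (\<integral>s. indicator {0..t} s * h_cov s \<partial>lborel)\<bar> \<le> \<epsilon>"
      using h_cov_estimate[OF t0(1)] unfolding K_def by linarith
    moreover have "K * (\<integral>s. indicator {0..t} s * ?x s \<partial>lborel) = K * (\<integral>s. indicator {0..t} s * h_cov s \<partial>lborel) - (t - relaxation K t)"
    proof -
      have "K * (a - b / K) = K * a - b" for a b using K by (simp add: right_diff_distrib)
      then show ?thesis unfolding ex[OF t0(1)] .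
    qed
    moreover have "\<bar>K * (\<integral>s. indicator {0..t} s * ?x s \<partial>lborel)\<bar> \<le> K * (LBINT s:{0..t}. \<bar>?x s\<bar>)"
      unfolding abs_mult using ex_le[of t] K by (simp add: mult_left_mono)
    ultimately show ?thesis by linarith
  qed
  have bnd: "\<bar>?x t\<bar> \<le> T + 1 / K" if "t \<in> {0..T}" for t
    using h_cov_bound[of t] relaxation_bound[OF K, of t] that by auto
  have x: "\<bar>?x t\<bar> \<le> 2 * \<epsilon> * exp (2 * K * T)" if "t \<in> {0..T}" for t
    by (rule weighted_gronwall[OF _ bnd K step that]) measurable
  have "expectation (\<lambda>\<omega>. (hobs.A T \<omega>)\<^sup>2) = (\<integral>s. 2 * (indicator {0..T} s * h_cov s) \<partial>lborel)"
    unfolding hobs.A_sq_eq[OF T] h_cov_def by (intro Bochner_Integration.integral_cong refl) simp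
  also have "\<dots> = 2 * (\<integral>s. indicator {0..T} s * h_cov s \<partial>lborel)" by (rule integral_mult_right_zero)
  finally have "expectation (\<lambda>\<omega>. (hobs.A T \<omega>)\<^sup>2) - 2 * ((T - relaxation K T) / K) = 2 * (\<integral>s. indicator {0..T} s * ?x s \<partial>lborel)"
    unfolding ex[OF T] by simp
  moreover have "\<bar>\<integral>s. indicator {0..T} s * ?x s \<partial>lborel\<bar> \<le> T * (2 * \<epsilon> * exp (2 * K * T))"
  proof -
    have "\<bar>\<integral>s. indicator {0..T} s * ?x s \<partial>lborel\<bar> \<le> (\<integral>s. \<bar>indicator {0..T} s * ?x s\<bar> \<partial>lborel)" by (rule integral_abs_bound)
    also have "\<dots> \<le> (\<integral>s. indicator {0..T} s * (2 * \<epsilon> * exp (2 * K * T)) \<partial>lborel)"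
    proof (rule integral_mono[OF integrable_abs[OF ix[OF T]]])
      show "\<bar>indicator {0..T} s * ?x s\<bar> \<le> indicator {0..T} s * (2 * \<epsilon> * exp (2 * K * T))" for s
        using x[of s] by (cases "s \<in> {0..T}") auto
    qed simp
    finally show ?thesis using T by simp
  qed
  ultimately show ?thesis by (simp add: mult_ac)
qed

end

section \<open>The iterated limits\<close>

definition volterra_rhs :: "(real \<Rightarrow> real) \<Rightarrow> (real \<Rightarrow> real) \<Rightarrow> real \<Rightarrow> real" where
  "volterra_rhs f j t = (\<integral>s. indicator {0..t} s * no_jump_cov f (t - s) \<partial>lborel) +
     (\<integral>s. indicator {0..t} s * (restart_mean f (t - s) * j s) \<partial>lborel)"

text \<open>The correlations of one dimension as approximate solutions of equations that do not
  mention the dimension. Phrased for plain functions, so that processes on different probability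
  spaces can be compared.\<close>

definition volterra_pair :: "real \<Rightarrow> (real \<Rightarrow> real) \<Rightarrow> (real \<Rightarrow> real) \<Rightarrow> bool" where
  "volterra_pair \<epsilon> j c \<longleftrightarrow> j \<in> borel_measurable borel \<and> c \<in> borel_measurable borel \<and>
     (\<forall>t\<ge>0. \<bar>j t\<bar> \<le> t \<and> \<bar>c t\<bar> \<le> t \<and>
        \<bar>j t - volterra_rhs (\<lambda>z. max z 0) j t\<bar> \<le> t\<^sup>2 * \<epsilon> \<and> \<bar>c t - volterra_rhs (\<lambda>z. z) j t\<bar> \<le> t\<^sup>2 * \<epsilon>)"

text \<open>The source terms cancel, and the kernel is at most \<open>T + 2\<close> by
  \<open>restart_mean_bound\<close>.\<close>

lemma volterra_rhs_diff:
  assumes f: "test_function f" and t: "0 \<le> t" "t \<le> T"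
    and j[measurable]: "j \<in> borel_measurable borel" "j' \<in> borel_measurable borel"
    and j_bound: "\<And>s. 0 \<le> s \<Longrightarrow> \<bar>j s\<bar> \<le> s" "\<And>s. 0 \<le> s \<Longrightarrow> \<bar>j' s\<bar> \<le> s"
  shows "\<bar>volterra_rhs f j t - volterra_rhs f j' t\<bar> \<le> (T + 2) * (LBINT s:{0..t}. \<bar>j s - j' s\<bar>)"
proof -
  interpret test_function f by fact
  have rm[measurable]: "(\<lambda>s. restart_mean f (t - s)) \<in> borel_measurable borel"
    by (rule measurable_compose[OF _ restart_mean_measurable]) measurable
  have i: "integrable lborel (\<lambda>s. indicator {0..t} s * (restart_mean f (t - s) * k s))"
    if [measurable]: "k \<in> borel_measurable borel" and k: "\<And>s. 0 \<le> s \<Longrightarrow> \<bar>k s\<bar> \<le> s" for k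
  proof (rule integrable_Icc_bounded[where t=t and K="(t + 2) * t"])
    show "\<bar>indicator {0..t} s * (restart_mean f (t - s) * k s)\<bar> \<le> indicator {0..t} s * ((t + 2) * t)" for s
    proof (cases "s \<in> {0..t}")
      case True
      have "\<bar>restart_mean f (t - s)\<bar> * \<bar>k s\<bar> \<le> (t + 2) * t"
        using True restart_mean_bound[of "t - s"] k[of s] by (intro mult_mono) auto
      then show ?thesis using True by (simp add: abs_mult)
    next
      case False then show ?thesis by simp
    qed
  qed measurable
  have i: "integrable lborel (\<lambda>s. indicator {0..t} s * (restart_mean f (t - s) * j s))"
      "integrable lborel (\<lambda>s. indicator {0..t} s * (restart_mean f (t - s) * j' s))"
    by (rule i, rule j, rule j_bound, assumption)+
  have id: "integrable lborel (\<lambda>s. indicator {0..t} s * \<bar>j s - j' s\<bar>)"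
  proof (rule integrable_Icc_bounded[where t=t and K="t + t"])
    show "\<bar>indicator {0..t} s * \<bar>j s - j' s\<bar>\<bar> \<le> indicator {0..t} s * (t + t)" for s
      using j_bound[of s] by (auto simp: indicator_def)
  qed measurable
  have eq: "volterra_rhs f j t - volterra_rhs f j' t =
      (\<integral>s. indicator {0..t} s * (restart_mean f (t - s) * j s) - indicator {0..t} s * (restart_mean f (t - s) * j' s) \<partial>lborel)"
    by (simp only: volterra_rhs_def Bochner_Integration.integral_diff[OF i(1) i(2)] add_diff_cancel_left)
  have le: "\<bar>indicator {0..t} s * (restart_mean f (t - s) * j s) - indicator {0..t} s * (restart_mean f (t - s) * j' s)\<bar>
      \<le> (T + 2) * (indicator {0..t} s * \<bar>j s - j' s\<bar>)" for s
  proof (cases "s \<in> {0..t}")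
    case True
    then have "\<bar>restart_mean f (t - s)\<bar> \<le> T + 2" using restart_mean_bound[of "t - s"] t by auto
    then have "\<bar>restart_mean f (t - s)\<bar> * \<bar>j s - j' s\<bar> \<le> (T + 2) * \<bar>j s - j' s\<bar>" by (intro mult_right_mono) auto
    then show ?thesis using True by (simp add: abs_mult[symmetric] right_diff_distrib)
  next
    case False then show ?thesis by simp
  qed
  have "\<bar>volterra_rhs f j t - volterra_rhs f j' t\<bar> \<le>
     (\<integral>s. \<bar>indicator {0..t} s * (restart_mean f (t - s) * j s) - indicator {0..t} s * (restart_mean f (t - s) * j' s)\<bar> \<partial>lborel)"
    unfolding eq by (rule integral_abs_bound)
  also have "\<dots> \<le> (\<integral>s. (T + 2) * (indicator {0..t} s * \<bar>j s - j' s\<bar>) \<partial>lborel)"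
    by (rule integral_mono[OF integrable_abs[OF Bochner_Integration.integrable_diff[OF i]] integrable_mult_right[OF id] le])
  also have "\<dots> = (T + 2) * (LBINT s:{0..t}. \<bar>j s - j' s\<bar>)"
    unfolding set_lebesgue_integral_def by simp
  finally show ?thesis .
qed

text \<open>The first equation is closed in \<open>j\<close>, so Gronwall controls the difference of
  the two versions of \<open>j\<close>; the second expresses \<open>c\<close> through
  \<open>j\<close> and inherits the bound.\<close>

lemma volterra_pair_diff:
  assumes p: "volterra_pair \<epsilon> j c" "volterra_pair \<epsilon>' j' c'" and \<epsilon>: "0 \<le> \<epsilon>" "0 \<le> \<epsilon>'" and T: "0 \<le> T"
  shows "\<bar>(\<integral>s. indicator {0..T} s * c s \<partial>lborel) - (\<integral>s. indicator {0..T} s * c' s \<partial>lborel)\<bar>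
    \<le> T * (T\<^sup>2 + (T + 2) * (T * (2 * T\<^sup>2 * exp (2 * (T + 2) * T)))) * (\<epsilon> + \<epsilon>')"
proof -
  let ?\<epsilon> = "T\<^sup>2 * (\<epsilon> + \<epsilon>')"
  have m[measurable]: "j \<in> borel_measurable borel" "j' \<in> borel_measurable borel" "c \<in> borel_measurable borel" "c' \<in> borel_measurable borel"
    and jb: "\<And>s. 0 \<le> s \<Longrightarrow> \<bar>j s\<bar> \<le> s" "\<And>s. 0 \<le> s \<Longrightarrow> \<bar>j' s\<bar> \<le> s"
    and cb: "\<And>s. 0 \<le> s \<Longrightarrow> \<bar>c s\<bar> \<le> s" "\<And>s. 0 \<le> s \<Longrightarrow> \<bar>c' s\<bar> \<le> s"
    using p unfolding volterra_pair_def by auto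
  have sq: "t\<^sup>2 * \<epsilon> + t\<^sup>2 * \<epsilon>' \<le> ?\<epsilon>" if "0 \<le> t" "t \<le> T" for t
    unfolding distrib_left[symmetric] using that \<epsilon> by (intro mult_right_mono power_mono) auto
  have jd: "\<bar>j t - j' t\<bar> \<le> ?\<epsilon> + (T + 2) * (LBINT s:{0..t}. \<bar>j s - j' s\<bar>)" if "t \<in> {0..T}" for t
  proof -
    have t: "0 \<le> t" "t \<le> T" using that by auto
    have "\<bar>j t - volterra_rhs (\<lambda>z. max z 0) j t\<bar> \<le> t\<^sup>2 * \<epsilon>" "\<bar>j' t - volterra_rhs (\<lambda>z. max z 0) j' t\<bar> \<le> t\<^sup>2 * \<epsilon>'"
      using p t unfolding volterra_pair_def by auto
    then show ?thesis using volterra_rhs_diff[OF max_0_test_function t m(1,2) jb] sq[OF t] by linarith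
  qed
  have bnd: "\<bar>j t - j' t\<bar> \<le> T + T" if "t \<in> {0..T}" for t using jb[of t] that by auto
  have j: "\<bar>j t - j' t\<bar> \<le> 2 * ?\<epsilon> * exp (2 * (T + 2) * T)" if "t \<in> {0..T}" for t
    by (rule weighted_gronwall[OF _ bnd _ jd that]) (use T in \<open>measurable, simp\<close>)
  define b where "b = 2 * ?\<epsilon> * exp (2 * (T + 2) * T)"
  have b: "0 \<le> b" unfolding b_def using \<epsilon> by simp
  have Ij: "(LBINT s:{0..t}. \<bar>j s - j' s\<bar>) \<le> T * b" if t: "0 \<le> t" "t \<le> T" for t
  proof -
    have le: "indicator {0..t} s * \<bar>j s - j' s\<bar> \<le> indicator {0..t} s * b" for s
      using j[of s, folded b_def] t by (auto simp: indicator_def)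
    have "(\<integral>s. indicator {0..t} s * \<bar>j s - j' s\<bar> \<partial>lborel) \<le> (\<integral>s. indicator {0..t} s * b \<partial>lborel)"
      by (rule integral_mono'[OF _ le]) (use b in auto)
    also have "\<dots> = t * b" using t by simp
    also have "\<dots> \<le> T * b" using t b by (intro mult_right_mono) auto
    finally show ?thesis unfolding set_lebesgue_integral_def by simp
  qed
  have c: "\<bar>c t - c' t\<bar> \<le> ?\<epsilon> + (T + 2) * (T * b)" if "t \<in> {0..T}" for t
  proof -
    have t: "0 \<le> t" "t \<le> T" using that by auto
    have "\<bar>c t - volterra_rhs (\<lambda>z. z) j t\<bar> \<le> t\<^sup>2 * \<epsilon>" "\<bar>c' t - volterra_rhs (\<lambda>z. z) j' t\<bar> \<le> t\<^sup>2 * \<epsilon>'"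
      using p t unfolding volterra_pair_def by auto
    moreover have "(T + 2) * (LBINT s:{0..t}. \<bar>j s - j' s\<bar>) \<le> (T + 2) * (T * b)"
      using Ij[OF t] T by (intro mult_left_mono) auto
    ultimately show ?thesis using volterra_rhs_diff[OF ident_test_function t m(1,2) jb] sq[OF t] by linarith
  qed
  have ci: "integrable lborel (\<lambda>s. indicator {0..T} s * k s)" if [measurable]: "k \<in> borel_measurable borel" and k: "\<And>s. 0 \<le> s \<Longrightarrow> \<bar>k s\<bar> \<le> s" for k :: "real \<Rightarrow> real"
  proof (rule integrable_Icc_bounded[where t=T and K=T])
    show "\<bar>indicator {0..T} s * k s\<bar> \<le> indicator {0..T} s * T" for s
      using k[of s] by (auto simp: indicator_def)
  qed measurable
  have ci: "integrable lborel (\<lambda>s. indicator {0..T} s * c s)" "integrable lborel (\<lambda>s. indicator {0..T} s * c' s)"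
    by (rule ci, rule m, rule cb, assumption)+
  have le: "\<bar>indicator {0..T} s * c s - indicator {0..T} s * c' s\<bar> \<le> indicator {0..T} s * (?\<epsilon> + (T + 2) * (T * b))" for s
    using c[of s] by (cases "s \<in> {0..T}") auto
  have eq: "(\<integral>s. indicator {0..T} s * c s \<partial>lborel) - (\<integral>s. indicator {0..T} s * c' s \<partial>lborel) =
      (\<integral>s. indicator {0..T} s * c s - indicator {0..T} s * c' s \<partial>lborel)"
    by (rule Bochner_Integration.integral_diff[OF ci, symmetric])
  have "\<bar>(\<integral>s. indicator {0..T} s * c s \<partial>lborel) - (\<integral>s. indicator {0..T} s * c' s \<partial>lborel)\<bar>
     \<le> (\<integral>s. \<bar>indicator {0..T} s * c s - indicator {0..T} s * c' s\<bar> \<partial>lborel)"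
    unfolding eq by (rule integral_abs_bound)
  also have "\<dots> \<le> (\<integral>s. indicator {0..T} s * (?\<epsilon> + (T + 2) * (T * b)) \<partial>lborel)"
    by (rule integral_mono[OF integrable_abs[OF Bochner_Integration.integrable_diff[OF ci]] _ le]) simp
  also have "\<dots> = T * (?\<epsilon> + (T + 2) * (T * b))" using T by simp
  also have "\<dots> = T * (T\<^sup>2 + (T + 2) * (T * (2 * T\<^sup>2 * exp (2 * (T + 2) * T)))) * (\<epsilon> + \<epsilon>')"
    unfolding b_def by (simp add: algebra_simps)
  finally show ?thesis .
qed

text \<open>Approximate solutions with vanishing errors are mutually close, so their integrals form
  a Cauchy sequence. An exact solution of the limiting equation is not constructed.\<close>

lemma volterra_pairs_convergent:
  assumes p: "\<And>d. 4 \<le> d \<Longrightarrow> volterra_pair (\<epsilon> d) (j d) (c d)" and \<epsilon>: "\<And>d. 0 \<le> \<epsilon> d" "\<epsilon> \<longlonglongrightarrow> 0" and T: "0 \<le> T"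
  shows "convergent (\<lambda>d. \<integral>s. indicator {0..T} s * c d s \<partial>lborel)"
proof -
  define C where "C = T * (T\<^sup>2 + (T + 2) * (T * (2 * T\<^sup>2 * exp (2 * (T + 2) * T))))"
  have C: "0 \<le> C" unfolding C_def using T by simp
  have "Cauchy (\<lambda>d. \<integral>s. indicator {0..T} s * c d s \<partial>lborel)"
  proof (rule metric_CauchyI)
    fix e :: real assume e: "0 < e"
    then have "0 < e / (2 * C + 1)" using C by simp
    from LIMSEQ_D[OF \<epsilon>(2) this] obtain N where N: "\<And>d. N \<le> d \<Longrightarrow> \<epsilon> d < e / (2 * C + 1)" by fastforce
    show "\<exists>N. \<forall>m\<ge>N. \<forall>n\<ge>N. dist (\<integral>s. indicator {0..T} s * c m s \<partial>lborel) (\<integral>s. indicator {0..T} s * c n s \<partial>lborel) < e"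
    proof (intro exI allI impI)
      fix m n assume mn: "max N 4 \<le> m" "max N 4 \<le> n"
      have "dist (\<integral>s. indicator {0..T} s * c m s \<partial>lborel) (\<integral>s. indicator {0..T} s * c n s \<partial>lborel) \<le> C * (\<epsilon> m + \<epsilon> n)"
        unfolding dist_real_def C_def using mn volterra_pair_diff[OF p[of m] p[of n] \<epsilon>(1) \<epsilon>(1) T] by simp
      also have "\<dots> \<le> C * (e / (2 * C + 1) + e / (2 * C + 1))"
        using N[of m] N[of n] mn C by (intro mult_left_mono add_mono) auto
      also have "\<dots> = (2 * C) * (e / (2 * C + 1))" by simp
      also have "\<dots> < (2 * C + 1) * (e / (2 * C + 1))" using e C by (intro mult_strict_right_mono) auto
      also have "\<dots> = e" using C by simp
      finally show "dist (\<integral>s. indicator {0..T} s * c m s \<partial>lborel) (\<integral>s. indicator {0..T} s * c n s \<partial>lborel) < e" .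
    qed
  qed
  then show ?thesis by (simp add: Cauchy_convergent_iff)
qed

section \<open>Variances in a fixed dimension\<close>

context fecmc_stationary
begin

text \<open>Everything about the radial velocity in one dimension, expressed by two real functions.
  This form allows choosing such functions for all dimensions simultaneously.\<close>

lemma g_summary:
  obtains j c where "volterra_pair (volterra_error d) j c"
    "\<And>T. 0 < T \<Longrightarrow> T * variance (g_hat d X V T) = 2 * (\<integral>s. indicator {0..T} s * c s \<partial>lborel) / T"
    "\<And>T. 0 \<le> T \<Longrightarrow> 0 \<le> 2 * (\<integral>s. indicator {0..T} s * c s \<partial>lborel)"
    "\<And>T. 0 \<le> T \<Longrightarrow> \<bar>2 * (\<integral>s. indicator {0..T} s * c s \<partial>lborel) - sqrt (2 / pi) * T\<bar>
       \<le> 2 * sqrt (2 * (\<integral>s. indicator {0..T} s * c s \<partial>lborel)) + 2 * (T\<^sup>2 * sqrt (44 / (real d + 1)))"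
proof
  interpret gobs: fecmc_observable M d \<nu> X V \<tau> "\<lambda>y g. g" "\<lambda>y g u. g * u + u\<^sup>2 / 2" 1 1
    by (rule g_observable)
  let ?c = "\<lambda>s. expectation (\<lambda>\<omega>. gobs.A s \<omega> * Gt s \<omega>)"
  have c_b: "\<bar>?c s\<bar> \<le> s" if "0 \<le> s" for s
    using gobs.A_mult_le(2)[of "Gt s" s 1] that G_moments(1)[of s 2] G_moments(3)[of s] by auto
  have c_m: "?c \<in> borel_measurable borel" by (rule expectation_measurable) measurable
  show "volterra_pair (volterra_error d) jump_cov ?c"
    unfolding volterra_pair_def volterra_rhs_def
    using c_m c_b jump_cov_bound volterra_estimate[OF ident_test_function] volterra_estimate[OF max_0_test_function, folded jump_cov_def]
    by auto
  have sq: "expectation (\<lambda>\<omega>. (gobs.A T \<omega>)\<^sup>2) = 2 * (\<integral>s. indicator {0..T} s * ?c s \<partial>lborel)" if "0 \<le> T" for T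
  proof -
    have "expectation (\<lambda>\<omega>. (gobs.A T \<omega>)\<^sup>2) = (\<integral>s. 2 * (indicator {0..T} s * ?c s) \<partial>lborel)"
      unfolding gobs.A_sq_eq[OF that] by (intro Bochner_Integration.integral_cong refl) simp
    then show ?thesis by simp
  qed
  show "0 \<le> 2 * (\<integral>s. indicator {0..T} s * ?c s \<partial>lborel)" if "0 \<le> T" for T
    using A_sq_estimate(1)[OF that] unfolding sq[OF that] .
  show "\<bar>2 * (\<integral>s. indicator {0..T} s * ?c s \<partial>lborel) - sqrt (2 / pi) * T\<bar>
       \<le> 2 * sqrt (2 * (\<integral>s. indicator {0..T} s * ?c s \<partial>lborel)) + 2 * (T\<^sup>2 * sqrt (44 / (real d + 1)))" if "0 \<le> T" for T
    using A_sq_estimate(2)[OF that] unfolding sq[OF that] phi_error_def .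
  show "T * variance (g_hat d X V T) = 2 * (\<integral>s. indicator {0..T} s * ?c s \<partial>lborel) / T" if T: "0 < T" for T
  proof -
    have hat: "g_hat d X V T = (\<lambda>\<omega>. gobs.A T \<omega> / T)"
    proof
      fix \<omega>
      have "(\<integral>s. indicator {0..T} s * g_fun d (X s \<omega>) (V s \<omega>) \<partial>lborel) = gobs.A T \<omega>"
        unfolding gobs.A_def by (intro Bochner_Integration.integral_cong refl) (auto simp: indicator_def Gt_def G_def g_fun_def)
      then show "g_hat d X V T \<omega> = gobs.A T \<omega> / T"
        unfolding g_hat_def set_lebesgue_integral_def by simp
    qed
    have "variance (g_hat d X V T) = expectation (\<lambda>\<omega>. (gobs.A T \<omega>)\<^sup>2) / T\<^sup>2"
      unfolding hat using gobs.A_mean[of T] by (simp add: power_divide)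
    then show ?thesis unfolding sq[OF less_imp_le[OF T]] using T by (simp add: power2_eq_square)
  qed
qed

text \<open>The horizon is \<open>d * T\<close>, so the second moment is divided by
  \<open>(d * T)^2\<close> and multiplied by \<open>T\<close>. The powers of \<open>d\<close> cancel
  and the error keeps only factors that are bounded or vanish.\<close>

lemma h_summary:
  assumes T: "0 < T"
  defines "K \<equiv> 2 * gauss_const / (real d + 1)"
  shows "\<bar>T * variance (h_hat d X (real d * T)) - 2 * ((real d * T - relaxation K (real d * T)) / K) / ((real d)\<^sup>2 * T)\<bar>
    \<le> 4 * (2 * T * corrector_error d + T\<^sup>2 * (real d / (real d + 1)) * relax_error d) * exp (2 * (2 * gauss_const * (real d / (real d + 1))) * T)"
proof -
  interpret hobs: fecmc_observable M d \<nu> X V \<tau> "\<lambda>y g. hc y"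
    "\<lambda>y g u. ((y - d) * u + g * u\<^sup>2 + u ^ 3 / 3) / sqrt (2 * real d)" "real d" 1
    by (rule h_observable)
  let ?T = "real d * T" and ?D = "real d + 1"
  let ?\<epsilon> = "2 * ?T * corrector_error d + ?T\<^sup>2 / ?D * relax_error d"
  have T': "0 < ?T" using T d_pos by simp
  have hat: "h_hat d X ?T = (\<lambda>\<omega>. hobs.A ?T \<omega> / ?T)"
  proof
    fix \<omega>
    have eq: "h_fun d x = hc (ip d x x)" for x
      by (simp add: h_fun_def hc_def L2_set_def ip_def sum_nonneg power2_eq_square[symmetric] real_sqrt_mult)
    have "(\<integral>s. indicator {0..?T} s * h_fun d (X s \<omega>) \<partial>lborel) = hobs.A ?T \<omega>"
      unfolding hobs.A_def eq by (intro Bochner_Integration.integral_cong refl) (auto simp: indicator_def Yt_def Y_def)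
    then show "h_hat d X ?T \<omega> = hobs.A ?T \<omega> / ?T"
      unfolding h_hat_def set_lebesgue_integral_def by simp
  qed
  have "variance (h_hat d X ?T) = expectation (\<lambda>\<omega>. (hobs.A ?T \<omega>)\<^sup>2) / ?T\<^sup>2"
    unfolding hat using hobs.A_mean[of ?T] by (simp add: power_divide)
  then have var: "T * variance (h_hat d X ?T) = expectation (\<lambda>\<omega>. (hobs.A ?T \<omega>)\<^sup>2) / ((real d)\<^sup>2 * T)"
    using T by (simp add: power2_eq_square)
  have "\<bar>expectation (\<lambda>\<omega>. (hobs.A ?T \<omega>)\<^sup>2) - 2 * ((?T - relaxation K ?T) / K)\<bar> \<le> 4 * ?T * ?\<epsilon> * exp (2 * K * ?T)"
    using h_cov_integral_estimate[of ?T] T' unfolding K_def by simp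
  then have "\<bar>expectation (\<lambda>\<omega>. (hobs.A ?T \<omega>)\<^sup>2) - 2 * ((?T - relaxation K ?T) / K)\<bar> / ((real d)\<^sup>2 * T)
      \<le> 4 * ?T * ?\<epsilon> * exp (2 * K * ?T) / ((real d)\<^sup>2 * T)"
    using T by (intro divide_right_mono) auto
  also have "\<dots> = 4 * (2 * T * corrector_error d + T\<^sup>2 * (real d / ?D) * relax_error d) * exp (2 * (2 * gauss_const * (real d / ?D)) * T)"
  proof -
    have "4 * (x * T) * (2 * (x * T) * p + (x * T)\<^sup>2 / D * q) * e / (x\<^sup>2 * T) = 4 * (2 * T * p + T\<^sup>2 * (x / D) * q) * e"
      if "0 < x" for x p D q e :: real
    proof -
      have "4 * (x * T) * (2 * (x * T) * p + (x * T)\<^sup>2 / D * q) * e = (x\<^sup>2 * T) * (4 * (2 * T * p + T\<^sup>2 * (x / D) * q) * e)"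
        by (simp add: power2_eq_square algebra_simps)
      moreover have "x\<^sup>2 * T \<noteq> 0" using that T by simp
      ultimately show ?thesis by (subst nonzero_divide_eq_eq) (simp_all only: mult.commute not_False_eq_True)
    qed
    moreover have "2 * K * ?T = 2 * (2 * gauss_const * (real d / ?D)) * T" by (simp add: K_def)
    ultimately show ?thesis using d_pos by simp
  qed
  finally have "\<bar>expectation (\<lambda>\<omega>. (hobs.A ?T \<omega>)\<^sup>2) - 2 * ((?T - relaxation K ?T) / K)\<bar> / ((real d)\<^sup>2 * T) \<le> \<dots>" .
  moreover have "\<bar>expectation (\<lambda>\<omega>. (hobs.A ?T \<omega>)\<^sup>2) - 2 * ((?T - relaxation K ?T) / K)\<bar> / ((real d)\<^sup>2 * T) =
     \<bar>T * variance (h_hat d X ?T) - 2 * ((?T - relaxation K ?T) / K) / ((real d)\<^sup>2 * T)\<bar>"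
  proof -
    have "\<bar>x - z\<bar> / m = \<bar>x / m - z / m\<bar>" if "0 < m" for x z m :: real
      using that by (simp add: diff_divide_distrib[symmetric])
    moreover have "0 < (real d)\<^sup>2 * T" using T d_pos by simp
    ultimately show ?thesis unfolding var by blast
  qed
  ultimately show ?thesis by simp
qed

end

lemma fecmc_stationary_exists:
  assumes "4 \<le> d" "orthogonal_kernel d \<nu>" "fecmc_process d \<nu> M X V"
    and "\<And>t. 0 \<le> t \<Longrightarrow> state_law d M X V t = gauss_law d \<Otimes>\<^sub>M sphere_unif d"
  shows "\<exists>\<tau>. fecmc_stationary M d \<nu> X V \<tau>"
proof -
  have "\<exists>\<tau>. fecmc M d \<nu> X V \<tau>"
    using assms(1-3) unfolding fecmc_process_def fecmc_def fecmc_axioms_def by (elim conjE exE) (intro exI conjI, (assumption | blast)+)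
  then show ?thesis using assms(4) by (auto simp: fecmc_stationary_def fecmc_stationary_axioms_def)
qed

section \<open>Passage to the limits\<close>

lemma iterated_limitI:
  fixes x :: "nat \<Rightarrow> real \<Rightarrow> real"
  assumes "\<And>T. 0 < T \<Longrightarrow> (\<lambda>d. x d T) \<longlonglongrightarrow> l T" "(l \<longlongrightarrow> L) at_top"
  shows "iterated_limit x L"
  using assms unfolding iterated_limit_def by blast

lemma sigma_F_sq_quarter: "sigma_F_sq / 4 = sqrt (2 / pi)"
proof -
  have "sqrt (32 / pi) = sqrt (4\<^sup>2 * (2 / pi))" by simp
  also have "\<dots> = 4 * sqrt (2 / pi)" by (subst real_sqrt_mult) simp
  finally show ?thesis by (simp add: sigma_F_sq_def)
qed

lemma two_gauss_const: "2 * gauss_const = sqrt (2 / pi)"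
proof -
  have "sqrt (2 / pi) * sqrt (2 * pi) = 2" by (simp add: real_sqrt_mult[symmetric])
  then show ?thesis by (simp add: gauss_const_def field_simps)
qed

text \<open>The rate \<open>\<theta> / (d + 1)\<close> times the horizon \<open>d * T\<close> tends
  to \<open>\<theta> * T\<close>; the limit is \<open>T\<close> times the variance of the time
  average over \<open>[0, T]\<close> of a stationary Ornstein-Uhlenbeck process of rate
  \<open>\<theta>\<close> and unit variance.\<close>

lemma relaxation_limit:
  fixes \<theta> T :: real
  assumes \<theta>: "0 < \<theta>" and T: "0 < T"
  shows "(\<lambda>d. 2 * ((real d * T - relaxation (\<theta> / (real d + 1)) (real d * T)) / (\<theta> / (real d + 1))) / ((real d)\<^sup>2 * T))
    \<longlonglongrightarrow> 2 * (T - (1 - exp (- (\<theta> * T))) / \<theta>) / (\<theta> * T)"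
proof -
  let ?u = "\<lambda>d. (real d + 1) / real d" and ?r = "\<lambda>d. real d / (real d + 1)"
  have u: "?u \<longlonglongrightarrow> 1" and r: "?r \<longlonglongrightarrow> 1" by real_asymp+
  have "(\<lambda>d. 2 * (T * ?u d - (1 - exp (- (\<theta> * ?r d * T))) * (?u d)\<^sup>2 / \<theta>) / (\<theta> * T))
     \<longlonglongrightarrow> 2 * (T * 1 - (1 - exp (- (\<theta> * 1 * T))) * 1\<^sup>2 / \<theta>) / (\<theta> * T)"
    by (intro tendsto_intros u r) (use \<theta> T in auto)
  moreover have "\<forall>\<^sub>F d in sequentially. 2 * (T * ?u d - (1 - exp (- (\<theta> * ?r d * T))) * (?u d)\<^sup>2 / \<theta>) / (\<theta> * T)
     = 2 * ((real d * T - relaxation (\<theta> / (real d + 1)) (real d * T)) / (\<theta> / (real d + 1))) / ((real d)\<^sup>2 * T)"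
    using eventually_gt_at_top[of 0]
  proof eventually_elim
    case (elim d)
    define x D where "x = real d" and "D = real d + 1"
    have xD: "0 < x" "0 < D" using elim by (auto simp: x_def D_def)
    have "2 * (T * (D / x) - (1 - e) * (D / x)\<^sup>2 / \<theta>) / (\<theta> * T) = 2 * ((x * T - (1 - e) / (\<theta> / D)) / (\<theta> / D)) / (x\<^sup>2 * T)" for e
    proof -
      define k where "k = D / x"
      have D: "D = k * x" using xD by (simp add: k_def)
      have "(x * T - (1 - e) / (\<theta> / D)) / (\<theta> / D) = x\<^sup>2 * ((T * k - (1 - e) * k\<^sup>2 / \<theta>) / \<theta>)"
        unfolding D by (simp add: power2_eq_square diff_divide_distrib algebra_simps)
      note eq = this
      show ?thesis unfolding k_def[symmetric] eq using xD by simp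
    qed
    from this[of "exp (- (\<theta> * (x / D) * T))"] show ?case
      unfolding relaxation_def by (simp add: x_def D_def)
  qed
  ultimately show ?thesis by (simp add: Lim_transform_eventually)
qed

lemma relaxation_limit_at_top:
  fixes \<theta> :: real
  assumes \<theta>: "0 < \<theta>"
  shows "((\<lambda>T. 2 * (T - (1 - exp (- (\<theta> * T))) / \<theta>) / (\<theta> * T)) \<longlongrightarrow> 2 / \<theta>) at_top"
  using \<theta> by real_asymp (simp add: divide_inverse)

text \<open>For fixed \<open>T\<close> the Volterra equations provide the existence of the limit in
  \<open>d\<close>, and the bound from \<open>phi\<close> passes to this limit. As \<open>T\<close>
  grows, that bound alone identifies the growth rate.\<close>

lemma g_limit:
  assumes st: "\<And>d. 4 \<le> d \<Longrightarrow> fecmc_stationary (M d) d (\<nu> d) (X d) (V d) (\<tau> d)"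
  shows "iterated_limit (\<lambda>d T. T * prob_space.variance (M d) (g_hat d (X d) (V d) T)) (sigma_F_sq / 4)"
proof -
  let ?e = "\<lambda>c T. 2 * (\<integral>s. indicator {0..T} s * c s \<partial>lborel)"
  \<comment> \<open>Collects the facts of one dimension in a single predicate, so that the axiom of
    choice can pick the two functions for all dimensions.\<close>
  define Q where "Q d j c \<longleftrightarrow> volterra_pair (volterra_error d) j c \<and>
     (\<forall>T>0. T * prob_space.variance (M d) (g_hat d (X d) (V d) T) = ?e c T / T) \<and>
     (\<forall>T\<ge>0. 0 \<le> ?e c T \<and> \<bar>?e c T - sqrt (2 / pi) * T\<bar> \<le> 2 * sqrt (?e c T) + 2 * (T\<^sup>2 * sqrt (44 / (real d + 1))))" for d j c
  have "\<exists>j c. 4 \<le> d \<longrightarrow> Q d j c" for d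
  proof (cases "4 \<le> d")
    case True
    interpret fecmc_stationary "M d" d "\<nu> d" "X d" "V d" "\<tau> d" by (rule st[OF True])
    show ?thesis
    proof (rule g_summary, goal_cases)
      case (1 j c)
      show ?case unfolding Q_def
        by (intro exI[of _ j] exI[of _ c] impI conjI allI; (rule 1; assumption?))
    qed
  qed simp
  then have "\<forall>d. \<exists>j c. 4 \<le> d \<longrightarrow> Q d j c" by blast
  from choice[OF this] obtain j where "\<forall>d. \<exists>c. 4 \<le> d \<longrightarrow> Q d (j d) c" by blast
  from choice[OF this] obtain c where "\<And>d. 4 \<le> d \<Longrightarrow> Q d (j d) (c d)" by blast
  then have jc: "\<And>d. 4 \<le> d \<Longrightarrow> volterra_pair (volterra_error d) (j d) (c d)"
    and var: "\<And>d T. 4 \<le> d \<Longrightarrow> 0 < T \<Longrightarrow> T * prob_space.variance (M d) (g_hat d (X d) (V d) T) = ?e (c d) T / T"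
    and e: "\<And>d T. 4 \<le> d \<Longrightarrow> 0 \<le> T \<Longrightarrow> 0 \<le> ?e (c d) T"
      "\<And>d T. 4 \<le> d \<Longrightarrow> 0 \<le> T \<Longrightarrow> \<bar>?e (c d) T - sqrt (2 / pi) * T\<bar> \<le> 2 * sqrt (?e (c d) T) + 2 * (T\<^sup>2 * sqrt (44 / (real d + 1)))"
    unfolding Q_def by blast+
  \<comment> \<open>The second moment of the limiting functional, known only as a limit; dividing by
    \<open>T\<close> gives the inner limit.\<close>
  define l where "l T = lim (\<lambda>d. ?e (c d) T)" for T
  have l: "(\<lambda>d. ?e (c d) T) \<longlonglongrightarrow> l T" if "0 \<le> T" for T
    unfolding l_def convergent_LIMSEQ_iff[symmetric]
    by (intro convergent_mult convergent_const volterra_pairs_convergent[OF jc volterra_error_nonneg volterra_error_tendsto that])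
  have l0: "0 \<le> l T" if "0 \<le> T" for T
    by (rule LIMSEQ_le_const[OF l[OF that]]) (use e(1) that in blast)
  have l1: "\<bar>l T - sqrt (2 / pi) * T\<bar> \<le> 2 * sqrt (l T)" if "0 \<le> T" for T
  proof (rule LIMSEQ_le)
    show "(\<lambda>d. \<bar>?e (c d) T - sqrt (2 / pi) * T\<bar>) \<longlonglongrightarrow> \<bar>l T - sqrt (2 / pi) * T\<bar>"
      by (intro tendsto_intros l that)
    have "(\<lambda>d. sqrt (44 / (real d + 1))) \<longlonglongrightarrow> 0" by real_asymp
    then have "(\<lambda>d. 2 * sqrt (?e (c d) T) + 2 * (T\<^sup>2 * sqrt (44 / (real d + 1)))) \<longlonglongrightarrow> 2 * sqrt (l T) + 2 * (T\<^sup>2 * 0)"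
      by (intro tendsto_intros l that)
    then show "(\<lambda>d. 2 * sqrt (?e (c d) T) + 2 * (T\<^sup>2 * sqrt (44 / (real d + 1)))) \<longlonglongrightarrow> 2 * sqrt (l T)" by simp
    show "\<exists>N. \<forall>d\<ge>N. \<bar>?e (c d) T - sqrt (2 / pi) * T\<bar> \<le> 2 * sqrt (?e (c d) T) + 2 * (T\<^sup>2 * sqrt (44 / (real d + 1)))"
      using e(2) that by blast
  qed
  show ?thesis
  proof (rule iterated_limitI[where l="\<lambda>T. l T / T"])
    fix T :: real assume T: "0 < T"
    have "(\<lambda>d. ?e (c d) T / T) \<longlonglongrightarrow> l T / T" using T by (intro tendsto_intros l) auto
    moreover have "\<forall>\<^sub>F d in sequentially. ?e (c d) T / T = T * prob_space.variance (M d) (g_hat d (X d) (V d) T)"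
      using eventually_ge_at_top[of 4] by eventually_elim (simp only: var[OF _ T])
    ultimately show "(\<lambda>d. T * prob_space.variance (M d) (g_hat d (X d) (V d) T)) \<longlonglongrightarrow> l T / T"
      by (rule Lim_transform_eventually)
  next
    let ?\<theta> = "sqrt (2 / pi)"
    have "((\<lambda>T. l T / T - ?\<theta>) \<longlongrightarrow> 0) at_top"
    proof (rule Lim_null_comparison)
      show "\<forall>\<^sub>F T in at_top. norm (l T / T - ?\<theta>) \<le> 2 * (1 + sqrt (1 + ?\<theta> * T)) / T"
        using eventually_gt_at_top[of 0]
      proof eventually_elim
        case (elim T)
        then have T: "0 \<le> T" by simp
        \<comment> \<open>Completing the square in \<open>l - 2 * sqrt l \<le> ?\<theta> * T\<close>
          bounds \<open>sqrt l\<close> by a multiple of \<open>sqrt T\<close> for large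
          \<open>T\<close>, so the error \<open>2 * sqrt l / T\<close> vanishes.\<close>
        have "(sqrt (l T) - 1)\<^sup>2 = l T - 2 * sqrt (l T) + 1" using l0[OF T] by (simp add: power2_diff)
        also have "\<dots> \<le> 1 + ?\<theta> * T" using l1[OF T] by linarith
        finally have "sqrt (l T) \<le> 1 + sqrt (1 + ?\<theta> * T)" using real_le_rsqrt by fastforce
        then have "\<bar>l T - ?\<theta> * T\<bar> / T \<le> 2 * (1 + sqrt (1 + ?\<theta> * T)) / T"
          using l1[OF T] elim by (intro divide_right_mono) auto
        moreover have "\<bar>l T - ?\<theta> * T\<bar> / T = \<bar>l T / T - ?\<theta>\<bar>" using elim by (simp add: diff_divide_distrib[symmetric] abs_divide field_simps)
        ultimately show ?case by simp
      qed
      have "((\<lambda>T. 2 * (1 + sqrt (1 + \<theta> * T)) / T) \<longlongrightarrow> 0) at_top" if "0 < \<theta>" for \<theta> :: real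
        using that by real_asymp
      from this[of ?\<theta>] show "((\<lambda>T. 2 * (1 + sqrt (1 + ?\<theta> * T)) / T) \<longlongrightarrow> 0) at_top" by simp
    qed
    then show "((\<lambda>T. l T / T) \<longlongrightarrow> sigma_F_sq / 4) at_top"
      unfolding sigma_F_sq_quarter by (rule LIM_zero_cancel)
  qed
qed

text \<open>Here the limit in \<open>d\<close> is explicit: the variance differs from the relaxation
  formula by an error that vanishes for each fixed \<open>T\<close>, and the formula has an
  elementary limit.\<close>

lemma h_limit:
  assumes st: "\<And>d. 4 \<le> d \<Longrightarrow> fecmc_stationary (M d) d (\<nu> d) (X d) (V d) (\<tau> d)"
  shows "iterated_limit (\<lambda>d T. T * prob_space.variance (M d) (h_hat d (X d) (real d * T))) (8 / sigma_F_sq)"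
proof -
  define \<theta> where "\<theta> = 2 * gauss_const"
  have \<theta>: "0 < \<theta>" unfolding \<theta>_def using gauss_const_bounds by simp
  have "8 / sigma_F_sq = 2 / (sigma_F_sq / 4)" by simp
  also have "\<dots> = 2 / \<theta>" unfolding sigma_F_sq_quarter \<theta>_def two_gauss_const ..
  finally have eq: "8 / sigma_F_sq = 2 / \<theta>" .
  show ?thesis unfolding eq
  proof (rule iterated_limitI[OF _ relaxation_limit_at_top[OF \<theta>]])
    fix T :: real assume T: "0 < T"
    let ?v = "\<lambda>d. T * prob_space.variance (M d) (h_hat d (X d) (real d * T))"
    let ?a = "\<lambda>d. 2 * ((real d * T - relaxation (\<theta> / (real d + 1)) (real d * T)) / (\<theta> / (real d + 1))) / ((real d)\<^sup>2 * T)"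
    have "(\<lambda>d. ?v d - ?a d) \<longlonglongrightarrow> 0"
    proof (rule Lim_null_comparison)
      show "\<forall>\<^sub>F d in sequentially. norm (?v d - ?a d) \<le> 4 * (2 * T * corrector_error d + T\<^sup>2 * (real d / (real d + 1)) * relax_error d)
          * exp (2 * (\<theta> * (real d / (real d + 1))) * T)"
        using eventually_ge_at_top[of 4]
      proof eventually_elim
        case (elim d)
        interpret fecmc_stationary "M d" d "\<nu> d" "X d" "V d" "\<tau> d" by (rule st[OF elim])
        show ?case unfolding real_norm_def \<theta>_def by (rule h_summary[OF T])
      qed
      have r: "(\<lambda>d. real d / (real d + 1)) \<longlonglongrightarrow> 1" by real_asymp
      have "(\<lambda>d. 4 * (2 * T * corrector_error d + T\<^sup>2 * (real d / (real d + 1)) * relax_error d)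
          * exp (2 * (\<theta> * (real d / (real d + 1))) * T)) \<longlonglongrightarrow> 4 * (2 * T * 0 + T\<^sup>2 * 1 * 0) * exp (2 * (\<theta> * 1) * T)"
        by (intro tendsto_mult tendsto_add tendsto_exp tendsto_const r corrector_error_tendsto relax_error_tendsto)
      then show "(\<lambda>d. 4 * (2 * T * corrector_error d + T\<^sup>2 * (real d / (real d + 1)) * relax_error d)
          * exp (2 * (\<theta> * (real d / (real d + 1))) * T)) \<longlonglongrightarrow> 0" by simp
    qed
    from tendsto_add[OF this relaxation_limit[OF \<theta> T]]
    show "?v \<longlonglongrightarrow> 2 * (T - (1 - exp (- (\<theta> * T))) / \<theta>) / (\<theta> * T)" by simp
  qed
qed

theorem proposition4p5:
  fixes M :: "nat \<Rightarrow> 'a measure"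
    and \<nu> :: "nat \<Rightarrow> rvec \<Rightarrow> rmat measure"
    and X V :: "nat \<Rightarrow> real \<Rightarrow> 'a \<Rightarrow> rvec"
  assumes kernel: "\<And>d. d \<ge> 2 \<Longrightarrow> orthogonal_kernel d (\<nu> d)"
    and fecmc: "\<And>d. d \<ge> 2 \<Longrightarrow> fecmc_process d (\<nu> d) (M d) (X d) (V d)"
    and start: "\<And>d. d \<ge> 2 \<Longrightarrow>
      state_law d (M d) (X d) (V d) 0 = gauss_law d \<Otimes>\<^sub>M sphere_unif d"
    and invariant: "\<And>d t. d \<ge> 2 \<Longrightarrow> t \<ge> 0 \<Longrightarrow>
      state_law d (M d) (X d) (V d) t = gauss_law d \<Otimes>\<^sub>M sphere_unif d"
  shows "iterated_limit
           (\<lambda>d T. T * prob_space.variance (M d) (h_hat d (X d) (real d * T))) (8 / sigma_F_sq) \<and>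
         iterated_limit
           (\<lambda>d T. T * prob_space.variance (M d) (g_hat d (X d) (V d) T)) (sigma_F_sq / 4)"
proof -
  \<comment> \<open>Limits in \<open>d\<close> are unaffected by small dimensions; for the others a
    sequence of jump times is chosen in each dimension.\<close>
  have "\<exists>\<tau>. 4 \<le> d \<longrightarrow> fecmc_stationary (M d) d (\<nu> d) (X d) (V d) \<tau>" for d
    using fecmc_stationary_exists[of d "\<nu> d" "M d" "X d" "V d"] kernel[of d] fecmc[of d] invariant[of d] by auto
  then obtain \<tau> where "\<And>d. 4 \<le> d \<Longrightarrow> fecmc_stationary (M d) d (\<nu> d) (X d) (V d) (\<tau> d)"
    using choice[of "\<lambda>d \<tau>. 4 \<le> d \<longrightarrow> fecmc_stationary (M d) d (\<nu> d) (X d) (V d) \<tau>"] by blast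
  then show ?thesis using h_limit[of M \<nu> X V \<tau>] g_limit[of M \<nu> X V \<tau>] by blast
qed

end
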